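(* Let $\theta\ge 0$. The largest eigenvalue $\lambda_1^{\theta,N}(1)$ of $H_N^\theta(1)$ satisfies, as $N\to\infty$, a large deviation principle on $\mathbb{R}$ in the scale $N$, with good rate function $K_\theta$ defined as follows. If $\theta\le 1$ (with the convention $\theta+\frac1\theta=+\infty$ when $\theta=0$), $$K_\theta(x)=\begin{cases}+\infty, & x<2,\\ \displaystyle\int_2^x\sqrt{z^2-4}\,dz, & 2\le x\le\theta+\frac1\theta,\\ M_\theta(x), & x\ge\theta+\frac1\theta,\end{cases}$$ with $$M_\theta(x)=\frac12\int_2^x\sqrt{z^2-4}\,dz-\theta x+\frac14x^2+\frac12+\frac12\theta^2+\log\theta.$$ If $\theta\ge1$, $$K_\theta(x)=\begin{cases}+\infty, & x<2,\\ L_\theta(x), & x\ge2,\end{cases}$$ with $$L_\theta(x)=\frac12\int_{\theta+\frac1\theta}^x\sqrt{z^2-4}\,dz-\theta\left(x-\left(\theta+\frac1\theta\right)\right)+\frac14\left(x^2-\left(\theta+\frac1\theta\right)^2\right).$$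
   Context: For $N\ge 1$, let $(\beta_{kl},\beta'_{kl})_{1\le k\le l\le N}$ be independent standard real Brownian motions, and let $(H_N(t))_{t\ge 0}$ be the process of $N\times N$ Hermitian matrices with entries $(H_N)_{kl}=\frac{1}{\sqrt{2N}}(\beta_{kl}+i\beta'_{kl})$ for $k<l$ and $(H_N)_{kk}=\frac{1}{\sqrt N}\beta_{kk}$. For $\theta\ge 0$ put $H_N^\theta(t)=H_N(t)+\mathrm{diag}(\theta,0,\dots,0)$, with largest eigenvalue $\lambda_1^{\theta,N}(t)$. A large deviation principle in the scale $N$ means a large deviation principle with speed $N$; a rate function is good if its sublevel sets are compact. *)

theory Defs
  imports
    "HOL-Probability.Probability"
    "Jordan_Normal_Form.Char_Poly"
begin

section \<open>Large deviation principles\<close>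

definition log_prob :: "real \<Rightarrow> ereal" where
  "log_prob p = (if p = 0 then -\<infinity> else ereal (ln p))"

text \<open>Lower semicontinuity of a rate function is expressed by closedness of its sublevel sets.\<close>

definition rate_function :: "('x :: topological_space \<Rightarrow> ereal) \<Rightarrow> bool" where
  "rate_function I \<longleftrightarrow> (\<forall>x. 0 \<le> I x) \<and> (\<forall>c::real. closed {x. I x \<le> ereal c})"

definition good_rate_function :: "('x :: topological_space \<Rightarrow> ereal) \<Rightarrow> bool" where
  "good_rate_function I \<longleftrightarrow> rate_function I \<and> (\<forall>c::real. compact {x. I x \<le> ereal c})"

text \<open>
  The laws \<open>\<mu> n\<close> are only required to be Borel probability measures for all large \<open>n\<close>. For laws
  given as \<open>distr M borel X\<close> this contains the measurability of \<open>X\<close>, since otherwise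
  the library's \<open>distr\<close> has total mass 0. The infimum over the empty set is \<open>\<infinity>\<close>.
\<close>

definition large_deviation_principle ::
    "(nat \<Rightarrow> 'x :: topological_space measure) \<Rightarrow> (nat \<Rightarrow> real) \<Rightarrow> ('x \<Rightarrow> ereal) \<Rightarrow> bool" where
  "large_deviation_principle \<mu> speed I \<longleftrightarrow>
     rate_function I \<and>
     filterlim speed at_top sequentially \<and>
     (\<forall>\<^sub>F n in sequentially. prob_space (\<mu> n) \<and> sets (\<mu> n) = sets borel) \<and>
     (\<forall>F. closed F \<longrightarrow>
        limsup (\<lambda>n. ereal (1 / speed n) * log_prob (measure (\<mu> n) F)) \<le> - (INF x\<in>F. I x)) \<and>
     (\<forall>G. open G \<longrightarrow>
        - (INF x\<in>G. I x) \<le> liminf (\<lambda>n. ereal (1 / speed n) * log_prob (measure (\<mu> n) G)))"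

section \<open>Brownian motion\<close>

text \<open>Processes are indexed by all reals, but only their restriction to \<open>{0..}\<close> is relevant.\<close>

definition standard_brownian_motion :: "'a measure \<Rightarrow> (real \<Rightarrow> 'a \<Rightarrow> real) \<Rightarrow> bool" where
  "standard_brownian_motion M B \<longleftrightarrow>
     prob_space M \<and>
     (\<forall>t\<ge>0. B t \<in> borel_measurable M) \<and>
     (AE \<omega> in M. B 0 \<omega> = 0) \<and>
     (AE \<omega> in M. continuous_on {0..} (\<lambda>t. B t \<omega>)) \<and>
     (\<forall>s t. 0 \<le> s \<longrightarrow> s < t \<longrightarrow>
        distributed M lborel (\<lambda>\<omega>. B t \<omega> - B s \<omega>) (normal_density 0 (sqrt (t - s)))) \<and>
     (\<forall>n (\<tau> :: nat \<Rightarrow> real). 0 \<le> \<tau> 0 \<longrightarrow> (\<forall>i<n. \<tau> i < \<tau> (Suc i)) \<longrightarrow>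
        prob_space.indep_vars M (\<lambda>_. borel) (\<lambda>i \<omega>. B (\<tau> (Suc i)) \<omega> - B (\<tau> i) \<omega>) {..<n})"

text \<open>Independence of processes: each is viewed as a random element of \<open>\<real>\<^bsup>[0,\<infinity>)\<^esup>\<close> with the
  product sigma-algebra.\<close>

definition independent_brownian_motions ::
    "'a measure \<Rightarrow> 'i set \<Rightarrow> ('i \<Rightarrow> real \<Rightarrow> 'a \<Rightarrow> real) \<Rightarrow> bool" where
  "independent_brownian_motions M J W \<longleftrightarrow>
     prob_space M \<and>
     (\<forall>j\<in>J. standard_brownian_motion M (W j)) \<and>
     prob_space.indep_vars M (\<lambda>_. Pi\<^sub>M {0..} (\<lambda>_. borel)) (\<lambda>j \<omega>. \<lambda>t\<in>{0..}. W j t \<omega>) J"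

section \<open>The deformed Hermitian Brownian motion\<close>

text \<open>Rows and columns are numbered from 0, so the index pairs \<open>1 \<le> k \<le> l \<le> N\<close> become
  \<open>k \<le> l < N\<close>.\<close>

definition upper_indices :: "nat \<Rightarrow> (nat \<times> nat) set" where
  "upper_indices N = {(k, l). k \<le> l \<and> l < N}"

definition hermitian_bm ::
    "nat \<Rightarrow> (nat \<times> nat \<Rightarrow> real \<Rightarrow> 'a \<Rightarrow> real) \<Rightarrow> (nat \<times> nat \<Rightarrow> real \<Rightarrow> 'a \<Rightarrow> real) \<Rightarrow>
     real \<Rightarrow> 'a \<Rightarrow> complex mat" where
  "hermitian_bm N \<beta> \<beta>' t \<omega> = Matrix.mat N N (\<lambda>(k, l).
     if k < l then complex_of_real (1 / sqrt (2 * real N)) * Complex (\<beta> (k, l) t \<omega>) (\<beta>' (k, l) t \<omega>)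
     else if k = l then complex_of_real (1 / sqrt (real N) * \<beta> (k, k) t \<omega>)
     else cnj (complex_of_real (1 / sqrt (2 * real N)) * Complex (\<beta> (l, k) t \<omega>) (\<beta>' (l, k) t \<omega>)))"

definition deformed_hermitian_bm ::
    "real \<Rightarrow> nat \<Rightarrow> (nat \<times> nat \<Rightarrow> real \<Rightarrow> 'a \<Rightarrow> real) \<Rightarrow> (nat \<times> nat \<Rightarrow> real \<Rightarrow> 'a \<Rightarrow> real) \<Rightarrow>
     real \<Rightarrow> 'a \<Rightarrow> complex mat" where
  "deformed_hermitian_bm \<theta> N \<beta> \<beta>' t \<omega> =
     hermitian_bm N \<beta> \<beta>' t \<omega> + mat_diag N (\<lambda>i. if i = 0 then complex_of_real \<theta> else 0)"

text \<open>Used for Hermitian matrices of positive size only, where the set is finite and nonempty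
  and contains all eigenvalues.\<close>

definition largest_eigenvalue :: "complex mat \<Rightarrow> real" where
  "largest_eigenvalue A = Max {x :: real. eigenvalue A (complex_of_real x)}"

section \<open>The rate function\<close>

text \<open>The interval integral is oriented, which matters in \<open>L_rate\<close> when \<open>x < \<theta> + 1 / \<theta>\<close>.\<close>

definition M_rate :: "real \<Rightarrow> real \<Rightarrow> real" where
  "M_rate \<theta> x = 1 / 2 * (LBINT z=ereal 2..ereal x. sqrt (z\<^sup>2 - 4)) - \<theta> * x + 1 / 4 * x\<^sup>2 + 1 / 2
     + 1 / 2 * \<theta>\<^sup>2 + ln \<theta>"

definition L_rate :: "real \<Rightarrow> real \<Rightarrow> real" where
  "L_rate \<theta> x = 1 / 2 * (LBINT z=ereal (\<theta> + 1 / \<theta>)..ereal x. sqrt (z\<^sup>2 - 4)) - \<theta> * (x - (\<theta> + 1 / \<theta>))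
     + 1 / 4 * (x\<^sup>2 - (\<theta> + 1 / \<theta>)\<^sup>2)"

definition threshold :: "real \<Rightarrow> ereal" where
  "threshold \<theta> = (if \<theta> = 0 then \<infinity> else ereal (\<theta> + 1 / \<theta>))"

text \<open>The overlapping cases agree: for \<open>0 < \<theta> \<le> 1\<close> the two expressions coincide at
  \<open>x = \<theta> + 1 / \<theta>\<close>, and \<open>M_rate 1 = L_rate 1\<close>.\<close>

definition K_rate :: "real \<Rightarrow> real \<Rightarrow> ereal" where
  "K_rate \<theta> x =
     (if \<theta> \<le> 1 then
        (if x < 2 then \<infinity>
         else if ereal x \<le> threshold \<theta> then ereal (LBINT z=ereal 2..ereal x. sqrt (z\<^sup>2 - 4))
         else ereal (M_rate \<theta> x))
      else
        (if x < 2 then \<infinity> else ereal (L_rate \<theta> x)))"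

end

theory Submission
  imports Defs "HOL-Real_Asymp.Real_Asymp" "Jordan_Normal_Form.Spectral_Radius"
begin

text \<open>
  The law of the matrix is invariant under unitary conjugation, so the spike may be turned into the
  last coordinate direction. By the Schur complement, \<open>H + c v v\<^sup>* < x\<close> for the unit vector \<open>v\<close> in that
  direction means that \<open>Y = x - H\<^sub>k\<^sub>k - c\<close> is positive and that \<open>H' + w w\<^sup>* / Y < x\<close>, where \<open>H'\<close> is the
  remaining corner and \<open>w\<close> the removed column. The corner is independent of \<open>(H\<^sub>k\<^sub>k, w)\<close> and only the length of \<open>w\<close>
  matters, so the event that the largest eigenvalue is below \<open>x\<close> becomes the survival of a killed Markov
  chain on \<open>[0, \<infinity>)\<close>, started at \<open>\<theta>\<close>, with steps \<open>c \<mapsto> g / (x - a - c)\<close> for a normal variable \<open>a\<close> of variance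
  \<open>1 / N\<close> and a gamma variable \<open>g\<close> close to 1. For \<open>x = A + 1 / A\<close> with \<open>A > 1\<close>, the noiseless map
  \<open>c \<mapsto> 1 / (x - c)\<close> has the attracting fixed point \<open>1 / A\<close> and the repelling fixed point \<open>A\<close>.
  Starting below \<open>A\<close>, the chain dies if it climbs to \<open>A\<close>; starting above \<open>A\<close>, it survives if it descends to \<open>A\<close>.
  The cheapest path runs the noiseless map backwards, and its cost
  is a difference of values of \<open>\<psi>\<^sub>x(c) = c\<^sup>2 / 2 - x c + ln c\<close>. For \<open>x < 2\<close> there is no fixed point and survival for \<open>N\<close>
  steps costs more than any exponential.

  The lower bounds follow the cheapest path. The upper bound for death compares with
  the measure of density \<open>c\<^sup>N\<^sup>-\<^sup>1 exp (N (c\<^sup>2 / 2 - x c))\<close>, under which the chain does not gain mass; the upper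
  bound for survival propagates bounds that are exponentially linear in \<open>c\<close>. The resulting rates for \<open>{x..}\<close> and
  \<open>{..<x}\<close> are strictly monotone on the two sides of their zero, which gives the large deviation principle.
\<close>

section \<open>The Schur complement chain\<close>

text \<open>The backward path is cheapest because the density named above is reversible for the
  killed chain with N degrees of freedom (see \<open>weight_invariant\<close>): a costly path is the
  time reversal of a free one, and its cost telescopes exactly (\<open>psi_step\<close>). The event
  decides how much of the chain has to be followed. Dying within a few steps is already death, and
  surviving requires surviving the first few steps, so the lower bound for death and the upper bound
  for survival involve only finitely many steps; there the lost degrees of freedom cost a bounded
  factor or a parameter \<kappa> arbitrarily close to 1. The other two bounds must follow all N
  steps, while the degrees of freedom drop to 0. Survival is kept alive by a trap below A that is
  left with exponentially small probability at each step. Death is compared with a chain whose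
  degrees of freedom stay at N, for which the excessive measure bounds the mass dying in N steps by
  N times that of one step.\<close>

definition normal_law :: "nat \<Rightarrow> real measure" where
  "normal_law N = density lborel (\<lambda>a. ennreal (normal_density 0 (1 / sqrt (real N)) a))"

text \<open>The law of the squared length of a column of \<open>k\<close> off-diagonal entries.\<close>

definition gamma_law :: "nat \<Rightarrow> nat \<Rightarrow> real measure" where
  "gamma_law N k = (if k = 0 then return borel 0
     else density lborel (\<lambda>g. ennreal (erlang_density (k - 1) (real N) g)))"

lemma sets_normal_law [measurable_cong, simp]: "sets (normal_law N) = sets borel"
  by (simp add: normal_law_def)

lemma space_normal_law [simp]: "space (normal_law N) = UNIV"
  by (simp add: normal_law_def)

lemma sets_gamma_law [measurable_cong, simp]: "sets (gamma_law N k) = sets borel"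
  by (simp add: gamma_law_def)

lemma space_gamma_law [simp]: "space (gamma_law N k) = UNIV"
  by (simp add: gamma_law_def)

lemma prob_space_normal_law: "0 < N \<Longrightarrow> prob_space (normal_law N)"
  unfolding normal_law_def by (rule prob_space_normal_density) simp

lemma prob_space_gamma_law: "0 < N \<Longrightarrow> prob_space (gamma_law N k)"
  unfolding gamma_law_def
  by (cases "k = 0") (auto intro: prob_space_return prob_space_erlang_density)

lemma AE_gamma_law_nonneg: "AE g in gamma_law N k. 0 \<le> g"
proof (cases "k = 0")
  case True
  have "AE g in return borel (0::real). 0 \<le> g"
    by (subst AE_return) auto
  moreover have "gamma_law N k = return borel 0" using True by (simp add: gamma_law_def)
  ultimately show ?thesis by (simp only:)
next
  case False
  then have "gamma_law N k = density lborel (\<lambda>g. ennreal (erlang_density (k - 1) (real N) g))"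
    by (simp add: gamma_law_def)
  moreover have "AE g in density lborel (\<lambda>g. ennreal (erlang_density (k - 1) (real N) g)). 0 \<le> g"
    by (subst AE_density) (auto simp: erlang_density_def)
  ultimately show ?thesis by (simp only:)
qed

section \<open>Transforms and comparison of the noise laws\<close>

lemma nn_integral_normal_density_1:
  assumes "0 < \<sigma>" shows "(\<integral>\<^sup>+x. ennreal (normal_density \<mu> \<sigma> x) \<partial>lborel) = 1"
  using prob_space.emeasure_space_1[OF prob_space_normal_density[OF assms, of \<mu>]]
  by (simp add: emeasure_density)

lemma nn_integral_erlang_density_1:
  assumes "0 < l" shows "(\<integral>\<^sup>+x. ennreal (erlang_density k l x) \<partial>lborel) = 1"
  using prob_space.emeasure_space_1[OF prob_space_erlang_density[OF assms, of k]]
  by (simp add: emeasure_density)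

lemma normal_law_mgf:
  assumes "0 < N"
  shows "(\<integral>\<^sup>+a. ennreal (exp (t * a)) \<partial>normal_law N) = ennreal (exp (t\<^sup>2 / (2 * real N)))"
proof -
  define \<sigma> where "\<sigma> = 1 / sqrt (real N)"
  have \<sigma>: "0 < \<sigma>" "\<sigma>\<^sup>2 = 1 / real N"
    using assms by (auto simp: \<sigma>_def power_divide)
  have N: "real N = 1 / \<sigma>\<^sup>2"
    using \<sigma> assms by simp
  have eq: "normal_density 0 \<sigma> a * exp (t * a)
      = exp (t\<^sup>2 / (2 * real N)) * normal_density (t * \<sigma>\<^sup>2) \<sigma> a" for a
  proof -
    have "- (a - 0)\<^sup>2 / (2 * \<sigma>\<^sup>2) + t * a
        = t\<^sup>2 / (2 * real N) + - (a - t * \<sigma>\<^sup>2)\<^sup>2 / (2 * \<sigma>\<^sup>2)"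
      unfolding N using \<sigma>(1) by (simp add: field_simps power2_eq_square)
    then have "exp (- (a - 0)\<^sup>2 / (2 * \<sigma>\<^sup>2)) * exp (t * a)
        = exp (t\<^sup>2 / (2 * real N)) * exp (- (a - t * \<sigma>\<^sup>2)\<^sup>2 / (2 * \<sigma>\<^sup>2))"
      by (simp only: exp_add[symmetric])
    then show ?thesis
      unfolding normal_density_def by (simp add: mult.assoc mult.left_commute)
  qed
  have "(\<integral>\<^sup>+a. ennreal (exp (t * a)) \<partial>normal_law N)
      = (\<integral>\<^sup>+a. ennreal (normal_density 0 \<sigma> a) * ennreal (exp (t * a)) \<partial>lborel)"
    unfolding normal_law_def \<sigma>_def[symmetric] by (subst nn_integral_density) auto
  also have "\<dots> = (\<integral>\<^sup>+a. ennreal (exp (t\<^sup>2 / (2 * real N))) * ennreal (normal_density (t * \<sigma>\<^sup>2) \<sigma> a) \<partial>lborel)"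
    by (intro nn_integral_cong) (simp add: ennreal_mult[symmetric] eq)
  also have "\<dots> = ennreal (exp (t\<^sup>2 / (2 * real N)))"
    using \<sigma>(1) by (subst nn_integral_cmult) (auto simp: nn_integral_normal_density_1)
  finally show ?thesis .
qed

text \<open>Multiplying the density by \<open>exp (- s * g)\<close> turns the rate \<open>N\<close>
  into \<open>N + s\<close>, and only the ratio of the normalising constants remains. Negative
  \<open>s\<close> is allowed while the new rate stays positive, so the formula serves both
  tails.\<close>

lemma gamma_law_laplace:
  assumes "0 < N" and s: "- real N < s"
  shows "(\<integral>\<^sup>+g. ennreal (exp (- s * g)) \<partial>gamma_law N k) = ennreal ((real N / (real N + s)) ^ k)"
proof (cases k)
  case 0
  then show ?thesis by (simp add: gamma_law_def nn_integral_return)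
next
  case (Suc m)
  define r where "r = real N / (real N + s)"
  have r: "0 \<le> r" using assms by (simp add: r_def)
  have eq: "erlang_density m (real N) g * exp (- s * g)
      = r ^ k * erlang_density m (real N + s) g" for g
  proof -
    have e: "exp (- real N * g) * exp (- s * g) = exp (- (real N + s) * g)"
      by (simp add: exp_add[symmetric] algebra_simps)
    have p: "real N ^ Suc m = r ^ Suc m * (real N + s) ^ Suc m"
      unfolding r_def power_mult_distrib[symmetric] using s assms by simp
    show ?thesis
    proof (cases "g < 0")
      case False
      have "erlang_density m (real N) g * exp (- s * g) = real N ^ Suc m * (g ^ m / fact m) * (exp (- real N * g) * exp (- s * g))"
        by (simp only: erlang_density_def False if_False times_divide_eq_left times_divide_eq_right mult_ac)
      also have "\<dots> = r ^ Suc m * erlang_density m (real N + s) g"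
        unfolding e p by (simp only: erlang_density_def False if_False times_divide_eq_left times_divide_eq_right mult_ac)
      finally show ?thesis by (simp only: Suc)
    qed (simp add: erlang_density_def)
  qed
  have "(\<integral>\<^sup>+g. ennreal (exp (- s * g)) \<partial>gamma_law N k)
      = (\<integral>\<^sup>+g. ennreal (erlang_density m (real N) g) * ennreal (exp (- s * g)) \<partial>lborel)"
    unfolding gamma_law_def using Suc by (simp, subst nn_integral_density) auto
  also have "\<dots> = (\<integral>\<^sup>+g. ennreal (r ^ k) * ennreal (erlang_density m (real N + s) g) \<partial>lborel)"
    using r s assms by (intro nn_integral_cong) (simp add: ennreal_mult[symmetric] eq[unfolded minus_mult_left[symmetric]])
  also have "\<dots> = ennreal (r ^ k)"
    using s by (subst nn_integral_cmult) (auto simp: nn_integral_erlang_density_1)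
  finally show ?thesis by (simp add: r_def)
qed

text \<open>The densities of consecutive gamma laws differ by the factor \<open>N g / k\<close>, so their difference
  changes sign exactly once.\<close>

lemma gamma_law_mono:
  assumes N: "0 < N" and f: "mono_on {0..} f" "f \<in> borel_measurable borel" and fin: "\<And>g. f g \<le> (1::ennreal)"
  shows "(\<integral>\<^sup>+g. f g \<partial>gamma_law N k) \<le> (\<integral>\<^sup>+g. f g \<partial>gamma_law N (Suc k))"
proof (cases k)
  case 0
  interpret prob_space "gamma_law N (Suc 0)" by (rule prob_space_gamma_law[OF N])
  have "f 0 = (\<integral>\<^sup>+g. f 0 \<partial>gamma_law N (Suc 0))"
    using emeasure_space_1 by simp
  also have "\<dots> \<le> (\<integral>\<^sup>+g. f g \<partial>gamma_law N (Suc 0))"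
    using AE_gamma_law_nonneg[of N "Suc 0"] f(1)
    by (intro nn_integral_mono_AE) (auto elim!: eventually_mono simp: mono_on_def)
  finally show ?thesis using 0 f(2) by (simp add: gamma_law_def[of N 0] nn_integral_return)
next
  case (Suc m)
  define h where "h g = enn2real (f g)" for g
  have fh: "f g = ennreal (h g)" for g
    unfolding h_def by (intro ennreal_enn2real[symmetric] le_less_trans[OF fin]) auto
  have h1: "0 \<le> h g" "h g \<le> 1" for g
    using fin[of g] by (auto simp: h_def enn2real_leI)
  have [measurable]: "h \<in> borel_measurable borel"
    using f(2) unfolding h_def by simp
  have hmono: "h a \<le> h b" if "0 \<le> a" "a \<le> b" for a b
  proof -
    have "ennreal (h a) \<le> ennreal (h b)"
      using mono_onD[OF f(1), of a b] that by (simp add: fh)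
    then show ?thesis using h1 by simp
  qed
  let ?e1 = "erlang_density m (real N)" and ?e2 = "erlang_density (Suc m) (real N)"
  have int1: "integrable lborel ?e1" and int2: "integrable lborel ?e2"
    and one1: "integral\<^sup>L lborel ?e1 = 1" and one2: "integral\<^sup>L lborel ?e2 = 1"
    using nn_integral_erlang_density_1[of "real N"] N
    by (auto intro!: integrableI_nonneg integral_eq_nn_integral[THEN trans] )
  have int1h: "integrable lborel (\<lambda>g. ?e1 g * h g)" and int2h: "integrable lborel (\<lambda>g. ?e2 g * h g)"
    by (rule Bochner_Integration.integrable_bound[OF int1] Bochner_Integration.integrable_bound[OF int2];
        use h1 N in \<open>auto simp: mult_left_le abs_mult\<close>)+
  define g0 where "g0 = real (Suc m) / real N"
  have g0': "0 < g0" and g0: "0 \<le> g0" using N by (simp_all add: g0_def)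
  have e: "?e2 g = ?e1 g * (g / g0)" for g
    using N by (simp add: erlang_density_def g0_def field_simps del: of_nat_Suc)
  \<comment> \<open>\<open>g0\<close> is the crossing point of the two densities, so
    \<open>h g - h g0\<close> and \<open>?e2 g - ?e1 g\<close> change sign together and their
    product is nonnegative. Both densities have mass 1, so the constant \<open>h g0\<close>
    integrates away.\<close>
  have pt: "h g0 * (?e2 g - ?e1 g) \<le> h g * (?e2 g - ?e1 g)" for g
  proof (cases "g < 0")
    case False
    have *: "?e2 g - ?e1 g = ?e1 g * ((g - g0) / g0)"
      using g0' unfolding e by (simp add: field_simps)
    show ?thesis
    proof (cases "g \<le> g0")
      case True
      then have "?e2 g - ?e1 g \<le> 0"
        unfolding * using N g0 by (intro mult_nonneg_nonpos divide_nonpos_nonneg) auto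
      then show ?thesis using hmono[of g g0] True False by (intro mult_right_mono_neg) auto
    next
      case le: False
      then have "0 \<le> ?e2 g - ?e1 g"
        unfolding * using N g0 by (intro mult_nonneg_nonneg divide_nonneg_nonneg) auto
      then show ?thesis using hmono[of g0 g] le g0 by (intro mult_right_mono) auto
    qed
  qed (simp add: erlang_density_def)
  have "0 = (LINT g|lborel. h g0 * (?e2 g - ?e1 g))"
    using int1 int2 one1 one2 by simp
  also have "\<dots> \<le> (LINT g|lborel. h g * (?e2 g - ?e1 g))"
    using int1 int2 int1h int2h pt
    by (intro integral_mono) (auto simp: algebra_simps)
  also have "\<dots> = (LINT g|lborel. ?e2 g * h g) - (LINT g|lborel. ?e1 g * h g)"
    using int1h int2h by (simp add: algebra_simps)
  finally have le: "(LINT g|lborel. ?e1 g * h g) \<le> (LINT g|lborel. ?e2 g * h g)" by simp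
  have tr: "(\<integral>\<^sup>+g. f g \<partial>density lborel (\<lambda>g. ennreal (erlang_density i (real N) g)))
      = ennreal (LINT g|lborel. erlang_density i (real N) g * h g)"
    if "integrable lborel (\<lambda>g. erlang_density i (real N) g * h g)" for i
    using that h1 N
    by (subst nn_integral_density, simp, simp add: f(2))
       (auto simp: fh ennreal_mult[symmetric] nn_integral_eq_integral)
  show ?thesis
    using le tr[OF int1h] tr[OF int2h] Suc by (simp add: gamma_law_def ennreal_leI)
qed

text \<open>Stirling up to a factor \<open>n\<close>, which the extra power of the rate in
  \<open>erlang_density\<close> will absorb. The induction step is
  \<open>exp 1 \<le> (1 + 1 / n) ^ Suc n\<close>, from \<open>ln t \<le> t - 1\<close> at
  \<open>t = n / (n + 1)\<close>.\<close>

lemma fact_le_exp: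
  assumes "1 \<le> n"
  shows "(fact n :: real) \<le> exp 1 * real n * (real n / exp 1) ^ n"
  using assms
proof (induction n rule: dec_induct)
  case base
  then show ?case by simp
next
  case (step n)
  have n: "0 < real n" using step by simp
  have "1 / (real n + 1) \<le> ln (1 + 1 / real n)"
  proof -
    have "ln (real n / (real n + 1)) \<le> real n / (real n + 1) - 1"
      using n by (intro ln_le_minus_one) auto
    moreover have "ln (real n / (real n + 1)) = - ln (1 + 1 / real n)"
      using n by (simp add: ln_div field_simps)
    moreover have "real n / (real n + 1) - 1 = - (1 / (real n + 1))"
      using n by (simp add: field_simps)
    ultimately show ?thesis by linarith
  qed
  then have "1 \<le> (real n + 1) * ln (1 + 1 / real n)"
    using n by (simp add: field_simps)
  then have "exp 1 \<le> exp (real (Suc n) * ln (1 + 1 / real n))"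
    by (simp add: add.commute)
  also have "\<dots> = (1 + 1 / real n) ^ Suc n"
  proof -
    have "0 < 1 + 1 / real n" using n by (simp add: add_pos_pos)
    then show ?thesis by (simp only: exp_of_nat_mult exp_ln)
  qed
  finally have "exp 1 * real n ^ Suc n \<le> (1 + 1 / real n) ^ Suc n * real n ^ Suc n"
    using n by (intro mult_right_mono) auto
  also have "\<dots> = real (Suc n) ^ Suc n"
  proof -
    have "(1 + 1 / real n) * real n = real (Suc n)" using n by (simp add: field_simps)
    then show ?thesis by (simp only: power_mult_distrib[symmetric])
  qed
  finally have *: "exp 1 * real n ^ Suc n \<le> real (Suc n) ^ Suc n" .
  have "(fact (Suc n) :: real) = real (Suc n) * fact n" by simp
  also have "\<dots> \<le> real (Suc n) * (exp 1 * real n * (real n / exp 1) ^ n)"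
    using step by (intro mult_left_mono) auto
  also have "\<dots> = real (Suc n) * (exp 1 * real n ^ Suc n) / exp 1 ^ n"
    by (simp add: power_divide)
  also have "\<dots> \<le> real (Suc n) * real (Suc n) ^ Suc n / exp 1 ^ n"
    using * by (intro divide_right_mono mult_left_mono) auto
  also have "\<dots> = exp 1 * real (Suc n) * (real (Suc n) / exp 1) ^ Suc n"
    by (simp add: power_divide)
  finally show ?case .
qed

text \<open>By Stirling, a gamma law with almost \<open>N\<close> degrees of freedom has the rate
  \<open>g - 1 - ln g\<close>. The \<open>j + 2\<close> missing powers enter only through a term
  that is independent of \<open>N\<close> and locally bounded in \<open>g > 0\<close>.\<close>

lemma erlang_density_lower:
  assumes g: "0 < g" and N: "j + 2 \<le> N"
  shows "exp (- real N * (g - 1 - ln g) - (real j + 3 + (real j + 2) * \<bar>ln g\<bar>))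
    \<le> erlang_density (N - j - 2) (real N) g"
proof (cases "N - j - 2 = 0")
  case True
  then have Nj: "real N = real j + 2" using N by linarith
  have "erlang_density (N - j - 2) (real N) g = real N * exp (- real N * g)"
    using True g by (simp add: erlang_density_def)
  moreover have "exp (- real N * (g - 1 - ln g) - (real j + 3 + (real j + 2) * \<bar>ln g\<bar>)) \<le> exp (- real N * g)"
  proof -
    have "real N * ln g \<le> (real j + 2) * \<bar>ln g\<bar>" unfolding Nj by (intro mult_left_mono) auto
    then show ?thesis using Nj by (simp add: algebra_simps)
  qed
  moreover have "exp (- real N * g) \<le> real N * exp (- real N * g)"
    using Nj by simp
  ultimately show ?thesis by linarith
next
  case False
  define n where "n = N - j - 2"
  have n: "1 \<le> n" "real n = real N - real j - 2" "N = n + j + 2" using False N by (auto simp: n_def)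
  have pos: "0 < real n" "0 < real N" using n by auto
  have "ln (fact n :: real) \<le> ln (exp 1 * real n * (real n / exp 1) ^ n)"
    using fact_le_exp[OF n(1)] pos by (subst ln_le_cancel_iff) auto
  also have "\<dots> = 1 + ln (real n) + real n * (ln (real n) - 1)"
    using pos by (simp add: ln_mult ln_realpow ln_div)
  also have "\<dots> = 1 - real n + real (Suc n) * ln (real n)" by (simp add: algebra_simps)
  also have "\<dots> \<le> 1 - real n + real (Suc n) * ln (real N)"
    using n pos by (intro add_left_mono mult_left_mono) auto
  finally have f: "ln (fact n :: real) \<le> 1 - real n + real (Suc n) * ln (real N)" .
  have "- real N * (g - 1 - ln g) - (real j + 3 + (real j + 2) * \<bar>ln g\<bar>)
      = real n - 1 - real N * g + real N * ln g - (real j + 2) * \<bar>ln g\<bar>"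
    using n by (simp add: algebra_simps)
  also have "\<dots> = real n - 1 - real N * g + real n * ln g + (real j + 2) * (ln g - \<bar>ln g\<bar>)"
    using n by (simp add: algebra_simps)
  also have "\<dots> \<le> real n - 1 - real N * g + real n * ln g"
    by (simp add: mult_nonneg_nonpos)
  also have "\<dots> \<le> real (Suc n) * ln (real N) + real n * ln g - real N * g - ln (fact n)"
    using f by simp
  also have "\<dots> = ln (real N ^ Suc n * g ^ n * exp (- real N * g) / fact n)"
    using pos g by (simp add: ln_mult ln_div ln_realpow algebra_simps)
  finally have "exp (- real N * (g - 1 - ln g) - (real j + 3 + (real j + 2) * \<bar>ln g\<bar>))
    \<le> exp (ln (real N ^ Suc n * g ^ n * exp (- real N * g) / fact n))" by simp
  also have "\<dots> = real N ^ Suc n * g ^ n * exp (- real N * g) / fact n"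
    using pos g by (intro exp_ln) auto
  also have "\<dots> = erlang_density n (real N) g"
    using g by (simp add: erlang_density_def)
  finally show ?thesis by (simp add: n_def)
qed

text \<open>The normalising factor is \<open>sqrt (N / (2 * pi))\<close>, at least 1 once
  \<open>N\<close> exceeds \<open>2 * pi\<close>; hence the 7.\<close>

lemma normal_density_lower:
  assumes "7 \<le> N"
  shows "exp (- real N * a\<^sup>2 / 2) \<le> normal_density 0 (1 / sqrt (real N)) a"
proof -
  have "2 * pi < 7" using pi_less_4 pi_approx by simp
  then have "2 * pi \<le> real N" using assms by linarith
  then have "sqrt (2 * pi * (1 / sqrt (real N))\<^sup>2) \<le> 1"
    using assms by (auto simp: power_divide)
  then have "1 \<le> 1 / sqrt (2 * pi * (1 / sqrt (real N))\<^sup>2)"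
    using assms by (auto simp: power_divide)
  then have "1 * exp (- real N * a\<^sup>2 / 2) \<le> 1 / sqrt (2 * pi * (1 / sqrt (real N))\<^sup>2) * exp (- real N * a\<^sup>2 / 2)"
    by (intro mult_right_mono) auto
  then show ?thesis unfolding normal_density_def by (simp add: power_divide mult.commute)
qed

text \<open>Here \<open>d\<close> is the value on the event that the chain is killed. In \<open>chain\<close> the value is \<open>F True\<close> on
  survival of all \<open>k\<close> steps and \<open>F False\<close> on death.\<close>

definition step_op :: "nat \<Rightarrow> real \<Rightarrow> ennreal \<Rightarrow> nat \<Rightarrow> (real \<Rightarrow> ennreal) \<Rightarrow> real \<Rightarrow> ennreal" where
  "step_op N x d k f c =
     (\<integral>\<^sup>+a. (\<integral>\<^sup>+g. (if 0 < x - a - c then f (g / (x - a - c)) else d) \<partial>gamma_law N k) \<partial>normal_law N)"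

primrec chain :: "nat \<Rightarrow> real \<Rightarrow> (bool \<Rightarrow> ennreal) \<Rightarrow> nat \<Rightarrow> real \<Rightarrow> ennreal" where
  "chain N x F 0 = (\<lambda>c. F True)"
| "chain N x F (Suc k) = step_op N x (F False) k (chain N x F k)"

abbreviation surv where "surv N x \<equiv> chain N x (\<lambda>b. if b then 1 else 0)"
abbreviation dead where "dead N x \<equiv> chain N x (\<lambda>b. if b then 0 else 1)"

section \<open>Monotonicity and measurability of the chain\<close>

lemma step_op_mono:
  assumes "\<And>c. 0 \<le> c \<Longrightarrow> f c \<le> h c" "d \<le> d'"
  shows "step_op N x d k f c \<le> step_op N x d' k h c"
  unfolding step_op_def
proof (rule nn_integral_mono, rule nn_integral_mono_AE)
  fix a
  show "AE g in gamma_law N k. (if 0 < x - a - c then f (g / (x - a - c)) else d)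
        \<le> (if 0 < x - a - c then h (g / (x - a - c)) else d')"
    using AE_gamma_law_nonneg[of N k] assms by (auto elim!: eventually_mono)
qed

lemma step_op_le_1:
  assumes N: "0 < N" and f: "\<And>c. 0 \<le> c \<Longrightarrow> f c \<le> 1" "d \<le> 1"
  shows "step_op N x d k f c \<le> 1"
proof -
  interpret n: prob_space "normal_law N" by (rule prob_space_normal_law[OF N])
  interpret g: prob_space "gamma_law N k" by (rule prob_space_gamma_law[OF N])
  have "step_op N x d k f c \<le> step_op N x 1 k (\<lambda>_. 1) c"
    using f by (intro step_op_mono)
  also have "\<dots> = 1"
    using n.emeasure_space_1 g.emeasure_space_1 by (simp add: step_op_def)
  finally show ?thesis .
qed

lemma chain_le_1:
  assumes "0 < N" "\<And>b. F b \<le> 1"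
  shows "chain N x F k c \<le> 1"
  using assms by (induction k arbitrary: c) (auto intro: step_op_le_1)

text \<open>A larger \<open>c\<close> both raises the next position \<open>g / (x - a - c)\<close>
  and enlarges the killing event, so the value at death has to lie on the same side as the values of
  \<open>f\<close> at large arguments.\<close>

lemma step_op_antimono_c:
  assumes f: "\<And>a b. 0 \<le> a \<Longrightarrow> a \<le> b \<Longrightarrow> f b \<le> f a" and d: "\<And>a. 0 \<le> a \<Longrightarrow> d \<le> f a" and "c \<le> c'"
  shows "step_op N x d k f c' \<le> step_op N x d k f c"
  unfolding step_op_def
proof (rule nn_integral_mono, rule nn_integral_mono_AE)
  fix a
  show "AE g in gamma_law N k. (if 0 < x - a - c' then f (g / (x - a - c')) else d)
        \<le> (if 0 < x - a - c then f (g / (x - a - c)) else d)"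
    using AE_gamma_law_nonneg[of N k]
  proof eventually_elim
    case (elim g)
    then show ?case using \<open>c \<le> c'\<close> by (auto intro!: f d frac_le divide_nonneg_pos)
  qed
qed

lemma step_op_mono_c:
  assumes f: "\<And>a b. 0 \<le> a \<Longrightarrow> a \<le> b \<Longrightarrow> f a \<le> f b" and d: "\<And>a. 0 \<le> a \<Longrightarrow> f a \<le> d" and "c \<le> c'"
  shows "step_op N x d k f c \<le> step_op N x d k f c'"
  unfolding step_op_def
proof (rule nn_integral_mono, rule nn_integral_mono_AE)
  fix a
  show "AE g in gamma_law N k. (if 0 < x - a - c then f (g / (x - a - c)) else d)
        \<le> (if 0 < x - a - c' then f (g / (x - a - c')) else d)"
    using AE_gamma_law_nonneg[of N k]
  proof eventually_elim
    case (elim g)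
    then show ?case using \<open>c \<le> c'\<close> by (auto intro!: f d frac_le divide_nonneg_pos)
  qed
qed

lemma surv_antimono: "c \<le> c' \<Longrightarrow> surv N x k c' \<le> surv N x k c"
proof (induction k arbitrary: c c')
  case (Suc k)
  then show ?case by (simp, intro step_op_antimono_c) auto
qed simp

lemma dead_mono: "0 < N \<Longrightarrow> c \<le> c' \<Longrightarrow> dead N x k c \<le> dead N x k c'"
proof (induction k arbitrary: c c')
  case (Suc k)
  then show ?case by (simp, intro step_op_mono_c) (auto intro: chain_le_1)
qed simp

text \<open>Measurability of \<open>surv\<close> in the starting point is read off from
  monotonicity, since superlevel sets are then intervals; the increasing version does the same for
  \<open>dead\<close>.\<close>

lemma borel_measurable_antimono_ennreal:
  fixes f :: "real \<Rightarrow> ennreal"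
  assumes "\<And>a b. a \<le> b \<Longrightarrow> f b \<le> f a" shows "f \<in> borel_measurable borel"
proof (rule borel_measurableI_greater)
  fix y
  have "is_interval {x. y < f x}"
    unfolding is_interval_1 using assms by (auto intro: less_le_trans)
  then show "{x \<in> space borel. y < f x} \<in> sets borel"
    by (simp add: real_interval_borel_measurable)
qed

lemma borel_measurable_mono_ennreal:
  fixes f :: "real \<Rightarrow> ennreal"
  assumes "\<And>a b. a \<le> b \<Longrightarrow> f a \<le> f b" shows "f \<in> borel_measurable borel"
proof (rule borel_measurableI_greater)
  fix y
  have "is_interval {x. y < f x}"
    unfolding is_interval_1 using assms by (auto intro: less_le_trans)
  then show "{x \<in> space borel. y < f x} \<in> sets borel"
    by (simp add: real_interval_borel_measurable)
qed

lemma measurable_surv [measurable]: "surv N x k \<in> borel_measurable borel"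
  by (intro borel_measurable_antimono_ennreal surv_antimono)

lemma measurable_dead [measurable]:
  assumes "0 < N" shows "dead N x k \<in> borel_measurable borel"
  using assms by (intro borel_measurable_mono_ennreal dead_mono)

section \<open>Probabilities of small windows\<close>

lemma eventually_exp_le:
  assumes "0 < \<epsilon>" "0 < b"
  shows "\<forall>\<^sub>F N in sequentially. exp (- real N * \<epsilon>) \<le> b"
proof -
  have "(\<lambda>N. exp (- real N * \<epsilon>)) \<longlonglongrightarrow> 0"
    using assms by real_asymp
  then have "\<forall>\<^sub>F N in sequentially. exp (- real N * \<epsilon>) < b"
    using assms(2) by (rule order_tendstoD(2))
  then show ?thesis by (rule eventually_mono) simp
qed

lemma emeasure_density_interval_ge:
  fixes f :: "real \<Rightarrow> real"
  assumes "f \<in> borel_measurable borel" "u \<le> v" "0 \<le> m" "\<And>t. u \<le> t \<Longrightarrow> t \<le> v \<Longrightarrow> m \<le> f t"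
  shows "ennreal (m * (v - u)) \<le> emeasure (density lborel (\<lambda>t. ennreal (f t))) {u..v}"
proof -
  have "ennreal (m * (v - u)) = (\<integral>\<^sup>+t. ennreal m * indicator {u..v} t \<partial>lborel)"
    using assms by (subst nn_integral_cmult_indicator) (auto simp: ennreal_mult)
  also have "\<dots> \<le> (\<integral>\<^sup>+t. ennreal (f t) * indicator {u..v} t \<partial>lborel)"
    using assms(4) by (intro nn_integral_mono) (auto split: split_indicator intro: ennreal_leI)
  also have "\<dots> = emeasure (density lborel (\<lambda>t. ennreal (f t))) {u..v}"
    using assms(1) by (subst emeasure_density) auto
  finally show ?thesis .
qed

text \<open>The window may lie on one side of \<open>\<alpha>\<close>: the jump lemmas use one-sided
  windows, in which every noise value is at least as favourable as \<open>\<alpha>\<close>. Half of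
  \<open>\<epsilon>\<close> pays for the variation of the exponent, half for the window
  length.\<close>

lemma normal_window:
  assumes "0 < \<epsilon>"
  shows "\<exists>\<delta>>0. \<forall>u v. \<alpha> - \<delta> \<le> u \<longrightarrow> u < v \<longrightarrow> v \<le> \<alpha> + \<delta> \<longrightarrow>
    (\<forall>\<^sub>F N in sequentially. ennreal (exp (- real N * (\<alpha>\<^sup>2 / 2 + \<epsilon>))) \<le> emeasure (normal_law N) {u..v})"
proof -
  have "((\<lambda>a. a\<^sup>2 / 2) \<longlongrightarrow> \<alpha>\<^sup>2 / 2) (at \<alpha>)" by (intro tendsto_intros) auto
  then obtain \<delta> where \<delta>: "0 < \<delta>" "\<And>a. a \<noteq> \<alpha> \<Longrightarrow> dist a \<alpha> < \<delta> \<Longrightarrow> dist (a\<^sup>2 / 2) (\<alpha>\<^sup>2 / 2) < \<epsilon> / 2"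
    unfolding tendsto_iff eventually_at using assms by (metis UNIV_I half_gt_zero)
  have close: "a\<^sup>2 / 2 \<le> \<alpha>\<^sup>2 / 2 + \<epsilon> / 2" if "\<bar>a - \<alpha>\<bar> \<le> \<delta> / 2" for a
  proof (cases "a = \<alpha>")
    case False
    then have "dist (a\<^sup>2 / 2) (\<alpha>\<^sup>2 / 2) < \<epsilon> / 2"
      using that \<delta>(1) by (intro \<delta>(2)) (auto simp: dist_real_def)
    then show ?thesis unfolding dist_real_def by linarith
  qed (use assms in simp)
  show ?thesis
  proof (intro exI[of _ "\<delta> / 2"] conjI allI impI)
    show "0 < \<delta> / 2" using \<delta> by simp
    fix u v assume uv: "\<alpha> - \<delta> / 2 \<le> u" "u < v" "v \<le> \<alpha> + \<delta> / 2"
    have "\<forall>\<^sub>F N in sequentially. exp (- real N * (\<epsilon> / 2)) \<le> v - u"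
      using uv assms by (intro eventually_exp_le) auto
    with eventually_ge_at_top[of 7]
    show "\<forall>\<^sub>F N in sequentially. ennreal (exp (- real N * (\<alpha>\<^sup>2 / 2 + \<epsilon>))) \<le> emeasure (normal_law N) {u..v}"
    proof eventually_elim
      case (elim N)
      have "exp (- real N * (\<alpha>\<^sup>2 / 2 + \<epsilon>)) = exp (- real N * (\<alpha>\<^sup>2 / 2 + \<epsilon> / 2)) * exp (- real N * (\<epsilon> / 2))"
        by (simp add: exp_add[symmetric] algebra_simps)
      also have "\<dots> \<le> exp (- real N * (\<alpha>\<^sup>2 / 2 + \<epsilon> / 2)) * (v - u)"
        using elim by (intro mult_left_mono) auto
      finally have "ennreal (exp (- real N * (\<alpha>\<^sup>2 / 2 + \<epsilon>))) \<le> ennreal (exp (- real N * (\<alpha>\<^sup>2 / 2 + \<epsilon> / 2)) * (v - u))"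
        by (rule ennreal_leI)
      also have "\<dots> \<le> emeasure (normal_law N) {u..v}"
        unfolding normal_law_def
      proof (rule emeasure_density_interval_ge)
        fix t assume t: "u \<le> t" "t \<le> v"
        have "t\<^sup>2 / 2 \<le> \<alpha>\<^sup>2 / 2 + \<epsilon> / 2" using t uv by (intro close) (simp only: abs_le_iff, linarith)
        then have "exp (- real N * (\<alpha>\<^sup>2 / 2 + \<epsilon> / 2)) \<le> exp (- real N * (t\<^sup>2 / 2))"
          by (simp only: exp_le_cancel_iff mult_minus_left neg_le_iff_le) (intro mult_left_mono, auto)
        also have "\<dots> \<le> normal_density 0 (1 / sqrt (real N)) t"
          using normal_density_lower[OF elim(1), of t] by simp
        finally show "exp (- real N * (\<alpha>\<^sup>2 / 2 + \<epsilon> / 2)) \<le> normal_density 0 (1 / sqrt (real N)) t" .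
      qed (use uv in auto)
      finally show ?case .
    qed
  qed
qed

text \<open>As for the normal law; \<open>\<delta> < \<gamma>\<close> keeps the window inside the
  positive reals. The three shares of \<open>\<epsilon>\<close> pay for the variation of the rate,
  for the window length, and for the constant left by the missing degrees of freedom.\<close>

lemma gamma_window:
  assumes "0 < \<epsilon>" "0 < \<gamma>"
  shows "\<exists>\<delta>>0. \<delta> < \<gamma> \<and> (\<forall>u v j. \<gamma> - \<delta> \<le> u \<longrightarrow> u < v \<longrightarrow> v \<le> \<gamma> + \<delta> \<longrightarrow>
    (\<forall>\<^sub>F N in sequentially. ennreal (exp (- real N * (\<gamma> - 1 - ln \<gamma> + \<epsilon>))) \<le> emeasure (gamma_law N (N - j - 1)) {u..v}))"
proof -
  have "((\<lambda>g. g - 1 - ln g) \<longlongrightarrow> \<gamma> - 1 - ln \<gamma>) (at \<gamma>)" using assms by (intro tendsto_intros) auto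
  then obtain \<delta>' where \<delta>': "0 < \<delta>'" "\<And>a. a \<noteq> \<gamma> \<Longrightarrow> dist a \<gamma> < \<delta>' \<Longrightarrow> dist (a - 1 - ln a) (\<gamma> - 1 - ln \<gamma>) < \<epsilon> / 3"
    unfolding tendsto_iff eventually_at using assms by (metis UNIV_I divide_pos_pos zero_less_numeral)
  define \<delta> where "\<delta> = min (\<delta>' / 2) (\<gamma> / 2)"
  have \<delta>: "0 < \<delta>" "\<delta> < \<gamma>" "\<delta> \<le> \<gamma> / 2" "\<delta> < \<delta>'" using \<delta>' assms by (auto simp: \<delta>_def)
  have close: "a - 1 - ln a \<le> \<gamma> - 1 - ln \<gamma> + \<epsilon> / 3" if "\<bar>a - \<gamma>\<bar> \<le> \<delta>" for a
  proof (cases "a = \<gamma>")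
    case False
    then have "dist (a - 1 - ln a) (\<gamma> - 1 - ln \<gamma>) < \<epsilon> / 3"
      using that \<delta> by (intro \<delta>'(2)) (auto simp: dist_real_def)
    then show ?thesis unfolding dist_real_def by linarith
  qed (use assms in simp)
  define L where "L = \<bar>ln (\<gamma> / 2)\<bar> + \<bar>ln (2 * \<gamma>)\<bar>"
  have L: "\<bar>ln a\<bar> \<le> L" if "\<bar>a - \<gamma>\<bar> \<le> \<delta>" for a
  proof -
    have "\<gamma> / 2 \<le> a" "a \<le> 2 * \<gamma>" using that \<delta> assms by auto
    then have "ln (\<gamma> / 2) \<le> ln a" "ln a \<le> ln (2 * \<gamma>)" using assms by auto
    then show ?thesis by (auto simp: L_def)
  qed
  show ?thesis
  proof (intro exI[of _ \<delta>] conjI allI impI \<delta>(1,2))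
    fix u v j assume uv: "\<gamma> - \<delta> \<le> u" "u < v" "v \<le> \<gamma> + \<delta>"
    define C where "C = real j + 3 + (real j + 2) * L"
    have "\<forall>\<^sub>F N in sequentially. exp (- real N * (\<epsilon> / 3)) \<le> v - u"
      "\<forall>\<^sub>F N in sequentially. exp (- real N * (\<epsilon> / 3)) \<le> exp (- C)"
      using uv assms by (intro eventually_exp_le; simp)+
    with eventually_ge_at_top[of "j + 2"]
    show "\<forall>\<^sub>F N in sequentially. ennreal (exp (- real N * (\<gamma> - 1 - ln \<gamma> + \<epsilon>))) \<le> emeasure (gamma_law N (N - j - 1)) {u..v}"
    proof eventually_elim
      case (elim N)
      let ?m = "exp (- real N * (\<gamma> - 1 - ln \<gamma> + \<epsilon> / 3) - C)"
      have "exp (- real N * (\<gamma> - 1 - ln \<gamma> + \<epsilon>)) = exp (- real N * (\<gamma> - 1 - ln \<gamma> + \<epsilon> / 3)) * exp (- real N * (\<epsilon> / 3)) * exp (- real N * (\<epsilon> / 3))"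
        by (simp add: exp_add[symmetric] algebra_simps)
      also have "\<dots> \<le> exp (- real N * (\<gamma> - 1 - ln \<gamma> + \<epsilon> / 3)) * exp (- C) * (v - u)"
        using elim by (intro mult_mono) auto
      also have "\<dots> = ?m * (v - u)" by (simp add: exp_add[symmetric])
      finally have "ennreal (exp (- real N * (\<gamma> - 1 - ln \<gamma> + \<epsilon>))) \<le> ennreal (?m * (v - u))"
        by (rule ennreal_leI)
      also have "\<dots> \<le> emeasure (density lborel (\<lambda>g. ennreal (erlang_density (N - j - 2) (real N) g))) {u..v}"
      proof (rule emeasure_density_interval_ge)
        fix t assume t: "u \<le> t" "t \<le> v"
        have t': "\<bar>t - \<gamma>\<bar> \<le> \<delta>" and t0: "0 < t" using t uv \<delta> by auto
        have "real N * (t - 1 - ln t) \<le> real N * (\<gamma> - 1 - ln \<gamma> + \<epsilon> / 3)"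
          by (intro mult_left_mono close t') simp
        moreover have "real j + 3 + (real j + 2) * \<bar>ln t\<bar> \<le> C"
          unfolding C_def by (intro add_left_mono mult_left_mono L t') simp
        ultimately have "?m \<le> exp (- real N * (t - 1 - ln t) - (real j + 3 + (real j + 2) * \<bar>ln t\<bar>))"
          by simp
        also have "\<dots> \<le> erlang_density (N - j - 2) (real N) t"
          by (rule erlang_density_lower[OF t0 elim(1)])
        finally show "?m \<le> erlang_density (N - j - 2) (real N) t" .
      qed (use uv in auto)
      also have "N - j - 1 \<noteq> 0" "N - j - 1 - 1 = N - j - 2" using elim by auto
      then have "density lborel (\<lambda>g. ennreal (erlang_density (N - j - 2) (real N) g)) = gamma_law N (N - j - 1)"
        by (simp add: gamma_law_def)
      finally show ?case .
    qed
  qed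
qed

section \<open>Exponential rates\<close>

text \<open>The shift by \<open>j\<close> makes these notions stable under a step of the chain, which lowers the number of remaining
  steps by one.\<close>

definition exp_lower :: "(nat \<Rightarrow> nat \<Rightarrow> real \<Rightarrow> ennreal) \<Rightarrow> real \<Rightarrow> real \<Rightarrow> bool" where
  "exp_lower P c r \<longleftrightarrow> (\<forall>\<epsilon>>0. \<forall>j. \<forall>\<^sub>F N in sequentially. ennreal (exp (- real N * (r + \<epsilon>))) \<le> P N (N - j) c)"

definition exp_upper :: "(nat \<Rightarrow> nat \<Rightarrow> real \<Rightarrow> ennreal) \<Rightarrow> real \<Rightarrow> real \<Rightarrow> bool" where
  "exp_upper P c r \<longleftrightarrow> (\<forall>\<epsilon>>0. \<forall>j. \<forall>\<^sub>F N in sequentially. P N (N - j) c \<le> ennreal (exp (- real N * (r - \<epsilon>))))"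

lemma exp_lower_weaken:
  assumes "exp_lower P c r" "r \<le> r'" "\<And>N k. 0 < N \<Longrightarrow> P N k c \<le> P N k c'"
  shows "exp_lower P c' r'"
  unfolding exp_lower_def
proof (intro allI impI)
  fix \<epsilon> :: real and j assume "0 < \<epsilon>"
  then have "\<forall>\<^sub>F N in sequentially. ennreal (exp (- real N * (r + \<epsilon>))) \<le> P N (N - j) c"
    using assms(1) by (auto simp: exp_lower_def)
  with eventually_gt_at_top[of 0]
  show "\<forall>\<^sub>F N in sequentially. ennreal (exp (- real N * (r' + \<epsilon>))) \<le> P N (N - j) c'"
  proof eventually_elim
    case (elim N)
    have "ennreal (exp (- real N * (r' + \<epsilon>))) \<le> ennreal (exp (- real N * (r + \<epsilon>)))"
      using assms(2) by (intro ennreal_leI) (simp add: mult_left_mono)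
    also have "\<dots> \<le> P N (N - j) c" by fact
    also have "\<dots> \<le> P N (N - j) c'" using assms(3) elim by simp
    finally show ?case .
  qed
qed

text \<open>Rates are proved with a surplus \<open>\<eta>\<close>, the price of a small kick across
  a fixed point of the noiseless map; here it is removed.\<close>

lemma exp_lower_closed:
  assumes "\<And>\<eta>. 0 < \<eta> \<Longrightarrow> exp_lower P c (r + \<eta>)" shows "exp_lower P c r"
  unfolding exp_lower_def
proof (intro allI impI)
  fix \<epsilon> :: real and j assume "0 < \<epsilon>"
  then show "\<forall>\<^sub>F N in sequentially. ennreal (exp (- real N * (r + \<epsilon>))) \<le> P N (N - j) c"
    using assms[of "\<epsilon> / 2", unfolded exp_lower_def, rule_format, of "\<epsilon> / 2" j] by (simp add: add.assoc)
qed

lemma exp_upper_closed: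
  assumes "\<And>\<eta>. 0 < \<eta> \<Longrightarrow> exp_upper P c (r - \<eta>)" shows "exp_upper P c r"
  unfolding exp_upper_def
proof (intro allI impI)
  fix \<epsilon> :: real and j assume "0 < \<epsilon>"
  then show "\<forall>\<^sub>F N in sequentially. P N (N - j) c \<le> ennreal (exp (- real N * (r - \<epsilon>)))"
    using assms[of "\<epsilon> / 2", unfolded exp_upper_def, rule_format, of "\<epsilon> / 2" j]
    by (simp add: diff_diff_eq)
qed

section \<open>Bounds for a single step of the chain\<close>

lemma step_op_ge_windows:
  assumes [measurable]: "U \<in> sets borel" "V \<in> sets borel"
    and "\<And>a g. a \<in> U \<Longrightarrow> g \<in> V \<Longrightarrow> p \<le> (if 0 < x - a - c then f (g / (x - a - c)) else d)"
  shows "emeasure (normal_law N) U * emeasure (gamma_law N k) V * p \<le> step_op N x d k f c"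
proof -
  have "emeasure (normal_law N) U * emeasure (gamma_law N k) V * p
      = (\<integral>\<^sup>+a. (\<integral>\<^sup>+g. indicator U a * p * indicator V g \<partial>gamma_law N k) \<partial>normal_law N)"
    by (simp add: nn_integral_cmult nn_integral_multc ac_simps)
  also have "\<dots> \<le> step_op N x d k f c"
    unfolding step_op_def
  proof (intro nn_integral_mono)
    fix a g
    show "indicator U a * p * indicator V g
      \<le> (if 0 < x - a - c then f (g / (x - a - c)) else d)"
      using assms(3)[of a g] by (cases "a \<in> U \<and> g \<in> V") (auto simp: indicator_def)
  qed
  finally show ?thesis .
qed

text \<open>Atypical noise is still multiplied by a bound \<open>p'\<close> on the continuation, not
  by 1. In \<open>exp_upper_surv_jump\<close> this \<open>p'\<close> is the survival probability
  from 0, and that is what lets the rate grow with each application.\<close>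

lemma step_op_le_windows:
  assumes N: "0 < N" and [measurable]: "U \<in> sets borel" "V \<in> sets borel"
    and good: "\<And>a g. a \<in> U \<Longrightarrow> g \<in> V \<Longrightarrow> (if 0 < x - a - c then f (g / (x - a - c)) else d) \<le> p"
    and bad: "\<And>c. 0 \<le> c \<Longrightarrow> f c \<le> p'" "d \<le> p'"
  shows "step_op N x d k f c \<le> p + (emeasure (normal_law N) (- U) + emeasure (gamma_law N k) (- V)) * p'"
proof -
  interpret n: prob_space "normal_law N" by (rule prob_space_normal_law[OF N])
  interpret g: prob_space "gamma_law N k" by (rule prob_space_gamma_law[OF N])
  have "step_op N x d k f c \<le> (\<integral>\<^sup>+a. (\<integral>\<^sup>+g. p + (indicator (- U) a * p' + indicator (- V) g * p') \<partial>gamma_law N k) \<partial>normal_law N)"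
    unfolding step_op_def
  proof (rule nn_integral_mono, rule nn_integral_mono_AE)
    fix a
    show "AE g in gamma_law N k. (if 0 < x - a - c then f (g / (x - a - c)) else d)
      \<le> p + (indicator (- U) a * p' + indicator (- V) g * p')"
      using AE_gamma_law_nonneg[of N k]
    proof eventually_elim
      case (elim g)
      show ?case
      proof (cases "a \<in> U \<and> g \<in> V")
        case True
        then show ?thesis using good[of a g] by (simp add: add_increasing2)
      next
        case False
        have "(if 0 < x - a - c then f (g / (x - a - c)) else d) \<le> p'"
          using bad elim by simp
        also have "\<dots> \<le> indicator (- U) a * p' + indicator (- V) g * p'"
          using False by (auto simp: indicator_def)
        finally show ?thesis by (simp add: add_increasing)
      qed
    qed
  qed
  also have "\<dots> = p + (emeasure (normal_law N) (- U) + emeasure (gamma_law N k) (- V)) * p'"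
    using n.emeasure_space_1 g.emeasure_space_1
    by (simp add: nn_integral_add nn_integral_multc distrib_right)
  finally show ?thesis .
qed

text \<open>One step with \<open>a\<close> near \<open>\<alpha>\<close> and \<open>g\<close> near
  \<open>\<gamma>\<close> leads from \<open>c\<close> to about \<open>c'\<close>; the noises are
  independent, so their rates are added to that of \<open>c'\<close>.\<close>

lemma exp_lower_dead_jump:
  assumes exp_lower: "exp_lower (\<lambda>N. dead N x) c' r" and y: "0 < x - \<alpha> - c" and \<gamma>: "0 < \<gamma>" and c': "c' = \<gamma> / (x - \<alpha> - c)"
  shows "exp_lower (\<lambda>N. dead N x) c (r + \<alpha>\<^sup>2 / 2 + (\<gamma> - 1 - ln \<gamma>))"
  unfolding exp_lower_def
proof (intro allI impI)
  fix \<epsilon> :: real and j assume \<epsilon>: "0 < \<epsilon>"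
  have \<epsilon>3: "0 < \<epsilon> / 3" using \<epsilon> by simp
  obtain \<delta>1 where \<delta>1: "0 < \<delta>1"
    and w1: "\<And>u v. \<alpha> - \<delta>1 \<le> u \<Longrightarrow> u < v \<Longrightarrow> v \<le> \<alpha> + \<delta>1 \<Longrightarrow>
      \<forall>\<^sub>F N in sequentially. ennreal (exp (- real N * (\<alpha>\<^sup>2 / 2 + \<epsilon> / 3))) \<le> emeasure (normal_law N) {u..v}"
    using normal_window[OF \<epsilon>3, of \<alpha>] by blast
  obtain \<delta>2 where \<delta>2: "0 < \<delta>2" "\<delta>2 < \<gamma>"
    and w2: "\<And>u v j. \<gamma> - \<delta>2 \<le> u \<Longrightarrow> u < v \<Longrightarrow> v \<le> \<gamma> + \<delta>2 \<Longrightarrow>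
      \<forall>\<^sub>F N in sequentially. ennreal (exp (- real N * (\<gamma> - 1 - ln \<gamma> + \<epsilon> / 3))) \<le> emeasure (gamma_law N (N - j - 1)) {u..v}"
    using gamma_window[OF \<epsilon>3 \<gamma>] by blast
  \<comment> \<open>Windows to the right: larger \<open>a\<close> or \<open>g\<close> only raises
    the next position or kills, and \<open>dead\<close> is increasing.\<close>
  have w1: "\<forall>\<^sub>F N in sequentially. ennreal (exp (- real N * (\<alpha>\<^sup>2 / 2 + \<epsilon> / 3))) \<le> emeasure (normal_law N) {\<alpha>..\<alpha> + \<delta>1}"
    using \<delta>1 by (intro w1) auto
  have w2: "\<forall>\<^sub>F N in sequentially. ennreal (exp (- real N * (\<gamma> - 1 - ln \<gamma> + \<epsilon> / 3))) \<le> emeasure (gamma_law N (N - j - 1)) {\<gamma>..\<gamma> + \<delta>2}"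
    using \<delta>2 by (intro w2) auto
  have "\<forall>\<^sub>F N in sequentially. ennreal (exp (- real N * (r + \<epsilon> / 3))) \<le> dead N x (N - Suc j) c'"
    using exp_lower \<epsilon> unfolding exp_lower_def by simp
  with w1 w2 eventually_gt_at_top[of j]
  show "\<forall>\<^sub>F N in sequentially. ennreal (exp (- real N * (r + \<alpha>\<^sup>2 / 2 + (\<gamma> - 1 - ln \<gamma>) + \<epsilon>))) \<le> dead N x (N - j) c"
  proof eventually_elim
    case (elim N)
    have N: "0 < N" "N - j = Suc (N - j - 1)" "N - j - 1 = N - Suc j" using elim by auto
    have "ennreal (exp (- real N * (r + \<alpha>\<^sup>2 / 2 + (\<gamma> - 1 - ln \<gamma>) + \<epsilon>)))
      = ennreal (exp (- real N * (\<alpha>\<^sup>2 / 2 + \<epsilon> / 3))) * ennreal (exp (- real N * (\<gamma> - 1 - ln \<gamma> + \<epsilon> / 3))) * ennreal (exp (- real N * (r + \<epsilon> / 3)))"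
      by (simp add: ennreal_mult[symmetric] exp_add[symmetric] algebra_simps)
    also have "\<dots> \<le> emeasure (normal_law N) {\<alpha>..\<alpha> + \<delta>1} * emeasure (gamma_law N (N - j - 1)) {\<gamma>..\<gamma> + \<delta>2} * dead N x (N - j - 1) c'"
      using elim N(3) by (intro mult_mono) auto
    also have "\<dots> \<le> step_op N x 1 (N - j - 1) (dead N x (N - j - 1)) c"
    proof (rule step_op_ge_windows[OF atLeastAtMost_borel atLeastAtMost_borel])
      fix a g assume ag: "a \<in> {\<alpha>..\<alpha> + \<delta>1}" "g \<in> {\<gamma>..\<gamma> + \<delta>2}"
      show "dead N x (N - j - 1) c' \<le> (if 0 < x - a - c then dead N x (N - j - 1) (g / (x - a - c)) else 1)"
      proof (cases "0 < x - a - c")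
        case True
        have "c' \<le> g / (x - a - c)" unfolding c' using ag True \<gamma> by (intro frac_le) auto
        then show ?thesis using True dead_mono[OF N(1)] by simp
      next
        case False
        then show ?thesis by (simp add: chain_le_1 N(1))
      qed
    qed
    also have "\<dots> = dead N x (N - j) c" by (subst (2) N(2)) simp
    finally show ?case .
  qed
qed

lemma exp_lower_surv_jump:
  assumes exp_lower: "exp_lower (\<lambda>N. surv N x) c' r" and y: "0 < x - \<alpha> - c" and \<gamma>: "0 < \<gamma>" and c': "c' = \<gamma> / (x - \<alpha> - c)"
  shows "exp_lower (\<lambda>N. surv N x) c (r + \<alpha>\<^sup>2 / 2 + (\<gamma> - 1 - ln \<gamma>))"
  unfolding exp_lower_def
proof (intro allI impI)
  fix \<epsilon> :: real and j assume \<epsilon>: "0 < \<epsilon>"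
  have \<epsilon>3: "0 < \<epsilon> / 3" using \<epsilon> by simp
  obtain \<delta>1 where \<delta>1: "0 < \<delta>1"
    and w1: "\<And>u v. \<alpha> - \<delta>1 \<le> u \<Longrightarrow> u < v \<Longrightarrow> v \<le> \<alpha> + \<delta>1 \<Longrightarrow>
      \<forall>\<^sub>F N in sequentially. ennreal (exp (- real N * (\<alpha>\<^sup>2 / 2 + \<epsilon> / 3))) \<le> emeasure (normal_law N) {u..v}"
    using normal_window[OF \<epsilon>3, of \<alpha>] by blast
  obtain \<delta>2 where \<delta>2: "0 < \<delta>2" "\<delta>2 < \<gamma>"
    and w2: "\<And>u v j. \<gamma> - \<delta>2 \<le> u \<Longrightarrow> u < v \<Longrightarrow> v \<le> \<gamma> + \<delta>2 \<Longrightarrow>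
      \<forall>\<^sub>F N in sequentially. ennreal (exp (- real N * (\<gamma> - 1 - ln \<gamma> + \<epsilon> / 3))) \<le> emeasure (gamma_law N (N - j - 1)) {u..v}"
    using gamma_window[OF \<epsilon>3 \<gamma>] by blast
  \<comment> \<open>Windows to the left: smaller \<open>a\<close> or \<open>g\<close> lowers the
    next position and avoids killing, and \<open>surv\<close> is decreasing.
    \<open>\<delta>2 < \<gamma>\<close> keeps \<open>g\<close> positive.\<close>
  have w1: "\<forall>\<^sub>F N in sequentially. ennreal (exp (- real N * (\<alpha>\<^sup>2 / 2 + \<epsilon> / 3))) \<le> emeasure (normal_law N) {\<alpha> - \<delta>1..\<alpha>}"
    using \<delta>1 by (intro w1) auto
  have w2: "\<forall>\<^sub>F N in sequentially. ennreal (exp (- real N * (\<gamma> - 1 - ln \<gamma> + \<epsilon> / 3))) \<le> emeasure (gamma_law N (N - j - 1)) {\<gamma> - \<delta>2..\<gamma>}"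
    using \<delta>2 by (intro w2) auto
  have "\<forall>\<^sub>F N in sequentially. ennreal (exp (- real N * (r + \<epsilon> / 3))) \<le> surv N x (N - Suc j) c'"
    using exp_lower \<epsilon> unfolding exp_lower_def by simp
  with w1 w2 eventually_gt_at_top[of j]
  show "\<forall>\<^sub>F N in sequentially. ennreal (exp (- real N * (r + \<alpha>\<^sup>2 / 2 + (\<gamma> - 1 - ln \<gamma>) + \<epsilon>))) \<le> surv N x (N - j) c"
  proof eventually_elim
    case (elim N)
    have N: "0 < N" "N - j = Suc (N - j - 1)" "N - j - 1 = N - Suc j" using elim by auto
    have "ennreal (exp (- real N * (r + \<alpha>\<^sup>2 / 2 + (\<gamma> - 1 - ln \<gamma>) + \<epsilon>)))
      = ennreal (exp (- real N * (\<alpha>\<^sup>2 / 2 + \<epsilon> / 3))) * ennreal (exp (- real N * (\<gamma> - 1 - ln \<gamma> + \<epsilon> / 3))) * ennreal (exp (- real N * (r + \<epsilon> / 3)))"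
      by (simp add: ennreal_mult[symmetric] exp_add[symmetric] algebra_simps)
    also have "\<dots> \<le> emeasure (normal_law N) {\<alpha> - \<delta>1..\<alpha>} * emeasure (gamma_law N (N - j - 1)) {\<gamma> - \<delta>2..\<gamma>} * surv N x (N - j - 1) c'"
      using elim N(3) by (intro mult_mono) auto
    also have "\<dots> \<le> step_op N x 0 (N - j - 1) (surv N x (N - j - 1)) c"
    proof (rule step_op_ge_windows[OF atLeastAtMost_borel atLeastAtMost_borel])
      fix a g assume ag: "a \<in> {\<alpha> - \<delta>1..\<alpha>}" "g \<in> {\<gamma> - \<delta>2..\<gamma>}"
      have "0 < x - a - c" using ag y by auto
      moreover have "g / (x - a - c) \<le> c'"
        unfolding c' using ag y \<delta>2 by (intro frac_le) auto
      ultimately show "surv N x (N - j - 1) c' \<le> (if 0 < x - a - c then surv N x (N - j - 1) (g / (x - a - c)) else 0)"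
        by (simp add: surv_antimono)
    qed
    also have "\<dots> = surv N x (N - j) c" by (subst (2) N(2)) simp
    finally show ?case .
  qed
qed

text \<open>From \<open>c \<ge> x\<close> every \<open>a \<ge> 0\<close> kills at once, and a window
  next to the mode of the normal law costs nothing on the exponential scale.\<close>

lemma exp_lower_dead_top:
  assumes "x \<le> c" shows "exp_lower (\<lambda>N. dead N x) c 0"
  unfolding exp_lower_def
proof (intro allI impI)
  fix \<epsilon> :: real and j assume \<epsilon>: "0 < \<epsilon>"
  obtain \<delta> where \<delta>: "0 < \<delta>"
    and w: "\<And>u v. 0 - \<delta> \<le> u \<Longrightarrow> u < v \<Longrightarrow> v \<le> 0 + \<delta> \<Longrightarrow>
      \<forall>\<^sub>F N in sequentially. ennreal (exp (- real N * (0\<^sup>2 / 2 + \<epsilon>))) \<le> emeasure (normal_law N) {u..v}"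
    using normal_window[OF \<epsilon>, of 0] by blast
  have "\<forall>\<^sub>F N in sequentially. ennreal (exp (- real N * (0\<^sup>2 / 2 + \<epsilon>))) \<le> emeasure (normal_law N) {0..\<delta>}"
    using \<delta> by (intro w) auto
  with eventually_gt_at_top[of j]
  show "\<forall>\<^sub>F N in sequentially. ennreal (exp (- real N * (0 + \<epsilon>))) \<le> dead N x (N - j) c"
  proof eventually_elim
    case (elim N)
    have N: "0 < N" "N - j = Suc (N - j - 1)" using elim by auto
    interpret g: prob_space "gamma_law N (N - j - 1)" by (rule prob_space_gamma_law[OF N(1)])
    have "ennreal (exp (- real N * (0 + \<epsilon>))) \<le> emeasure (normal_law N) {0..\<delta>}"
      using elim by simp
    also have "\<dots> = (\<integral>\<^sup>+a. indicator {0..\<delta>} a \<partial>normal_law N)" by simp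
    also have "\<dots> \<le> (\<integral>\<^sup>+a. (\<integral>\<^sup>+g. (if 0 < x - a - c then dead N x (N - j - 1) (g / (x - a - c)) else 1) \<partial>gamma_law N (N - j - 1)) \<partial>normal_law N)"
      using assms g.emeasure_space_1 by (intro nn_integral_mono) (auto split: split_indicator)
    also have "\<dots> = dead N x (Suc (N - j - 1)) c" unfolding chain.simps step_op_def by simp
    also have "\<dots> = dead N x (N - j) c" using N(2) by simp
    finally show ?case .
  qed
qed

text \<open>Iterating \<open>T\<close> moves any point of \<open>(l, u)\<close> beyond \<open>u\<close> in finitely many steps; the supremum of the
  counterexamples replaces the iteration.\<close>

lemma escape_induct_up:
  fixes P :: "real \<Rightarrow> bool"
  assumes cont: "continuous_on {l<..u} T" and T: "\<And>c. l < c \<Longrightarrow> c \<le> u \<Longrightarrow> c < T c"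
    and top: "\<And>c. u \<le> c \<Longrightarrow> P c" and step: "\<And>c. l < c \<Longrightarrow> c < u \<Longrightarrow> P (T c) \<Longrightarrow> P c"
    and c: "l < c"
  shows "P c"
proof (rule ccontr)
  assume neg: "\<not> P c"
  define B where "B = {b. l < b \<and> \<not> P b}"
  have cB: "c \<in> B" using neg c by (simp add: B_def)
  have Bu: "b < u" if "b \<in> B" for b using that top[of b] by (force simp: B_def)
  have bdd: "bdd_above B" using Bu by (intro bdd_aboveI[of _ u]) (simp add: less_imp_le)
  define s where "s = Sup B"
  have sc: "c \<le> s" unfolding s_def by (rule cSup_upper[OF cB bdd])
  have su: "s \<le> u" unfolding s_def using cB Bu by (intro cSup_least) (auto simp: less_imp_le)
  have above: "P b" if "s < b" for b
    using that cSup_upper[OF _ bdd, of b] sc c by (force simp: B_def s_def)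
  have "s \<in> {l<..u}" using sc su c by simp
  moreover have "0 < T s - s" using T[of s] sc su c by simp
  \<comment> \<open>Near their supremum \<open>s\<close>, the counterexamples are carried by
    \<open>T\<close> beyond \<open>s\<close>, where none is left.\<close>
  ultimately obtain d where d: "0 < d" "\<And>b. b \<in> {l<..u} \<Longrightarrow> dist b s < d \<Longrightarrow> dist (T b) (T s) < T s - s"
    using cont unfolding continuous_on_iff by blast
  obtain b where b: "b \<in> B" "s - d < b"
    using d(1) cB less_cSup_iff[of B "s - d"] bdd by (auto simp: s_def)
  have "b \<le> s" unfolding s_def by (rule cSup_upper[OF b(1) bdd])
  then have "s < T b"
    using d(2)[of b] b Bu[OF b(1)] by (auto simp: B_def dist_real_def)
  then have "P (T b)" by (rule above)
  then have "P b" using step[of b] b(1) Bu[OF b(1)] by (auto simp: B_def)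
  then show False using b(1) by (simp add: B_def)
qed

lemma escape_induct_down:
  fixes P :: "real \<Rightarrow> bool"
  assumes cont: "continuous_on {u..<l} T" and T: "\<And>c. c < l \<Longrightarrow> u \<le> c \<Longrightarrow> T c < c"
    and top: "\<And>c. c \<le> u \<Longrightarrow> P c" and step: "\<And>c. c < l \<Longrightarrow> u < c \<Longrightarrow> P (T c) \<Longrightarrow> P c"
    and c: "c < l"
  shows "P c"
proof -
  have "P (- b)" if "- l < b" for b
  proof (rule escape_induct_up[where P = "\<lambda>b. P (- b)" and l = "- l" and u = "- u" and T = "\<lambda>b. - T (- b)"])
    show "continuous_on {- l<..- u} (\<lambda>b. - T (- b))"
      by (intro continuous_on_minus continuous_on_compose2[OF cont] continuous_intros) auto
    show "b < - T (- b)" if "- l < b" "b \<le> - u" for b using T[of "- b"] that by simp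
  qed (use top step that in auto)
  from this[of "- c"] c show ?thesis by simp
qed

text \<open>The potential of the chain: \<open>exp (N * psi x c) / c\<close> is the density of the
  overview. For \<open>x = A + 1 / A\<close> the derivative is
  \<open>(c - A) * (c - 1 / A) / c\<close>, so the critical points are the fixed points of the
  noiseless map, with a local maximum at \<open>1 / A\<close> and a local minimum at
  \<open>A\<close> when \<open>A > 1\<close>.\<close>

definition psi :: "real \<Rightarrow> real \<Rightarrow> real" where
  "psi x c = c\<^sup>2 / 2 - x * c + ln c"

text \<open>\<open>c'\<close> is the preimage of \<open>c\<close> under the noiseless map. It is
  reached by the noise \<open>a = c' - c\<close>, \<open>g = c' / c\<close>, and the left side is
  the rate of that noise, so the costs along a backward path telescope.\<close>

lemma psi_step:
  assumes "0 < c" "0 < c'" "c' = x - 1 / c"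
  shows "(c' - c)\<^sup>2 / 2 + (c' / c - 1 - ln (c' / c)) = psi x c - psi x c'"
proof -
  have x: "x = c' + 1 / c" using assms by simp
  show ?thesis unfolding psi_def x using assms(1,2)
    by (simp add: ln_div field_simps power2_eq_square)
qed

lemma psi_antimono:
  assumes A: "1 \<le> A" and x: "x = A + 1 / A" and c: "1 / A \<le> c" "c \<le> c'" "c' \<le> A"
  shows "psi x c' \<le> psi x c"
proof (rule DERIV_nonpos_imp_nonincreasing[OF c(2)])
  fix t assume t: "c \<le> t" "t \<le> c'"
  have t0: "0 < t" using c t A by (smt (verit) divide_pos_pos)
  have "(psi x has_real_derivative (t - x + 1 / t)) (at t)"
    unfolding psi_def using t0 by (auto intro!: derivative_eq_intros)
  moreover have "t - x + 1 / t = (t - A) * (t - 1 / A) / t"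
    unfolding x using A t0 by (simp add: field_simps)
  moreover have "(t - A) * (t - 1 / A) / t \<le> 0"
    using t c t0 by (intro divide_nonpos_pos mult_nonpos_nonneg) auto
  ultimately show "\<exists>y. DERIV (psi x) t :> y \<and> y \<le> 0" by metis
qed

section \<open>Lower bound for the probability of death\<close>

lemma flow_up_iff:
  fixes A x c :: real
  assumes A: "1 \<le> A" and x: "x = A + 1 / A" and c: "c < x"
  shows "c < 1 / (x - c) \<longleftrightarrow> 0 < (c - A) * (c - 1 / A)"
proof -
  have "c < 1 / (x - c) \<longleftrightarrow> c * (x - c) < 1" using pos_less_divide_eq[of "x - c" c 1] c by simp
  also have "1 - c * (x - c) = (c - A) * (c - 1 / A)" unfolding x using A by (simp add: field_simps)
  then have "c * (x - c) < 1 \<longleftrightarrow> 0 < (c - A) * (c - 1 / A)" by linarith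
  finally show ?thesis .
qed

text \<open>Above the repelling fixed point the noiseless map, which costs nothing, passes
  \<open>x\<close> after finitely many steps.\<close>

lemma dead_lower_above:
  assumes A: "1 < A" and x: "x = A + 1 / A" and c: "A < c"
  shows "exp_lower (\<lambda>N. dead N x) c 0"
proof -
  have x0: "2 \<le> x" "0 < x"
  proof -
    have "0 \<le> (A - 1)\<^sup>2 / A" using A by simp
    also have "(A - 1)\<^sup>2 / A = x - 2" unfolding x using A by (simp add: field_simps power2_eq_square)
    finally show "2 \<le> x" by simp
    then show "0 < x" by simp
  qed
  have drift: "exp_lower (\<lambda>N. dead N x) b 0" if "exp_lower (\<lambda>N. dead N x) (1 / (x - b)) 0" "b < x" for b
    using exp_lower_dead_jump[OF that(1), of 0 b 1] that(2) by simp
  show ?thesis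
  \<comment> \<open>\<open>x - 1 / x\<close> is the point that the noiseless map sends to
    \<open>x\<close>.\<close>
  proof (rule escape_induct_up[where P = "\<lambda>c. exp_lower (\<lambda>N. dead N x) c 0" and l = A and u = "x - 1 / x" and T = "\<lambda>c. 1 / (x - c)"])
    show "continuous_on {A<..x - 1 / x} (\<lambda>c. 1 / (x - c))"
    proof (intro continuous_intros ballI)
      fix b assume "b \<in> {A<..x - 1 / x}"
      then have "b \<le> x - 1 / x" by simp
      also have "\<dots> < x" using x0 by simp
      finally show "x - b \<noteq> 0" by simp
    qed
    show "b < 1 / (x - b)" if "A < b" "b \<le> x - 1 / x" for b
    proof -
      have "b < x" using that(2) x0 by (smt (verit) divide_pos_pos)
      moreover have "0 < (b - A) * (b - 1 / A)"
        using that A by (intro mult_pos_pos) (auto simp: less_trans[of "1 / A" 1] intro: less_trans[of "1 / A" 1])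
      ultimately show ?thesis using flow_up_iff[of A x b] A x by simp
    qed
    show "exp_lower (\<lambda>N. dead N x) b 0" if "x - 1 / x \<le> b" for b
    proof (cases "x \<le> b")
      case False
      then have "x \<le> 1 / (x - b)" using that x0 by (simp add: field_simps)
      then show ?thesis using drift[of b] exp_lower_dead_top False by simp
    qed (rule exp_lower_dead_top)
    show "exp_lower (\<lambda>N. dead N x) b 0" if "A < b" "b < x - 1 / x" "exp_lower (\<lambda>N. dead N x) (1 / (x - b)) 0" for b
      using drift[of b] that x0 by (smt (verit) divide_pos_pos)
  qed (rule c)
qed

lemma dead_lower_mid:
  assumes A: "1 < A" and x: "x = A + 1 / A" and c: "1 / A < c" "c \<le> A"
  shows "exp_lower (\<lambda>N. dead N x) c (psi x c - psi x A)"
proof (rule exp_lower_closed)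
  fix \<eta> :: real assume \<eta>: "0 < \<eta>"
  \<comment> \<open>A kick \<open>a = \<beta>\<close> costs
    \<open>\<beta>\<^sup>2 / 2 \<le> \<eta>\<close> and carries the chain from within
    \<open>\<beta> / 2\<close> of \<open>A\<close> to above \<open>A\<close>. The other two terms
    keep \<open>x - \<beta> - b\<close> positive for \<open>b \<le> A\<close> and the kicking range
    above \<open>1 / A\<close>.\<close>
  define \<beta> where "\<beta> = min (sqrt (2 * \<eta>)) (min (1 / (2 * A)) (A - 1 / A))"
  have iA: "0 < 1 / A" "1 / A < A"
    using A by (auto intro: less_trans[of "1 / A" 1])
  have \<beta>: "0 < \<beta>" "\<beta> \<le> 1 / (2 * A)" "\<beta> \<le> A - 1 / A" using \<eta> A iA by (auto simp: \<beta>_def)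
  have \<beta>2: "\<beta>\<^sup>2 / 2 \<le> \<eta>"
  proof -
    have "\<beta>\<^sup>2 \<le> (sqrt (2 * \<eta>))\<^sup>2" using \<beta> by (intro power_mono) (auto simp: \<beta>_def)
    then show ?thesis using \<eta> by simp
  qed
  have \<beta>A: "\<beta> < 1 / A"
  proof -
    have "1 / (2 * A) < 1 / A" using A by (simp add: field_simps)
    then show ?thesis using \<beta> by linarith
  qed
  define P where "P c \<longleftrightarrow> (c \<le> A \<longrightarrow> exp_lower (\<lambda>N. dead N x) c (psi x c - psi x A + \<eta>))" for c
  have "P c"
  proof (rule escape_induct_up[where P = P and l = "1 / A" and u = "A - \<beta> / 2" and T = "\<lambda>c. x - 1 / c"])
    show "continuous_on {1 / A<..A - \<beta> / 2} (\<lambda>c. x - 1 / c)"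
      using iA by (intro continuous_intros) auto
    show "b < x - 1 / b" if "1 / A < b" "b \<le> A - \<beta> / 2" for b
    proof -
      have b: "0 < b" "b < A" using that iA \<beta> by linarith+
      have "0 < (A - b) * (b - 1 / A) / b" using that b by (intro divide_pos_pos mult_pos_pos) auto
      also have "\<dots> = x - 1 / b - b" unfolding x using b A by (simp add: field_simps)
      finally show ?thesis by simp
    qed
    show "P b" if "A - \<beta> / 2 \<le> b" for b
      unfolding P_def
    proof
      assume bA: "b \<le> A"
      have y: "0 < x - \<beta> - b" "x - \<beta> - b < 1 / A" using bA \<beta> \<beta>A that x by linarith+
      have "A < 1 / (x - \<beta> - b)" using y A by (simp add: field_simps)
      from exp_lower_dead_jump[OF dead_lower_above[OF A x this] y(1), of 1]
      have "exp_lower (\<lambda>N. dead N x) b (\<beta>\<^sup>2 / 2)" by simp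
      moreover have "psi x A \<le> psi x b"
      proof (rule psi_antimono[OF _ x])
        show "1 / A \<le> b" using that \<beta> by linarith
      qed (use bA A in auto)
      ultimately show "exp_lower (\<lambda>N. dead N x) b (psi x b - psi x A + \<eta>)"
        using \<beta>2 by (elim exp_lower_weaken) auto
    qed
    show "P b" if b: "1 / A < b" "b < A - \<beta> / 2" and IH: "P (x - 1 / b)" for b
      unfolding P_def
    proof
      have b0: "0 < b" "b < A" using b iA \<beta> by linarith+
      have "1 / A < 1 / b" using b0 by (simp add: field_simps)
      then have le: "x - 1 / b \<le> A" using x by simp
      have "1 / b < A" using b(1) A b0 by (simp add: field_simps)
      then have c'0: "0 < x - 1 / b" using x iA by linarith
      let ?c' = "x - 1 / b"
      have "exp_lower (\<lambda>N. dead N x) ?c' (psi x ?c' - psi x A + \<eta>)"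
        using IH le by (simp add: P_def)
      moreover have "0 < x - (?c' - b) - b" "0 < ?c' / b" "?c' = ?c' / b / (x - (?c' - b) - b)"
        using b0 c'0 by (auto simp: field_simps)
      ultimately have "exp_lower (\<lambda>N. dead N x) b (psi x ?c' - psi x A + \<eta> + (?c' - b)\<^sup>2 / 2 + (?c' / b - 1 - ln (?c' / b)))"
        by (rule exp_lower_dead_jump)
      moreover have "psi x ?c' - psi x A + \<eta> + (?c' - b)\<^sup>2 / 2 + (?c' / b - 1 - ln (?c' / b)) = psi x b - psi x A + \<eta>"
        using psi_step[OF b0(1) c'0 refl] by linarith
      ultimately show "exp_lower (\<lambda>N. dead N x) b (psi x b - psi x A + \<eta>)" by simp
    qed
  qed (use c in auto)
  then show "exp_lower (\<lambda>N. dead N x) c (psi x c - psi x A + \<eta>)" using c by (simp add: P_def)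
qed

text \<open>Below the attracting fixed point the noiseless map climbs for free and a small kick
  carries the chain past \<open>1 / A\<close>. So all these starting points share the cost from
  \<open>1 / A\<close>.\<close>

lemma dead_lower_low:
  assumes A: "1 < A" and x: "x = A + 1 / A" and c: "0 \<le> c" "c \<le> 1 / A"
  shows "exp_lower (\<lambda>N. dead N x) c (psi x (1 / A) - psi x A)"
proof (rule exp_lower_closed)
  fix \<eta> :: real assume \<eta>: "0 < \<eta>"
  define \<beta> where "\<beta> = min (sqrt (2 * \<eta>)) (1 / 2)"
  have iA: "0 < 1 / A" "1 / A < A" using A by (auto intro: less_trans[of "1 / A" 1])
  have \<beta>: "0 < \<beta>" "\<beta> < A" using \<eta> A by (auto simp: \<beta>_def)
  have \<beta>2: "\<beta>\<^sup>2 / 2 \<le> \<eta>"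
  proof -
    have "\<beta>\<^sup>2 \<le> (sqrt (2 * \<eta>))\<^sup>2" using \<beta> by (intro power_mono) (auto simp: \<beta>_def)
    then show ?thesis using \<eta> by simp
  qed
  define R where "R = psi x (1 / A) - psi x A"
  have R0: "0 \<le> R" using psi_antimono[of A x "1 / A" A] A x iA by (simp add: R_def)
  have up: "exp_lower (\<lambda>N. dead N x) b R" if "1 / A < b" for b
  proof (cases "b \<le> A")
    case True
    have "psi x b \<le> psi x (1 / A)" using that True A by (intro psi_antimono[OF _ x]) auto
    then show ?thesis using dead_lower_mid[OF A x that True] by (elim exp_lower_weaken) (auto simp: R_def)
  next
    case False
    then show ?thesis using dead_lower_above[OF A x, of b] R0 by (auto elim: exp_lower_weaken)
  qed
  have "exp_lower (\<lambda>N. dead N x) c (R + \<eta>)"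
  \<comment> \<open>The \<open>-1\<close> serves as a strict lower bound for the starts
    \<open>c \<ge> 0\<close>.\<close>
  proof (rule escape_induct_up[where P = "\<lambda>c. exp_lower (\<lambda>N. dead N x) c (R + \<eta>)" and l = "-1" and u = "1 / A - \<beta> / 2" and T = "\<lambda>c. 1 / (x - c)"])
    show "continuous_on {-1<..1 / A - \<beta> / 2} (\<lambda>c. 1 / (x - c))"
    proof (intro continuous_intros ballI)
      fix b assume "b \<in> {-1<..1 / A - \<beta> / 2}"
      then have "b \<le> 1 / A - \<beta> / 2" by simp
      then show "x - b \<noteq> 0" using x \<beta> A by linarith
    qed
    show "b < 1 / (x - b)" if "-1 < b" "b \<le> 1 / A - \<beta> / 2" for b
    proof -
      have "0 < (b - A) * (b - 1 / A)" using that \<beta> iA by (intro mult_neg_neg) linarith+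
      moreover have "b < x" using that x A \<beta> by linarith
      ultimately show ?thesis using flow_up_iff[of A x b] A x by simp
    qed
    show "exp_lower (\<lambda>N. dead N x) b (R + \<eta>)" if "1 / A - \<beta> / 2 \<le> b" for b
    proof (cases "b \<le> 1 / A")
      case True
      have y: "0 < x - \<beta> - b" "x - \<beta> - b < A" using True that \<beta> x by linarith+
      have "1 / A < 1 / (x - \<beta> - b)" using y A by (simp add: field_simps)
      from exp_lower_dead_jump[OF up[OF this] y(1), of 1]
      have "exp_lower (\<lambda>N. dead N x) b (R + \<beta>\<^sup>2 / 2)" by simp
      then show ?thesis using \<beta>2 by (elim exp_lower_weaken) auto
    next
      case False
      then show ?thesis using up[of b] \<eta> by (auto elim: exp_lower_weaken)
    qed
    show "exp_lower (\<lambda>N. dead N x) b (R + \<eta>)" if "-1 < b" "b < 1 / A - \<beta> / 2" "exp_lower (\<lambda>N. dead N x) (1 / (x - b)) (R + \<eta>)" for b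
    proof -
      have "b < x" using that x A \<beta> by linarith
      then show ?thesis using exp_lower_dead_jump[OF that(3), of 0 b 1] by simp
    qed
  qed (use c in auto)
  then show "exp_lower (\<lambda>N. dead N x) c (psi x (1 / A) - psi x A + \<eta>)" by (simp add: R_def)
qed

lemma dead_lower:
  assumes A: "1 < A" and x: "x = A + 1 / A" and c: "0 \<le> c" "c \<le> A"
  shows "exp_lower (\<lambda>N. dead N x) c (psi x (max c (1 / A)) - psi x A)"
proof (cases "c \<le> 1 / A")
  case True
  then show ?thesis using dead_lower_low[OF A x c(1) True] by (simp add: max_absorb2)
next
  case False
  then show ?thesis using dead_lower_mid[OF A x _ c(2)] by (simp add: max_absorb1)
qed

section \<open>Chernoff bounds for the noise\<close>

lemma normal_law_upper_tail:
  assumes "0 < N" "0 < \<delta>"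
  shows "emeasure (normal_law N) {\<delta><..} \<le> ennreal (exp (- real N * (\<delta>\<^sup>2 / 2)))"
proof -
  have "emeasure (normal_law N) {\<delta><..} = (\<integral>\<^sup>+a. indicator {\<delta><..} a \<partial>normal_law N)" by simp
  also have "\<dots> \<le> (\<integral>\<^sup>+a. ennreal (exp (- real N * \<delta>\<^sup>2)) * ennreal (exp (real N * \<delta> * a)) \<partial>normal_law N)"
  proof (rule nn_integral_mono)
    fix a
    have "1 \<le> exp (- real N * \<delta>\<^sup>2) * exp (real N * \<delta> * a)" if "\<delta> < a"
    proof -
      have "0 \<le> real N * \<delta> * (a - \<delta>)" using that assms by simp
      then show ?thesis by (simp add: exp_add[symmetric] algebra_simps power2_eq_square)
    qed
    then show "indicator {\<delta><..} a \<le> ennreal (exp (- real N * \<delta>\<^sup>2)) * ennreal (exp (real N * \<delta> * a))"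
      by (auto simp: indicator_def ennreal_mult[symmetric])
  qed
  also have "\<dots> = ennreal (exp (- real N * \<delta>\<^sup>2)) * ennreal (exp ((real N * \<delta>)\<^sup>2 / (2 * real N)))"
    using normal_law_mgf[OF assms(1), of "real N * \<delta>"] by (subst nn_integral_cmult) auto
  also have "\<dots> = ennreal (exp (- real N * (\<delta>\<^sup>2 / 2)))"
    using assms(1) by (simp add: ennreal_mult[symmetric] exp_add[symmetric] power2_eq_square field_simps)
  finally show ?thesis .
qed

lemma normal_law_lower_tail:
  assumes "0 < N" "0 < \<delta>"
  shows "emeasure (normal_law N) {..<-\<delta>} \<le> ennreal (exp (- real N * (\<delta>\<^sup>2 / 2)))"
proof -
  have "emeasure (normal_law N) {..<-\<delta>} = (\<integral>\<^sup>+a. indicator {..<-\<delta>} a \<partial>normal_law N)" by simp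
  also have "\<dots> \<le> (\<integral>\<^sup>+a. ennreal (exp (- real N * \<delta>\<^sup>2)) * ennreal (exp ((- real N * \<delta>) * a)) \<partial>normal_law N)"
  proof (rule nn_integral_mono)
    fix a
    have "1 \<le> exp (- real N * \<delta>\<^sup>2) * exp ((- real N * \<delta>) * a)" if "a < - \<delta>"
    proof -
      have "0 \<le> real N * \<delta> * (- a - \<delta>)" using that assms by simp
      then show ?thesis by (simp add: exp_add[symmetric] algebra_simps power2_eq_square)
    qed
    then show "indicator {..<-\<delta>} a \<le> ennreal (exp (- real N * \<delta>\<^sup>2)) * ennreal (exp ((- real N * \<delta>) * a))"
      by (auto simp: indicator_def ennreal_mult[symmetric])
  qed
  also have "\<dots> = ennreal (exp (- real N * \<delta>\<^sup>2)) * ennreal (exp ((- real N * \<delta>)\<^sup>2 / (2 * real N)))"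
    using normal_law_mgf[OF assms(1), of "- real N * \<delta>"] by (subst nn_integral_cmult) auto
  also have "\<dots> = ennreal (exp (- real N * (\<delta>\<^sup>2 / 2)))"
    using assms(1) by (simp add: ennreal_mult[symmetric] exp_add[symmetric] power2_eq_square field_simps)
  finally show ?thesis .
qed

text \<open>One exponential Markov inequality for both tails: the sign of \<open>s\<close> decides
  on which side of \<open>m\<close> the set \<open>V\<close> lies.\<close>

lemma gamma_law_exp_bound:
  assumes N: "0 < N" and s: "-1 < s" and V: "V \<in> sets borel" "\<And>g. g \<in> V \<Longrightarrow> 0 \<le> s * (m - g)"
  shows "emeasure (gamma_law N k) V \<le> ennreal (exp (real N * s * m - real k * ln (1 + s)))"
proof -
  have "emeasure (gamma_law N k) V = (\<integral>\<^sup>+g. indicator V g \<partial>gamma_law N k)" using V by simp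
  also have "\<dots> \<le> (\<integral>\<^sup>+g. ennreal (exp (real N * s * m)) * ennreal (exp (- (real N * s) * g)) \<partial>gamma_law N k)"
  proof (rule nn_integral_mono)
    fix g
    have "1 \<le> exp (real N * s * m) * exp (- (real N * s) * g)" if "g \<in> V"
    proof -
      have "0 \<le> real N * (s * (m - g))" using V(2)[OF that] by simp
      then show ?thesis by (simp add: exp_add[symmetric] algebra_simps)
    qed
    then show "indicator V g \<le> ennreal (exp (real N * s * m)) * ennreal (exp (- (real N * s) * g))"
      by (auto simp: indicator_def ennreal_mult[symmetric])
  qed
  also have "\<dots> = ennreal (exp (real N * s * m)) * ennreal ((real N / (real N + real N * s)) ^ k)"
  proof -
    have "real N * (-1) < real N * s" using N s by (intro mult_strict_left_mono) auto
    then show ?thesis using gamma_law_laplace[OF N, of "real N * s" k] by (subst nn_integral_cmult) auto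
  qed
  also have "real N / (real N + real N * s) = exp (- ln (1 + s))"
  proof -
    have "real N + real N * s = real N * (1 + s)" by (simp add: algebra_simps)
    then show ?thesis using N s by (simp add: exp_minus inverse_eq_divide)
  qed
  also have "\<dots> ^ k = exp (- (real k * ln (1 + s)))" by (simp add: exp_of_nat_mult[symmetric])
  finally show ?thesis by (simp add: ennreal_mult[symmetric] exp_add[symmetric])
qed

lemma gamma_law_upper_tail:
  assumes N: "0 < N" and \<delta>: "0 < \<delta>" and k: "k \<le> N"
  shows "emeasure (gamma_law N k) {1 + \<delta><..} \<le> ennreal (exp (- real N * (\<delta> - ln (1 + \<delta>))))"
proof -
  \<comment> \<open>The tilt that moves the mean of a gamma variable with \<open>N\<close> degrees
    of freedom to \<open>1 + \<delta>\<close>.\<close>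
  let ?s = "- \<delta> / (1 + \<delta>)"
  have s: "-1 < ?s" "1 + ?s = 1 / (1 + \<delta>)" "?s * (1 + \<delta>) = - \<delta>" using \<delta> by (auto simp: field_simps)
  have "emeasure (gamma_law N k) {1 + \<delta><..} \<le> ennreal (exp (real N * ?s * (1 + \<delta>) - real k * ln (1 + ?s)))"
  proof (rule gamma_law_exp_bound[OF N s(1)])
    fix g assume "g \<in> {1 + \<delta><..}"
    then show "0 \<le> ?s * (1 + \<delta> - g)" using \<delta> by (intro mult_nonpos_nonpos) auto
  qed simp
  also have "real N * ?s * (1 + \<delta>) - real k * ln (1 + ?s) = - real N * \<delta> + real k * ln (1 + \<delta>)"
    unfolding s(2) using \<delta> by (simp add: ln_div)
  also have "ennreal (exp \<dots>) \<le> ennreal (exp (- real N * (\<delta> - ln (1 + \<delta>))))"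
    using k \<delta> by (intro ennreal_leI) (auto simp: algebra_simps intro!: mult_right_mono)
  finally show ?thesis .
qed

lemma gamma_law_lower_tail:
  assumes N: "0 < N" and \<delta>: "0 < \<delta>" "\<delta> < 1" and k: "real N - j \<le> real k"
  shows "emeasure (gamma_law N k) {..<1 - \<delta>} \<le> ennreal (exp (- real N * (- ln (1 - \<delta>) - \<delta>) - j * ln (1 - \<delta>)))"
proof -
  \<comment> \<open>The tilt to the mean \<open>1 - \<delta>\<close>. A shortage of at most
    \<open>j\<close> degrees of freedom leaves the factor
    \<open>exp (- j * ln (1 - \<delta>))\<close>.\<close>
  let ?s = "\<delta> / (1 - \<delta>)"
  have s: "-1 < ?s" "1 + ?s = 1 / (1 - \<delta>)" "?s * (1 - \<delta>) = \<delta>" using \<delta> by (auto simp: field_simps)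
  have "emeasure (gamma_law N k) {..<1 - \<delta>} \<le> ennreal (exp (real N * ?s * (1 - \<delta>) - real k * ln (1 + ?s)))"
  proof (rule gamma_law_exp_bound[OF N s(1)])
    fix g assume "g \<in> {..<1 - \<delta>}"
    then show "0 \<le> ?s * (1 - \<delta> - g)" using \<delta> by (intro mult_nonneg_nonneg) auto
  qed simp
  also have "real N * ?s * (1 - \<delta>) - real k * ln (1 + ?s) = real N * \<delta> + real k * ln (1 - \<delta>)"
    unfolding s(2) using \<delta> by (simp add: ln_div)
  also have "\<dots> \<le> - real N * (- ln (1 - \<delta>) - \<delta>) - j * ln (1 - \<delta>)"
  proof -
    have "real k * ln (1 - \<delta>) \<le> (real N - j) * ln (1 - \<delta>)"
      using k \<delta> by (intro mult_right_mono_neg) auto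
    then show ?thesis by (simp add: algebra_simps)
  qed
  finally show ?thesis by (simp add: ennreal_leI)
qed

section \<open>Lower bound for the probability of survival\<close>

lemma psi_mono:
  assumes A: "1 \<le> A" and x: "x = A + 1 / A" and c: "A \<le> c" "c \<le> c'"
  shows "psi x c \<le> psi x c'"
proof (rule DERIV_nonneg_imp_nondecreasing[OF c(2)])
  fix t assume t: "c \<le> t" "t \<le> c'"
  have t0: "0 < t" using c t A by linarith
  have "1 / A \<le> 1" using A by simp
  have "(psi x has_real_derivative (t - x + 1 / t)) (at t)"
    unfolding psi_def using t0 by (auto intro!: derivative_eq_intros)
  moreover have "t - x + 1 / t = (t - A) * (t - 1 / A) / t"
    unfolding x using A t0 by (simp add: field_simps)
  moreover have "0 \<le> (t - A) * (t - 1 / A) / t"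
    using t c t0 A \<open>1 / A \<le> 1\<close> by (intro divide_nonneg_pos mult_nonneg_nonneg) linarith+
  ultimately show "\<exists>y. DERIV (psi x) t :> y \<and> 0 \<le> y" by metis
qed

lemma (in prob_space) emeasure_ge_1_minus:
  assumes "A \<in> sets M" "emeasure M (space M - A) \<le> ennreal e" "0 \<le> e"
  shows "ennreal (1 - e) \<le> emeasure M A"
proof -
  have "measure M (space M - A) \<le> e"
    using assms(2,3) by (simp add: emeasure_eq_measure)
  then have "1 - e \<le> measure M A" using assms(1) by (simp add: prob_compl)
  then show ?thesis by (simp add: emeasure_eq_measure ennreal_leI)
qed

text \<open>A half-line ending at a suitable \<open>b < A\<close> is a trap: it is left only by
  atypical noise, of exponentially small probability at each step, so the chain stays there for all
  \<open>N\<close> steps with probability tending to 1.\<close>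

lemma surv_lower_below:
  assumes A: "1 < A" and x: "x = A + 1 / A" and c: "c < A"
  shows "exp_lower (\<lambda>N. surv N x) c 0"
proof -
  have iA: "0 < 1 / A" "1 / A < A" using A by (auto intro: less_trans[of "1 / A" 1])
  \<comment> \<open>Strictly between the fixed points the noiseless map moves \<open>b\<close> down,
    which leaves room for noise.\<close>
  define b where "b = max c ((1 / A + A) / 2)"
  have b: "1 / A < b" "b < A" "c \<le> b" using iA c unfolding b_def max_def by (simp_all split: if_splits; linarith?)+
  then have b0: "0 < b" using iA by linarith
  note b = b b0
  have "0 < (A - b) * (b - 1 / A)" using b by simp
  also have "\<dots> = b * (x - b) - 1" unfolding x using A by (simp add: field_simps)
  finally have bx: "1 < b * (x - b)" by simp
  \<comment> \<open>The solution of \<open>(1 + \<delta>) / (x - \<delta> - b) = b\<close>: noise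
    with \<open>a \<le> \<delta>\<close> and \<open>g \<le> 1 + \<delta>\<close> does not lead above
    \<open>b\<close>.\<close>
  define \<delta> where "\<delta> = (b * (x - b) - 1) / (1 + b)"
  have \<delta>: "0 < \<delta>" using bx b by (simp add: \<delta>_def)
  have "\<delta> * (1 + b) = b * (x - b) - 1" using b by (simp add: \<delta>_def)
  then have "1 + \<delta> = b * (x - \<delta> - b)" by (simp add: algebra_simps)
  moreover from this have "0 < b * (x - \<delta> - b)" using \<delta> by linarith
  then have "0 < x - \<delta> - b" using b zero_less_mult_pos by blast
  ultimately have y: "1 + \<delta> = b * (x - \<delta> - b)" "0 < x - \<delta> - b" by auto
  have r: "ln (1 + \<delta>) < \<delta>" using \<delta> ln_le_minus_one[of "1 + \<delta>"] ln_eq_minus_one[of "1 + \<delta>"] by fastforce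
  define e1 e2 where "e1 N = exp (- real N * (\<delta>\<^sup>2 / 2))" and "e2 N = exp (- real N * (\<delta> - ln (1 + \<delta>)))" for N
  have e01: "0 \<le> e1 N" "e1 N \<le> 1" "0 \<le> e2 N" "e2 N \<le> 1" for N
    using r by (auto simp: e1_def e2_def)
  have ind: "ennreal (((1 - e1 N) * (1 - e2 N)) ^ k) \<le> surv N x k b" if N: "0 < N" "k \<le> N" for N k
    using \<open>k \<le> N\<close>
  proof (induction k)
    case (Suc k)
    interpret n: prob_space "normal_law N" by (rule prob_space_normal_law[OF N(1)])
    interpret g: prob_space "gamma_law N k" by (rule prob_space_gamma_law[OF N(1)])
    have "ennreal (1 - e1 N) \<le> emeasure (normal_law N) {..\<delta>}"
    proof (rule n.emeasure_ge_1_minus)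
      have "space (normal_law N) - {..\<delta>} = {\<delta><..}" by auto
      then show "emeasure (normal_law N) (space (normal_law N) - {..\<delta>}) \<le> ennreal (e1 N)"
        using normal_law_upper_tail[OF N(1) \<delta>] by (simp add: e1_def)
    qed (use e01 in auto)
    moreover have "ennreal (1 - e2 N) \<le> emeasure (gamma_law N k) {..1 + \<delta>}"
    proof (rule g.emeasure_ge_1_minus)
      have "space (gamma_law N k) - {..1 + \<delta>} = {1 + \<delta><..}" by auto
      then show "emeasure (gamma_law N k) (space (gamma_law N k) - {..1 + \<delta>}) \<le> ennreal (e2 N)"
        using gamma_law_upper_tail[OF N(1) \<delta>, of k] Suc.prems by (simp add: e2_def)
    qed (use e01 in auto)
    moreover have "ennreal (((1 - e1 N) * (1 - e2 N)) ^ k) \<le> surv N x k b" using Suc by simp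
    ultimately have "ennreal (1 - e1 N) * ennreal (1 - e2 N) * ennreal (((1 - e1 N) * (1 - e2 N)) ^ k)
        \<le> emeasure (normal_law N) {..\<delta>} * emeasure (gamma_law N k) {..1 + \<delta>} * surv N x k b"
      by (intro mult_mono) auto
    also have "\<dots> \<le> step_op N x 0 k (surv N x k) b"
    proof (rule step_op_ge_windows)
      fix a g assume ag: "a \<in> {..\<delta>}" "g \<in> {..1 + \<delta>}"
      have Y: "0 < x - a - b" using ag y by auto
      have "g / (x - a - b) \<le> b"
      proof -
        have "g \<le> b * (x - \<delta> - b)" using ag y by simp
        also have "\<dots> \<le> b * (x - a - b)" using ag b by (intro mult_left_mono) auto
        finally show ?thesis using Y by (simp add: pos_divide_le_eq)
      qed
      then show "surv N x k b \<le> (if 0 < x - a - b then surv N x k (g / (x - a - b)) else 0)"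
        using Y by (simp add: surv_antimono)
    qed auto
    finally show ?case using e01[of N] by (simp add: ennreal_mult[symmetric] mult_ac)
  qed simp
  show ?thesis
    unfolding exp_lower_def
  proof (intro allI impI)
    fix \<epsilon> :: real and j assume \<epsilon>: "0 < \<epsilon>"
    \<comment> \<open>Even summed over \<open>N\<close> steps the failure probabilities vanish; the
      Bernoulli inequality below turns this sum into a bound for the product.\<close>
    have "(\<lambda>N. 1 - real N * (e1 N + e2 N) - exp (- real N * \<epsilon>)) \<longlonglongrightarrow> 1"
    proof -
      have "0 < \<delta>\<^sup>2 / 2" "0 < \<delta> - ln (1 + \<delta>)" using \<delta> r by auto
      then have "(\<lambda>N. real N * exp (- real N * (\<delta>\<^sup>2 / 2))) \<longlonglongrightarrow> 0" "(\<lambda>N. real N * exp (- real N * (\<delta> - ln (1 + \<delta>)))) \<longlonglongrightarrow> 0"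
        "(\<lambda>N. exp (- real N * \<epsilon>)) \<longlonglongrightarrow> 0"
        using \<epsilon> by real_asymp+
      then have "(\<lambda>N. 1 - (real N * exp (- real N * (\<delta>\<^sup>2 / 2)) + real N * exp (- real N * (\<delta> - ln (1 + \<delta>)))) - exp (- real N * \<epsilon>)) \<longlonglongrightarrow> 1 - (0 + 0) - 0"
        by (intro tendsto_intros)
      then show ?thesis by (simp add: e1_def e2_def distrib_left)
    qed
    then have "\<forall>\<^sub>F N in sequentially. 0 < 1 - real N * (e1 N + e2 N) - exp (- real N * \<epsilon>)"
      by (rule order_tendstoD(1)) simp
    with eventually_gt_at_top[of 0]
    show "\<forall>\<^sub>F N in sequentially. ennreal (exp (- real N * (0 + \<epsilon>))) \<le> surv N x (N - j) c"
    proof eventually_elim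
      case (elim N)
      let ?q = "(1 - e1 N) * (1 - e2 N)"
      have q: "0 \<le> ?q" "?q \<le> 1" using e01[of N] by (auto intro: mult_le_one)
      have "exp (- real N * (0 + \<epsilon>)) \<le> 1 + real N * (- (e1 N + e2 N))" using elim by (simp add: algebra_simps)
      also have "\<dots> \<le> 1 + real N * (?q - 1)"
        using e01[of N] by (intro add_left_mono mult_left_mono) (auto simp: algebra_simps)
      also have "\<dots> \<le> (1 + (?q - 1)) ^ N" using q by (intro Bernoulli_inequality) simp
      also have "\<dots> \<le> ?q ^ (N - j)" using q by (simp add: power_decreasing)
      finally have "ennreal (exp (- real N * (0 + \<epsilon>))) \<le> ennreal (?q ^ (N - j))" by (rule ennreal_leI)
      also have "\<dots> \<le> surv N x (N - j) b" using elim by (intro ind) auto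
      also have "\<dots> \<le> surv N x (N - j) c" by (intro surv_antimono b)
      finally show ?case .
    qed
  qed
qed

text \<open>Mirror image of \<open>dead_lower_mid\<close>: backward steps descend towards
  \<open>A\<close> from above, and a last kick \<open>a = - \<beta>\<close> puts the chain into the
  trap of \<open>surv_lower_below\<close>.\<close>

lemma surv_lower:
  assumes A: "1 < A" and x: "x = A + 1 / A" and c: "A < c"
  shows "exp_lower (\<lambda>N. surv N x) c (psi x c - psi x A)"
proof (rule exp_lower_closed)
  fix \<eta> :: real assume \<eta>: "0 < \<eta>"
  define \<beta> where "\<beta> = sqrt (2 * \<eta>)"
  have \<beta>: "0 < \<beta>" "\<beta>\<^sup>2 / 2 = \<eta>" using \<eta> by (auto simp: \<beta>_def)
  have iA: "0 < 1 / A" "1 / A < A" using A by (auto intro: less_trans[of "1 / A" 1])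
  define P where "P c \<longleftrightarrow> (A < c \<longrightarrow> exp_lower (\<lambda>N. surv N x) c (psi x c - psi x A + \<eta>))" for c
  have "P c"
  proof (rule escape_induct_down[where P = P and l = "c + 1" and u = "A + \<beta> / 2" and T = "\<lambda>c. x - 1 / c"])
    show "continuous_on {A + \<beta> / 2..<c + 1} (\<lambda>c. x - 1 / c)"
      using A \<beta> by (intro continuous_intros) auto
    show "x - 1 / b < b" if "A + \<beta> / 2 \<le> b" for b
    proof -
      have b: "0 < b" "A < b" using that A \<beta> by linarith+
      have "0 < (b - A) * (b - 1 / A) / b" using b iA by (intro divide_pos_pos mult_pos_pos) linarith+
      also have "\<dots> = b - (x - 1 / b)" unfolding x using b A by (simp add: field_simps)
      finally show ?thesis by simp
    qed
    show "P b" if "b \<le> A + \<beta> / 2" for b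
      unfolding P_def
    proof
      assume bA: "A < b"
      have y: "0 < x - - \<beta> - b" "1 / A < x - - \<beta> - b" using that bA \<beta> x iA by linarith+
      have "1 / (x - - \<beta> - b) < A" using y A by (simp add: field_simps)
      from exp_lower_surv_jump[OF surv_lower_below[OF A x this] y(1), of 1]
      have "exp_lower (\<lambda>N. surv N x) b \<eta>" using \<beta> by simp
      moreover have "psi x A \<le> psi x b" using A bA by (intro psi_mono[OF _ x]) auto
      ultimately show "exp_lower (\<lambda>N. surv N x) b (psi x b - psi x A + \<eta>)"
        by (elim exp_lower_weaken) auto
    qed
    show "P b" if b: "A + \<beta> / 2 < b" and IH: "P (x - 1 / b)" for b
      unfolding P_def
    proof
      have b0: "0 < b" "A < b" using b \<beta> A by linarith+
      have "1 / b < 1 / A" using b0 A by (simp add: field_simps)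
      then have le: "A < x - 1 / b" using x by simp
      then have c'0: "0 < x - 1 / b" using A by linarith
      let ?c' = "x - 1 / b"
      have "exp_lower (\<lambda>N. surv N x) ?c' (psi x ?c' - psi x A + \<eta>)"
        using IH le by (simp add: P_def)
      moreover have "0 < x - (?c' - b) - b" "0 < ?c' / b" "?c' = ?c' / b / (x - (?c' - b) - b)"
        using b0 c'0 by (auto simp: field_simps)
      ultimately have "exp_lower (\<lambda>N. surv N x) b (psi x ?c' - psi x A + \<eta> + (?c' - b)\<^sup>2 / 2 + (?c' / b - 1 - ln (?c' / b)))"
        by (rule exp_lower_surv_jump)
      moreover have "psi x ?c' - psi x A + \<eta> + (?c' - b)\<^sup>2 / 2 + (?c' / b - 1 - ln (?c' / b)) = psi x b - psi x A + \<eta>"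
        using psi_step[OF b0(1) c'0 refl] by linarith
      ultimately show "exp_lower (\<lambda>N. surv N x) b (psi x b - psi x A + \<eta>)" by simp
    qed
  qed simp
  then show "exp_lower (\<lambda>N. surv N x) c (psi x c - psi x A + \<eta>)" using c by (simp add: P_def)
qed

text \<open>Either both noises are nearly typical and the chain is killed or lands at or above
  \<open>(1 - \<delta>) / (x + \<delta> - c)\<close>, or one of them is atypical, at cost
  \<open>\<eta>\<close>, and the continuation survives at most as well as from 0. The second branch
  already has the rate \<open>r + \<eta>\<close>, so only the first one has to be supplied.\<close>

lemma exp_upper_surv_jump:
  assumes \<delta>: "0 < \<delta>" "\<delta> < 1" and \<eta>: "\<eta> \<le> \<delta>\<^sup>2 / 2" "\<eta> \<le> - ln (1 - \<delta>) - \<delta>"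
    and UB0: "exp_upper (\<lambda>N. surv N x) 0 r"
    and UB': "0 < x + \<delta> - c \<Longrightarrow> exp_upper (\<lambda>N. surv N x) ((1 - \<delta>) / (x + \<delta> - c)) (r + \<eta>)"
  shows "exp_upper (\<lambda>N. surv N x) c (r + \<eta>)"
  unfolding exp_upper_def
proof (intro allI impI)
  fix \<epsilon> :: real and j assume \<epsilon>: "0 < \<epsilon>"
  \<comment> \<open>The price of the \<open>Suc j\<close> degrees of freedom missing in the gamma
    tail. With the two other terms of the final sum it gives the factor
    \<open>2 + K\<close>.\<close>
  define K where "K = exp (- (real (Suc j)) * ln (1 - \<delta>))"
  have K: "0 < K" by (simp add: K_def)
  define f where "f N = (if 0 < x + \<delta> - c then surv N x (N - Suc j) ((1 - \<delta>) / (x + \<delta> - c)) else 0)" for N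
  have f: "\<forall>\<^sub>F N in sequentially. f N \<le> ennreal (exp (- real N * (r + \<eta> - \<epsilon> / 2)))"
  proof (cases "0 < x + \<delta> - c")
    case True
    then show ?thesis using UB'[OF True] \<epsilon> unfolding exp_upper_def f_def by simp
  qed (simp add: f_def)
  have "\<forall>\<^sub>F N in sequentially. exp (- real N * (\<epsilon> / 2)) \<le> 1 / (2 + K)"
    using \<epsilon> K by (intro eventually_exp_le) auto
  moreover have "\<forall>\<^sub>F N in sequentially. surv N x (N - Suc j) 0 \<le> ennreal (exp (- real N * (r - \<epsilon> / 2)))"
    using UB0 \<epsilon> unfolding exp_upper_def by simp
  ultimately show "\<forall>\<^sub>F N in sequentially. surv N x (N - j) c \<le> ennreal (exp (- real N * (r + \<eta> - \<epsilon>)))"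
    using f eventually_gt_at_top[of j]
  proof eventually_elim
    case (elim N)
    have N: "0 < N" "N - j = Suc (N - Suc j)" using elim by auto
    define k where "k = N - Suc j"
    let ?E = "exp (- real N * (r + \<eta> - \<epsilon> / 2))"
    have tail1: "emeasure (normal_law N) (- {- \<delta>..}) \<le> ennreal (exp (- real N * \<eta>))"
    proof -
      have "- {- \<delta>..} = {..< - \<delta>}" by auto
      then have "emeasure (normal_law N) (- {- \<delta>..}) \<le> ennreal (exp (- real N * (\<delta>\<^sup>2 / 2)))"
        using normal_law_lower_tail[OF N(1) \<delta>(1)] by simp
      also have "\<dots> \<le> ennreal (exp (- real N * \<eta>))"
        using \<eta> by (intro ennreal_leI) (simp only: exp_le_cancel_iff mult_minus_left neg_le_iff_le, intro mult_left_mono, auto)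
      finally show ?thesis .
    qed
    have tail2: "emeasure (gamma_law N k) (- {1 - \<delta>..}) \<le> ennreal (K * exp (- real N * \<eta>))"
    proof -
      have "- {1 - \<delta>..} = {..< 1 - \<delta>}" by auto
      then have "emeasure (gamma_law N k) (- {1 - \<delta>..}) \<le> ennreal (exp (- real N * (- ln (1 - \<delta>) - \<delta>) - real (Suc j) * ln (1 - \<delta>)))"
        using gamma_law_lower_tail[OF N(1) \<delta>, of "real (Suc j)" k] by (simp add: k_def)
      also have "\<dots> \<le> ennreal (exp (- real N * \<eta> - real (Suc j) * ln (1 - \<delta>)))"
        using \<eta> by (intro ennreal_leI) (simp only: exp_le_cancel_iff mult_minus_left, intro diff_right_mono, simp only: neg_le_iff_le, intro mult_left_mono, auto)
      also have "exp (- real N * \<eta> - real (Suc j) * ln (1 - \<delta>)) = K * exp (- real N * \<eta>)"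
        by (simp add: K_def exp_add[symmetric] algebra_simps)
      finally show ?thesis .
    qed
    have "surv N x (N - j) c = step_op N x 0 k (surv N x k) c"
      using N(2) by (simp add: k_def)
    also have "\<dots> \<le> f N + (emeasure (normal_law N) (- {- \<delta>..}) + emeasure (gamma_law N k) (- {1 - \<delta>..})) * surv N x k 0"
    proof (rule step_op_le_windows[OF N(1)])
      fix a g assume ag: "a \<in> {- \<delta>..}" "g \<in> {1 - \<delta>..}"
      show "(if 0 < x - a - c then surv N x k (g / (x - a - c)) else 0) \<le> f N"
      proof (cases "0 < x - a - c")
        case True
        then have "0 < x + \<delta> - c" using ag by simp
        moreover have "(1 - \<delta>) / (x + \<delta> - c) \<le> g / (x - a - c)"
          using ag True \<delta> by (intro frac_le) auto
        ultimately show ?thesis using True by (simp add: f_def k_def surv_antimono)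
      qed simp
    qed (auto intro: surv_antimono)
    also have "\<dots> \<le> ennreal ?E + (ennreal (exp (- real N * \<eta>)) + ennreal (K * exp (- real N * \<eta>))) * ennreal (exp (- real N * (r - \<epsilon> / 2)))"
      using elim tail1 tail2 by (intro add_mono mult_mono) (auto simp: k_def)
    also have "\<dots> = ennreal (?E + (exp (- real N * \<eta>) + K * exp (- real N * \<eta>)) * exp (- real N * (r - \<epsilon> / 2)))"
      using K by (simp add: ennreal_mult[symmetric] ennreal_plus[symmetric] del: ennreal_plus)
    also have "?E + (exp (- real N * \<eta>) + K * exp (- real N * \<eta>)) * exp (- real N * (r - \<epsilon> / 2)) = (2 + K) * ?E"
      by (simp add: algebra_simps exp_add[symmetric])
    also have "\<dots> = (2 + K) * exp (- real N * (\<epsilon> / 2)) * exp (- real N * (r + \<eta> - \<epsilon>))"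
      by (simp add: algebra_simps exp_add[symmetric])
    also have "ennreal \<dots> \<le> ennreal (1 * exp (- real N * (r + \<eta> - \<epsilon>)))"
      using elim K by (intro ennreal_leI mult_right_mono) (auto simp: field_simps)
    finally show ?case by simp
  qed
qed

text \<open>Without a fixed point even the most favourable typical noise drives the chain to death
  in finitely many steps, so survival needs an atypical noise early on. This improves any rate valid
  from 0 by a fixed \<open>\<eta>\<close>, and repetition passes every \<open>r\<close>.\<close>

lemma surv_upper_sub:
  assumes x: "x < 2" and c: "0 \<le> c"
  shows "exp_upper (\<lambda>N. surv N x) c r"
proof -
  \<comment> \<open>\<open>(2 - x) / 8\<close> makes
    \<open>x + \<delta> \<le> 2 - 7 * \<delta>\<close>, which \<open>flow\<close> uses to get below
    \<open>1 - \<delta>\<close>.\<close>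
  define \<delta> where "\<delta> = min ((2 - x) / 8) (1 / 8)"
  have \<delta>: "0 < \<delta>" "\<delta> < 1" "\<delta> \<le> (2 - x) / 8" "\<delta> \<le> 1 / 8" using x by (simp_all only: \<delta>_def min_less_iff_conj min.cobounded1 min.cobounded2, simp_all add: min_def)
  have flow: "b * (x + \<delta> - b) < 1 - \<delta>" if b: "0 \<le> b" for b
  proof (cases "x + \<delta> \<le> 0")
    case True
    then have "b * (x + \<delta> - b) \<le> 0" using b by (intro mult_nonneg_nonpos) auto
    then show ?thesis using \<delta> by linarith
  next
    case False
    have "b * (x + \<delta> - b) \<le> (x + \<delta>)\<^sup>2 / 4"
      using zero_le_power2[of "b - (x + \<delta>) / 2"] by (simp add: power2_eq_square field_simps)
    also have "\<dots> \<le> (2 - 7 * \<delta>)\<^sup>2 / 4"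
      using False \<delta> by (intro divide_right_mono power_mono) auto
    also have "\<dots> = (1 - 7 / 2 * \<delta>)\<^sup>2" by (simp add: power2_eq_square field_simps)
    also have "\<dots> \<le> 1 - 7 / 2 * \<delta>" using \<delta> by (auto simp: power2_eq_square intro!: mult_left_le)
    finally show ?thesis using \<delta> by linarith
  qed
  define \<eta> where "\<eta> = min (\<delta>\<^sup>2 / 2) (- ln (1 - \<delta>) - \<delta>)"
  have "ln (1 - \<delta>) < - \<delta>"
    using \<delta> ln_le_minus_one[of "1 - \<delta>"] ln_eq_minus_one[of "1 - \<delta>"] by fastforce
  then have \<eta>: "0 < \<eta>" "\<eta> \<le> \<delta>\<^sup>2 / 2" "\<eta> \<le> - ln (1 - \<delta>) - \<delta>"
    using \<delta> unfolding \<eta>_def by (simp_all only: min_less_iff_conj min.cobounded1 min.cobounded2, simp)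
  have improve: "exp_upper (\<lambda>N. surv N x) c (r + \<eta>)" if r: "exp_upper (\<lambda>N. surv N x) 0 r" and c: "0 \<le> c" for r c
  proof -
    define P where "P c \<longleftrightarrow> (0 \<le> c \<longrightarrow> exp_upper (\<lambda>N. surv N x) c (r + \<eta>))" for c
    note jump = exp_upper_surv_jump[OF \<delta>(1,2) \<eta>(2,3) r]
    \<comment> \<open>From \<open>u\<close> on the next position is at least
      \<open>\<bar>x\<bar> + 2\<close>, hence beyond \<open>x + \<delta>\<close>, where typical
      noise kills.\<close>
    define u where "u = x + \<delta> - (1 - \<delta>) / (\<bar>x\<bar> + 2)"
    have ux: "u < x + \<delta>" using \<delta> by (simp add: u_def)
    have high: "P b" if "x + \<delta> \<le> b" for b using jump[of b] that by (simp add: P_def)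
    have "P c"
    proof (rule escape_induct_up[where P = P and l = "-1" and u = u and T = "\<lambda>c. (1 - \<delta>) / (x + \<delta> - c)"])
      show "continuous_on {-1<..u} (\<lambda>c. (1 - \<delta>) / (x + \<delta> - c))"
        using ux by (intro continuous_intros) auto
      show "b < (1 - \<delta>) / (x + \<delta> - b)" if "-1 < b" "b \<le> u" for b
      proof -
        have y: "0 < x + \<delta> - b" using that ux by linarith
        show ?thesis
        proof (cases "0 \<le> b")
          case True
          then show ?thesis using flow[OF True] pos_less_divide_eq[OF y, of b "1 - \<delta>"] by simp
        next
          case False
          then have "b < 0" by simp
          also have "0 < (1 - \<delta>) / (x + \<delta> - b)" using y \<delta> by simp
          finally show ?thesis .
        qed
      qed
      show "P b" if "u \<le> b" for b
      proof (cases "x + \<delta> \<le> b")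
        case False
        then have y: "0 < x + \<delta> - b" by simp
        have "(x + \<delta> - b) * (\<bar>x\<bar> + 2) \<le> 1 - \<delta>"
          using that pos_le_divide_eq[of "\<bar>x\<bar> + 2" "x + \<delta> - b" "1 - \<delta>"] by (simp add: u_def)
        then have "\<bar>x\<bar> + 2 \<le> (1 - \<delta>) / (x + \<delta> - b)"
          using pos_le_divide_eq[OF y, of "\<bar>x\<bar> + 2" "1 - \<delta>"] by (simp add: mult.commute)
        then have "P ((1 - \<delta>) / (x + \<delta> - b))"
          using \<delta> by (intro high) linarith
        moreover have "0 \<le> (1 - \<delta>) / (x + \<delta> - b)" using \<delta> y by simp
        ultimately show ?thesis using jump[of b] by (simp add: P_def)
      qed (rule high)
      show "P b" if "-1 < b" "b < u" "P ((1 - \<delta>) / (x + \<delta> - b))" for b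
        unfolding P_def
      proof
        show "exp_upper (\<lambda>N. surv N x) b (r + \<eta>)"
        proof (rule jump)
          assume "0 < x + \<delta> - b"
          then have "0 \<le> (1 - \<delta>) / (x + \<delta> - b)" using \<delta> by simp
          then show "exp_upper (\<lambda>N. surv N x) ((1 - \<delta>) / (x + \<delta> - b)) (r + \<eta>)" using that(3) by (simp add: P_def)
        qed
      qed
    qed (use c in simp)
    then show ?thesis using c by (simp add: P_def)
  qed
  have base: "exp_upper (\<lambda>N. surv N x) c 0" for c
    unfolding exp_upper_def
  proof (intro allI impI)
    fix \<epsilon> :: real and j assume "0 < \<epsilon>"
    show "\<forall>\<^sub>F N in sequentially. surv N x (N - j) c \<le> ennreal (exp (- real N * (0 - \<epsilon>)))"
      using eventually_gt_at_top[of 0]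
    proof eventually_elim
      case (elim N)
      have "surv N x (N - j) c \<le> 1" using elim by (intro chain_le_1) auto
      also have "\<dots> \<le> ennreal (exp (- real N * (0 - \<epsilon>)))"
        using \<open>0 < \<epsilon>\<close> by (simp add: ennreal_le_iff2 flip: ennreal_1)
      finally show ?case .
    qed
  qed
  have all: "exp_upper (\<lambda>N. surv N x) c (real n * \<eta>)" if "0 \<le> c" for n c
    using that
  proof (induction n arbitrary: c)
    case (Suc n)
    then show ?case using improve[OF Suc.IH[of 0] Suc.prems] by (simp add: algebra_simps)
  qed (simp add: base)
  obtain n where n: "r \<le> real n * \<eta>"
    using \<eta>(1) by (metis less_imp_le reals_Archimedean3)
  show ?thesis
    unfolding exp_upper_def
  proof (intro allI impI)
    fix \<epsilon> :: real and j assume \<epsilon>: "0 < \<epsilon>"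
    have "\<forall>\<^sub>F N in sequentially. surv N x (N - j) c \<le> ennreal (exp (- real N * (real n * \<eta> - \<epsilon>)))"
      using all[OF c, of n] \<epsilon> by (simp add: exp_upper_def)
    then show "\<forall>\<^sub>F N in sequentially. surv N x (N - j) c \<le> ennreal (exp (- real N * (r - \<epsilon>)))"
    proof eventually_elim
      case (elim N)
      have "real N * (r - \<epsilon>) \<le> real N * (real n * \<eta> - \<epsilon>)" using n by (intro mult_left_mono) auto
      then have "ennreal (exp (- real N * (real n * \<eta> - \<epsilon>))) \<le> ennreal (exp (- real N * (r - \<epsilon>)))"
        by (intro ennreal_leI) simp
      then show ?case using elim by (rule order_trans[rotated])
    qed
  qed
qed

text \<open>The left side is concave in \<open>Y\<close> and so lies below its tangent at
  \<open>y\<close>. A bound linear in \<open>Y = x - a - c\<close> is what the normal moment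
  generating function can integrate.\<close>

lemma ln_ratio_le_tangent:
  fixes Y y s :: real
  assumes "0 < Y" "0 < y" "0 < s"
  shows "ln (Y / (Y + s)) \<le> ln (y / (y + s)) + (1 / y - 1 / (y + s)) * (Y - y)"
proof -
  define r where "r = Y * (y + s) / (y * (Y + s))"
  have r: "0 < r" using assms by (simp add: r_def)
  have "ln (Y / (Y + s)) - ln (y / (y + s)) = ln r"
    using assms by (simp add: r_def ln_div ln_mult)
  also have "\<dots> \<le> r - 1" using r by (rule ln_le_minus_one)
  also have "\<dots> = s * (Y - y) / (y * (Y + s))"
  proof -
    have "Y * (y + s) = y * (Y + s) + s * (Y - y)" by (simp add: algebra_simps)
    then show ?thesis using assms by (simp add: r_def add_divide_distrib)
  qed
  also have "\<dots> \<le> s * (Y - y) / (y * (y + s))"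
  proof (cases "y \<le> Y")
    case True
    then show ?thesis using assms by (intro divide_left_mono mult_left_mono) auto
  next
    case False
    then have "s * (y - Y) / (y * (y + s)) \<le> s * (y - Y) / (y * (Y + s))"
      using assms by (intro divide_left_mono mult_left_mono) auto
    then show ?thesis by (simp add: right_diff_distrib diff_divide_distrib)
  qed
  also have "\<dots> = (1 / y - 1 / (y + s)) * (Y - y)" using assms by (simp add: field_simps)
  finally show ?thesis by simp
qed

text \<open>Taking \<open>\<kappa> < 1\<close> leaves room for the number of remaining steps \<open>N - j\<close>, which is at least \<open>\<kappa> N\<close> for large \<open>N\<close>.
  The slope in \<open>exp_dominated\<close> is the derivative of \<open>psik \<kappa> x\<close> at \<open>z\<close>.\<close>

definition psik :: "real \<Rightarrow> real \<Rightarrow> real \<Rightarrow> real" where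
  "psik \<kappa> x c = c\<^sup>2 / 2 - x * c + \<kappa> * ln c"

definition exp_dominated :: "real \<Rightarrow> real \<Rightarrow> real \<Rightarrow> real \<Rightarrow> bool" where
  "exp_dominated x \<kappa> z e \<longleftrightarrow> (\<forall>j. \<forall>\<^sub>F N in sequentially. \<forall>c\<ge>0.
     surv N x (N - j) c \<le> ennreal (exp (- real N * (e + (z - x + \<kappa> / z) * (c - z)))))"

text \<open>Survival of the first step already requires \<open>a < x - c\<close>; this event alone
  is estimated, by a Chernoff bound with tilt \<open>N * s\<close>.\<close>

lemma exp_dominated_base:
  assumes s: "s = z - x + \<kappa> / z" "0 < s" and e: "e \<le> s * (z - x) - s\<^sup>2 / 2"
  shows "exp_dominated x \<kappa> z e"
  unfolding exp_dominated_def s(1)[symmetric]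
proof (intro allI)
  fix j
  show "\<forall>\<^sub>F N in sequentially. \<forall>c\<ge>0. surv N x (N - j) c \<le> ennreal (exp (- real N * (e + s * (c - z))))"
    using eventually_gt_at_top[of j]
  proof (eventually_elim, intro allI impI)
    fix N c assume jN: "j < N" and "0 \<le> (c::real)"
    have N: "0 < N" "N - j = Suc (N - Suc j)" using jN by auto
    define k where "k = N - Suc j"
    interpret g: prob_space "gamma_law N k" by (rule prob_space_gamma_law[OF N(1)])
    have "surv N x (N - j) c = step_op N x 0 k (surv N x k) c" using N(2) by (simp add: k_def)
    also have "\<dots> \<le> (\<integral>\<^sup>+a. ennreal (exp (real N * s * (x - c))) * ennreal (exp ((- real N * s) * a)) \<partial>normal_law N)"
      unfolding step_op_def
    proof (rule nn_integral_mono)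
      fix a
      show "(\<integral>\<^sup>+g. (if 0 < x - a - c then surv N x k (g / (x - a - c)) else 0) \<partial>gamma_law N k)
        \<le> ennreal (exp (real N * s * (x - c))) * ennreal (exp ((- real N * s) * a))"
      proof (cases "0 < x - a - c")
        case True
        have "(\<integral>\<^sup>+g. (if 0 < x - a - c then surv N x k (g / (x - a - c)) else 0) \<partial>gamma_law N k) \<le> (\<integral>\<^sup>+g. 1 \<partial>gamma_law N k)"
          using N by (intro nn_integral_mono) (auto intro: chain_le_1)
        also have "\<dots> = 1" using g.emeasure_space_1 by simp
        also have "\<dots> \<le> ennreal (exp (real N * s * (x - a - c)))"
          using True s by (simp flip: ennreal_1 add: ennreal_leI)
        also have "\<dots> = ennreal (exp (real N * s * (x - c))) * ennreal (exp ((- real N * s) * a))"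
          by (simp add: ennreal_mult[symmetric] exp_add[symmetric] algebra_simps)
        finally show ?thesis .
      qed simp
    qed
    also have "\<dots> = ennreal (exp (real N * s * (x - c))) * ennreal (exp ((- real N * s)\<^sup>2 / (2 * real N)))"
      using normal_law_mgf[OF N(1), of "- real N * s"] by (subst nn_integral_cmult) auto
    also have "\<dots> = ennreal (exp (real N * (s * (x - c) + s\<^sup>2 / 2)))"
      using N by (simp add: ennreal_mult[symmetric] exp_add[symmetric] power2_eq_square field_simps)
    also have "\<dots> \<le> ennreal (exp (- real N * (e + s * (c - z))))"
    proof -
      have "s * (x - c) + s\<^sup>2 / 2 \<le> - (e + s * (c - z))" using e by (simp add: algebra_simps)
      then have "real N * (s * (x - c) + s\<^sup>2 / 2) \<le> real N * - (e + s * (c - z))" by (intro mult_left_mono) auto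
      then show ?thesis by (intro ennreal_leI) (simp only: exp_le_cancel_iff mult_minus_left mult_minus_right)
    qed
    finally show "surv N x (N - j) c \<le> ennreal (exp (- real N * (e + s * (c - z))))" .
  qed
qed

text \<open>Exponentials of linear functions are reproduced by a step: the gamma transform gives
  \<open>(Y / (Y + s')) ^ k\<close>, concavity makes its logarithm linear in \<open>Y\<close>, and
  the normal variable integrates the result. The bound with the slope of \<open>psik\<close> at
  \<open>z'\<close> becomes one with its slope at \<open>z\<close>, where \<open>z'\<close> follows
  \<open>z\<close> on the cheapest path.\<close>

lemma exp_dominated_step:
  assumes \<kappa>: "0 < \<kappa>" "\<kappa> < 1" and z: "0 < z" and z': "z' = x - \<kappa> / z" "0 < z'" "z' < z"
    and Z: "exp_dominated x \<kappa> z' e"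
  shows "exp_dominated x \<kappa> z (e + psik \<kappa> x z - psik \<kappa> x z')"
  unfolding exp_dominated_def
proof (intro allI)
  fix j
  define s s' where "s = z - x + \<kappa> / z" and "s' = z' - x + \<kappa> / z'"
  have s: "s = z - z'" "0 < s" using z' by (auto simp: s_def)
  have s': "s' = \<kappa> / z' - \<kappa> / z" using z' by (auto simp: s'_def)
  have s'0: "0 < s'" unfolding s' using \<kappa> z z' by (simp add: frac_less2)
  \<comment> \<open>The value of \<open>x - a - c\<close> on the cheapest step from \<open>z\<close>
    to \<open>z'\<close>, where \<open>c = z\<close> and \<open>a = z' - z\<close>; the tangent is
    taken there so that the bound is sharp on that path.\<close>
  define y where "y = \<kappa> / z"
  have y: "0 < y" "y + s' = \<kappa> / z'" "x - y = z'" using \<kappa> z z' s' by (auto simp: y_def)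
  have tang: "\<kappa> * ln (Y / (Y + s')) \<le> \<kappa> * ln (z' / z) + s * (Y - y)" if "0 < Y" for Y
  proof -
    have "\<kappa> * ln (Y / (Y + s')) \<le> \<kappa> * (ln (y / (y + s')) + (1 / y - 1 / (y + s')) * (Y - y))"
      using \<kappa> by (intro mult_left_mono ln_ratio_le_tangent that y s'0) auto
    also have "y / (y + s') = z' / z" unfolding y using \<kappa> z z' by (simp add: y_def)
    also have "1 / y - 1 / (y + s') = s / \<kappa>" unfolding y using \<kappa> z z' by (simp add: y_def s diff_divide_distrib)
    finally show ?thesis using \<kappa> by (simp add: distrib_left)
  qed
  have "\<forall>\<^sub>F N in sequentially. \<kappa> * real N \<le> real N - real (Suc j)"
    using \<kappa> by real_asymp
  moreover have "\<forall>\<^sub>F N in sequentially. \<forall>c\<ge>0. surv N x (N - Suc j) c \<le> ennreal (exp (- real N * (e + s' * (c - z'))))"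
    using Z by (simp add: exp_dominated_def s'_def)
  ultimately show "\<forall>\<^sub>F N in sequentially. \<forall>c\<ge>0. surv N x (N - j) c
      \<le> ennreal (exp (- real N * (e + psik \<kappa> x z - psik \<kappa> x z' + (z - x + \<kappa> / z) * (c - z))))"
    using eventually_gt_at_top[of j]
  proof (eventually_elim, intro allI impI)
    fix N c assume kN: "\<kappa> * real N \<le> real N - real (Suc j)"
      and IH: "\<forall>c\<ge>0. surv N x (N - Suc j) c \<le> ennreal (exp (- real N * (e + s' * (c - z'))))"
      and jN: "j < N" and c: "0 \<le> (c::real)"
    have N: "0 < N" "N - j = Suc (N - Suc j)" using jN by auto
    define k where "k = N - Suc j"
    have k: "\<kappa> * real N \<le> real k" using kN jN by (simp add: k_def)
    define E where "E = - real N * e + real N * s' * z' + real N * (\<kappa> * ln (z' / z)) + real N * s * (z' - c)"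
    have "surv N x (N - j) c = step_op N x 0 k (surv N x k) c" using N(2) by (simp add: k_def)
    also have "\<dots> \<le> (\<integral>\<^sup>+a. ennreal (exp E) * ennreal (exp ((- real N * s) * a)) \<partial>normal_law N)"
      unfolding step_op_def
    proof (rule nn_integral_mono)
      fix a
      show "(\<integral>\<^sup>+g. (if 0 < x - a - c then surv N x k (g / (x - a - c)) else 0) \<partial>gamma_law N k)
        \<le> ennreal (exp E) * ennreal (exp ((- real N * s) * a))"
      proof (cases "0 < x - a - c")
        case True
        define Y where "Y = x - a - c"
        have Y: "0 < Y" using True by (simp add: Y_def)
        let ?t = "real N * s' / Y"
        have t: "- real N < ?t" using N Y s'0 by (smt (verit) divide_pos_pos mult_pos_pos of_nat_0_less_iff)
        have "(\<integral>\<^sup>+g. (if 0 < x - a - c then surv N x k (g / (x - a - c)) else 0) \<partial>gamma_law N k)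
            \<le> (\<integral>\<^sup>+g. ennreal (exp (- real N * e + real N * s' * z')) * ennreal (exp (- ?t * g)) \<partial>gamma_law N k)"
        proof (rule nn_integral_mono_AE)
          show "AE g in gamma_law N k. (if 0 < x - a - c then surv N x k (g / (x - a - c)) else 0)
              \<le> ennreal (exp (- real N * e + real N * s' * z')) * ennreal (exp (- ?t * g))"
            using AE_gamma_law_nonneg[of N k]
          proof eventually_elim
            case (elim g)
            have "surv N x k (g / Y) \<le> ennreal (exp (- real N * (e + s' * (g / Y - z'))))"
              using IH elim Y by (simp add: k_def)
            also have "\<dots> = ennreal (exp (- real N * e + real N * s' * z')) * ennreal (exp (- ?t * g))"
              by (simp add: ennreal_mult[symmetric] exp_add[symmetric] algebra_simps)
            finally show ?case using True by (simp add: Y_def)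
          qed
        qed
        also have "\<dots> = ennreal (exp (- real N * e + real N * s' * z')) * ennreal ((real N / (real N + ?t)) ^ k)"
          using gamma_law_laplace[OF N(1) t, of k] by (subst nn_integral_cmult) auto
        also have "real N / (real N + ?t) = Y / (Y + s')"
        proof -
          have "real N + ?t = real N * (Y + s') / Y" using Y by (simp add: field_simps)
          then show ?thesis using N Y s'0 by simp
        qed
        also have "(Y / (Y + s')) ^ k = exp (real k * ln (Y / (Y + s')))"
          using Y s'0 by (simp add: exp_of_nat_mult)
        also have "ennreal (exp (- real N * e + real N * s' * z')) * ennreal (exp (real k * ln (Y / (Y + s'))))
            = ennreal (exp (- real N * e + real N * s' * z' + real k * ln (Y / (Y + s'))))"
          by (simp add: ennreal_mult[symmetric] exp_add[symmetric])
        also have "\<dots> \<le> ennreal (exp (E + (- real N * s) * a))"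
        proof -
          \<comment> \<open>The logarithm is at most 0, so lowering \<open>k\<close> to
            \<open>\<kappa> * N\<close> only enlarges the value.\<close>
          have "ln (Y / (Y + s')) \<le> 0" using Y s'0 by simp
          then have "real k * ln (Y / (Y + s')) \<le> \<kappa> * real N * ln (Y / (Y + s'))"
            using k by (intro mult_right_mono_neg)
          also have "\<dots> = real N * (\<kappa> * ln (Y / (Y + s')))" by simp
          also have "\<dots> \<le> real N * (\<kappa> * ln (z' / z) + s * (Y - y))"
            by (intro mult_left_mono tang Y) simp
          also have "Y - y = z' - a - c" using y(3) by (simp add: Y_def)
          finally show ?thesis by (intro ennreal_leI) (simp add: E_def algebra_simps)
        qed
        also have "\<dots> = ennreal (exp E) * ennreal (exp ((- real N * s) * a))"
          by (simp add: ennreal_mult[symmetric] exp_add[symmetric])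
        finally show ?thesis .
      qed simp
    qed
    also have "\<dots> = ennreal (exp E) * ennreal (exp ((- real N * s)\<^sup>2 / (2 * real N)))"
      using normal_law_mgf[OF N(1), of "- real N * s"] by (subst nn_integral_cmult) auto
    also have "\<dots> = ennreal (exp (E + real N * (s\<^sup>2 / 2)))"
      using N by (simp add: ennreal_mult[symmetric] exp_add[symmetric] power2_eq_square field_simps)
    also have "E + real N * (s\<^sup>2 / 2) = - real N * (e + psik \<kappa> x z - psik \<kappa> x z' + s * (c - z))"
    proof -
      have x: "x = z' + \<kappa> / z" using z' by simp
      have "s' * z' + \<kappa> * ln (z' / z) + s * (z' - c) + s\<^sup>2 / 2 = - (psik \<kappa> x z - psik \<kappa> x z' + s * (c - z))"
      proof -
        define q where "q = \<kappa> / z"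
        have "s' * z' = \<kappa> - q * z'" unfolding s' left_diff_distrib q_def using z'(2) by simp
        also have "\<dots> = q * (z - z')" using z by (simp add: q_def right_diff_distrib)
        finally have e1: "s' * z' = q * (z - z')" .
        have e2: "ln (z' / z) = ln z' - ln z" using z z' by (simp add: ln_div)
        have e3: "x = z' + q" using x by (simp add: q_def)
        show ?thesis unfolding psik_def s(1) e1 e2 unfolding e3
          by (simp add: field_simps power2_eq_square)
      qed
      then have "real N * (s' * z' + \<kappa> * ln (z' / z) + s * (z' - c) + s\<^sup>2 / 2) = real N * - (psik \<kappa> x z - psik \<kappa> x z' + s * (c - z))"
        by simp
      then show ?thesis unfolding E_def by (simp add: algebra_simps)
    qed
    finally show "surv N x (N - j) c \<le> ennreal (exp (- real N * (e + psik \<kappa> x z - psik \<kappa> x z' + (z - x + \<kappa> / z) * (c - z))))"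
      by (simp add: s_def)
  qed
qed

text \<open>\<open>B\<close> is the larger fixed point of \<open>c = \<kappa> / (x - c)\<close>, the
  other one being \<open>\<kappa> / B\<close>. Finitely many backward steps lead from
  \<open>c\<close> close to \<open>B\<close>, where the one-step bound loses at most
  \<open>\<eta>\<close>.\<close>

lemma surv_upper_aux:
  assumes B: "0 < B" "B < c" and \<kappa>: "\<kappa> = B * (x - B)" "0 < \<kappa>" "\<kappa> < 1" "x < 2 * B"
  shows "exp_upper (\<lambda>N. surv N x) c (psik \<kappa> x c - psik \<kappa> x B)"
proof (rule exp_upper_closed)
  fix \<eta> :: real assume \<eta>: "0 < \<eta>"
  have x: "x = B + \<kappa> / B" using B \<kappa> by simp
  have kB: "\<kappa> / B < B" using \<kappa>(4) x by linarith
  define s where "s z = z - x + \<kappa> / z" for z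
  have s: "s z = (z - B) * (z - \<kappa> / B) / z" if "0 < z" for z
    unfolding s_def x using that B by (simp add: field_simps)
  have s0: "0 < s z" if "B < z" for z
    unfolding s[OF less_trans[OF B(1) that]] using that B kB by (intro divide_pos_pos mult_pos_pos) linarith+
  \<comment> \<open>Compares \<open>psik\<close> with the largest constant that
    \<open>exp_dominated_base\<close> allows. The slope \<open>s\<close> vanishes at
    \<open>B\<close>, so \<open>h z\<close> tends to \<open>psik \<kappa> x B\<close>.\<close>
  define h where "h z = psik \<kappa> x z - (s z * (z - x) - (s z)\<^sup>2 / 2)" for z
  have "isCont h B" unfolding h_def psik_def s_def using B by (intro continuous_intros) auto
  moreover have "h B = psik \<kappa> x B" by (simp add: h_def s_def x)
  ultimately have "(h \<longlongrightarrow> psik \<kappa> x B) (at B)" by (simp add: isCont_def)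
  then have "\<forall>\<^sub>F z in at B. h z < psik \<kappa> x B + \<eta>" using \<eta> by (intro order_tendstoD) auto
  then obtain d where d: "0 < d" "\<And>z. z \<noteq> B \<Longrightarrow> dist z B < d \<Longrightarrow> h z < psik \<kappa> x B + \<eta>"
    unfolding eventually_at by auto
  define P where "P z \<longleftrightarrow> (B < z \<longrightarrow> exp_dominated x \<kappa> z (psik \<kappa> x z - psik \<kappa> x B - \<eta>))" for z
  have "P c"
  proof (rule escape_induct_down[where P = P and l = "c + 1" and u = "B + d / 2" and T = "\<lambda>z. x - \<kappa> / z"])
    show "continuous_on {B + d / 2..<c + 1} (\<lambda>z. x - \<kappa> / z)"
      using B d by (intro continuous_intros) auto
    show "x - \<kappa> / b < b" if "B + d / 2 \<le> b" for b
      using s0[of b] that d by (simp add: s_def)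
    show "P b" if "b \<le> B + d / 2" for b
      unfolding P_def
    proof
      assume b: "B < b"
      have "h b < psik \<kappa> x B + \<eta>" using b that d(1) by (intro d(2)) (auto simp: dist_real_def)
      then show "exp_dominated x \<kappa> b (psik \<kappa> x b - psik \<kappa> x B - \<eta>)"
        using s0[OF b] by (intro exp_dominated_base[OF s_def]) (auto simp: h_def)
    qed
    show "P b" if b: "B + d / 2 < b" and IH: "P (x - \<kappa> / b)" for b
      unfolding P_def
    proof
      assume bB: "B < b"
      have b0: "0 < b" using bB B by linarith
      have "\<kappa> / b < \<kappa> / B" using bB b0 B \<kappa> by (intro divide_strict_left_mono) auto
      then have z': "B < x - \<kappa> / b" using x by simp
      have "exp_dominated x \<kappa> b ((psik \<kappa> x (x - \<kappa> / b) - psik \<kappa> x B - \<eta>) + psik \<kappa> x b - psik \<kappa> x (x - \<kappa> / b))"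
        using IH z' B s0[OF bB] by (intro exp_dominated_step[OF \<kappa>(2,3) b0 refl]) (auto simp: P_def s_def)
      then show "exp_dominated x \<kappa> b (psik \<kappa> x b - psik \<kappa> x B - \<eta>)" by (simp add: algebra_simps)
    qed
  qed simp
  then have Z: "exp_dominated x \<kappa> c (psik \<kappa> x c - psik \<kappa> x B - \<eta>)" using B by (simp add: P_def)
  show "exp_upper (\<lambda>N. surv N x) c (psik \<kappa> x c - psik \<kappa> x B - \<eta>)"
    unfolding exp_upper_def
  proof (intro allI impI)
    fix \<epsilon> :: real and j assume "0 < \<epsilon>"
    have "\<forall>\<^sub>F N in sequentially. \<forall>b\<ge>0. surv N x (N - j) b
      \<le> ennreal (exp (- real N * ((psik \<kappa> x c - psik \<kappa> x B - \<eta>) + (c - x + \<kappa> / c) * (b - c))))"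
      using Z by (simp add: exp_dominated_def)
    then show "\<forall>\<^sub>F N in sequentially. surv N x (N - j) c \<le> ennreal (exp (- real N * (psik \<kappa> x c - psik \<kappa> x B - \<eta> - \<epsilon>)))"
    proof eventually_elim
      case (elim N)
      have "surv N x (N - j) c \<le> ennreal (exp (- real N * (psik \<kappa> x c - psik \<kappa> x B - \<eta>)))"
        using elim[rule_format, of c] B by simp
      also have "\<dots> \<le> ennreal (exp (- real N * (psik \<kappa> x c - psik \<kappa> x B - \<eta> - \<epsilon>)))"
        using \<open>0 < \<epsilon>\<close> by (intro ennreal_leI) (simp add: mult_left_mono)
      finally show ?case .
    qed
  qed
qed

lemma exp_upper_weaken:
  assumes "exp_upper P c r" "r' \<le> r"
  shows "exp_upper P c r'"
  unfolding exp_upper_def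
proof (intro allI impI)
  fix \<epsilon> :: real and j assume "0 < \<epsilon>"
  then have "\<forall>\<^sub>F N in sequentially. P N (N - j) c \<le> ennreal (exp (- real N * (r - \<epsilon>)))"
    using assms(1) by (auto simp: exp_upper_def)
  then show "\<forall>\<^sub>F N in sequentially. P N (N - j) c \<le> ennreal (exp (- real N * (r' - \<epsilon>)))"
  proof eventually_elim
    case (elim N)
    note elim
    also have "ennreal (exp (- real N * (r - \<epsilon>))) \<le> ennreal (exp (- real N * (r' - \<epsilon>)))"
      using assms(2) by (intro ennreal_leI) (simp add: mult_left_mono)
    finally show ?case .
  qed
qed

text \<open>The fixed point \<open>A\<close> belongs to \<open>\<kappa> = 1\<close>. A
  \<open>B\<close> slightly above \<open>A\<close> is the larger fixed point for
  \<open>\<kappa> = B * (x - B) < 1\<close>, and the resulting rate depends continuously on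
  \<open>B\<close>.\<close>

lemma surv_upper:
  assumes A: "1 < A" and x: "x = A + 1 / A" and c: "A < c"
  shows "exp_upper (\<lambda>N. surv N x) c (psi x c - psi x A)"
proof (rule exp_upper_closed)
  fix \<eta> :: real assume \<eta>: "0 < \<eta>"
  have iA: "0 < 1 / A" "1 / A < A" using A by (auto intro: less_trans[of "1 / A" 1])
  define F where "F B = psik (B * (x - B)) x c - psik (B * (x - B)) x B" for B
  have FA: "F A = psi x c - psi x A" using A by (simp add: F_def psik_def psi_def x)
  have "isCont F A" unfolding F_def psik_def using A by (intro continuous_intros) auto
  then have "(F \<longlongrightarrow> F A) (at A)" by (simp add: isCont_def)
  then have "\<forall>\<^sub>F B in at A. F A - \<eta> < F B" using \<eta> by (intro order_tendstoD) auto
  then obtain d where d: "0 < d" "\<And>B. B \<noteq> A \<Longrightarrow> dist B A < d \<Longrightarrow> F A - \<eta> < F B"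
    unfolding eventually_at by auto
  \<comment> \<open>The three terms give closeness to \<open>A\<close>, \<open>B < c\<close>, and
    \<open>B < x\<close>, the last of which makes \<open>\<kappa>\<close> positive.\<close>
  define B where "B = A + min (d / 2) (min ((c - A) / 2) (1 / (2 * A)))"
  have mp: "0 < min (d / 2) (min ((c - A) / 2) (1 / (2 * A)))" using d c A by auto
  have B: "A < B" "B < c" "dist B A < d" "B < x"
  proof -
    show "A < B" using mp by (simp add: B_def)
    have "B \<le> A + (c - A) / 2" unfolding B_def by (intro add_left_mono) (simp only: min.coboundedI2 min.cobounded1)
    then show "B < c" using c by (simp add: field_simps)
    have "B \<le> A + d / 2" unfolding B_def by (intro add_left_mono) simp
    then show "dist B A < d" using \<open>A < B\<close> d by (simp add: dist_real_def)
    have "B \<le> A + 1 / (2 * A)" unfolding B_def by (intro add_left_mono) (simp only: min.coboundedI2 min.cobounded2)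
    also have "\<dots> < x" unfolding x using A by (simp add: field_simps)
    finally show "B < x" .
  qed
  have "0 < (B - A) * (B - 1 / A)" using B iA by (intro mult_pos_pos) linarith+
  also have "\<dots> = 1 - B * (x - B)" unfolding x using A by (simp add: field_simps)
  finally have k1: "B * (x - B) < 1" by simp
  have "exp_upper (\<lambda>N. surv N x) c (F B)"
    unfolding F_def
  proof (rule surv_upper_aux)
    show "x < 2 * B" using x B iA by linarith
  qed (use B A k1 in auto)
  then show "exp_upper (\<lambda>N. surv N x) c (psi x c - psi x A - \<eta>)"
    using d(2)[of B] B FA by (elim exp_upper_weaken) auto
qed

section \<open>An excessive measure and the upper bound for death\<close>

definition weight :: "nat \<Rightarrow> real \<Rightarrow> real \<Rightarrow> ennreal" where
  "weight N x c = ennreal (c ^ (N - 1) * exp (real N * (c\<^sup>2 / 2 - x * c)))"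

lemma measurable_weight [measurable]: "weight N x \<in> borel_measurable borel"
  unfolding weight_def by measurable

text \<open>The coordinates are \<open>Y = x - a - c\<close> and the next position
  \<open>c1 = g / Y\<close>; the factor \<open>Y\<close> in front of the Erlang density is the
  Jacobian.\<close>

lemma step_op_density:
  assumes N: "0 < N" and f[measurable]: "f \<in> borel_measurable borel"
  shows "step_op N x 0 N f c = (\<integral>\<^sup>+Y. (\<integral>\<^sup>+c1. indicator {0<..} Y * ennreal (normal_density 0 (1 / sqrt (real N)) (x - c - Y))
      * (ennreal (Y * erlang_density (N - 1) (real N) (Y * c1)) * f c1) \<partial>lborel) \<partial>lborel)"
proof -
  let ?n = "\<lambda>a. ennreal (normal_density 0 (1 / sqrt (real N)) a)"
  let ?e = "\<lambda>g. ennreal (erlang_density (N - 1) (real N) g)"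
  define G where "G Y = (\<integral>\<^sup>+g. ?e g * (if 0 < Y then f (g / Y) else 0) \<partial>lborel)" for Y
  have [measurable]: "G \<in> borel_measurable borel" unfolding G_def by measurable
  have "step_op N x 0 N f c = (\<integral>\<^sup>+a. G (x - a - c) \<partial>normal_law N)"
  proof -
    have "gamma_law N N = density lborel ?e" using N by (simp add: gamma_law_def)
    then have "(\<lambda>a. \<integral>\<^sup>+g. (if 0 < x - a - c then f (g / (x - a - c)) else 0) \<partial>gamma_law N N) = (\<lambda>a. G (x - a - c))"
      unfolding G_def by (simp add: nn_integral_density)
    then show ?thesis unfolding step_op_def by (rule arg_cong)
  qed
  also have "\<dots> = (\<integral>\<^sup>+a. ?n a * G (x - a - c) \<partial>lborel)"
    by (simp add: normal_law_def nn_integral_density)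
  also have "\<dots> = (\<integral>\<^sup>+Y. ?n (x - c - Y) * G Y \<partial>lborel)"
    by (subst nn_integral_real_affine[where c = "-1" and t = "x - c"]) (auto simp: algebra_simps)
  also have "\<dots> = (\<integral>\<^sup>+Y. (\<integral>\<^sup>+c1. indicator {0<..} Y * ?n (x - c - Y) * (ennreal (Y * erlang_density (N - 1) (real N) (Y * c1)) * f c1) \<partial>lborel) \<partial>lborel)"
  proof (rule nn_integral_cong)
    fix Y :: real
    show "?n (x - c - Y) * G Y = (\<integral>\<^sup>+c1. indicator {0<..} Y * ?n (x - c - Y) * (ennreal (Y * erlang_density (N - 1) (real N) (Y * c1)) * f c1) \<partial>lborel)"
    proof (cases "0 < Y")
      case True
      have "G Y = (\<integral>\<^sup>+g. ?e g * f (g / Y) \<partial>lborel)" using True by (simp add: G_def)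
      also have "\<dots> = ennreal Y * (\<integral>\<^sup>+c1. ?e (Y * c1) * f c1 \<partial>lborel)"
        using True by (subst nn_integral_real_affine[where c = Y and t = 0]) auto
      also have "\<dots> = (\<integral>\<^sup>+c1. ennreal (Y * erlang_density (N - 1) (real N) (Y * c1)) * f c1 \<partial>lborel)"
        using True by (subst nn_integral_cmult[symmetric]) (auto simp: ennreal_mult mult.assoc)
      finally show ?thesis using True by (simp add: nn_integral_cmult)
    qed (simp add: G_def)
  qed
  finally show ?thesis .
qed

text \<open>For \<open>Y > 0\<close>, the weight times the joint density of
  \<open>Y = x - a - c\<close> and the next position \<open>c1\<close> is proportional to \<open>(c
  * c1) ^ (N - 1) * Y ^ N * exp (- N * (x - Y)\<^sup>2 / 2 - N * Y * (c + c1))\<close>. This is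
  symmetric in \<open>c\<close> and \<open>c1\<close>, so the weight is reversible for the killed
  chain. After \<open>c\<close> is integrated out, extending the integral over \<open>Y\<close> to
  the whole line returns exactly the weight of \<open>c1\<close>; the true integral has
  \<open>Y > 0\<close> only, hence the inequality.\<close>

lemma weight_invariant:
  assumes N: "2 \<le> N" and f[measurable]: "f \<in> borel_measurable borel"
  shows "(\<integral>\<^sup>+c. indicator {0<..} c * (weight N x c * step_op N x 0 N f c) \<partial>lborel)
    \<le> (\<integral>\<^sup>+c. indicator {0<..} c * (weight N x c * f c) \<partial>lborel)"
proof -
  define n where "n = normal_density 0 (1 / sqrt (real N))"
  define e where "e = erlang_density (N - 1) (real N)"
  have [measurable]: "n \<in> borel_measurable borel" "e \<in> borel_measurable borel" by (simp_all add: n_def e_def)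
  have n0: "0 \<le> n a" and e0: "0 \<le> e a" for a by (simp_all add: n_def e_def)
  define D where "D c Y c1 = indicator {0<..} c * weight N x c * (indicator {0<..} Y * ennreal (n (x - c - Y)) * (ennreal (Y * e (Y * c1)) * f c1))" for c Y c1
  have [measurable]: "(\<lambda>(c, Y, c1). D c Y c1) \<in> borel_measurable (borel \<Otimes>\<^sub>M borel \<Otimes>\<^sub>M borel)"
    unfolding D_def by measurable
  have [measurable]: "(\<lambda>z. D (snd z) (fst z) c1) \<in> borel_measurable (borel \<Otimes>\<^sub>M borel)" for c1
    unfolding D_def by measurable
  have [measurable]: "(\<lambda>z. D (snd (fst z)) (snd z) (fst (fst z))) \<in> borel_measurable ((borel \<Otimes>\<^sub>M borel) \<Otimes>\<^sub>M borel)"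
    unfolding D_def by measurable
  have "(\<integral>\<^sup>+c. indicator {0<..} c * (weight N x c * step_op N x 0 N f c) \<partial>lborel)
      = (\<integral>\<^sup>+c. (\<integral>\<^sup>+Y. (\<integral>\<^sup>+c1. D c Y c1 \<partial>lborel) \<partial>lborel) \<partial>lborel)"
  proof (rule nn_integral_cong)
    fix c
    have "(\<integral>\<^sup>+Y. (\<integral>\<^sup>+c1. D c Y c1 \<partial>lborel) \<partial>lborel)
      = (\<integral>\<^sup>+Y. indicator {0<..} c * weight N x c * (\<integral>\<^sup>+c1. indicator {0<..} Y * ennreal (n (x - c - Y)) * (ennreal (Y * e (Y * c1)) * f c1) \<partial>lborel) \<partial>lborel)"
      unfolding D_def by (intro nn_integral_cong nn_integral_cmult) measurable
    also have "\<dots> = indicator {0<..} c * weight N x c * (\<integral>\<^sup>+Y. (\<integral>\<^sup>+c1. indicator {0<..} Y * ennreal (n (x - c - Y)) * (ennreal (Y * e (Y * c1)) * f c1) \<partial>lborel) \<partial>lborel)"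
      by (intro nn_integral_cmult) measurable
    also have "\<dots> = indicator {0<..} c * (weight N x c * step_op N x 0 N f c)"
      using N by (subst step_op_density) (auto simp: n_def e_def mult.assoc)
    finally show "indicator {0<..} c * (weight N x c * step_op N x 0 N f c) = (\<integral>\<^sup>+Y. (\<integral>\<^sup>+c1. D c Y c1 \<partial>lborel) \<partial>lborel)" ..
  qed
  \<comment> \<open>The integral over \<open>c\<close> is moved inside: for fixed \<open>Y\<close>
    it is that of an Erlang density of rate \<open>N * Y\<close>, and afterwards \<open>Y\<close> is
    integrated by the normal moment generating function.\<close>
  also have "\<dots> = (\<integral>\<^sup>+c. (\<integral>\<^sup>+c1. (\<integral>\<^sup>+Y. D c Y c1 \<partial>lborel) \<partial>lborel) \<partial>lborel)"
    by (rule nn_integral_cong, rule lborel_pair.Fubini') measurable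
  also have "\<dots> = (\<integral>\<^sup>+c1. (\<integral>\<^sup>+c. (\<integral>\<^sup>+Y. D c Y c1 \<partial>lborel) \<partial>lborel) \<partial>lborel)"
    by (intro lborel_pair.Fubini') measurable
  also have "\<dots> = (\<integral>\<^sup>+c1. (\<integral>\<^sup>+Y. (\<integral>\<^sup>+c. D c Y c1 \<partial>lborel) \<partial>lborel) \<partial>lborel)"
    by (rule nn_integral_cong, rule lborel_pair.Fubini') measurable
  also have "\<dots> \<le> (\<integral>\<^sup>+c1. indicator {0<..} c1 * (weight N x c1 * f c1) \<partial>lborel)"
  proof (rule nn_integral_mono)
    fix c1 :: real
    show "(\<integral>\<^sup>+Y. (\<integral>\<^sup>+c. D c Y c1 \<partial>lborel) \<partial>lborel) \<le> indicator {0<..} c1 * (weight N x c1 * f c1)"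
    proof (cases "0 < c1")
      case False
      have "D c Y c1 = 0" for c Y
      proof (cases "0 < Y")
        case True
        then have "Y * c1 \<le> 0" using False by (intro mult_nonneg_nonpos) auto
        \<comment> \<open>At \<open>c1 = 0\<close> the density vanishes because its power
          \<open>N - 1\<close> is positive, hence \<open>2 \<le> N\<close>.\<close>
        then have "e (Y * c1) = 0" using N unfolding e_def erlang_density_def
          by (cases "Y * c1 = 0") auto
        then show ?thesis by (simp add: D_def)
      qed (simp add: D_def)
      then show ?thesis by simp
    next
      case True
      have inner: "(\<integral>\<^sup>+c. D c Y c1 \<partial>lborel) \<le> ennreal (n (x - Y)) * ennreal (exp (- (real N * c1) * Y)) * ennreal (c1 ^ (N - 1)) * f c1" for Y
      proof (cases "0 < Y")
        case Y: True
        have NY: "0 < real N * Y" using N Y by simp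
        have "D c Y c1 \<le> ennreal (erlang_density (N - 1) (real N * Y) c) * (ennreal (n (x - Y)) * ennreal (exp (- (real N * c1) * Y)) * ennreal (c1 ^ (N - 1)) * f c1)" for c
        proof (cases "0 < c")
          case c: True
          have expo: "exp (real N * (c\<^sup>2 / 2 - x * c)) * exp (- (x - c - Y)\<^sup>2 / (2 * (1 / real N)))
              = exp (- real N * Y * c) * exp (- (x - Y)\<^sup>2 / (2 * (1 / real N)))"
            using N by (simp only: exp_add[symmetric], intro arg_cong[where f = exp]) (simp add: field_simps power2_eq_square)
          have "c ^ (N - 1) * exp (real N * (c\<^sup>2 / 2 - x * c)) * n (x - c - Y) * (Y * e (Y * c1))
            = erlang_density (N - 1) (real N * Y) c * (n (x - Y) * exp (- (real N * c1) * Y) * c1 ^ (N - 1))"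
          proof -
            have ye: "Y * e (Y * c1) = (real N * Y) ^ Suc (N - 1) * c1 ^ (N - 1) * exp (- (real N * c1) * Y) / fact (N - 1)"
              using Y mult_pos_pos[OF Y True] by (simp add: e_def erlang_density_def power_mult_distrib mult_ac)
            have "c ^ (N - 1) * exp (real N * (c\<^sup>2 / 2 - x * c)) * n (x - c - Y) * (Y * e (Y * c1))
              = (exp (real N * (c\<^sup>2 / 2 - x * c)) * exp (- (x - c - Y)\<^sup>2 / (2 * (1 / real N)))) *
                (c ^ (N - 1) * (1 / sqrt (2 * pi * (1 / real N))) * (Y * e (Y * c1)))"
              by (simp add: n_def normal_density_def power_divide)
            also have "\<dots> = (exp (- real N * Y * c) * exp (- (x - Y)\<^sup>2 / (2 * (1 / real N)))) *
                (c ^ (N - 1) * (1 / sqrt (2 * pi * (1 / real N))) * (Y * e (Y * c1)))"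
              by (simp only: expo)
            also have "\<dots> = (exp (- real N * Y * c) * exp (- (x - Y)\<^sup>2 / (2 * (1 / real N)))) *
                (c ^ (N - 1) * (1 / sqrt (2 * pi * (1 / real N))) * ((real N * Y) ^ Suc (N - 1) * c1 ^ (N - 1) * exp (- (real N * c1) * Y) / fact (N - 1)))"
              by (simp only: ye)
            also have "\<dots> = erlang_density (N - 1) (real N * Y) c * (n (x - Y) * exp (- (real N * c1) * Y) * c1 ^ (N - 1))"
              using c by (simp add: erlang_density_def n_def normal_density_def power_divide mult_ac)
            finally show ?thesis .
          qed
          then have "ennreal (c ^ (N - 1) * exp (real N * (c\<^sup>2 / 2 - x * c)) * n (x - c - Y) * (Y * e (Y * c1))) * f c1
            = ennreal (erlang_density (N - 1) (real N * Y) c * (n (x - Y) * exp (- (real N * c1) * Y) * c1 ^ (N - 1))) * f c1"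
            by simp
          moreover have "D c Y c1 = ennreal (c ^ (N - 1) * exp (real N * (c\<^sup>2 / 2 - x * c)) * n (x - c - Y) * (Y * e (Y * c1))) * f c1"
            using c Y n0 e0 by (simp add: D_def weight_def ennreal_mult mult.assoc)
          moreover have "ennreal (erlang_density (N - 1) (real N * Y) c * (n (x - Y) * exp (- (real N * c1) * Y) * c1 ^ (N - 1))) * f c1
            = ennreal (erlang_density (N - 1) (real N * Y) c) * (ennreal (n (x - Y)) * ennreal (exp (- (real N * c1) * Y)) * ennreal (c1 ^ (N - 1)) * f c1)"
            using NY True n0 by (simp add: ennreal_mult mult.assoc)
          ultimately show ?thesis by simp
        qed (simp add: D_def)
        then have "(\<integral>\<^sup>+c. D c Y c1 \<partial>lborel) \<le> (\<integral>\<^sup>+c. ennreal (erlang_density (N - 1) (real N * Y) c) * (ennreal (n (x - Y)) * ennreal (exp (- (real N * c1) * Y)) * ennreal (c1 ^ (N - 1)) * f c1) \<partial>lborel)"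
          by (intro nn_integral_mono)
        then show ?thesis using nn_integral_erlang_density_1[OF NY] by (simp add: nn_integral_multc)
      qed (simp add: D_def)
      have "(\<integral>\<^sup>+Y. (\<integral>\<^sup>+c. D c Y c1 \<partial>lborel) \<partial>lborel)
          \<le> (\<integral>\<^sup>+Y. ennreal (n (x - Y)) * ennreal (exp (- (real N * c1) * Y)) * ennreal (c1 ^ (N - 1)) * f c1 \<partial>lborel)"
        by (intro nn_integral_mono inner)
      also have "\<dots> = (\<integral>\<^sup>+Y. ennreal (n (x - Y)) * ennreal (exp (- (real N * c1) * Y)) \<partial>lborel) * ennreal (c1 ^ (N - 1)) * f c1"
        by (simp add: nn_integral_multc)
      also have "(\<integral>\<^sup>+Y. ennreal (n (x - Y)) * ennreal (exp (- (real N * c1) * Y)) \<partial>lborel)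
          = (\<integral>\<^sup>+a. ennreal (n a) * ennreal (exp (- (real N * c1) * (x - a))) \<partial>lborel)"
        by (subst nn_integral_real_affine[where c = "-1" and t = x]) auto
      also have "\<dots> = (\<integral>\<^sup>+a. ennreal (exp (- (real N * c1) * (x - a))) \<partial>normal_law N)"
        unfolding normal_law_def n_def by (subst nn_integral_density) auto
      also have "\<dots> = (\<integral>\<^sup>+a. ennreal (exp (- (real N * c1) * x)) * ennreal (exp ((real N * c1) * a)) \<partial>normal_law N)"
        by (intro nn_integral_cong) (simp add: ennreal_mult[symmetric] exp_add[symmetric] algebra_simps)
      also have "\<dots> = ennreal (exp (- (real N * c1) * x)) * ennreal (exp ((real N * c1)\<^sup>2 / (2 * real N)))"
        using normal_law_mgf[of N "real N * c1"] N by (subst nn_integral_cmult) auto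
      also have "\<dots> = ennreal (exp (real N * (c1\<^sup>2 / 2 - x * c1)))"
        using N by (simp add: ennreal_mult[symmetric] exp_add[symmetric] power2_eq_square field_simps)
      also have "\<dots> * ennreal (c1 ^ (N - 1)) = weight N x c1"
        using True by (simp add: weight_def ennreal_mult[symmetric] mult.commute)
      finally show ?thesis using True by simp
    qed
  qed
  finally show ?thesis .
qed

lemma power_pred_eq_exp:
  assumes "0 < N" "0 < (c::real)"
  shows "c ^ (N - 1) = exp (real N * ln c) / c"
proof -
  have "exp (real N * ln c) = c ^ (N - 1) * c"
    using assms by (cases N; simp add: exp_of_nat_mult del: of_nat_Suc)
  then show ?thesis using assms by simp
qed

text \<open>Dominates the death probability, with the number of gamma degrees of freedom fixed at \<open>N\<close>, so that \<open>weight\<close>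
  is excessive for every step.\<close>

primrec exit_prob :: "nat \<Rightarrow> real \<Rightarrow> real \<Rightarrow> nat \<Rightarrow> real \<Rightarrow> ennreal" where
  "exit_prob N x A 0 = (\<lambda>c. if A \<le> c then 1 else 0)"
| "exit_prob N x A (Suc j) = (\<lambda>c. if A \<le> c then 1 else step_op N x 1 N (exit_prob N x A j) c)"

lemma exit_prob_le_1: "0 < N \<Longrightarrow> exit_prob N x A j c \<le> 1"
  by (induction j arbitrary: c) (auto intro: step_op_le_1)

lemma exit_prob_mono: "0 < N \<Longrightarrow> c \<le> c' \<Longrightarrow> exit_prob N x A j c \<le> exit_prob N x A j c'"
proof (induction j arbitrary: c c')
  case (Suc j)
  show ?case
  proof (cases "A \<le> c'")
    case True
    have "exit_prob N x A (Suc j) c \<le> 1" by (rule exit_prob_le_1[OF Suc.prems(1)])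
    then show ?thesis using True by simp
  next
    case False
    then have "\<not> A \<le> c" using Suc.prems by simp
    then show ?thesis using False Suc.prems
      by (simp, intro step_op_mono_c Suc.IH) (auto intro: exit_prob_le_1)
  qed
qed simp

lemma measurable_exit_prob: "0 < N \<Longrightarrow> exit_prob N x A j \<in> borel_measurable borel"
  by (intro borel_measurable_mono_ennreal exit_prob_mono)

lemma gamma_law_mono_le:
  assumes "0 < N" "mono_on {0..} f" "f \<in> borel_measurable borel" "\<And>g. f g \<le> (1::ennreal)" "k \<le> k'"
  shows "(\<integral>\<^sup>+g. f g \<partial>gamma_law N k) \<le> (\<integral>\<^sup>+g. f g \<partial>gamma_law N k')"
  using assms(5)
proof (induction rule: dec_induct)
  case (step n)
  show ?case by (rule order_trans[OF step.IH gamma_law_mono[OF assms(1-4)]])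
qed simp

text \<open>Two modifications, both upward: reaching \<open>A\<close> counts as death, and the gamma
  variable gets all \<open>N\<close> degrees of freedom, which helps because the integrand increases
  with \<open>g\<close>.\<close>

lemma dead_le_exit_prob:
  assumes N: "0 < N" and k: "k \<le> N"
  shows "dead N x k c \<le> exit_prob N x A k c"
  using k
proof (induction k arbitrary: c)
  case (Suc k)
  show ?case
  proof (cases "A \<le> c")
    case True
    have "dead N x (Suc k) c \<le> 1" by (rule chain_le_1[OF N]) simp
    then show ?thesis using True by simp
  next
    case False
    have "dead N x (Suc k) c = step_op N x 1 k (dead N x k) c" by simp
    also have "\<dots> \<le> step_op N x 1 k (exit_prob N x A k) c"
      using Suc by (intro step_op_mono) auto
    also have "\<dots> \<le> step_op N x 1 N (exit_prob N x A k) c"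
      unfolding step_op_def
    proof (rule nn_integral_mono)
      fix a
      note [measurable] = measurable_exit_prob[OF N]
      show "(\<integral>\<^sup>+g. (if 0 < x - a - c then exit_prob N x A k (g / (x - a - c)) else 1) \<partial>gamma_law N k)
        \<le> (\<integral>\<^sup>+g. (if 0 < x - a - c then exit_prob N x A k (g / (x - a - c)) else 1) \<partial>gamma_law N N)"
        using Suc.prems
        by (intro gamma_law_mono_le[OF N] mono_onI)
           (auto intro!: exit_prob_mono[OF N] exit_prob_le_1[OF N] divide_right_mono)
    qed
    finally show ?thesis using False by simp
  qed
qed simp

text \<open>Death or a jump above \<open>A\<close> forces \<open>x - a - c \<le> g / A\<close>. With
  the tilt \<open>A - c\<close> the Chernoff bound becomes exactly a potential difference, so that
  multiplied by the weight it depends on \<open>c\<close> only through a factor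
  \<open>1 / c\<close>.\<close>

lemma one_step_exit:
  assumes N: "0 < N" and A: "1 < A" and x: "x = A + 1 / A" and c: "0 < c" "c < A"
  shows "step_op N x 1 N (\<lambda>c. if A \<le> c then 1 else 0) c \<le> ennreal (exp (real N * (psi x A - psi x c)))"
proof -
  define s where "s = A - c"
  have s: "0 < s" "s < A" using c by (auto simp: s_def)
  have "step_op N x 1 N (\<lambda>c. if A \<le> c then 1 else 0) c
      \<le> (\<integral>\<^sup>+a. (\<integral>\<^sup>+g. ennreal (exp (real N * s * (c - x))) * ennreal (exp (real N * s * a)) * ennreal (exp (- (- real N * s / A) * g)) \<partial>gamma_law N N) \<partial>normal_law N)"
    unfolding step_op_def
  proof (rule nn_integral_mono, rule nn_integral_mono_AE)
    fix a
    show "AE g in gamma_law N N. (if 0 < x - a - c then if A \<le> g / (x - a - c) then 1 else 0 else 1)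
       \<le> ennreal (exp (real N * s * (c - x))) * ennreal (exp (real N * s * a)) * ennreal (exp (- (- real N * s / A) * g))"
      using AE_gamma_law_nonneg[of N N]
    proof eventually_elim
      case (elim g)
      have "1 \<le> ennreal (exp (real N * s * (g / A - (x - a - c))))" if "x - a - c \<le> g / A"
        using that s by (simp flip: ennreal_1 add: ennreal_leI)
      also have "real N * s * (g / A - (x - a - c)) = real N * s * (c - x) + real N * s * a + - (- real N * s / A) * g"
        by (simp add: algebra_simps)
      also have "ennreal (exp \<dots>) = ennreal (exp (real N * s * (c - x))) * ennreal (exp (real N * s * a)) * ennreal (exp (- (- real N * s / A) * g))"
        by (simp add: ennreal_mult[symmetric] exp_add)
      finally have *: "1 \<le> ennreal (exp (real N * s * (c - x))) * ennreal (exp (real N * s * a)) * ennreal (exp (- (- real N * s / A) * g))"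
        if "x - a - c \<le> g / A" using that .
      show ?case
      proof (cases "0 < x - a - c")
        case True
        then have "A \<le> g / (x - a - c) \<longleftrightarrow> x - a - c \<le> g / A"
          using A by (simp add: pos_le_divide_eq mult.commute)
        then show ?thesis using * True by simp
      next
        case False
        have "0 \<le> g / A" using elim A by simp
        then show ?thesis using * False by simp
      qed
    qed
  qed
  also have "\<dots> = (\<integral>\<^sup>+a. ennreal (exp (real N * s * (c - x))) * ennreal (exp (real N * s * a)) * ennreal ((real N / (real N + - real N * s / A)) ^ N) \<partial>normal_law N)"
  proof -
    have "- real N < - real N * s / A" using N s A by (simp add: field_simps)
    then show ?thesis using gamma_law_laplace[OF N, of "- real N * s / A" N]
      by (intro nn_integral_cong, subst nn_integral_cmult) auto
  qed
  also have "\<dots> = ennreal (exp (real N * s * (c - x))) * ennreal (exp ((real N * s)\<^sup>2 / (2 * real N))) * ennreal ((real N / (real N + - real N * s / A)) ^ N)"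
    using normal_law_mgf[OF N, of "real N * s"]
    by (subst nn_integral_multc, simp, subst nn_integral_cmult) auto
  also have "real N / (real N + - real N * s / A) = A / c"
  proof -
    have "real N + - real N * s / A = real N * c / A" using A by (simp add: s_def field_simps)
    then show ?thesis using N A c by simp
  qed
  also have "(A / c) ^ N = exp (real N * (ln A - ln c))"
    using A c by (simp add: exp_of_nat_mult exp_diff)
  also have "(real N * s)\<^sup>2 / (2 * real N) = real N * (s\<^sup>2 / 2)"
    using N by (simp add: power2_eq_square)
  also have "ennreal (exp (real N * s * (c - x))) * ennreal (exp (real N * (s\<^sup>2 / 2))) * ennreal (exp (real N * (ln A - ln c)))
      = ennreal (exp (real N * (s * (c - x) + s\<^sup>2 / 2 + (ln A - ln c))))"
    by (simp add: ennreal_mult[symmetric] exp_add[symmetric] algebra_simps)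
  also have "s * (c - x) + s\<^sup>2 / 2 + (ln A - ln c) = psi x A - psi x c"
    unfolding psi_def s_def by (simp add: field_simps power2_eq_square)
  finally show ?thesis .
qed

text \<open>The leftover \<open>1 / c\<close> is unbounded near 0, so that estimate is used for
  \<open>c \<ge> exp (psi x A)\<close> only. Below this point the weight alone is small enough,
  being at most \<open>exp (psi x A) ^ (N - 1)\<close>.\<close>

lemma weight_one_step_exit:
  assumes N: "2 \<le> N" and A: "1 < A" and x: "x = A + 1 / A" and c: "0 < c" "c < A"
  shows "weight N x c * step_op N x 1 N (\<lambda>c. if A \<le> c then 1 else 0) c
    \<le> ennreal (exp (real N * psi x A) * exp (- psi x A))"
proof (cases "exp (psi x A) \<le> c")
  case True
  have "weight N x c * step_op N x 1 N (\<lambda>c. if A \<le> c then 1 else 0) c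
      \<le> ennreal (c ^ (N - 1) * exp (real N * (c\<^sup>2 / 2 - x * c))) * ennreal (exp (real N * (psi x A - psi x c)))"
    unfolding weight_def using N by (intro mult_left_mono one_step_exit[OF _ A x c]) auto
  also have "c ^ (N - 1) = exp (real N * ln c) / c"
    using N c by (intro power_pred_eq_exp) auto
  also have "ennreal (exp (real N * ln c) / c * exp (real N * (c\<^sup>2 / 2 - x * c))) * ennreal (exp (real N * (psi x A - psi x c)))
      = ennreal (exp (real N * psi x A) * (1 / c))"
  proof -
    have "exp (real N * ln c) * exp (real N * (c\<^sup>2 / 2 - x * c)) * exp (real N * (psi x A - psi x c)) = exp (real N * psi x A)"
      by (simp only: exp_add[symmetric], intro arg_cong[where f = exp]) (simp add: psi_def algebra_simps)
    then have "exp (real N * ln c) / c * exp (real N * (c\<^sup>2 / 2 - x * c)) * exp (real N * (psi x A - psi x c)) = exp (real N * psi x A) * (1 / c)"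
      by (simp add: mult_ac)
    then show ?thesis using c by (simp add: ennreal_mult[symmetric])
  qed
  also have "\<dots> \<le> ennreal (exp (real N * psi x A) * exp (- psi x A))"
    using True c by (intro ennreal_leI mult_left_mono) (auto simp: exp_minus inverse_eq_divide intro!: divide_left_mono)
  finally show ?thesis .
next
  case False
  have "step_op N x 1 N (\<lambda>c. if A \<le> c then 1 else 0) c \<le> 1"
    using N by (intro step_op_le_1) auto
  then have "weight N x c * step_op N x 1 N (\<lambda>c. if A \<le> c then 1 else 0) c \<le> weight N x c * 1"
    by (intro mult_left_mono) auto
  also have "\<dots> \<le> ennreal (exp (psi x A) ^ (N - 1) * 1)"
    unfolding weight_def mult_1_right[of "ennreal _"]
  proof (intro ennreal_leI mult_mono power_mono)
    have "c\<^sup>2 / 2 \<le> x * c"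
    proof -
      have "c * c \<le> (2 * x) * c" using c A by (intro mult_right_mono) (auto simp: x field_simps, smt (verit) mult_mono)
      then show ?thesis by (simp add: power2_eq_square)
    qed
    then have "real N * (c\<^sup>2 / 2 - x * c) \<le> 0" by (intro mult_nonneg_nonpos) auto
    then show "exp (real N * (c\<^sup>2 / 2 - x * c)) \<le> 1" by simp
  qed (use c False in auto)
  also have "exp (psi x A) ^ (N - 1) * 1 = exp (real N * psi x A) * exp (- psi x A)"
    using N by (simp add: exp_of_nat_mult[symmetric] exp_add[symmetric] of_nat_diff algebra_simps)
  finally show ?thesis .
qed

text \<open>An exit is either immediate, with weighted mass controlled by
  \<open>weight_one_step_exit\<close>, or happens later from the next position, with a weighted mass
  that cannot grow because the weight is excessive. Each step therefore adds the same
  amount.\<close>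

lemma exit_prob_integral:
  assumes N: "2 \<le> N" and A: "1 < A" and x: "x = A + 1 / A"
  shows "(\<integral>\<^sup>+c. indicator {0<..<A} c * (weight N x c * exit_prob N x A j c) \<partial>lborel)
    \<le> of_nat j * ennreal (A * (exp (real N * psi x A) * exp (- psi x A)))"
proof (induction j)
  case 0
  have "(\<integral>\<^sup>+c. indicator {0<..<A} c * (weight N x c * exit_prob N x A 0 c) \<partial>lborel) = (\<integral>\<^sup>+c. 0 \<partial>(lborel::real measure))"
    by (intro nn_integral_cong) (auto simp: indicator_def)
  then show ?case by simp
next
  case (Suc j)
  have N0: "0 < N" using N by simp
  note [measurable] = measurable_exit_prob[OF N0]
  let ?K = "exp (real N * psi x A) * exp (- psi x A)"
  \<comment> \<open>\<open>f\<close> counts later exits from positions below \<open>A\<close>, with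
    value 0 on killing; killing and jumps above \<open>A\<close> are both left to
    \<open>h\<close>.\<close>
  define f where "f = (\<lambda>c. indicator {..<A} c * exit_prob N x A j c)"
  define h where "h = (\<lambda>c::real. if A \<le> c then 1 else 0 :: ennreal)"
  have fm[measurable]: "f \<in> borel_measurable borel" unfolding f_def by measurable
  have split: "exit_prob N x A (Suc j) c \<le> step_op N x 0 N f c + step_op N x 1 N h c" if "c < A" for c
  proof -
    have "exit_prob N x A (Suc j) c = step_op N x 1 N (exit_prob N x A j) c" using that by simp
    also have "\<dots> \<le> (\<integral>\<^sup>+a. (\<integral>\<^sup>+g. (if 0 < x - a - c then f (g / (x - a - c)) else 0) + (if 0 < x - a - c then h (g / (x - a - c)) else 1) \<partial>gamma_law N N) \<partial>normal_law N)"
      unfolding step_op_def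
    proof (intro nn_integral_mono)
      fix a g
      have "exit_prob N x A j b \<le> f b + h b" for b
        using exit_prob_le_1[OF N0, of x A j b] by (cases "b < A") (auto simp: f_def h_def)
      then show "(if 0 < x - a - c then exit_prob N x A j (g / (x - a - c)) else 1)
        \<le> (if 0 < x - a - c then f (g / (x - a - c)) else 0) + (if 0 < x - a - c then h (g / (x - a - c)) else 1)"
        by simp
    qed
    also have "\<dots> = step_op N x 0 N f c + step_op N x 1 N h c"
    proof -
      have [measurable]: "h \<in> borel_measurable borel" unfolding h_def by measurable
      interpret g: prob_space "gamma_law N N" by (rule prob_space_gamma_law[OF N0])
      show ?thesis unfolding step_op_def by (subst nn_integral_add[symmetric]; (subst nn_integral_add[symmetric])?; measurable)
    qed
    finally show ?thesis .
  qed
  have "(\<integral>\<^sup>+c. indicator {0<..<A} c * (weight N x c * exit_prob N x A (Suc j) c) \<partial>lborel)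
    \<le> (\<integral>\<^sup>+c. indicator {0<..} c * (weight N x c * step_op N x 0 N f c) + ennreal ?K * indicator {0<..<A} c \<partial>lborel)"
  proof (rule nn_integral_mono)
    fix c
    show "indicator {0<..<A} c * (weight N x c * exit_prob N x A (Suc j) c)
      \<le> indicator {0<..} c * (weight N x c * step_op N x 0 N f c) + ennreal ?K * indicator {0<..<A} c"
    proof (cases "c \<in> {0<..<A}")
      case True
      then have c: "0 < c" "c < A" by auto
      have "weight N x c * exit_prob N x A (Suc j) c \<le> weight N x c * (step_op N x 0 N f c + step_op N x 1 N h c)"
        using split[OF c(2)] by (rule mult_left_mono) simp
      also have "\<dots> = weight N x c * step_op N x 0 N f c + weight N x c * step_op N x 1 N h c"
        by (rule distrib_left)
      also have "\<dots> \<le> weight N x c * step_op N x 0 N f c + ennreal ?K"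
        unfolding h_def by (intro add_left_mono weight_one_step_exit[OF N A x c])
      finally show ?thesis using c by simp
    qed simp
  qed
  also have "\<dots> = (\<integral>\<^sup>+c. indicator {0<..} c * (weight N x c * step_op N x 0 N f c) \<partial>lborel) + (\<integral>\<^sup>+c. ennreal ?K * indicator {0<..<A} c \<partial>lborel)"
  proof (rule nn_integral_add)
    have [measurable]: "step_op N x 0 N f \<in> borel_measurable borel"
    proof -
      have "step_op N x 0 N f = (\<lambda>c. (\<integral>\<^sup>+Y. (\<integral>\<^sup>+c1. indicator {0<..} Y * ennreal (normal_density 0 (1 / sqrt (real N)) (x - c - Y))
        * (ennreal (Y * erlang_density (N - 1) (real N) (Y * c1)) * f c1) \<partial>lborel) \<partial>lborel))"
        using step_op_density[OF N0 fm] by (intro ext)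
      then show ?thesis by simp
    qed
    show "(\<lambda>c. indicator {0<..} c * (weight N x c * step_op N x 0 N f c)) \<in> borel_measurable lborel" by measurable
  qed simp
  also have "(\<integral>\<^sup>+c. ennreal ?K * indicator {0<..<A} c \<partial>lborel) = ennreal (A * ?K)"
    using A by (subst nn_integral_cmult_indicator) (auto simp: ennreal_mult mult.commute)
  also have "(\<integral>\<^sup>+c. indicator {0<..} c * (weight N x c * step_op N x 0 N f c) \<partial>lborel)
    \<le> (\<integral>\<^sup>+c. indicator {0<..} c * (weight N x c * f c) \<partial>lborel)"
    by (rule weight_invariant[OF N fm])
  also have "\<dots> = (\<integral>\<^sup>+c. indicator {0<..<A} c * (weight N x c * exit_prob N x A j c) \<partial>lborel)"
    by (intro nn_integral_cong) (auto simp: f_def indicator_def)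
  also have "\<dots> \<le> of_nat j * ennreal (A * ?K)" by (rule Suc.IH)
  finally show ?case by (simp add: distrib_right add.commute)
qed

text \<open>The integral bound becomes pointwise because \<open>exit_prob\<close> increases: its
  value at \<open>b\<close> times the weight of \<open>[b, b']\<close> is at most the integral, and
  there the weight is at least \<open>exp (N * psi x b') / A\<close>, since \<open>psi\<close>
  decreases up to \<open>A\<close>.\<close>

lemma exp_upper_dead_between:
  assumes A: "1 < A" and x: "x = A + 1 / A" and b: "1 / A \<le> b" "b < b'" "b' < A" and c: "c \<le> b"
  shows "exp_upper (\<lambda>N. dead N x) c (psi x b' - psi x A)"
  unfolding exp_upper_def
proof (intro allI impI)
  fix \<epsilon> :: real and j assume \<epsilon>: "0 < \<epsilon>"
  have b0: "0 < b" using b A by (smt (verit) divide_pos_pos)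
  \<comment> \<open>The factors independent of \<open>N\<close>; multiplied by the number of steps
    they are absorbed by \<open>\<epsilon>\<close>.\<close>
  define C where "C = A * A * exp (- psi x A) / (b' - b)"
  have C: "0 < C" using A b by (simp add: C_def)
  have "(\<lambda>N. C * real N * exp (- real N * \<epsilon>)) \<longlonglongrightarrow> 0" using \<epsilon> by real_asymp
  then have "\<forall>\<^sub>F N in sequentially. C * real N * exp (- real N * \<epsilon>) < 1" by (rule order_tendstoD(2)) simp
  with eventually_ge_at_top[of 2]
  show "\<forall>\<^sub>F N in sequentially. dead N x (N - j) c \<le> ennreal (exp (- real N * (psi x b' - psi x A - \<epsilon>)))"
  proof eventually_elim
    case (elim N)
    have N0: "0 < N" using elim by simp
    note [measurable] = measurable_exit_prob[OF N0]
    let ?K = "exp (real N * psi x A) * exp (- psi x A)"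
    define r where "r = exit_prob N x A (N - j) b"
    define m where "m = exp (real N * psi x b') / A"
    have m: "0 < m" using A by (simp add: m_def)
    have r1: "r \<le> 1" unfolding r_def by (rule exit_prob_le_1[OF N0])
    have "ennreal (m * (b' - b)) * r = (\<integral>\<^sup>+c. ennreal m * r * indicator {b..b'} c \<partial>lborel)"
      using b m by (subst nn_integral_cmult_indicator) (auto simp: ennreal_mult mult_ac)
    also have "\<dots> \<le> (\<integral>\<^sup>+c. indicator {0<..<A} c * (weight N x c * exit_prob N x A (N - j) c) \<partial>lborel)"
    proof (rule nn_integral_mono)
      fix c
      show "ennreal m * r * indicator {b..b'} c \<le> indicator {0<..<A} c * (weight N x c * exit_prob N x A (N - j) c)"
      proof (cases "c \<in> {b..b'}")
        case True
        then have c: "0 < c" "c < A" "b \<le> c" "c \<le> b'" using b b0 by auto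
        have "m \<le> exp (real N * psi x c) / c"
        proof -
          have "psi x b' \<le> psi x c" using A b c by (intro psi_antimono[OF _ x]) auto
          then have "exp (real N * psi x b') \<le> exp (real N * psi x c)" by (simp add: mult_left_mono)
          then show ?thesis unfolding m_def using c A by (intro frac_le) auto
        qed
        also have "exp (real N * psi x c) / c = c ^ (N - 1) * exp (real N * (c\<^sup>2 / 2 - x * c))"
        proof -
          have "c ^ (N - 1) = exp (real N * ln c) / c"
            by (rule power_pred_eq_exp[OF N0 c(1)])
          then show ?thesis by (simp add: psi_def exp_add[symmetric] algebra_simps)
        qed
        finally have "ennreal m \<le> weight N x c" unfolding weight_def by (rule ennreal_leI)
        moreover have "r \<le> exit_prob N x A (N - j) c" unfolding r_def by (intro exit_prob_mono N0 c)
        ultimately have "ennreal m * r \<le> weight N x c * exit_prob N x A (N - j) c" by (rule mult_mono) auto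
        then show ?thesis using True c by simp
      qed simp
    qed
    also have "\<dots> \<le> of_nat (N - j) * ennreal (A * ?K)" by (rule exit_prob_integral[OF elim(1) A x])
    also have "\<dots> \<le> ennreal (real N) * ennreal (A * ?K)"
      by (intro mult_right_mono) (auto simp: ennreal_of_nat_eq_real_of_nat intro!: ennreal_leI)
    finally have le: "ennreal (m * (b' - b)) * r \<le> ennreal (real N * (A * ?K))"
      using A by (simp add: ennreal_mult)
    obtain r' where r': "r = ennreal r'" "0 \<le> r'" using r1 by (cases r) (auto simp: top_unique)
    have "m * (b' - b) * r' \<le> real N * (A * ?K)"
      using le m b A r' by (simp add: ennreal_mult[symmetric] ennreal_le_iff)
    then have "r' \<le> real N * (A * ?K) / (m * (b' - b))"
      using m b by (subst pos_le_divide_eq) (auto simp: mult_ac)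
    also have "\<dots> = C * real N * (exp (real N * psi x A) / exp (real N * psi x b'))"
      using A b by (simp add: C_def m_def field_simps)
    also have "exp (real N * psi x A) / exp (real N * psi x b') = exp (- real N * \<epsilon>) * exp (- real N * (psi x b' - psi x A - \<epsilon>))"
      by (simp add: exp_diff[symmetric] exp_add[symmetric] algebra_simps)
    also have "C * real N * (exp (- real N * \<epsilon>) * exp (- real N * (psi x b' - psi x A - \<epsilon>)))
      \<le> 1 * exp (- real N * (psi x b' - psi x A - \<epsilon>))"
      unfolding mult.assoc[symmetric] using elim by (intro mult_right_mono) auto
    finally have "r \<le> ennreal (exp (- real N * (psi x b' - psi x A - \<epsilon>)))"
      using r' by (simp add: ennreal_leI)
    moreover have "dead N x (N - j) c \<le> dead N x (N - j) b" by (intro dead_mono N0 c)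
    moreover have "dead N x (N - j) b \<le> r" unfolding r_def by (intro dead_le_exit_prob N0) simp
    ultimately show ?case by (meson order_trans)
  qed
qed

lemma dead_upper:
  assumes A: "1 < A" and x: "x = A + 1 / A" and c: "c < A"
  shows "exp_upper (\<lambda>N. dead N x) c (psi x (max c (1 / A)) - psi x A)"
proof (rule exp_upper_closed)
  fix \<eta> :: real assume \<eta>: "0 < \<eta>"
  have iA: "0 < 1 / A" "1 / A < A" using A by (auto intro: less_trans[of "1 / A" 1])
  \<comment> \<open>For \<open>c\<close> below \<open>1 / A\<close> monotonicity transfers the bound
    from \<open>1 / A\<close>, in agreement with \<open>dead_lower_low\<close>.\<close>
  define b where "b = max c (1 / A)"
  have b: "1 / A \<le> b" "b < A" "c \<le> b" using iA c by (auto simp: b_def)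
  then have "0 < b" using iA by linarith
  note b = b this
  have "isCont (psi x) b" unfolding psi_def using b by (intro continuous_intros) auto
  then have "(psi x \<longlongrightarrow> psi x b) (at b)" by (simp add: isCont_def)
  then have "\<forall>\<^sub>F t in at b. psi x b - \<eta> < psi x t" using \<eta> by (intro order_tendstoD) auto
  then obtain d where d: "0 < d" "\<And>t. t \<noteq> b \<Longrightarrow> dist t b < d \<Longrightarrow> psi x b - \<eta> < psi x t"
    unfolding eventually_at by auto
  define b' where "b' = b + min (d / 2) ((A - b) / 2)"
  have b': "b < b'" "b' < A" "dist b' b < d"
    using d b by (auto simp: b'_def dist_real_def min_def field_simps)
  have "exp_upper (\<lambda>N. dead N x) c (psi x b' - psi x A)"
    by (rule exp_upper_dead_between[OF A x b(1) b'(1,2) b(3)])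
  then show "exp_upper (\<lambda>N. dead N x) c (psi x (max c (1 / A)) - psi x A - \<eta>)"
    using d(2)[of b'] b' unfolding b_def by (elim exp_upper_weaken) auto
qed

section \<open>Gaussian vectors\<close>

definition std_normal :: "real measure" where
  "std_normal = density lborel (\<lambda>x. ennreal (normal_density 0 1 x))"

definition std_gauss :: "'i set \<Rightarrow> ('i \<Rightarrow> real) measure" where
  "std_gauss I = Pi\<^sub>M I (\<lambda>_. std_normal)"

lemma sets_std_normal [measurable_cong, simp]: "sets std_normal = sets borel"
  by (simp add: std_normal_def)

lemma space_std_normal [simp]: "space std_normal = UNIV"
  by (simp add: std_normal_def)

lemma prob_space_std_normal: "prob_space std_normal"
  unfolding std_normal_def by (rule prob_space_normal_density) simp

lemma sets_std_gauss [measurable_cong, simp]: "sets (std_gauss I) = sets (Pi\<^sub>M I (\<lambda>_. borel))"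
  unfolding std_gauss_def by (intro sets_PiM_cong) auto

lemma space_std_gauss [simp]: "space (std_gauss I) = (\<Pi>\<^sub>E i\<in>I. UNIV)"
  by (simp add: std_gauss_def space_PiM)

lemma prob_space_std_gauss: "prob_space (std_gauss I)"
  unfolding std_gauss_def by (intro prob_space_PiM prob_space_std_normal)

text \<open>A half-line indicator convolved with a normal law. The edge is shifted by
  \<open>1 / Suc n\<close>, much more than the standard deviation
  \<open>1 / (Suc n)\<^sup>2\<close>, so that the limit is right also at
  \<open>t = b\<close>.\<close>

definition smooth_step :: "nat \<Rightarrow> real \<Rightarrow> real \<Rightarrow> ennreal" where
  "smooth_step n b t = (\<integral>\<^sup>+y. indicator {..b + 1 / real (Suc n)} y * ennreal (normal_density 0 (1 / (real (Suc n))\<^sup>2) (t - y)) \<partial>lborel)"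

lemma smooth_step_eq:
  "smooth_step n b t = (\<integral>\<^sup>+\<xi>. indicator {..b + 1 / real (Suc n)} (t - \<xi> / (real (Suc n))\<^sup>2) * ennreal (normal_density 0 1 \<xi>) \<partial>lborel)"
proof -
  define \<sigma> where "\<sigma> = 1 / (real (Suc n))\<^sup>2"
  have \<sigma>: "0 < \<sigma>" by (simp add: \<sigma>_def)
  have nd: "\<sigma> * normal_density 0 \<sigma> (\<sigma> * \<xi>) = normal_density 0 1 \<xi>" for \<xi>
    using \<sigma> by (simp add: normal_density_def real_sqrt_mult power_mult_distrib)
  have "smooth_step n b t = ennreal \<sigma> * (\<integral>\<^sup>+\<xi>. indicator {..b + 1 / real (Suc n)} (t - \<sigma> * \<xi>) * ennreal (normal_density 0 \<sigma> (\<sigma> * \<xi>)) \<partial>lborel)"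
    unfolding smooth_step_def \<sigma>_def[symmetric] using \<sigma>
    by (subst nn_integral_real_affine[where c = "- \<sigma>" and t = t]) auto
  also have "\<dots> = (\<integral>\<^sup>+\<xi>. indicator {..b + 1 / real (Suc n)} (t - \<sigma> * \<xi>) * ennreal (normal_density 0 1 \<xi>) \<partial>lborel)"
    using \<sigma> unfolding nd[symmetric]
    by (subst nn_integral_cmult[symmetric]) (auto simp: ennreal_mult mult_ac)
  finally show ?thesis by (simp add: \<sigma>_def)
qed

lemma nn_integral_std_normal: "(\<integral>\<^sup>+\<xi>. ennreal (normal_density 0 1 \<xi>) \<partial>lborel) = 1"
  using prob_space.emeasure_space_1[OF prob_space_std_normal] by (simp add: std_normal_def emeasure_density)

lemma smooth_step_le_1: "smooth_step n b t \<le> 1"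
proof -
  have "smooth_step n b t \<le> (\<integral>\<^sup>+\<xi>. ennreal (normal_density 0 1 \<xi>) \<partial>lborel)"
    unfolding smooth_step_eq by (intro nn_integral_mono) (auto simp: indicator_def)
  then show ?thesis by (simp add: nn_integral_std_normal)
qed

lemma measurable_smooth_step [measurable]: "smooth_step n b \<in> borel_measurable borel"
proof -
  have "(\<lambda>t. \<integral>\<^sup>+y. indicator {..b + 1 / real (Suc n)} y * ennreal (normal_density 0 (1 / (real (Suc n))\<^sup>2) (t - y)) \<partial>lborel) \<in> borel_measurable borel"
    by measurable
  then show ?thesis unfolding smooth_step_def[abs_def] .
qed

lemma smooth_step_tendsto: "(\<lambda>n. smooth_step n b t) \<longlonglongrightarrow> indicator {..b} t"
proof -
  have "(\<lambda>n. \<integral>\<^sup>+\<xi>. indicator {..b + 1 / real (Suc n)} (t - \<xi> / (real (Suc n))\<^sup>2) * ennreal (normal_density 0 1 \<xi>) \<partial>lborel)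
    \<longlonglongrightarrow> (\<integral>\<^sup>+\<xi>. indicator {..b} t * ennreal (normal_density 0 1 \<xi>) \<partial>lborel)"
  proof (rule nn_integral_dominated_convergence[where w = "\<lambda>\<xi>. ennreal (normal_density 0 1 \<xi>)"])
    show "AE \<xi> in lborel. (\<lambda>n. indicator {..b + 1 / real (Suc n)} (t - \<xi> / (real (Suc n))\<^sup>2) * ennreal (normal_density 0 1 \<xi>))
      \<longlonglongrightarrow> indicator {..b} t * ennreal (normal_density 0 1 \<xi>)"
    proof (rule AE_I2)
      fix \<xi> :: real
      have "\<forall>\<^sub>F n in sequentially. (t - \<xi> / (real (Suc n))\<^sup>2 \<le> b + 1 / real (Suc n)) = (t \<le> b)"
      proof (cases "t \<le> b")
        case True
        obtain n0 where n0: "\<bar>\<xi>\<bar> \<le> real n0" using real_arch_simple by blast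
        show ?thesis
          using eventually_ge_at_top[of n0]
        proof eventually_elim
          case (elim n)
          have "- \<xi> \<le> real (Suc n)" using n0 elim by linarith
          then have "- \<xi> / (real (Suc n))\<^sup>2 \<le> real (Suc n) / (real (Suc n))\<^sup>2" by (intro divide_right_mono) auto
          then show ?case using True by (simp add: power2_eq_square)
        qed
      next
        case False
        have "(\<lambda>n. t - \<xi> / (real (Suc n))\<^sup>2 - (b + 1 / real (Suc n))) \<longlonglongrightarrow> t - b"
          by real_asymp
        then have "\<forall>\<^sub>F n in sequentially. 0 < t - \<xi> / (real (Suc n))\<^sup>2 - (b + 1 / real (Suc n))"
          using False by (intro order_tendstoD(1)) auto
        then show ?thesis by eventually_elim (use False in auto)
      qed
      then have "\<forall>\<^sub>F n in sequentially. indicator {..b + 1 / real (Suc n)} (t - \<xi> / (real (Suc n))\<^sup>2) * ennreal (normal_density 0 1 \<xi>)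
        = indicator {..b} t * ennreal (normal_density 0 1 \<xi>)"
        by eventually_elim (simp add: indicator_def)
      then show "(\<lambda>n. indicator {..b + 1 / real (Suc n)} (t - \<xi> / (real (Suc n))\<^sup>2) * ennreal (normal_density 0 1 \<xi>))
        \<longlonglongrightarrow> indicator {..b} t * ennreal (normal_density 0 1 \<xi>)"
        by (rule tendsto_eventually)
    qed
  qed (auto simp: indicator_def nn_integral_std_normal)
  then show ?thesis
    by (simp add: smooth_step_eq nn_integral_cmult nn_integral_std_normal)
qed

text \<open>A law on a finite product is determined by its convolutions with centred Gaussian products:
  integrating them over orthants and letting the variance tend to 0 recovers the distribution function.\<close>

lemma orthant_eq_lim_smooth:
  assumes I: "finite I" and Q: "prob_space Q" and [measurable_cong]: "sets Q = sets (Pi\<^sub>M I (\<lambda>_. borel))"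
  shows "(\<lambda>n. \<integral>\<^sup>+f. (\<Prod>i\<in>I. smooth_step n (b i) (f i)) \<partial>Q) \<longlonglongrightarrow> emeasure Q {f \<in> space Q. \<forall>i\<in>I. f i \<le> b i}"
proof -
  interpret prob_space Q by fact
  have "(\<lambda>n. \<integral>\<^sup>+f. (\<Prod>i\<in>I. smooth_step n (b i) (f i)) \<partial>Q) \<longlonglongrightarrow> (\<integral>\<^sup>+f. (\<Prod>i\<in>I. indicator {..b i} (f i)) \<partial>Q)"
  proof (rule nn_integral_dominated_convergence[where w = "\<lambda>_. 1"])
    show "AE f in Q. (\<lambda>n. \<Prod>i\<in>I. smooth_step n (b i) (f i)) \<longlonglongrightarrow> (\<Prod>i\<in>I. indicator {..b i} (f i))"
    proof (rule AE_I2)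
      fix f
      have "((\<lambda>n. \<Prod>i\<in>J. smooth_step n (b i) (f i)) \<longlongrightarrow> (\<Prod>i\<in>J. indicator {..b i} (f i))) sequentially" if "finite J" for J
        using that
      proof (induction J)
        case (insert j J)
        have "(\<Prod>i\<in>J. indicator {..b i} (f i)) \<noteq> (\<top>::ennreal)"
          using insert.hyps by (simp add: indicator_def ennreal_prod_eq_top)
        moreover have "indicator {..b j} (f j) \<noteq> (\<top>::ennreal)" by (simp add: indicator_def)
        ultimately show ?case using insert
          by (simp, intro tendsto_mult_ennreal smooth_step_tendsto) auto
      qed simp
      then show "(\<lambda>n. \<Prod>i\<in>I. smooth_step n (b i) (f i)) \<longlonglongrightarrow> (\<Prod>i\<in>I. indicator {..b i} (f i))" using I by blast
    qed
    show "AE f in Q. (\<Prod>i\<in>I. smooth_step n (b i) (f i)) \<le> 1" for n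
      using smooth_step_le_1 by (intro AE_I2 prod_le_1) auto
  qed (use I emeasure_space_1 in auto)
  also have "(\<integral>\<^sup>+f. (\<Prod>i\<in>I. indicator {..b i} (f i)) \<partial>Q) = (\<integral>\<^sup>+f. indicator {f \<in> space Q. \<forall>i\<in>I. f i \<le> b i} f \<partial>Q)"
    using I by (intro nn_integral_cong) (auto simp: indicator_def)
  also have "\<dots> = emeasure Q {f \<in> space Q. \<forall>i\<in>I. f i \<le> b i}"
    using I by (intro nn_integral_indicator) measurable
  finally show ?thesis .
qed

text \<open>Fubini isolates the law: \<open>Q\<close> enters only through its convolution with a
  Gaussian product, evaluated at \<open>y\<close>.\<close>

lemma integral_prod_smooth:
  fixes I :: "'i set" and Q :: "('i \<Rightarrow> real) measure"
  assumes I: "finite I" and Q: "prob_space Q" and [measurable_cong]: "sets Q = sets (Pi\<^sub>M I (\<lambda>_. borel))"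
  shows "(\<integral>\<^sup>+f. (\<Prod>i\<in>I. smooth_step n (b i) (f i)) \<partial>Q) =
    (\<integral>\<^sup>+y. (\<Prod>i\<in>I. indicator {..b i + 1 / real (Suc n)} (y i)) *
      (\<integral>\<^sup>+f. (\<Prod>i\<in>I. ennreal (normal_density 0 (1 / (real (Suc n))\<^sup>2) (f i - y i))) \<partial>Q) \<partial>Pi\<^sub>M I (\<lambda>_. lborel))"
proof -
  interpret Q: prob_space Q by fact
  interpret L: product_sigma_finite "\<lambda>_::'i. lborel :: real measure" by standard
  interpret P: pair_sigma_finite Q "Pi\<^sub>M I (\<lambda>_. lborel :: real measure)"
    by (intro pair_sigma_finite.intro L.sigma_finite I) unfold_locales
  let ?B = "\<lambda>i. {..b i + 1 / real (Suc n)}" and ?\<sigma> = "1 / (real (Suc n))\<^sup>2"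
  have [measurable_cong]: "sets (Pi\<^sub>M I (\<lambda>_. lborel :: real measure)) = sets (Pi\<^sub>M I (\<lambda>_. borel))"
    by (intro sets_PiM_cong) auto
  have "(\<integral>\<^sup>+f. (\<Prod>i\<in>I. smooth_step n (b i) (f i)) \<partial>Q)
    = (\<integral>\<^sup>+f. (\<integral>\<^sup>+y. (\<Prod>i\<in>I. indicator (?B i) (y i) * ennreal (normal_density 0 ?\<sigma> (f i - y i))) \<partial>Pi\<^sub>M I (\<lambda>_. lborel)) \<partial>Q)"
    unfolding smooth_step_def
    by (intro nn_integral_cong L.product_nn_integral_prod[symmetric] I) measurable
  also have "\<dots> = (\<integral>\<^sup>+y. (\<integral>\<^sup>+f. (\<Prod>i\<in>I. indicator (?B i) (y i) * ennreal (normal_density 0 ?\<sigma> (f i - y i))) \<partial>Q) \<partial>Pi\<^sub>M I (\<lambda>_. lborel))"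
    using I by (intro P.Fubini'[symmetric]) measurable
  also have "\<dots> = (\<integral>\<^sup>+y. (\<Prod>i\<in>I. indicator (?B i) (y i)) * (\<integral>\<^sup>+f. (\<Prod>i\<in>I. ennreal (normal_density 0 ?\<sigma> (f i - y i))) \<partial>Q) \<partial>Pi\<^sub>M I (\<lambda>_. lborel))"
    using I by (intro nn_integral_cong) (simp add: prod.distrib nn_integral_cmult)
  finally show ?thesis .
qed

lemma measure_eqI_smooth:
  fixes I :: "'i set" and P Q :: "('i \<Rightarrow> real) measure"
  assumes I: "finite I" and P: "prob_space P" "sets P = sets (Pi\<^sub>M I (\<lambda>_. borel))"
    and Q: "prob_space Q" "sets Q = sets (Pi\<^sub>M I (\<lambda>_. borel))"
    and eq: "\<And>\<sigma> y. 0 < \<sigma> \<Longrightarrow> y \<in> extensional I \<Longrightarrow>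
      (\<integral>\<^sup>+f. (\<Prod>i\<in>I. ennreal (normal_density 0 \<sigma> (f i - y i))) \<partial>P) = (\<integral>\<^sup>+f. (\<Prod>i\<in>I. ennreal (normal_density 0 \<sigma> (f i - y i))) \<partial>Q)"
  shows "P = Q"
proof -
  interpret P: prob_space P by fact
  interpret Q: prob_space Q by fact
  let ?\<Omega> = "\<Pi>\<^sub>E i\<in>I. (UNIV :: real set)"
  have spP: "space P = ?\<Omega>" and spQ: "space Q = ?\<Omega>"
    using P(2) Q(2) by (auto dest!: sets_eq_imp_space_eq simp: space_PiM)
  have orth: "emeasure P {f \<in> ?\<Omega>. \<forall>i\<in>I. f i \<le> b i} = emeasure Q {f \<in> ?\<Omega>. \<forall>i\<in>I. f i \<le> b i}" for b
  proof -
    have "(\<integral>\<^sup>+f. (\<Prod>i\<in>I. smooth_step n (b i) (f i)) \<partial>P) = (\<integral>\<^sup>+f. (\<Prod>i\<in>I. smooth_step n (b i) (f i)) \<partial>Q)" for n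
      unfolding integral_prod_smooth[OF I P] integral_prod_smooth[OF I Q]
      by (intro nn_integral_cong arg_cong2[where f = "(*)"] refl eq) (auto simp: space_PiM PiE_def)
    then show ?thesis
      using orthant_eq_lim_smooth[OF I P, of b] orthant_eq_lim_smooth[OF I Q, of b]
      unfolding spP spQ by (simp add: LIMSEQ_unique)
  qed
  \<comment> \<open>The shape that \<open>sets_PiM_sigma\<close> produces; the members are just the
    orthants of \<open>orth\<close>.\<close>
  define E where "E = {{f\<in>?\<Omega>. \<forall>i\<in>j. f i \<in> A i} | A j. j \<in> {I} \<and> A \<in> Pi j (\<lambda>_. range (\<lambda>a::real. {..a}))}"
  have E: "\<exists>b. X = {f \<in> ?\<Omega>. \<forall>i\<in>I. f i \<le> b i}" if "X \<in> E" for X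
  proof -
    obtain A where A: "X = {f\<in>?\<Omega>. \<forall>i\<in>I. f i \<in> A i}" "A \<in> Pi I (\<lambda>_. range (\<lambda>a::real. {..a}))"
      using \<open>X \<in> E\<close> unfolding E_def by auto
    then have "\<forall>i\<in>I. \<exists>b. A i = {..b}" by auto
    then obtain b where "\<forall>i\<in>I. A i = {..b i}" by metis
    then show ?thesis using A by auto
  qed
  have E': "{f \<in> ?\<Omega>. \<forall>i\<in>I. f i \<le> b i} \<in> E" for b
    unfolding E_def by (auto intro!: exI[of _ "\<lambda>i. {..b i}"])
  have "sets (Pi\<^sub>M I (\<lambda>_. sigma UNIV (range (\<lambda>a::real. {..a})))) = sets (sigma ?\<Omega> E)"
    unfolding E_def
  proof (rule sets_PiM_sigma)
    show "\<exists>S\<subseteq>range (\<lambda>a::real. {..a}). countable S \<and> UNIV = \<Union>S"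
      by (intro exI[of _ "range (\<lambda>n::nat. {..real n})"]) (auto intro: real_arch_simple)
  qed (use I in auto)
  moreover have "sets (sigma ?\<Omega> E) = sigma_sets ?\<Omega> E"
    by (intro sets_measure_of) (auto simp: E_def)
  ultimately have setsE: "sets (Pi\<^sub>M I (\<lambda>_. borel :: real measure)) = sigma_sets ?\<Omega> E"
    by (simp only: borel_eq_atMost)
  show ?thesis
  proof (rule measure_eqI_generator_eq[where \<Omega> = ?\<Omega> and E = E and A = "\<lambda>n. {f \<in> ?\<Omega>. \<forall>i\<in>I. f i \<le> real n}"])
    show "Int_stable E"
    proof (rule Int_stableI)
      fix X Y assume "X \<in> E" "Y \<in> E"
      then obtain b b' where "X = {f \<in> ?\<Omega>. \<forall>i\<in>I. f i \<le> b i}" "Y = {f \<in> ?\<Omega>. \<forall>i\<in>I. f i \<le> b' i}"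
        using E by meson
      then have "X \<inter> Y = {f \<in> ?\<Omega>. \<forall>i\<in>I. f i \<le> min (b i) (b' i)}" by auto
      then show "X \<inter> Y \<in> E" using E'[of "\<lambda>i. min (b i) (b' i)"] by (simp only:)
    qed
    show "E \<subseteq> Pow ?\<Omega>" by (auto simp: E_def)
    show "emeasure P X = emeasure Q X" if "X \<in> E" for X using E[OF that] orth by auto
    show "sets P = sigma_sets ?\<Omega> E" "sets Q = sigma_sets ?\<Omega> E" using P Q setsE by auto
    show "range (\<lambda>n. {f \<in> ?\<Omega>. \<forall>i\<in>I. f i \<le> real n}) \<subseteq> E" using E' by auto
    show "(\<Union>n. {f \<in> ?\<Omega>. \<forall>i\<in>I. f i \<le> real n}) = ?\<Omega>"
    proof (intro equalityI subsetI)
      fix f assume f: "f \<in> ?\<Omega>"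
      obtain n where "(\<Sum>i\<in>I. \<bar>f i\<bar>) \<le> real n" using real_arch_simple by blast
      moreover have "f i \<le> (\<Sum>i\<in>I. \<bar>f i\<bar>)" if "i \<in> I" for i
        using member_le_sum[of i I "\<lambda>i. \<bar>f i\<bar>"] that I by auto
      ultimately have "\<forall>i\<in>I. f i \<le> real n" by (meson order_trans)
      then show "f \<in> (\<Union>n. {f \<in> ?\<Omega>. \<forall>i\<in>I. f i \<le> real n})" using f by auto
    qed auto
    show "emeasure P {f \<in> ?\<Omega>. \<forall>i\<in>I. f i \<le> real n} \<noteq> \<infinity>" for n by simp
  qed
qed

section \<open>Invariance of the Gaussian product under isometries\<close>

lemma std_gauss_smooth:
  assumes I: "finite I" and \<sigma>: "0 < \<sigma>"
  shows "(\<integral>\<^sup>+f. (\<Prod>i\<in>I. ennreal (normal_density 0 \<sigma> (f i - y i))) \<partial>std_gauss I) = (\<Prod>i\<in>I. ennreal (normal_density 0 (sqrt (\<sigma>\<^sup>2 + 1)) (y i)))"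
proof -
  interpret S: prob_space std_normal by (rule prob_space_std_normal)
  interpret product_sigma_finite "\<lambda>_. std_normal" by standard
  have "(\<integral>\<^sup>+t. ennreal (normal_density 0 \<sigma> (t - u)) \<partial>std_normal) = ennreal (normal_density 0 (sqrt (\<sigma>\<^sup>2 + 1)) u)" for u
  proof -
    have "(\<integral>\<^sup>+t. ennreal (normal_density 0 \<sigma> (t - u)) \<partial>std_normal) = (\<integral>\<^sup>+t. ennreal (normal_density 0 \<sigma> (u - t) * normal_density 0 1 t) \<partial>lborel)"
    proof -
      have "normal_density 0 \<sigma> (t - u) = normal_density 0 \<sigma> (u - t)" for t
        by (simp add: normal_density_def power2_commute)
      then show ?thesis
        unfolding std_normal_def by (subst nn_integral_density) (auto simp: ennreal_mult mult.commute)
    qed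
    also have "\<dots> = ennreal (normal_density 0 (sqrt (\<sigma>\<^sup>2 + 1)) u)"
      using conv_normal_density_zero_mean[OF \<sigma>, of 1] by (simp add: fun_eq_iff)
    finally show ?thesis .
  qed
  then show ?thesis
    unfolding std_gauss_def by (subst product_nn_integral_prod[OF I]) auto
qed

lemma prod_normal_density:
  assumes "finite I"
  shows "(\<Prod>i\<in>I. ennreal (normal_density 0 \<sigma> (v i))) = ennreal ((1 / sqrt (2 * pi * \<sigma>\<^sup>2)) ^ card I * exp (- (\<Sum>i\<in>I. (v i)\<^sup>2) / (2 * \<sigma>\<^sup>2)))"
proof -
  have "(\<Prod>i\<in>I. ennreal (normal_density 0 \<sigma> (v i))) = ennreal (\<Prod>i\<in>I. normal_density 0 \<sigma> (v i))"
    by (intro prod_ennreal) simp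
  also have "(\<Prod>i\<in>I. normal_density 0 \<sigma> (v i)) = (1 / sqrt (2 * pi * \<sigma>\<^sup>2)) ^ card I * exp (\<Sum>i\<in>I. - (v i)\<^sup>2 / (2 * \<sigma>\<^sup>2))"
    using assms by (simp add: normal_density_def prod_dividef exp_sum power_one_over)
  also have "(\<Sum>i\<in>I. - (v i)\<^sup>2 / (2 * \<sigma>\<^sup>2)) = - (\<Sum>i\<in>I. (v i)\<^sup>2) / (2 * \<sigma>\<^sup>2)"
    by (simp add: sum_divide_distrib sum_negf)
  finally show ?thesis .
qed

text \<open>A product of centred normal densities depends only on a Euclidean distance. So smoothing
  the law of \<open>R\<close> at \<open>y\<close> means smoothing the standard law at
  \<open>R' y\<close>, and the smoothed standard law depends on the norm alone. \<open>R'\<close>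
  acts as the inverse of \<open>R\<close>.\<close>

lemma std_gauss_isometry_invariant:
  fixes R R' :: "('i \<Rightarrow> real) \<Rightarrow> ('i \<Rightarrow> real)"
  assumes I: "finite I" and R[measurable]: "R \<in> Pi\<^sub>M I (\<lambda>_. borel) \<rightarrow>\<^sub>M Pi\<^sub>M I (\<lambda>_. borel)"
    and iso: "\<And>z y. z \<in> extensional I \<Longrightarrow> y \<in> extensional I \<Longrightarrow> (\<Sum>i\<in>I. (R z i - y i)\<^sup>2) = (\<Sum>i\<in>I. (z i - R' y i)\<^sup>2)"
    and norm: "\<And>y. y \<in> extensional I \<Longrightarrow> (\<Sum>i\<in>I. (R' y i)\<^sup>2) = (\<Sum>i\<in>I. (y i)\<^sup>2)"
  shows "distr (std_gauss I) (Pi\<^sub>M I (\<lambda>_. borel)) R = std_gauss I"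
proof (rule measure_eqI_smooth[OF I])
  interpret prob_space "std_gauss I" by (rule prob_space_std_gauss)
  show "prob_space (distr (std_gauss I) (Pi\<^sub>M I (\<lambda>_. borel)) R)" by (intro prob_space_distr) measurable
  show "prob_space (std_gauss I)" by (rule prob_space_std_gauss)
  fix \<sigma> :: real and y :: "'i \<Rightarrow> real" assume \<sigma>: "0 < \<sigma>" and y: "y \<in> extensional I"
  have "(\<integral>\<^sup>+f. (\<Prod>i\<in>I. ennreal (normal_density 0 \<sigma> (f i - y i))) \<partial>distr (std_gauss I) (Pi\<^sub>M I (\<lambda>_. borel)) R)
      = (\<integral>\<^sup>+z. (\<Prod>i\<in>I. ennreal (normal_density 0 \<sigma> (R z i - y i))) \<partial>std_gauss I)"
    using I by (subst nn_integral_distr) auto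
  also have "\<dots> = (\<integral>\<^sup>+z. (\<Prod>i\<in>I. ennreal (normal_density 0 \<sigma> (z i - R' y i))) \<partial>std_gauss I)"
    using iso y by (intro nn_integral_cong) (auto simp: prod_normal_density[OF I] PiE_def)
  also have "\<dots> = (\<integral>\<^sup>+f. (\<Prod>i\<in>I. ennreal (normal_density 0 \<sigma> (f i - y i))) \<partial>std_gauss I)"
    unfolding std_gauss_smooth[OF I \<sigma>] prod_normal_density[OF I, of "sqrt (\<sigma>\<^sup>2 + 1)"] by (simp add: norm[OF y])
  finally show "(\<integral>\<^sup>+f. (\<Prod>i\<in>I. ennreal (normal_density 0 \<sigma> (f i - y i))) \<partial>distr (std_gauss I) (Pi\<^sub>M I (\<lambda>_. borel)) R)
      = (\<integral>\<^sup>+f. (\<Prod>i\<in>I. ennreal (normal_density 0 \<sigma> (f i - y i))) \<partial>std_gauss I)" .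
qed simp_all

section \<open>Coordinates of a Gaussian vector and the law of a row\<close>

lemma std_gauss_component:
  assumes "j \<in> J"
  shows "distr (std_gauss J) borel (\<lambda>y. y j) = std_normal"
proof -
  have "distr (Pi\<^sub>M J (\<lambda>_. std_normal)) std_normal (\<lambda>\<omega>. \<omega> j) = std_normal"
    using assms by (intro distr_PiM_component prob_space_std_normal)
  moreover have "distr (std_gauss J) borel (\<lambda>y. y j) = distr (Pi\<^sub>M J (\<lambda>_. std_normal)) std_normal (\<lambda>\<omega>. \<omega> j)"
    unfolding std_gauss_def by (intro distr_cong) auto
  ultimately show ?thesis by simp
qed

lemma std_gauss_indep_vars:
  shows "prob_space.indep_vars (std_gauss J) (\<lambda>_. borel) (\<lambda>j y. y j) J"
proof (cases "J = {}")
  case True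
  interpret prob_space "std_gauss J" by (rule prob_space_std_gauss)
  show ?thesis unfolding indep_vars_def indep_sets_def using True by auto
next
  case False
  interpret prob_space "std_gauss J" by (rule prob_space_std_gauss)
  have "distr (std_gauss J) (Pi\<^sub>M J (\<lambda>_. borel)) (\<lambda>y. \<lambda>j\<in>J. y j) = distr (std_gauss J) (std_gauss J) (\<lambda>y. y)"
    by (intro distr_cong) (auto simp: PiE_def extensional_restrict restrict_def fun_eq_iff extensional_def)
  also have "\<dots> = std_gauss J" by (rule distr_id)
  also have "\<dots> = Pi\<^sub>M J (\<lambda>j. distr (std_gauss J) borel (\<lambda>y. y j))"
    unfolding std_gauss_def by (intro PiM_cong refl) (simp add: std_gauss_component[unfolded std_gauss_def])
  finally show ?thesis using False
    by (subst indep_vars_iff_distr_eq_PiM') auto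
qed

lemma std_gauss_pair:
  assumes J: "finite J" "p \<in> J" "q \<in> J" "p \<noteq> q"
    and F[measurable]: "F \<in> borel_measurable (borel \<Otimes>\<^sub>M borel)"
  shows "(\<integral>\<^sup>+y. F (y p, y q) \<partial>std_gauss J) = (\<integral>\<^sup>+u. (\<integral>\<^sup>+v. F (u, v) \<partial>std_normal) \<partial>std_normal)"
proof -
  interpret S: prob_space std_normal by (rule prob_space_std_normal)
  interpret product_prob_space "\<lambda>_. std_normal" J by standard
  have "(\<integral>\<^sup>+y. F (y p, y q) \<partial>std_gauss J) = (\<integral>\<^sup>+y. F (restrict y {p, q} p, restrict y {p, q} q) \<partial>Pi\<^sub>M J (\<lambda>_. std_normal))"
    by (simp add: std_gauss_def)
  also have "\<dots> = (\<integral>\<^sup>+y. F (y p, y q) \<partial>distr (Pi\<^sub>M J (\<lambda>_. std_normal)) (Pi\<^sub>M {p, q} (\<lambda>_. std_normal)) (\<lambda>y. restrict y {p, q}))"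
    using J by (subst nn_integral_distr) (auto intro!: measurable_restrict_subset)
  also have "distr (Pi\<^sub>M J (\<lambda>_. std_normal)) (Pi\<^sub>M {p, q} (\<lambda>_. std_normal)) (\<lambda>y. restrict y {p, q}) = Pi\<^sub>M {p, q} (\<lambda>_. std_normal)"
    using J by (intro distr_restrict[symmetric]) auto
  also have "(\<integral>\<^sup>+y. F (y p, y q) \<partial>Pi\<^sub>M {p, q} (\<lambda>_. std_normal)) = (\<integral>\<^sup>+u. (\<integral>\<^sup>+v. F (u, v) \<partial>std_normal) \<partial>std_normal)"
  proof -
    have "(\<integral>\<^sup>+y. F (y p, y q) \<partial>Pi\<^sub>M (insert p {q}) (\<lambda>_. std_normal))
        = (\<integral>\<^sup>+u. (\<integral>\<^sup>+v. F (u, v) \<partial>std_normal) \<partial>std_normal)"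
      using J(4)
      by (subst product_nn_integral_insert_rev) (auto simp: product_nn_integral_singleton[where f = "\<lambda>v. F (_, v)"])
    then show ?thesis by simp
  qed
  finally show ?thesis .
qed

text \<open>The radial part of the integral in \<open>std_normal_pair_tail\<close>, along a line of
  fixed ratio \<open>s = v / u\<close>; \<open>q\<close> stands for
  \<open>1 + s\<^sup>2\<close>.\<close>

lemma radial_integral:
  assumes q: "0 < q" and r: "0 \<le> r"
  shows "(\<integral>\<^sup>+u. ennreal (\<bar>u\<bar> * exp (- u\<^sup>2 * q / 2)) * indicator {u. 2 * r < u\<^sup>2 * q} u \<partial>lborel) = ennreal (2 * exp (- r) / q)"
proof -
  define a where "a = sqrt (2 * r / q)"
  have a: "0 \<le> a" "a\<^sup>2 * q = 2 * r" using q r by (auto simp: a_def)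
  define h where "h u = ennreal (\<bar>u\<bar> * exp (- u\<^sup>2 * q / 2)) * indicator {u. 2 * r < u\<^sup>2 * q} u" for u
  have [measurable]: "h \<in> borel_measurable borel" unfolding h_def by measurable
  have iff: "2 * r < u\<^sup>2 * q \<longleftrightarrow> a < u" if "0 \<le> u" for u
  proof -
    have "2 * r < u\<^sup>2 * q \<longleftrightarrow> a\<^sup>2 < u\<^sup>2" unfolding a(2)[symmetric] using q by simp
    also have "\<dots> \<longleftrightarrow> a < u" using a that by (auto intro: power2_less_imp_less power_strict_mono)
    finally show ?thesis .
  qed
  have half: "(\<integral>\<^sup>+u. h u * indicator {0<..} u \<partial>lborel) = ennreal (exp (- r) / q)"
  proof -
    have "(\<integral>\<^sup>+u. h u * indicator {0<..} u \<partial>lborel) = (\<integral>\<^sup>+u. ennreal (u * exp (- u\<^sup>2 * q / 2)) * indicator {a..} u \<partial>lborel)"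
    proof (rule nn_integral_cong_AE)
      have "AE u in lborel. u \<noteq> a" by (rule AE_lborel_singleton)
      then show "AE u in lborel. h u * indicator {0<..} u = ennreal (u * exp (- u\<^sup>2 * q / 2)) * indicator {a..} u"
      proof eventually_elim
        case (elim u)
        show ?case
        proof (cases "0 < u")
          case True
          then show ?thesis using iff[of u] elim by (auto simp: h_def indicator_def)
        next
          case False
          then show ?thesis using a by (cases "u = 0") (auto simp: indicator_def)
        qed
      qed
    qed
    also have "\<dots> = ennreal (0 - (- exp (- a\<^sup>2 * q / 2) / q))"
    proof (rule nn_integral_FTC_atLeast)
      show "((\<lambda>u. - exp (- u\<^sup>2 * q / 2) / q) has_real_derivative u * exp (- u\<^sup>2 * q / 2)) (at u)" for u
        using q by (auto intro!: derivative_eq_intros simp: field_simps power2_eq_square)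
      show "((\<lambda>u. - exp (- u\<^sup>2 * q / 2) / q) \<longlongrightarrow> 0) at_top"
        using q by real_asymp
    qed (use a in auto)
    also have "- a\<^sup>2 * q / 2 = - r" using a(2) by simp
    finally show ?thesis by simp
  qed
  have "(\<integral>\<^sup>+u. h u \<partial>lborel) = (\<integral>\<^sup>+u. h u * indicator {0<..} u + h u * indicator {..<0} u \<partial>lborel)"
    by (intro nn_integral_cong) (auto simp: h_def indicator_def)
  also have "\<dots> = (\<integral>\<^sup>+u. h u * indicator {0<..} u \<partial>lborel) + (\<integral>\<^sup>+u. h u * indicator {..<0} u \<partial>lborel)"
    by (rule nn_integral_add) measurable
  also have "(\<integral>\<^sup>+u. h u * indicator {..<0} u \<partial>lborel) = (\<integral>\<^sup>+u. h u * indicator {0<..} u \<partial>lborel)"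
    by (subst nn_integral_real_affine[where c = "-1" and t = 0]) (auto simp: h_def indicator_def intro!: nn_integral_cong)
  finally show ?thesis using half q by (simp add: h_def ennreal_plus[symmetric] del: ennreal_plus)
qed

text \<open>The ratio \<open>s = v / u\<close> takes the place of the polar angle. The integral
  factors into \<open>exp (- r)\<close> and the mass \<open>C\<close> of the Cauchy density, which
  is found to be 1 by comparison at \<open>r = 0\<close>, where the event is almost sure.\<close>

lemma std_normal_pair_tail:
  assumes r: "0 \<le> r"
  shows "(\<integral>\<^sup>+u. (\<integral>\<^sup>+v. indicator {2 * r<..} (u\<^sup>2 + v\<^sup>2) \<partial>std_normal) \<partial>std_normal) = ennreal (exp (- r))"
proof -
  define C where "C = (\<integral>\<^sup>+s. ennreal (1 / (pi * (1 + s\<^sup>2))) \<partial>lborel)"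
  have main: "(\<integral>\<^sup>+u. (\<integral>\<^sup>+v. indicator {2 * r<..} (u\<^sup>2 + v\<^sup>2) \<partial>std_normal) \<partial>std_normal) = ennreal (exp (- r)) * C"
    if r: "0 \<le> r" for r
  proof -
    have "(\<integral>\<^sup>+u. (\<integral>\<^sup>+v. indicator {2 * r<..} (u\<^sup>2 + v\<^sup>2) \<partial>std_normal) \<partial>std_normal)
      = (\<integral>\<^sup>+u. (\<integral>\<^sup>+v. ennreal (normal_density 0 1 u) * (ennreal (normal_density 0 1 v) * indicator {2 * r<..} (u\<^sup>2 + v\<^sup>2)) \<partial>lborel) \<partial>lborel)"
      unfolding std_normal_def by (simp add: nn_integral_density nn_integral_cmult)
    also have "\<dots> = (\<integral>\<^sup>+u. (\<integral>\<^sup>+s. ennreal (1 / (2 * pi)) * (ennreal (\<bar>u\<bar> * exp (- u\<^sup>2 * (1 + s\<^sup>2) / 2)) * indicator {u. 2 * r < u\<^sup>2 * (1 + s\<^sup>2)} u) \<partial>lborel) \<partial>lborel)"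
    proof (rule nn_integral_cong_AE)
      have "AE u in lborel. u \<noteq> (0::real)" by (rule AE_lborel_singleton)
      then show "AE u in lborel. (\<integral>\<^sup>+v. ennreal (normal_density 0 1 u) * (ennreal (normal_density 0 1 v) * indicator {2 * r<..} (u\<^sup>2 + v\<^sup>2)) \<partial>lborel)
        = (\<integral>\<^sup>+s. ennreal (1 / (2 * pi)) * (ennreal (\<bar>u\<bar> * exp (- u\<^sup>2 * (1 + s\<^sup>2) / 2)) * indicator {u. 2 * r < u\<^sup>2 * (1 + s\<^sup>2)} u) \<partial>lborel)"
      proof eventually_elim
        case (elim u)
        have "(\<integral>\<^sup>+v. ennreal (normal_density 0 1 u) * (ennreal (normal_density 0 1 v) * indicator {2 * r<..} (u\<^sup>2 + v\<^sup>2)) \<partial>lborel)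
          = ennreal \<bar>u\<bar> * (\<integral>\<^sup>+s. ennreal (normal_density 0 1 u) * (ennreal (normal_density 0 1 (u * s)) * indicator {2 * r<..} (u\<^sup>2 + (u * s)\<^sup>2)) \<partial>lborel)"
          using elim by (subst nn_integral_real_affine[where c = u and t = 0]) auto
        also have "\<dots> = (\<integral>\<^sup>+s. ennreal \<bar>u\<bar> * (ennreal (normal_density 0 1 u) * (ennreal (normal_density 0 1 (u * s)) * indicator {2 * r<..} (u\<^sup>2 + (u * s)\<^sup>2))) \<partial>lborel)"
          by (subst nn_integral_cmult) auto
        also have "\<dots> = (\<integral>\<^sup>+s. ennreal (1 / (2 * pi)) * (ennreal (\<bar>u\<bar> * exp (- u\<^sup>2 * (1 + s\<^sup>2) / 2)) * indicator {u. 2 * r < u\<^sup>2 * (1 + s\<^sup>2)} u) \<partial>lborel)"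
        proof (rule nn_integral_cong)
          fix s
          have "\<bar>u\<bar> * (normal_density 0 1 u * normal_density 0 1 (u * s)) = 1 / (2 * pi) * (\<bar>u\<bar> * exp (- u\<^sup>2 * (1 + s\<^sup>2) / 2))"
            by (simp add: normal_density_def exp_add[symmetric] field_simps power_mult_distrib)
          then have "ennreal \<bar>u\<bar> * (ennreal (normal_density 0 1 u) * ennreal (normal_density 0 1 (u * s))) = ennreal (1 / (2 * pi)) * ennreal (\<bar>u\<bar> * exp (- u\<^sup>2 * (1 + s\<^sup>2) / 2))"
            by (simp only: ennreal_mult[symmetric] normal_density_nonneg abs_ge_zero mult_nonneg_nonneg exp_ge_zero divide_nonneg_nonneg) (simp add: ennreal_mult[symmetric])
          moreover have "u\<^sup>2 + (u * s)\<^sup>2 = u\<^sup>2 * (1 + s\<^sup>2)" by (simp add: algebra_simps power_mult_distrib)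
          ultimately show "ennreal \<bar>u\<bar> * (ennreal (normal_density 0 1 u) * (ennreal (normal_density 0 1 (u * s)) * indicator {2 * r<..} (u\<^sup>2 + (u * s)\<^sup>2)))
            = ennreal (1 / (2 * pi)) * (ennreal (\<bar>u\<bar> * exp (- u\<^sup>2 * (1 + s\<^sup>2) / 2)) * indicator {u. 2 * r < u\<^sup>2 * (1 + s\<^sup>2)} u)"
            by (simp add: indicator_def)
        qed
        finally show ?case .
      qed
    qed
    also have "\<dots> = (\<integral>\<^sup>+s. (\<integral>\<^sup>+u. ennreal (1 / (2 * pi)) * (ennreal (\<bar>u\<bar> * exp (- u\<^sup>2 * (1 + s\<^sup>2) / 2)) * indicator {u. 2 * r < u\<^sup>2 * (1 + s\<^sup>2)} u) \<partial>lborel) \<partial>lborel)"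
      by (rule lborel_pair.Fubini'[symmetric]) measurable
    also have "\<dots> = (\<integral>\<^sup>+s. ennreal (exp (- r)) * ennreal (1 / (pi * (1 + s\<^sup>2))) \<partial>lborel)"
    proof (rule nn_integral_cong)
      fix s :: real
      have q: "0 < 1 + s\<^sup>2" by (simp add: add_pos_nonneg)
      have "(\<integral>\<^sup>+u. ennreal (1 / (2 * pi)) * (ennreal (\<bar>u\<bar> * exp (- u\<^sup>2 * (1 + s\<^sup>2) / 2)) * indicator {u. 2 * r < u\<^sup>2 * (1 + s\<^sup>2)} u) \<partial>lborel)
        = ennreal (1 / (2 * pi)) * ennreal (2 * exp (- r) / (1 + s\<^sup>2))"
        by (subst nn_integral_cmult, measurable, simp only: radial_integral[OF q r])
      also have "\<dots> = ennreal (exp (- r)) * ennreal (1 / (pi * (1 + s\<^sup>2)))"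
        using q by (simp add: ennreal_mult[symmetric])
      finally show "(\<integral>\<^sup>+u. ennreal (1 / (2 * pi)) * (ennreal (\<bar>u\<bar> * exp (- u\<^sup>2 * (1 + s\<^sup>2) / 2)) * indicator {u. 2 * r < u\<^sup>2 * (1 + s\<^sup>2)} u) \<partial>lborel)
        = ennreal (exp (- r)) * ennreal (1 / (pi * (1 + s\<^sup>2)))" .
    qed
    also have "\<dots> = ennreal (exp (- r)) * C" unfolding C_def by (rule nn_integral_cmult) measurable
    finally show ?thesis .
  qed
  interpret S: prob_space std_normal by (rule prob_space_std_normal)
  have "AE u in lborel. u \<noteq> (0::real)" by (rule AE_lborel_singleton)
  then have "AE u in std_normal. u \<noteq> 0" unfolding std_normal_def by (subst AE_density) auto
  then have "(\<integral>\<^sup>+u. (\<integral>\<^sup>+v. indicator {2 * 0<..} (u\<^sup>2 + v\<^sup>2) \<partial>std_normal) \<partial>std_normal) = (\<integral>\<^sup>+u. (\<integral>\<^sup>+v. 1 \<partial>std_normal) \<partial>std_normal)"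
    by (intro nn_integral_cong_AE, eventually_elim) (auto intro!: nn_integral_cong simp: indicator_def sum_power2_gt_zero_iff)
  then have "C = 1" using main[of 0] S.emeasure_space_1 by simp
  then show ?thesis using main[OF r] by simp
qed

text \<open>Half the sum of two squared standard normals is exponential, so every off-diagonal entry
  contributes an exponential variable of rate \<open>N\<close>. Entries use disjoint coordinates,
  whence the sum is a gamma variable independent of the diagonal entry.\<close>

lemma std_gauss_row_law:
  fixes k N :: nat
  defines "J \<equiv> insert (k, k) ((\<lambda>i. (i, k)) ` {..<k} \<union> (\<lambda>i. (k, i)) ` {..<k})"
  assumes N: "0 < N" and \<Phi>[measurable]: "\<Phi> \<in> borel_measurable (borel \<Otimes>\<^sub>M borel)"
  shows "(\<integral>\<^sup>+y. \<Phi> (y (k, k) / sqrt (real N), \<Sum>i<k. ((y (i, k))\<^sup>2 + (y (k, i))\<^sup>2) / (2 * real N)) \<partial>std_gauss J)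
    = (\<integral>\<^sup>+a. (\<integral>\<^sup>+g. \<Phi> (a, g) \<partial>gamma_law N k) \<partial>normal_law N)"
proof -
  interpret prob_space "std_gauss J" by (rule prob_space_std_gauss)
  interpret gk: prob_space "gamma_law N k" by (rule prob_space_gamma_law[OF N])
  have J: "finite J" "(k, k) \<in> J" "\<And>i. i < k \<Longrightarrow> (i, k) \<in> J" "\<And>i. i < k \<Longrightarrow> (k, i) \<in> J"
    by (auto simp: J_def)
  \<comment> \<open>The diagonal entry gets the index \<open>k\<close>, so that all variables form
    one independent family over \<open>{..k}\<close>.\<close>
  define Z where "Z i y = (if i < k then ((y (i, k))\<^sup>2 + (y (k, i))\<^sup>2) / (2 * real N) else y (k, k) / sqrt (real N))" for i and y :: "nat \<times> nat \<Rightarrow> real"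
  define K where "K i = {(i, k), (k, i)}" for i
  have KJ: "K i \<subseteq> J" if "i \<le> k" for i using that J by (cases "i = k") (auto simp: K_def)
  have Zm[measurable]: "Z i \<in> borel_measurable (std_gauss J)" if "i \<le> k" for i
  proof -
    have "(\<lambda>y. y (i, k)) \<in> borel_measurable (std_gauss J)" "(\<lambda>y. y (k, i)) \<in> borel_measurable (std_gauss J)" "(\<lambda>y. y (k, k)) \<in> borel_measurable (std_gauss J)"
      using KJ[OF that] J(2) by (auto simp: K_def intro!: measurable_component_singleton)
    then show ?thesis unfolding Z_def by (cases "i < k") auto
  qed
  have "indep_vars (\<lambda>i. Pi\<^sub>M (K i) (\<lambda>_. borel)) (\<lambda>i y. restrict (\<lambda>p. y p) (K i)) {..k}"
    using KJ by (intro indep_vars_restrict[OF std_gauss_indep_vars]) (auto simp: disjoint_family_on_def K_def)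
  then have "indep_vars (\<lambda>_. borel) (\<lambda>i y. Z i (restrict (\<lambda>p. y p) (K i))) {..k}"
  proof (rule indep_vars_compose2)
    fix i assume i: "i \<in> {..k}"
    have "(\<lambda>y. y (i, k)) \<in> borel_measurable (Pi\<^sub>M (K i) (\<lambda>_. borel :: real measure))" "(\<lambda>y. y (k, i)) \<in> borel_measurable (Pi\<^sub>M (K i) (\<lambda>_. borel :: real measure))"
      by (auto simp: K_def intro!: measurable_component_singleton)
    then show "Z i \<in> Pi\<^sub>M (K i) (\<lambda>_. borel) \<rightarrow>\<^sub>M borel" using i unfolding Z_def by (cases "i < k") auto
  qed
  then have ind: "indep_vars (\<lambda>_. borel) Z {..k}"
    by (rule indep_vars_cong[THEN iffD1, rotated 3]) (auto simp: Z_def K_def fun_eq_iff)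
  have lawk: "distr (std_gauss J) borel (Z k) = normal_law N"
  proof -
    have "distributed (std_gauss J) lborel (\<lambda>y. y (k, k)) (normal_density 0 1)"
    proof -
      have "distr (std_gauss J) lborel (\<lambda>y. y (k, k)) = distr (std_gauss J) borel (\<lambda>y. y (k, k))"
        by (intro distr_cong) auto
      then have "distr (std_gauss J) lborel (\<lambda>y. y (k, k)) = density lborel (\<lambda>x. ennreal (normal_density 0 1 x))"
        using std_gauss_component[OF J(2)] by (simp add: std_normal_def)
      moreover have "(\<lambda>y. y (k, k)) \<in> borel_measurable (std_gauss J)"
        using J(2) by (intro measurable_component_singleton[THEN measurable_cong_sets[THEN equalityD1, THEN subsetD, rotated 2]]) auto
      ultimately show ?thesis unfolding distributed_def by simp
    qed
    then have "distributed (std_gauss J) lborel (\<lambda>y. 0 + 1 / sqrt (real N) * y (k, k)) (normal_density (0 + 1 / sqrt (real N) * 0) (\<bar>1 / sqrt (real N)\<bar> * 1))"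
      using N by (intro normal_density_affine) auto
    then have "distr (std_gauss J) lborel (\<lambda>y. 0 + 1 / sqrt (real N) * y (k, k)) = normal_law N"
      unfolding distributed_def normal_law_def by simp
    moreover have "distr (std_gauss J) borel (Z k) = distr (std_gauss J) lborel (\<lambda>y. 0 + 1 / sqrt (real N) * y (k, k))"
      by (intro distr_cong) (auto simp: Z_def)
    ultimately show ?thesis by simp
  qed
  have expo: "distributed (std_gauss J) lborel (Z i) (exponential_density (real N))" if i: "i < k" for i
  proof (rule exponential_distributedI)
    show "Z i \<in> borel_measurable (std_gauss J)" using i by (intro Zm) simp
    fix r :: real assume r: "0 \<le> r"
    have [measurable]: "Z i \<in> borel_measurable (std_gauss J)" using i by (intro Zm) simp
    have "emeasure (std_gauss J) {y \<in> space (std_gauss J). r < Z i y} = (\<integral>\<^sup>+y. indicator {2 * (r * real N)<..} ((y (i, k))\<^sup>2 + (y (k, i))\<^sup>2) \<partial>std_gauss J)"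
    proof -
      have "(\<integral>\<^sup>+y. indicator {2 * (r * real N)<..} ((y (i, k))\<^sup>2 + (y (k, i))\<^sup>2) \<partial>std_gauss J) = (\<integral>\<^sup>+y. indicator {y \<in> space (std_gauss J). r < Z i y} y \<partial>std_gauss J)"
        using N i by (intro nn_integral_cong) (auto simp: indicator_def Z_def field_simps)
      also have "\<dots> = emeasure (std_gauss J) {y \<in> space (std_gauss J). r < Z i y}"
        by (intro nn_integral_indicator) measurable
      finally show ?thesis ..
    qed
    also have "\<dots> = ennreal (exp (- (r * real N)))"
      using std_normal_pair_tail[of "r * real N"] r std_gauss_pair[of J "(i, k)" "(k, i)" "\<lambda>(u, v). indicator {2 * (r * real N)<..} (u\<^sup>2 + v\<^sup>2)"] J i
      by simp
    finally have "prob {y \<in> space (std_gauss J). r < Z i y} = exp (- (r * real N))"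
      by (simp add: emeasure_eq_measure)
    moreover have "{y \<in> space (std_gauss J). Z i y \<le> r} = space (std_gauss J) - {y \<in> space (std_gauss J). r < Z i y}" by auto
    moreover have "prob (space (std_gauss J) - {y \<in> space (std_gauss J). r < Z i y}) = 1 - prob {y \<in> space (std_gauss J). r < Z i y}"
      by (rule prob_compl) measurable
    ultimately have "prob {y \<in> space (std_gauss J). Z i y \<le> r} = 1 - exp (- (r * real N))"
      by (simp only:)
    then show "emeasure (std_gauss J) {y \<in> space (std_gauss J). Z i y \<le> r} = 1 - ennreal (exp (- r * real N))"
      by (simp add: emeasure_eq_measure ennreal_minus flip: ennreal_1)
  qed (use N in simp)
  have lawsum: "distr (std_gauss J) borel (\<lambda>y. \<Sum>i<k. Z i y) = gamma_law N k"
  proof (cases "k = 0")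
    case True
    have "distr (std_gauss J) borel (\<lambda>y. 0 :: real) = return borel 0"
      by (rule distr_const) simp
    then show ?thesis using True by (simp add: gamma_law_def)
  next
    case False
    have "distributed (std_gauss J) lborel (\<lambda>y. \<Sum>i\<in>{..<k}. Z i y) (erlang_density (card {..<k} - 1) (real N))"
      using False N expo by (intro exponential_distributed_sum indep_vars_subset[OF ind]) auto
    then have "distr (std_gauss J) lborel (\<lambda>y. \<Sum>i<k. Z i y) = gamma_law N k"
      using False unfolding distributed_def gamma_law_def by simp
    moreover have "distr (std_gauss J) borel (\<lambda>y. \<Sum>i<k. Z i y) = distr (std_gauss J) lborel (\<lambda>y. \<Sum>i<k. Z i y)"
      by (intro distr_cong) auto
    ultimately show ?thesis by simp
  qed
  have "indep_var borel (Z k) borel (\<lambda>y. \<Sum>i<k. Z i y)"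
  proof (rule indep_vars_sum)
    have "insert k {..<k} = {..k}" by auto
    then show "indep_vars (\<lambda>_. borel) Z (insert k {..<k})" using ind by simp
  qed auto
  then have "normal_law N \<Otimes>\<^sub>M gamma_law N k = distr (std_gauss J) (borel \<Otimes>\<^sub>M borel) (\<lambda>y. (Z k y, \<Sum>i<k. Z i y))"
    unfolding indep_var_distribution_eq lawk lawsum by simp
  then have "(\<integral>\<^sup>+w. \<Phi> w \<partial>(normal_law N \<Otimes>\<^sub>M gamma_law N k)) = (\<integral>\<^sup>+y. \<Phi> (Z k y, \<Sum>i<k. Z i y) \<partial>std_gauss J)"
    using Zm by (simp, subst nn_integral_distr) auto
  also have "\<dots> = (\<integral>\<^sup>+y. \<Phi> (y (k, k) / sqrt (real N), \<Sum>i<k. ((y (i, k))\<^sup>2 + (y (k, i))\<^sup>2) / (2 * real N)) \<partial>std_gauss J)"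
    by (simp add: Z_def)
  finally show ?thesis
    by (subst (asm) gk.nn_integral_fst[symmetric]) auto
qed

section \<open>Quadratic forms and the Schur complement\<close>

definition sqnorm :: "nat \<Rightarrow> (nat \<Rightarrow> complex) \<Rightarrow> real" where
  "sqnorm k u = (\<Sum>i<k. (cmod (u i))\<^sup>2)"

definition cip :: "nat \<Rightarrow> (nat \<Rightarrow> complex) \<Rightarrow> (nat \<Rightarrow> complex) \<Rightarrow> complex" where
  "cip k w u = (\<Sum>i<k. cnj (w i) * u i)"

definition herm_form :: "nat \<Rightarrow> (nat \<Rightarrow> nat \<Rightarrow> complex) \<Rightarrow> (nat \<Rightarrow> complex) \<Rightarrow> real" where
  "herm_form k A u = Re (\<Sum>i<k. \<Sum>j<k. cnj (u i) * A i j * u j)"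

text \<open>The largest eigenvalue of \<open>A + w w\<^sup>*\<close> is below \<open>x\<close>, for the \<open>k \<times> k\<close> corner of a Hermitian \<open>A\<close>.\<close>

definition spec_below :: "nat \<Rightarrow> (nat \<Rightarrow> nat \<Rightarrow> complex) \<Rightarrow> (nat \<Rightarrow> complex) \<Rightarrow> real \<Rightarrow> bool" where
  "spec_below k A w x \<longleftrightarrow> (\<exists>\<epsilon>>0. \<forall>u. herm_form k A u + (cmod (cip k w u))\<^sup>2 \<le> (x - \<epsilon>) * sqnorm k u)"

lemma sqnorm_nonneg: "0 \<le> sqnorm k u"
  by (simp add: sqnorm_def sum_nonneg)

lemma sqnorm_cong: "(\<And>i. i < k \<Longrightarrow> u i = v i) \<Longrightarrow> sqnorm k u = sqnorm k v"
  by (simp add: sqnorm_def)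

lemma cip_cong: "(\<And>i. i < k \<Longrightarrow> w i = w' i) \<Longrightarrow> (\<And>i. i < k \<Longrightarrow> u i = v i) \<Longrightarrow> cip k w u = cip k w' v"
  by (simp add: cip_def)

lemma herm_form_cong:
  "(\<And>i j. i < k \<Longrightarrow> j < k \<Longrightarrow> A i j = B i j) \<Longrightarrow> (\<And>i. i < k \<Longrightarrow> u i = v i) \<Longrightarrow> herm_form k A u = herm_form k B v"
  unfolding herm_form_def by (intro arg_cong[where f = Re] sum.cong) auto

lemma spec_below_cong:
  assumes "\<And>i j. i < k \<Longrightarrow> j < k \<Longrightarrow> A i j = B i j" "\<And>i. i < k \<Longrightarrow> w i = w' i"
  shows "spec_below k A w x \<longleftrightarrow> spec_below k B w' x"
  unfolding spec_below_def using herm_form_cong[of k A B, OF assms(1)] cip_cong[of k w w', OF assms(2)] by simp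

lemma cip_self: "cip k u u = of_real (sqnorm k u)"
  unfolding cip_def sqnorm_def of_real_sum by (intro sum.cong refl) (simp only: complex_norm_square, simp add: mult.commute)

lemma cip_commute: "cip k u v = cnj (cip k v u)"
  by (simp add: cip_def mult.commute)

lemma cip_diff_right: "cip k u (\<lambda>i. v i - w i) = cip k u v - cip k u w"
  by (simp add: cip_def right_diff_distrib sum_subtractf)

lemma cip_diff_left: "cip k (\<lambda>i. v i - w i) u = cip k v u - cip k w u"
  by (simp add: cip_def left_diff_distrib sum_subtractf)

lemma cip_scale_right: "cip k u (\<lambda>i. c * v i) = c * cip k u v"
  by (simp add: cip_def sum_distrib_left mult_ac)

lemma cip_scale_left: "cip k (\<lambda>i. c * u i) v = cnj c * cip k u v"
  by (simp add: cip_def sum_distrib_left mult_ac)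

lemma cip_Cauchy_Schwarz: "(cmod (cip k w u))\<^sup>2 \<le> sqnorm k w * sqnorm k u"
proof -
  have "cmod (cip k w u) \<le> (\<Sum>i<k. \<bar>cmod (w i)\<bar> * \<bar>cmod (u i)\<bar>)"
    unfolding cip_def by (rule order_trans[OF norm_sum]) (simp add: norm_mult)
  also have "\<dots> \<le> L2_set (\<lambda>i. cmod (w i)) {..<k} * L2_set (\<lambda>i. cmod (u i)) {..<k}"
    by (rule L2_set_mult_ineq)
  finally have "(cmod (cip k w u))\<^sup>2 \<le> (L2_set (\<lambda>i. cmod (w i)) {..<k} * L2_set (\<lambda>i. cmod (u i)) {..<k})\<^sup>2"
    by (intro power_mono) auto
  also have "\<dots> = sqnorm k w * sqnorm k u"
    by (simp add: power_mult_distrib L2_set_def sqnorm_def sum_nonneg)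
  finally show ?thesis .
qed

lemma herm_form_Suc:
  assumes herm: "\<And>i. i < k \<Longrightarrow> A k i = cnj (A i k)"
  shows "herm_form (Suc k) A u = herm_form k A u + 2 * Re (cnj (u k) * cip k (\<lambda>i. A i k) u) + Re (A k k) * (cmod (u k))\<^sup>2"
proof -
  let ?\<zeta> = "cip k (\<lambda>i. A i k) u"
  have 1: "(\<Sum>i<Suc k. \<Sum>j<Suc k. cnj (u i) * A i j * u j)
     = (\<Sum>i<k. \<Sum>j<k. cnj (u i) * A i j * u j) + (\<Sum>i<k. cnj (u i) * A i k * u k)
       + (\<Sum>j<k. cnj (u k) * A k j * u j) + cnj (u k) * A k k * u k"
    by (simp add: sum.distrib)
  have 2: "(\<Sum>j<k. cnj (u k) * A k j * u j) = cnj (u k) * ?\<zeta>"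
    unfolding cip_def sum_distrib_left by (intro sum.cong refl) (simp add: herm mult.assoc)
  have 3: "(\<Sum>i<k. cnj (u i) * A i k * u k) = cnj (cnj (u k) * ?\<zeta>)"
    by (simp add: cip_def sum_distrib_left mult_ac)
  have 4: "cnj (u k) * A k k * u k = A k k * of_real ((cmod (u k))\<^sup>2)"
    by (simp only: complex_norm_square) (simp add: mult_ac)
  have 5: "Re (z * of_real r) = Re z * r" for z r by simp
  have 6: "Re (cnj z) = Re z" for z by simp
  show ?thesis unfolding herm_form_def 1 2 3 4 plus_complex.sel 5 6 by simp
qed

lemma complete_square:
  fixes t \<zeta> :: complex
  assumes "0 < Y"
  shows "Y * (cmod t)\<^sup>2 - 2 * Re (cnj t * \<zeta>) = Y * (cmod (t - \<zeta> / of_real Y))\<^sup>2 - (cmod \<zeta>)\<^sup>2 / Y"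
  using assms unfolding cmod_power2 by (simp add: field_simps power2_eq_square)

text \<open>\<open>gap2\<close> completes the square in the last coordinate. The choice
  \<open>\<zeta> u / Y\<close> for that coordinate removes the square and gives one direction; in
  the other, the uniform gap of the corner has to be shared with the last coordinate.\<close>

lemma spec_below_Suc:
  assumes herm: "\<And>i. i < k \<Longrightarrow> A k i = cnj (A i k)" and c: "0 \<le> c"
    and Y_def: "Y = x - Re (A k k) - c"
  shows "spec_below (Suc k) A (\<lambda>i. if i = k then of_real (sqrt c) else 0) x \<longleftrightarrow>
    0 < Y \<and> spec_below k A (\<lambda>i. A i k / of_real (sqrt Y)) x"
proof -
  let ?w = "\<lambda>i. if i = k then complex_of_real (sqrt c) else 0"
  define \<zeta> where "\<zeta> u = cip k (\<lambda>i. A i k) u" for u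
  have ipw: "(cmod (cip (Suc k) ?w u))\<^sup>2 = c * (cmod (u k))\<^sup>2" for u
    using c by (simp add: cip_def norm_mult power_mult_distrib)
  have n2S: "sqnorm (Suc k) u = sqnorm k u + (cmod (u k))\<^sup>2" for u by (simp add: sqnorm_def)
  have ipY: "(cmod (cip k (\<lambda>i. A i k / of_real (sqrt Y)) u))\<^sup>2 = (cmod (\<zeta> u))\<^sup>2 / Y" if "0 < Y" for u
  proof -
    have "cip k (\<lambda>i. A i k / of_real (sqrt Y)) u = \<zeta> u / of_real (sqrt Y)"
      unfolding \<zeta>_def cip_def sum_divide_distrib by (intro sum.cong) auto
    then show ?thesis using that by (simp add: norm_divide power_divide)
  qed
  have gap: "x * sqnorm (Suc k) u - (herm_form (Suc k) A u + (cmod (cip (Suc k) ?w u))\<^sup>2)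
      = x * sqnorm k u - herm_form k A u + (Y * (cmod (u k))\<^sup>2 - 2 * Re (cnj (u k) * \<zeta> u))" for u
    using herm_form_Suc[where k = k and A = A and u = u] herm unfolding ipw n2S \<zeta>_def Y_def by (simp add: algebra_simps)
  have gap2: "x * sqnorm (Suc k) u - (herm_form (Suc k) A u + (cmod (cip (Suc k) ?w u))\<^sup>2)
      = x * sqnorm k u - (herm_form k A u + (cmod (cip k (\<lambda>i. A i k / of_real (sqrt Y)) u))\<^sup>2) + Y * (cmod (u k - \<zeta> u / of_real Y))\<^sup>2"
    if "0 < Y" for u
    unfolding gap complete_square[OF that] ipY[OF that] by simp
  show ?thesis
  proof
    assume "spec_below (Suc k) A ?w x"
    then obtain e where e: "0 < e" "\<And>u. herm_form (Suc k) A u + (cmod (cip (Suc k) ?w u))\<^sup>2 \<le> (x - e) * sqnorm (Suc k) u"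
      by (auto simp: spec_below_def)
    have e': "e * sqnorm (Suc k) u \<le> x * sqnorm (Suc k) u - (herm_form (Suc k) A u + (cmod (cip (Suc k) ?w u))\<^sup>2)" for u
      using e(2)[of u] by (simp add: algebra_simps)
    have Y: "0 < Y"
    proof -
      let ?u = "\<lambda>i. if i = k then 1 else (0 :: complex)"
      have "sqnorm k ?u = 0" "herm_form k A ?u = 0" "\<zeta> ?u = 0" by (auto simp: sqnorm_def herm_form_def \<zeta>_def cip_def)
      then have "e \<le> Y" using e'[of ?u, unfolded gap] by (simp add: n2S)
      then show ?thesis using e by simp
    qed
    have "herm_form k A u + (cmod (cip k (\<lambda>i. A i k / of_real (sqrt Y)) u))\<^sup>2 \<le> (x - e) * sqnorm k u" for u
    proof -
      define v where "v = u(k := \<zeta> u / of_real Y)"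
      have vu: "sqnorm k v = sqnorm k u" "herm_form k A v = herm_form k A u" "\<zeta> v = \<zeta> u"
        "cip k (\<lambda>i. A i k / of_real (sqrt Y)) v = cip k (\<lambda>i. A i k / of_real (sqrt Y)) u"
        by (auto simp: v_def \<zeta>_def intro!: sqnorm_cong herm_form_cong cip_cong)
      have "e * sqnorm (Suc k) v \<le> x * sqnorm k u - (herm_form k A u + (cmod (cip k (\<lambda>i. A i k / of_real (sqrt Y)) u))\<^sup>2)"
        using e'[of v] unfolding gap2[OF Y] vu by (simp add: v_def)
      moreover have "e * sqnorm k u \<le> e * sqnorm (Suc k) v" unfolding n2S vu using e by simp
      ultimately show ?thesis by (simp add: algebra_simps)
    qed
    then show "0 < Y \<and> spec_below k A (\<lambda>i. A i k / of_real (sqrt Y)) x"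
      using Y e(1) by (auto simp: spec_below_def)
  next
    assume R: "0 < Y \<and> spec_below k A (\<lambda>i. A i k / of_real (sqrt Y)) x"
    then have Y: "0 < Y" by simp
    obtain e where e: "0 < e" "\<And>u. herm_form k A u + (cmod (cip k (\<lambda>i. A i k / of_real (sqrt Y)) u))\<^sup>2 \<le> (x - e) * sqnorm k u"
      using R by (auto simp: spec_below_def)
    define V where "V = sqnorm k (\<lambda>i. A i k)"
    have V: "0 \<le> V" by (simp add: V_def sqnorm_nonneg)
    \<comment> \<open>\<open>Y / 2\<close> lets the completed square absorb its part of the last
      coordinate; the second term lets the gap \<open>e\<close> of the corner absorb the part that
      comes from \<open>\<zeta> u / Y\<close>.\<close>
    define \<delta> where "\<delta> = min (Y / 2) (e / (1 + 2 * V / Y\<^sup>2))"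
    have den: "0 < 1 + 2 * V / Y\<^sup>2" using V Y by (simp add: add_pos_nonneg)
    have \<delta>: "0 < \<delta>" "2 * \<delta> \<le> Y" "\<delta> * (1 + 2 * V / Y\<^sup>2) \<le> e"
    proof -
      show "0 < \<delta>" using Y e den by (simp add: \<delta>_def)
      have "\<delta> \<le> Y / 2" unfolding \<delta>_def by (rule min.cobounded1)
      then show "2 * \<delta> \<le> Y" by simp
      have "\<delta> \<le> e / (1 + 2 * V / Y\<^sup>2)" unfolding \<delta>_def by (rule min.cobounded2)
      then show "\<delta> * (1 + 2 * V / Y\<^sup>2) \<le> e" using pos_le_divide_eq[OF den] by blast
    qed
    have "herm_form (Suc k) A u + (cmod (cip (Suc k) ?w u))\<^sup>2 \<le> (x - \<delta>) * sqnorm (Suc k) u" for u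
    proof -
      define D where "D = u k - \<zeta> u / of_real Y"
      have "(cmod (u k))\<^sup>2 \<le> (cmod D + cmod (\<zeta> u / of_real Y))\<^sup>2"
        unfolding D_def by (intro power_mono) (use norm_triangle_ineq[of "u k - \<zeta> u / of_real Y" "\<zeta> u / of_real Y"] in auto)
      also have "\<dots> \<le> 2 * (cmod D)\<^sup>2 + 2 * (cmod (\<zeta> u / of_real Y))\<^sup>2"
        using zero_le_power2[of "cmod D - cmod (\<zeta> u / of_real Y)"] by (simp add: power2_eq_square algebra_simps)
      also have "(cmod (\<zeta> u / of_real Y))\<^sup>2 = (cmod (\<zeta> u))\<^sup>2 / Y\<^sup>2" using Y by (simp add: norm_divide power_divide)
      also have "(cmod (\<zeta> u))\<^sup>2 \<le> V * sqnorm k u" unfolding \<zeta>_def V_def by (rule cip_Cauchy_Schwarz)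
      finally have "(cmod (u k))\<^sup>2 \<le> 2 * (cmod D)\<^sup>2 + 2 * (V * sqnorm k u / Y\<^sup>2)"
        using Y by (simp add: divide_right_mono)
      then have "\<delta> * sqnorm (Suc k) u \<le> \<delta> * (sqnorm k u + (2 * (cmod D)\<^sup>2 + 2 * (V * sqnorm k u / Y\<^sup>2)))"
        unfolding n2S using \<delta> by (intro mult_left_mono add_left_mono) auto
      also have "\<dots> = \<delta> * (1 + 2 * V / Y\<^sup>2) * sqnorm k u + 2 * \<delta> * (cmod D)\<^sup>2" by (simp add: algebra_simps)
      also have "\<dots> \<le> e * sqnorm k u + Y * (cmod D)\<^sup>2"
        using \<delta> by (intro add_mono mult_right_mono sqnorm_nonneg) auto
      also have "\<dots> \<le> x * sqnorm k u - (herm_form k A u + (cmod (cip k (\<lambda>i. A i k / of_real (sqrt Y)) u))\<^sup>2) + Y * (cmod D)\<^sup>2"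
        using e(2)[of u] by (simp add: algebra_simps)
      also have "\<dots> = x * sqnorm (Suc k) u - (herm_form (Suc k) A u + (cmod (cip (Suc k) ?w u))\<^sup>2)"
        unfolding gap2[OF Y] D_def ..
      finally show ?thesis by (simp add: algebra_simps)
    qed
    then show "spec_below (Suc k) A ?w x" using \<delta>(1) by (auto simp: spec_below_def)
  qed
qed

text \<open>The Householder reflection along \<open>d\<close>; it is the identity if \<open>d\<close> vanishes, since then \<open>2 / sqnorm k d = 0\<close>.\<close>

definition refl_app :: "nat \<Rightarrow> (nat \<Rightarrow> complex) \<Rightarrow> (nat \<Rightarrow> complex) \<Rightarrow> nat \<Rightarrow> complex" where
  "refl_app k d u = (\<lambda>i. u i - of_real (2 / sqnorm k d) * d i * cip k d u)"

lemma cip_refl_app: "cip k w (refl_app k d u) = cip k w u - of_real (2 / sqnorm k d) * cip k w d * cip k d u"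
  unfolding refl_app_def cip_diff_right by (simp add: cip_def sum_distrib_left sum_distrib_right mult_ac)

lemma cip_refl_app_commute: "cip k w (refl_app k d u) = cip k (refl_app k d w) u"
proof -
  have "cip k (refl_app k d w) u = cnj (cip k u (refl_app k d w))" by (rule cip_commute)
  also have "\<dots> = cip k w u - of_real (2 / sqnorm k d) * cip k w d * cip k d u"
    unfolding cip_refl_app using cip_commute[of k u w] cip_commute[of k u d] cip_commute[of k d w] by (simp add: mult_ac)
  finally show ?thesis by (simp add: cip_refl_app)
qed

lemma refl_app_involution: "i < k \<Longrightarrow> refl_app k d (refl_app k d u) i = u i"
proof (cases "sqnorm k d = 0")
  case False
  have "cip k d (refl_app k d u) = - cip k d u"
    unfolding cip_refl_app cip_self using False by simp
  then show ?thesis by (simp add: refl_app_def)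
qed (simp add: refl_app_def)

lemma sqnorm_refl_app: "sqnorm k (refl_app k d u) = sqnorm k u"
proof -
  have "complex_of_real (sqnorm k (refl_app k d u)) = cip k (refl_app k d u) (refl_app k d u)" by (simp add: cip_self)
  also have "\<dots> = cip k u (refl_app k d (refl_app k d u))" by (rule cip_refl_app_commute[symmetric])
  also have "\<dots> = cip k u u" by (intro cip_cong refl_app_involution refl)
  finally show ?thesis by (simp add: cip_self)
qed

text \<open>A reflection along the difference exchanges two vectors of equal length only if their
  inner product is real, so \<open>w'\<close> is first turned by a phase \<open>\<alpha>\<close>.
  The phase disappears in \<open>cmod\<close>, which is all that \<open>spec_below\<close>
  sees.\<close>

lemma exists_reflection:
  assumes n: "sqnorm k w = sqnorm k w'"
  shows "\<exists>d. \<forall>u. cmod (cip k w (refl_app k d u)) = cmod (cip k w' u)"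
proof -
  define p where "p = cip k w w'"
  define \<alpha> where "\<alpha> = (if p = 0 then 1 else cnj p / of_real (cmod p))"
  have \<alpha>: "cmod \<alpha> = 1" by (simp add: \<alpha>_def norm_divide)
  have real: "\<alpha> * p = of_real (cmod p)"
    by (simp add: \<alpha>_def) (metis complex_norm_square mult.commute of_real_mult power2_eq_square nonzero_mult_div_cancel_right norm_eq_zero of_real_eq_0_iff)
  define d where "d = (\<lambda>i. w i - \<alpha> * w' i)"
  have dw: "cip k d w = of_real (sqnorm k w - cmod p)"
  proof -
    have "cip k d w = cip k w w - cnj \<alpha> * cip k w' w" unfolding d_def cip_diff_left cip_scale_left ..
    also have "cip k w' w = cnj p" unfolding p_def by (rule cip_commute)
    also have "cnj \<alpha> * cnj p = of_real (cmod p)" using arg_cong[OF real, of cnj] by simp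
    finally show ?thesis by (simp add: cip_self)
  qed
  have nd: "sqnorm k d = 2 * (sqnorm k w - cmod p)"
  proof -
    have "complex_of_real (sqnorm k d) = cip k d w - \<alpha> * cip k d w'"
      unfolding cip_self[symmetric] by (subst (2) d_def) (simp add: cip_diff_right cip_scale_right)
    also have "cip k d w' = p - cnj \<alpha> * of_real (sqnorm k w')"
      unfolding d_def cip_diff_left cip_scale_left cip_self p_def ..
    also have "\<alpha> * (p - cnj \<alpha> * of_real (sqnorm k w')) = of_real (cmod p) - of_real (sqnorm k w)"
      unfolding right_diff_distrib real mult.assoc[symmetric] complex_norm_square[symmetric] n by (simp add: \<alpha>)
    finally have "complex_of_real (sqnorm k d) = of_real (2 * (sqnorm k w - cmod p))" unfolding dw by simp
    then show ?thesis by (simp only: of_real_eq_iff)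
  qed
  have refl: "refl_app k d w i = \<alpha> * w' i" if "i < k" for i
  proof (cases "sqnorm k d = 0")
    case True
    then have "d i = 0" using that by (auto simp: sqnorm_def sum_nonneg_eq_0_iff)
    then show ?thesis by (simp add: refl_app_def d_def)
  next
    case False
    then have "2 / sqnorm k d * (sqnorm k w - cmod p) = 1" using nd by simp
    then have "complex_of_real (2 / sqnorm k d) * cip k d w = 1" unfolding dw of_real_mult[symmetric] by simp
    then have "refl_app k d w i = w i - d i" by (simp add: refl_app_def mult_ac)
    then show ?thesis by (simp add: d_def)
  qed
  have "cmod (cip k w (refl_app k d u)) = cmod (cip k w' u)" for u
  proof -
    have "cip k w (refl_app k d u) = cip k (\<lambda>i. \<alpha> * w' i) u"
      unfolding cip_refl_app_commute by (intro cip_cong refl) auto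
    then show ?thesis by (simp add: cip_scale_left norm_mult \<alpha>)
  qed
  then show ?thesis by blast
qed

text \<open>Conjugation of \<open>H\<close> by the reflection. As the reflection is Hermitian,
  multiplication from the right amounts to reflecting the conjugated rows.\<close>

definition conj_refl :: "nat \<Rightarrow> (nat \<Rightarrow> complex) \<Rightarrow> (nat \<Rightarrow> nat \<Rightarrow> complex) \<Rightarrow> nat \<Rightarrow> nat \<Rightarrow> complex" where
  "conj_refl k d H = (\<lambda>i j. refl_app k d (\<lambda>a. cnj (refl_app k d (\<lambda>b. cnj (H a b)) j)) i)"

lemma conj_refl_explicit:
  "conj_refl k d H i j = H i j - of_real (2 / sqnorm k d) * d i * (\<Sum>a<k. cnj (d a) * H a j)
    - of_real (2 / sqnorm k d) * cnj (d j) * (\<Sum>b<k. H i b * d b)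
    + (of_real (2 / sqnorm k d))\<^sup>2 * d i * cnj (d j) * (\<Sum>a<k. \<Sum>b<k. cnj (d a) * H a b * d b)"
proof -
  define t where "t = complex_of_real (2 / sqnorm k d)"
  have t: "cnj t = t" by (simp add: t_def)
  show ?thesis
    unfolding conj_refl_def refl_app_def t_def[symmetric]
    by (simp add: t cip_def algebra_simps sum_subtractf sum_distrib_left sum_distrib_right power2_eq_square)
qed

lemma conj_refl_involution:
  assumes "i < k" "j < k"
  shows "conj_refl k d (conj_refl k d H) i j = H i j"
proof -
  \<comment> \<open>Multiplications from the left and from the right commute, so the two reflections
    on either side can be cancelled separately.\<close>
  have comm: "conj_refl k d G a b = cnj (refl_app k d (\<lambda>b. cnj (refl_app k d (\<lambda>a. G a b) a)) b)" for G a b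
  proof -
    define t where "t = complex_of_real (2 / sqnorm k d)"
    have t: "cnj t = t" by (simp add: t_def)
    have "(\<Sum>i<k. \<Sum>j<k. F i j) = (\<Sum>j<k. \<Sum>i<k. F i j)" for F :: "nat \<Rightarrow> nat \<Rightarrow> complex" by (rule sum.swap)
    from this[of "\<lambda>i j. t * (t * (d a * (d j * (cnj (d i) * (cnj (d b) * G i j)))))"]
    show ?thesis
      unfolding conj_refl_def refl_app_def t_def[symmetric]
      by (simp add: t cip_def algebra_simps sum_subtractf sum_distrib_left sum_distrib_right)
  qed
  have "refl_app k d (\<lambda>a. conj_refl k d H a b) i = cnj (refl_app k d (\<lambda>b. cnj (H i b)) b)" for b
    unfolding conj_refl_def by (rule refl_app_involution[OF assms(1)])
  then have "conj_refl k d (conj_refl k d H) i j = cnj (refl_app k d (\<lambda>b. refl_app k d (\<lambda>b. cnj (H i b)) b) j)"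
    unfolding comm[of "conj_refl k d H"] by simp
  also have "\<dots> = H i j" using refl_app_involution[OF assms(2), of d "\<lambda>b. cnj (H i b)"] by simp
  finally show ?thesis .
qed

lemma herm_form_conj_refl: "herm_form k (conj_refl k d H) u = herm_form k H (refl_app k d u)"
proof -
  let ?v = "refl_app k d u"
  have "(\<Sum>i<k. \<Sum>j<k. cnj (u i) * conj_refl k d H i j * u j) = (\<Sum>j<k. cip k u (\<lambda>i. conj_refl k d H i j) * u j)"
    by (subst sum.swap) (simp add: cip_def sum_distrib_right)
  also have "\<dots> = (\<Sum>j<k. cip k ?v (\<lambda>a. cnj (refl_app k d (\<lambda>b. cnj (H a b)) j)) * u j)"
    unfolding conj_refl_def cip_refl_app_commute ..
  also have "\<dots> = (\<Sum>a<k. cnj (?v a) * cnj (cip k u (refl_app k d (\<lambda>b. cnj (H a b)))))"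
    unfolding cip_def sum_distrib_right by (subst sum.swap) (simp add: sum_distrib_left mult_ac)
  also have "\<dots> = (\<Sum>a<k. cnj (?v a) * cnj (cip k ?v (\<lambda>b. cnj (H a b))))"
    unfolding cip_refl_app_commute ..
  also have "\<dots> = (\<Sum>i<k. \<Sum>j<k. cnj (?v i) * H i j * ?v j)"
    by (simp add: cip_def sum_distrib_left mult_ac)
  finally show ?thesis by (simp add: herm_form_def)
qed

lemma spec_below_conj_refl:
  assumes d: "\<And>u. cmod (cip k w (refl_app k d u)) = cmod (cip k w' u)"
  shows "spec_below k (conj_refl k d H) w' x \<longleftrightarrow> spec_below k H w x"
proof
  assume "spec_below k H w x"
  then obtain e where e: "0 < e" "\<And>u. herm_form k H u + (cmod (cip k w u))\<^sup>2 \<le> (x - e) * sqnorm k u"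
    by (auto simp: spec_below_def)
  have "herm_form k (conj_refl k d H) u + (cmod (cip k w' u))\<^sup>2 \<le> (x - e) * sqnorm k u" for u
    using e(2)[of "refl_app k d u"] by (simp add: herm_form_conj_refl d sqnorm_refl_app)
  then show "spec_below k (conj_refl k d H) w' x" using e(1) by (auto simp: spec_below_def)
next
  assume "spec_below k (conj_refl k d H) w' x"
  then obtain e where e: "0 < e" "\<And>u. herm_form k (conj_refl k d H) u + (cmod (cip k w' u))\<^sup>2 \<le> (x - e) * sqnorm k u"
    by (auto simp: spec_below_def)
  have "herm_form k H u + (cmod (cip k w u))\<^sup>2 \<le> (x - e) * sqnorm k u" for u
  proof -
    let ?v = "refl_app k d u"
    have "herm_form k H (refl_app k d ?v) = herm_form k H u" "cip k w (refl_app k d ?v) = cip k w u" "sqnorm k ?v = sqnorm k u"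
      by (auto intro!: herm_form_cong cip_cong refl_app_involution simp: sqnorm_refl_app)
    then show ?thesis using e(2)[of ?v] d[of ?v] by (simp add: herm_form_conj_refl)
  qed
  then show "spec_below k H w x" using e(1) by (auto simp: spec_below_def)
qed

lemma frobenius_conj_refl:
  "(\<Sum>i<k. \<Sum>j<k. (cmod (conj_refl k d H i j))\<^sup>2) = (\<Sum>i<k. \<Sum>j<k. (cmod (H i j))\<^sup>2)"
proof -
  have "(\<Sum>i<k. \<Sum>j<k. (cmod (conj_refl k d H i j))\<^sup>2) = (\<Sum>j<k. sqnorm k (\<lambda>i. conj_refl k d H i j))"
    unfolding sqnorm_def by (rule sum.swap)
  also have "\<dots> = (\<Sum>j<k. sqnorm k (\<lambda>a. cnj (refl_app k d (\<lambda>b. cnj (H a b)) j)))"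
    unfolding conj_refl_def sqnorm_refl_app ..
  also have "\<dots> = (\<Sum>a<k. sqnorm k (refl_app k d (\<lambda>b. cnj (H a b))))"
    unfolding sqnorm_def by (subst sum.swap) simp
  also have "\<dots> = (\<Sum>i<k. \<Sum>j<k. (cmod (H i j))\<^sup>2)"
    unfolding sqnorm_refl_app by (simp add: sqnorm_def)
  finally show ?thesis .
qed

lemma conj_refl_hermitian:
  assumes herm: "\<And>i j. i < k \<Longrightarrow> j < k \<Longrightarrow> H i j = cnj (H j i)" and ij: "i < k" "j < k"
  shows "conj_refl k d H i j = cnj (conj_refl k d H j i)"
proof -
  define p where "p = (\<Sum>b<k. H j b * d b)"
  define q where "q = (\<Sum>a<k. cnj (d a) * H a i)"
  define S where "S = (\<Sum>a<k. \<Sum>b<k. cnj (d a) * H a b * d b)"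
  have 1: "(\<Sum>a<k. cnj (d a) * H a j) = cnj p"
    unfolding p_def cnj_sum
  proof (intro sum.cong refl)
    fix a assume "a \<in> {..<k}"
    then show "cnj (d a) * H a j = cnj (H j a * d a)" using herm[of a j] ij by simp
  qed
  have 2: "(\<Sum>b<k. H i b * d b) = cnj q"
    unfolding q_def cnj_sum
  proof (intro sum.cong refl)
    fix b assume "b \<in> {..<k}"
    then show "H i b * d b = cnj (cnj (d b) * H b i)" using herm[of i b] ij by simp
  qed
  have "cnj S = (\<Sum>a<k. \<Sum>b<k. cnj (cnj (d a) * H a b * d b))" unfolding S_def cnj_sum ..
  also have "\<dots> = (\<Sum>b<k. \<Sum>a<k. cnj (cnj (d a) * H a b * d b))" by (rule sum.swap)
  also have "\<dots> = S"
    unfolding S_def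
  proof (intro sum.cong refl)
    fix a b assume "a \<in> {..<k}" "b \<in> {..<k}"
    then show "cnj (cnj (d b) * H b a * d a) = cnj (d a) * H a b * d b" using herm[of a b] by simp
  qed
  finally have 3: "cnj S = S" .
  have "conj_refl k d H i j = H i j - of_real (2 / sqnorm k d) * d i * cnj p - of_real (2 / sqnorm k d) * cnj (d j) * cnj q
      + (of_real (2 / sqnorm k d))\<^sup>2 * d i * cnj (d j) * S"
    unfolding conj_refl_explicit 1 2 S_def ..
  moreover have "conj_refl k d H j i = H j i - of_real (2 / sqnorm k d) * d j * q - of_real (2 / sqnorm k d) * cnj (d i) * p
      + (of_real (2 / sqnorm k d))\<^sup>2 * d j * cnj (d i) * S"
    unfolding conj_refl_explicit p_def q_def S_def ..
  ultimately show ?thesis using herm[OF ij] 3 by simp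
qed

section \<open>Unitary invariance of Gaussian Hermitian matrices\<close>

text \<open>The entries of \<open>z\<close> above the diagonal become real parts, those below it imaginary parts. The scaling makes
  the Euclidean norm of \<open>z\<close> the Frobenius norm of the matrix, so that conjugation by a unitary is an isometry in \<open>z\<close>.\<close>

definition herm :: "(nat \<times> nat \<Rightarrow> real) \<Rightarrow> nat \<Rightarrow> nat \<Rightarrow> complex" where
  "herm z i j = (if i < j then Complex (z (i, j) / sqrt 2) (z (j, i) / sqrt 2)
     else if i = j then of_real (z (i, i)) else Complex (z (j, i) / sqrt 2) (- z (i, j) / sqrt 2))"

definition coords :: "(nat \<Rightarrow> nat \<Rightarrow> complex) \<Rightarrow> nat \<times> nat \<Rightarrow> real" where
  "coords M = (\<lambda>(i, j). if i < j then sqrt 2 * Re (M i j) else if i = j then Re (M i i) else sqrt 2 * Im (M j i))"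

definition gue :: "nat \<Rightarrow> (nat \<times> nat \<Rightarrow> real) \<Rightarrow> nat \<Rightarrow> nat \<Rightarrow> complex" where
  "gue N z i j = herm z i j / of_real (sqrt (real N))"

abbreviation sq :: "nat \<Rightarrow> (nat \<times> nat) set" where
  "sq k \<equiv> {..<k} \<times> {..<k}"

lemma herm_hermitian: "herm z i j = cnj (herm z j i)"
  by (auto simp: herm_def complex_eq_iff)

lemma coords_herm: "coords (herm z) p = z p"
  by (cases p) (auto simp: coords_def herm_def)

lemma herm_coords:
  assumes "M i j = cnj (M j i)"
  shows "herm (coords M) i j = M i j"
  using assms by (auto simp: herm_def coords_def complex_eq_iff)

lemma herm_cong: "(\<And>p. p \<in> {(i, j), (j, i)} \<Longrightarrow> z p = z' p) \<Longrightarrow> herm z i j = herm z' i j"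
  by (auto simp: herm_def)

lemma frobenius_herm: "(\<Sum>i<k. \<Sum>j<k. (cmod (herm z i j))\<^sup>2) = (\<Sum>p\<in>sq k. (z p)\<^sup>2)"
proof -
  have "(\<Sum>i<k. \<Sum>j<k. (cmod (herm z i j))\<^sup>2) = (\<Sum>i<k. \<Sum>j<k. ((z (i, j))\<^sup>2 + (z (j, i))\<^sup>2) / 2)"
    by (intro sum.cong refl) (auto simp: herm_def cmod_power2 power_divide add_divide_distrib)
  also have "\<dots> = ((\<Sum>i<k. \<Sum>j<k. (z (i, j))\<^sup>2) + (\<Sum>i<k. \<Sum>j<k. (z (j, i))\<^sup>2)) / 2"
    by (simp add: sum.distrib sum_divide_distrib add_divide_distrib)
  also have "(\<Sum>i<k. \<Sum>j<k. (z (j, i))\<^sup>2) = (\<Sum>i<k. \<Sum>j<k. (z (i, j))\<^sup>2)" by (rule sum.swap)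
  finally show ?thesis by (simp add: sum.cartesian_product)
qed

definition reflect_coords :: "nat \<Rightarrow> (nat \<Rightarrow> complex) \<Rightarrow> (nat \<times> nat \<Rightarrow> real) \<Rightarrow> nat \<times> nat \<Rightarrow> real" where
  "reflect_coords k d z = restrict (coords (conj_refl k d (herm z))) (sq k)"

lemma herm_reflect_coords:
  assumes "i < k" "j < k"
  shows "herm (reflect_coords k d z) i j = conj_refl k d (herm z) i j"
proof -
  have "herm (reflect_coords k d z) i j = herm (coords (conj_refl k d (herm z))) i j"
    using assms by (intro herm_cong) (auto simp: reflect_coords_def)
  also have "\<dots> = conj_refl k d (herm z) i j"
    by (intro herm_coords conj_refl_hermitian assms herm_hermitian)
  finally show ?thesis .
qed

lemma herm_diff: "herm (\<lambda>p. z p - y p) i j = herm z i j - herm y i j"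
  by (auto simp: herm_def complex_eq_iff diff_divide_distrib)

lemma conj_refl_diff: "conj_refl k d (\<lambda>i j. G i j - H i j) i j = conj_refl k d G i j - conj_refl k d H i j"
  unfolding conj_refl_explicit by (simp add: algebra_simps sum_subtractf)

lemma coords_diff: "coords (\<lambda>i j. G i j - H i j) p = coords G p - coords H p"
  by (cases p) (simp add: coords_def algebra_simps)

lemma conj_refl_cong:
  "(\<And>a b. a < k \<Longrightarrow> b < k \<Longrightarrow> G a b = H a b) \<Longrightarrow> i < k \<Longrightarrow> j < k \<Longrightarrow> conj_refl k d G i j = conj_refl k d H i j"
  unfolding conj_refl_explicit by simp

lemma reflect_coords_involution: "p \<in> sq k \<Longrightarrow> reflect_coords k d (reflect_coords k d z) p = z p"
proof -
  assume p: "p \<in> sq k"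
  have "conj_refl k d (herm (reflect_coords k d z)) i j = herm z i j" if "i < k" "j < k" for i j
  proof -
    have "conj_refl k d (herm (reflect_coords k d z)) i j = conj_refl k d (conj_refl k d (herm z)) i j"
      by (intro conj_refl_cong herm_reflect_coords that)
    then show ?thesis using conj_refl_involution[OF that] by simp
  qed
  then have "reflect_coords k d (reflect_coords k d z) p = coords (herm z) p"
    using p by (cases p) (auto simp: reflect_coords_def coords_def)
  then show ?thesis by (simp add: coords_herm)
qed

lemma reflect_coords_norm: "(\<Sum>p\<in>sq k. (reflect_coords k d z p)\<^sup>2) = (\<Sum>p\<in>sq k. (z p)\<^sup>2)"
proof -
  have "(\<Sum>p\<in>sq k. (reflect_coords k d z p)\<^sup>2) = (\<Sum>i<k. \<Sum>j<k. (cmod (herm (reflect_coords k d z) i j))\<^sup>2)"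
    by (rule frobenius_herm[symmetric])
  also have "\<dots> = (\<Sum>i<k. \<Sum>j<k. (cmod (conj_refl k d (herm z) i j))\<^sup>2)"
    by (intro sum.cong refl) (simp add: herm_reflect_coords)
  finally show ?thesis by (simp add: frobenius_conj_refl frobenius_herm)
qed

lemma reflect_coords_diff: "p \<in> sq k \<Longrightarrow> reflect_coords k d (\<lambda>p. z p - y p) p = reflect_coords k d z p - reflect_coords k d y p"
proof -
  assume p: "p \<in> sq k"
  have "coords (conj_refl k d (herm (\<lambda>p. z p - y p))) p = coords (\<lambda>i j. conj_refl k d (herm z) i j - conj_refl k d (herm y) i j) p"
    by (intro arg_cong[where f = "\<lambda>M. coords M p"] ext) (simp add: conj_refl_diff[symmetric] herm_diff[abs_def])
  then show ?thesis using p by (simp add: reflect_coords_def coords_diff)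
qed

text \<open>A linear involution preserving the norm satisfies the hypothesis of
  \<open>std_gauss_isometry_invariant\<close> with itself as inverse.\<close>

lemma reflect_coords_isometry: "(\<Sum>p\<in>sq k. (reflect_coords k d z p - y p)\<^sup>2) = (\<Sum>p\<in>sq k. (z p - reflect_coords k d y p)\<^sup>2)"
proof -
  have "(\<Sum>p\<in>sq k. (reflect_coords k d z p - y p)\<^sup>2) = (\<Sum>p\<in>sq k. (reflect_coords k d (\<lambda>p. z p - reflect_coords k d y p) p)\<^sup>2)"
  proof (intro sum.cong refl)
    fix p assume p: "p \<in> sq k"
    show "(reflect_coords k d z p - y p)\<^sup>2 = (reflect_coords k d (\<lambda>p. z p - reflect_coords k d y p) p)\<^sup>2"
      unfolding reflect_coords_diff[OF p] reflect_coords_involution[OF p] ..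
  qed
  then show ?thesis by (simp only: reflect_coords_norm)
qed

lemma measurable_Complex [measurable (raw)]:
  "f \<in> borel_measurable M \<Longrightarrow> g \<in> borel_measurable M \<Longrightarrow> (\<lambda>x. Complex (f x) (g x)) \<in> borel_measurable M"
  by (simp add: borel_measurable_complex_iff)

lemma measurable_herm:
  assumes "i < k" "j < k"
  shows "(\<lambda>z. herm z i j) \<in> borel_measurable (Pi\<^sub>M (sq k) (\<lambda>_. borel))"
proof -
  have [measurable]: "(\<lambda>z. z (i, j)) \<in> borel_measurable (Pi\<^sub>M (sq k) (\<lambda>_. borel :: real measure))"
    "(\<lambda>z. z (j, i)) \<in> borel_measurable (Pi\<^sub>M (sq k) (\<lambda>_. borel :: real measure))"
    "(\<lambda>z. z (i, i)) \<in> borel_measurable (Pi\<^sub>M (sq k) (\<lambda>_. borel :: real measure))"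
    using assms by (auto intro!: measurable_component_singleton)
  show ?thesis unfolding herm_def by measurable
qed

lemma measurable_reflect_coords: "reflect_coords k d \<in> Pi\<^sub>M (sq k) (\<lambda>_. borel) \<rightarrow>\<^sub>M Pi\<^sub>M (sq k) (\<lambda>_. borel)"
  unfolding reflect_coords_def[abs_def]
proof (rule measurable_restrict)
  fix p assume "p \<in> sq k"
  then obtain i j where p: "p = (i, j)" "i < k" "j < k" by auto
  have c: "(\<lambda>z. conj_refl k d (herm z) a b) \<in> borel_measurable (Pi\<^sub>M (sq k) (\<lambda>_. borel))" if "a < k" "b < k" for a b
    unfolding conj_refl_explicit using that
    by (intro borel_measurable_add borel_measurable_diff borel_measurable_times borel_measurable_const borel_measurable_sum measurable_herm) auto
  show "(\<lambda>z. coords (conj_refl k d (herm z)) p) \<in> Pi\<^sub>M (sq k) (\<lambda>_. borel) \<rightarrow>\<^sub>M borel"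
    using c[OF p(2,3)] c[OF p(2,2)] c[OF p(3,2)] unfolding p coords_def by (auto simp: borel_measurable_complex_iff)
qed

lemma std_gauss_reflect_coords_invariant: "distr (std_gauss (sq k)) (Pi\<^sub>M (sq k) (\<lambda>_. borel)) (reflect_coords k d) = std_gauss (sq k)"
  by (rule std_gauss_isometry_invariant[where R' = "reflect_coords k d"]) (auto intro: reflect_coords_isometry reflect_coords_norm measurable_reflect_coords)

section \<open>Measurability of \<open>spec_below\<close>\<close>

definition rat_complex :: "complex set" where
  "rat_complex = (\<lambda>(a, b). Complex a b) ` (\<rat> \<times> \<rat>)"

lemma countable_rat_complex: "countable rat_complex"
  unfolding rat_complex_def by (intro countable_image countable_SIGMA countable_rat)

lemma rat_complex_dense:
  assumes "0 < e" shows "\<exists>q\<in>rat_complex. cmod (q - c) < e"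
proof -
  obtain a where a: "a \<in> \<rat>" "Re c - e / 2 < a" "a < Re c + e / 2"
    using Rats_dense_in_real[of "Re c - e / 2" "Re c + e / 2"] assms by auto
  obtain b where b: "b \<in> \<rat>" "Im c - e / 2 < b" "b < Im c + e / 2"
    using Rats_dense_in_real[of "Im c - e / 2" "Im c + e / 2"] assms by auto
  have "cmod (Complex a b - c) \<le> \<bar>Re (Complex a b - c)\<bar> + \<bar>Im (Complex a b - c)\<bar>" by (rule cmod_le)
  also have "\<dots> < e" using a b by simp
  finally show ?thesis using a b by (auto simp: rat_complex_def intro!: bexI[of _ "Complex a b"])
qed

text \<open>Both sides are continuous in \<open>u\<close>, so rational vectors and gaps
  \<open>1 / Suc n\<close> suffice, and the event becomes a countable combination of measurable
  ones.\<close>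

lemma spec_below_countable:
  "spec_below k A w x \<longleftrightarrow> (\<exists>n::nat. \<forall>u\<in>Pi\<^sub>E {..<k} (\<lambda>_. rat_complex).
     herm_form k A u + (cmod (cip k w u))\<^sup>2 \<le> (x - 1 / real (Suc n)) * sqnorm k u)"
proof
  assume "spec_below k A w x"
  then obtain e where e: "0 < e" "\<And>u. herm_form k A u + (cmod (cip k w u))\<^sup>2 \<le> (x - e) * sqnorm k u"
    by (auto simp: spec_below_def)
  obtain n where n: "1 / real (Suc n) < e" using e(1) nat_approx_posE by blast
  have "herm_form k A u + (cmod (cip k w u))\<^sup>2 \<le> (x - 1 / real (Suc n)) * sqnorm k u" for u
    by (rule order_trans[OF e(2)]) (use n in \<open>auto intro!: mult_right_mono sqnorm_nonneg\<close>)
  then show "\<exists>n::nat. \<forall>u\<in>Pi\<^sub>E {..<k} (\<lambda>_. rat_complex). herm_form k A u + (cmod (cip k w u))\<^sup>2 \<le> (x - 1 / real (Suc n)) * sqnorm k u" by blast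
next
  assume "\<exists>n::nat. \<forall>u\<in>Pi\<^sub>E {..<k} (\<lambda>_. rat_complex). herm_form k A u + (cmod (cip k w u))\<^sup>2 \<le> (x - 1 / real (Suc n)) * sqnorm k u"
  then obtain n where n: "\<And>u. u \<in> Pi\<^sub>E {..<k} (\<lambda>_. rat_complex) \<Longrightarrow> herm_form k A u + (cmod (cip k w u))\<^sup>2 \<le> (x - 1 / real (Suc n)) * sqnorm k u" by blast
  have "herm_form k A u + (cmod (cip k w u))\<^sup>2 \<le> (x - 1 / real (Suc n)) * sqnorm k u" for u
  proof -
    define q where "q m i = (SOME q. q \<in> rat_complex \<and> cmod (q - u i) < 1 / real (Suc m))" for m i
    have "q m i \<in> rat_complex \<and> cmod (q m i - u i) < 1 / real (Suc m)" for i m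
      unfolding q_def by (rule someI_ex) (use rat_complex_dense[of "1 / real (Suc m)" "u i"] in auto)
    then have q: "\<And>i m. q m i \<in> rat_complex" "\<And>i m. cmod (q m i - u i) < 1 / real (Suc m)" by auto
    define U where "U m = restrict (q m) {..<k}" for m
    have lim: "(\<lambda>m. U m i) \<longlonglongrightarrow> u i" if "i < k" for i
    proof -
      have "(\<lambda>m. q m i - u i) \<longlonglongrightarrow> 0"
      proof (rule Lim_null_comparison)
        show "\<forall>\<^sub>F m in sequentially. cmod (q m i - u i) \<le> 1 / real (Suc m)"
          by (intro always_eventually allI less_imp_le q)
        show "(\<lambda>m. 1 / real (Suc m)) \<longlonglongrightarrow> 0"
          by (rule LIMSEQ_inverse_real_of_nat[unfolded inverse_eq_divide])
      qed
      then show ?thesis using that by (simp add: U_def LIM_zero_iff)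
    qed
    have "(\<lambda>m. herm_form k A (U m) + (cmod (cip k w (U m)))\<^sup>2) \<longlonglongrightarrow> herm_form k A u + (cmod (cip k w u))\<^sup>2"
      unfolding herm_form_def cip_def by (intro tendsto_intros lim) auto
    moreover have "(\<lambda>m. (x - 1 / real (Suc n)) * sqnorm k (U m)) \<longlonglongrightarrow> (x - 1 / real (Suc n)) * sqnorm k u"
      unfolding sqnorm_def by (intro tendsto_intros lim) auto
    moreover have "U m \<in> Pi\<^sub>E {..<k} (\<lambda>_. rat_complex)" for m using q(1) by (auto simp: U_def)
    ultimately show ?thesis using n by (intro LIMSEQ_le[of "\<lambda>m. herm_form k A (U m) + (cmod (cip k w (U m)))\<^sup>2" _ "\<lambda>m. (x - 1 / real (Suc n)) * sqnorm k (U m)"]) auto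
  qed
  then show "spec_below k A w x" unfolding spec_below_def by (intro exI[of _ "1 / real (Suc n)"]) simp
qed

lemma measurable_spec_below:
  assumes A: "\<And>i j. i < k \<Longrightarrow> j < k \<Longrightarrow> (\<lambda>z. A z i j) \<in> borel_measurable M"
    and w: "\<And>i. i < k \<Longrightarrow> (\<lambda>z. w z i) \<in> borel_measurable M"
  shows "Measurable.pred M (\<lambda>z. spec_below k (A z) (w z) x)"
proof -
  have cnt: "countable (Pi\<^sub>E {..<k} (\<lambda>_. rat_complex))"
    by (intro countable_PiE countable_rat_complex) auto
  have [measurable]: "(\<lambda>z. herm_form k (A z) u) \<in> borel_measurable M" for u
    unfolding herm_form_def
    by (intro borel_measurable_Re[THEN measurable_compose[rotated]] borel_measurable_sum borel_measurable_times borel_measurable_const A) auto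
  have [measurable]: "(\<lambda>z. cip k (w z) u) \<in> borel_measurable M" for u
  proof -
    have "(\<lambda>z. cnj (w z i)) \<in> borel_measurable M" if "i < k" for i
      using w[OF that] by (simp add: borel_measurable_complex_iff)
    then show ?thesis unfolding cip_def by (intro borel_measurable_sum borel_measurable_times borel_measurable_const) auto
  qed
  let ?D = "Pi\<^sub>E {..<k} (\<lambda>_. rat_complex)"
  have "?D \<noteq> {}" using rat_complex_dense[of 1 0] by (auto simp: PiE_eq_empty_iff)
  then have "(\<forall>u\<in>?D. P u) \<longleftrightarrow> (\<forall>m. P (from_nat_into ?D m))" for P
    using cnt by (metis from_nat_into from_nat_into_surj)
  then show ?thesis
    unfolding spec_below_countable by simp
qed

section \<open>From the random matrix to the chain\<close>

definition spike_vec :: "real \<Rightarrow> nat \<Rightarrow> complex" where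
  "spike_vec c = (\<lambda>i. if i = 0 then of_real (sqrt c) else 0)"

lemma sqnorm_spike_vec: "0 \<le> c \<Longrightarrow> 0 < k \<Longrightarrow> sqnorm k (spike_vec c) = c"
proof -
  assume c: "0 \<le> c" and k: "0 < k"
  have "sqnorm k (spike_vec c) = (\<Sum>i\<in>{0}. (cmod (spike_vec c i))\<^sup>2)"
    unfolding sqnorm_def using k by (intro sum.mono_neutral_right) (auto simp: spike_vec_def)
  then show ?thesis using c by (simp add: spike_vec_def)
qed

lemma measurable_gue:
  assumes "i < k" "j < k"
  shows "(\<lambda>z. gue N z i j) \<in> borel_measurable (std_gauss (sq k))"
proof -
  have "(\<lambda>z. herm z i j) \<in> borel_measurable (std_gauss (sq k))"
    using measurable_herm[OF assms] by (simp cong: measurable_cong_sets)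
  then show ?thesis unfolding gue_def by measurable
qed

lemma conj_refl_scale: "conj_refl k d (\<lambda>i j. H i j / of_real s) i j = conj_refl k d H i j / of_real s"
  unfolding conj_refl_explicit
  by (simp add: diff_divide_distrib add_divide_distrib sum_divide_distrib[symmetric])

lemma gue_prob_direction_invariant:
  assumes n: "sqnorm k w = sqnorm k w'"
  shows "(\<integral>\<^sup>+z. F (spec_below k (gue N z) w x) \<partial>std_gauss (sq k)) = (\<integral>\<^sup>+z. F (spec_below k (gue N z) w' x) \<partial>std_gauss (sq k))"
proof -
  obtain d where d: "\<And>u. cmod (cip k w (refl_app k d u)) = cmod (cip k w' u)"
    using exists_reflection[OF n] by blast
  have [measurable]: "reflect_coords k d \<in> std_gauss (sq k) \<rightarrow>\<^sub>M std_gauss (sq k)"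
    using measurable_reflect_coords[of k d] by (simp cong: measurable_cong_sets)
  have [measurable]: "Measurable.pred (std_gauss (sq k)) (\<lambda>z. spec_below k (gue N z) w' x)"
    by (intro measurable_spec_below measurable_gue) auto
  have F: "F b = (if b then F True else F False)" for b by simp
  have [measurable]: "(\<lambda>z. F (spec_below k (gue N z) w' x)) \<in> borel_measurable (std_gauss (sq k))"
    by (subst F) measurable
  have "spec_below k (gue N (reflect_coords k d z)) w' x \<longleftrightarrow> spec_below k (gue N z) w x" for z
  proof -
    have "spec_below k (gue N (reflect_coords k d z)) w' x \<longleftrightarrow> spec_below k (conj_refl k d (gue N z)) w' x"
    proof (rule spec_below_cong)
      fix i j assume "i < k" "j < k"
      then show "gue N (reflect_coords k d z) i j = conj_refl k d (gue N z) i j"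
        unfolding gue_def[abs_def] conj_refl_scale by (simp add: herm_reflect_coords)
    qed simp
    then show ?thesis using spec_below_conj_refl[OF d] by simp
  qed
  then have "(\<integral>\<^sup>+z. F (spec_below k (gue N z) w x) \<partial>std_gauss (sq k)) = (\<integral>\<^sup>+z. F (spec_below k (gue N (reflect_coords k d z)) w' x) \<partial>std_gauss (sq k))"
    by simp
  also have "\<dots> = (\<integral>\<^sup>+z. F (spec_below k (gue N z) w' x) \<partial>distr (std_gauss (sq k)) (std_gauss (sq k)) (reflect_coords k d))"
    by (rule nn_integral_distr[symmetric]) measurable
  also have "distr (std_gauss (sq k)) (std_gauss (sq k)) (reflect_coords k d) = distr (std_gauss (sq k)) (Pi\<^sub>M (sq k) (\<lambda>_. borel)) (reflect_coords k d)"
    by (intro distr_cong) auto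
  also have "\<dots> = std_gauss (sq k)" by (rule std_gauss_reflect_coords_invariant)
  finally show ?thesis .
qed

text \<open>\<open>N\<close> stays fixed while \<open>k\<close> decreases, because corners keep the
  scaling of the full matrix. At \<open>k = 0\<close> the chain may stand at any \<open>c\<close>
  although every vector has length 0, hence the case distinction in the hypothesis on
  \<open>w\<close>.\<close>

lemma gue_prob_eq_chain:
  fixes F :: "bool \<Rightarrow> ennreal"
  assumes N: "0 < N" and meas: "\<And>k. chain N x F k \<in> borel_measurable borel"
    and w: "sqnorm k w = (if k = 0 then 0 else c)" and c: "0 \<le> c"
  shows "(\<integral>\<^sup>+z. F (spec_below k (gue N z) w x) \<partial>std_gauss (sq k)) = chain N x F k c"
  using w c
proof (induction k arbitrary: w c)
  case 0
  interpret prob_space "std_gauss (sq 0)" by (rule prob_space_std_gauss)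
  have "spec_below 0 A w x" for A by (auto simp: spec_below_def herm_form_def cip_def sqnorm_def intro: exI[of _ 1])
  then show ?case using emeasure_space_1 by simp
next
  case (Suc k)
  define J where "J = insert (k, k) ((\<lambda>i. (i, k)) ` {..<k} \<union> (\<lambda>i. (k, i)) ` {..<k})"
  have J: "J \<inter> sq k = {}" "finite J" "sq (Suc k) = J \<union> sq k" by (auto simp: J_def less_Suc_eq)
  interpret S: prob_space std_normal by (rule prob_space_std_normal)
  interpret P: product_sigma_finite "\<lambda>_::nat \<times> nat. std_normal" by standard
  define ek where "ek = (\<lambda>i. if i = k then complex_of_real (sqrt c) else 0)"
  have F: "F b = (if b then F True else F False)" for b by simp
  have nek: "sqnorm (Suc k) ek = sqnorm (Suc k) w"
    using Suc.prems by (simp add: sqnorm_def ek_def)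
  have [measurable]: "(\<lambda>z. F (spec_below (Suc k) (gue N z) ek x)) \<in> borel_measurable (Pi\<^sub>M (J \<union> sq k) (\<lambda>_. std_normal))"
  proof -
    have [measurable]: "Measurable.pred (std_gauss (sq (Suc k))) (\<lambda>z. spec_below (Suc k) (gue N z) ek x)"
      by (intro measurable_spec_below measurable_gue) auto
    have "(\<lambda>z. F (spec_below (Suc k) (gue N z) ek x)) \<in> borel_measurable (std_gauss (sq (Suc k)))"
      by (subst F) measurable
    then show ?thesis by (simp add: std_gauss_def J(3))
  qed
  define a where "a y = y (k, k) / sqrt (real N)" for y :: "nat \<times> nat \<Rightarrow> real"
  define g where "g y = (\<Sum>i<k. ((y (i, k))\<^sup>2 + (y (k, i))\<^sup>2) / (2 * real N))" for y :: "nat \<times> nat \<Rightarrow> real"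
  have "(\<integral>\<^sup>+z. F (spec_below (Suc k) (gue N z) w x) \<partial>std_gauss (sq (Suc k))) = (\<integral>\<^sup>+z. F (spec_below (Suc k) (gue N z) ek x) \<partial>std_gauss (sq (Suc k)))"
    by (rule gue_prob_direction_invariant[OF nek[symmetric]])
  also have "\<dots> = (\<integral>\<^sup>+y. (\<integral>\<^sup>+z. F (spec_below (Suc k) (gue N (merge J (sq k) (y, z))) ek x) \<partial>std_gauss (sq k)) \<partial>std_gauss J)"
    unfolding std_gauss_def J(3) using J by (subst P.product_nn_integral_fold) auto
  also have "\<dots> = (\<integral>\<^sup>+y. (if 0 < x - a y - c then chain N x F k (g y / (x - a y - c)) else F False) \<partial>std_gauss J)"
  proof (rule nn_integral_cong)
    fix y :: "nat \<times> nat \<Rightarrow> real"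
    interpret gk: prob_space "std_gauss (sq k)" by (rule prob_space_std_gauss)
    define Y where "Y = x - a y - c"
    \<comment> \<open>The removed column over \<open>sqrt Y\<close>. It depends on \<open>y\<close>
      only, so inside the inner integral it is a fixed vector, of squared length
      \<open>g y / Y\<close> when \<open>Y\<close> is positive.\<close>
    define v where "v = (\<lambda>i. Complex (y (i, k) / sqrt 2) (y (k, i) / sqrt 2) / of_real (sqrt (real N)) / of_real (sqrt Y))"
    have eq: "spec_below (Suc k) (gue N (merge J (sq k) (y, z))) ek x \<longleftrightarrow> 0 < Y \<and> spec_below k (gue N z) v x" for z
    proof -
      define z' where "z' = merge J (sq k) (y, z)"
      have z'J: "z' p = y p" if "p \<in> J" for p using that by (simp add: z'_def merge_def)
      have z'k: "z' p = z p" if "p \<in> sq k" for p using that J(1) by (auto simp: z'_def merge_def)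
      have r1: "Re (gue N z' k k) = a y" using z'J[of "(k, k)"] by (simp add: gue_def herm_def a_def J_def)
      have r2: "gue N z' k i = cnj (gue N z' i k)" for i
        unfolding gue_def by (subst herm_hermitian) simp
      have "spec_below (Suc k) (gue N z') ek x \<longleftrightarrow> 0 < Y \<and> spec_below k (gue N z') (\<lambda>i. gue N z' i k / of_real (sqrt Y)) x"
        unfolding ek_def
      proof (rule spec_below_Suc)
        show "Y = x - Re (gue N z' k k) - c" by (simp only: r1 Y_def)
      qed (rule r2 Suc.prems)+
      also have "spec_below k (gue N z') (\<lambda>i. gue N z' i k / of_real (sqrt Y)) x \<longleftrightarrow> spec_below k (gue N z) v x"
      proof (rule spec_below_cong)
        show "gue N z' i j = gue N z i j" if "i < k" "j < k" for i j
          unfolding gue_def using that by (intro arg_cong2[where f = "(/)"] herm_cong refl z'k) auto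
        show "gue N z' i k / of_real (sqrt Y) = v i" if "i < k" for i
        proof -
          have "herm z' i k = herm y i k" using that by (intro herm_cong z'J) (auto simp: J_def)
          then show ?thesis using that by (simp add: gue_def v_def herm_def)
        qed
      qed
      finally show ?thesis by (simp add: z'_def)
    qed
    show "(\<integral>\<^sup>+z. F (spec_below (Suc k) (gue N (merge J (sq k) (y, z))) ek x) \<partial>std_gauss (sq k))
        = (if 0 < x - a y - c then chain N x F k (g y / (x - a y - c)) else F False)"
    proof (cases "0 < Y")
      case True
      have "sqnorm k v = g y / Y"
        unfolding sqnorm_def g_def v_def sum_divide_distrib
        using True by (intro sum.cong refl) (simp add: norm_divide power_divide cmod_power2 real_sqrt_mult field_simps N)
      moreover have "0 \<le> g y / Y" using True N by (auto simp: g_def intro!: divide_nonneg_pos sum_nonneg)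
      ultimately have "(\<integral>\<^sup>+z. F (spec_below k (gue N z) v x) \<partial>std_gauss (sq k)) = chain N x F k (g y / Y)"
        by (intro Suc.IH) (auto simp: g_def)
      then show ?thesis using True unfolding eq by (simp add: Y_def)
    next
      case False
      then show ?thesis using gk.emeasure_space_1 unfolding eq by (simp add: Y_def)
    qed
  qed
  also have "\<dots> = (\<integral>\<^sup>+a. (\<integral>\<^sup>+g. (if 0 < x - a - c then chain N x F k (g / (x - a - c)) else F False) \<partial>gamma_law N k) \<partial>normal_law N)"
  proof -
    note [measurable] = meas
    show ?thesis
      unfolding a_def g_def J_def
      using std_gauss_row_law[OF N, of "\<lambda>(a, g). if 0 < x - a - c then chain N x F k (g / (x - a - c)) else F False" k]
      by simp
  qed
  also have "\<dots> = chain N x F (Suc k) c" by (simp add: step_op_def)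
  finally show ?case .
qed

lemma emeasure_spec_below:
  assumes N: "0 < N" and c: "0 \<le> c" and k: "0 < k"
  shows "emeasure (std_gauss (sq k)) {z \<in> space (std_gauss (sq k)). spec_below k (gue N z) (spike_vec c) x} = surv N x k c"
    and "emeasure (std_gauss (sq k)) {z \<in> space (std_gauss (sq k)). \<not> spec_below k (gue N z) (spike_vec c) x} = dead N x k c"
proof -
  have [measurable]: "Measurable.pred (std_gauss (sq k)) (\<lambda>z. spec_below k (gue N z) (spike_vec c) x)"
    by (intro measurable_spec_below measurable_gue) auto
  have "emeasure (std_gauss (sq k)) {z \<in> space (std_gauss (sq k)). spec_below k (gue N z) (spike_vec c) x}
    = (\<integral>\<^sup>+z. indicator {z \<in> space (std_gauss (sq k)). spec_below k (gue N z) (spike_vec c) x} z \<partial>std_gauss (sq k))"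
    by (intro nn_integral_indicator[symmetric]) measurable
  also have "\<dots> = (\<integral>\<^sup>+z. (\<lambda>b. if b then 1 else 0) (spec_below k (gue N z) (spike_vec c) x) \<partial>std_gauss (sq k))"
    by (intro nn_integral_cong) (auto simp: indicator_def)
  also have "\<dots> = surv N x k c"
    using sqnorm_spike_vec[OF c k] k c by (intro gue_prob_eq_chain N measurable_surv) auto
  finally show "emeasure (std_gauss (sq k)) {z \<in> space (std_gauss (sq k)). spec_below k (gue N z) (spike_vec c) x} = surv N x k c" .
  have "emeasure (std_gauss (sq k)) {z \<in> space (std_gauss (sq k)). \<not> spec_below k (gue N z) (spike_vec c) x}
    = (\<integral>\<^sup>+z. indicator {z \<in> space (std_gauss (sq k)). \<not> spec_below k (gue N z) (spike_vec c) x} z \<partial>std_gauss (sq k))"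
    by (intro nn_integral_indicator[symmetric]) measurable
  also have "\<dots> = (\<integral>\<^sup>+z. (\<lambda>b. if b then 0 else 1) (spec_below k (gue N z) (spike_vec c) x) \<partial>std_gauss (sq k))"
    by (intro nn_integral_cong) (auto simp: indicator_def)
  also have "\<dots> = dead N x k c"
    using sqnorm_spike_vec[OF c k] k c by (intro gue_prob_eq_chain N measurable_dead) auto
  finally show "emeasure (std_gauss (sq k)) {z \<in> space (std_gauss (sq k)). \<not> spec_below k (gue N z) (spike_vec c) x} = dead N x k c" .
qed

section \<open>The largest eigenvalue\<close>

definition sesq_form :: "nat \<Rightarrow> (nat \<Rightarrow> nat \<Rightarrow> complex) \<Rightarrow> (nat \<Rightarrow> complex) \<Rightarrow> (nat \<Rightarrow> complex) \<Rightarrow> complex" where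
  "sesq_form k A u v = (\<Sum>i<k. \<Sum>j<k. cnj (u i) * A i j * v j)"

lemma herm_form_eq_sesq_form: "herm_form k A u = Re (sesq_form k A u u)"
  by (simp add: herm_form_def sesq_form_def)

lemma norm_le_sqnorm: "i < k \<Longrightarrow> (cmod (u i))\<^sup>2 \<le> sqnorm k u"
  unfolding sqnorm_def by (rule member_le_sum) auto

lemma herm_form_bound: "\<bar>herm_form k A u\<bar> \<le> (\<Sum>i<k. \<Sum>j<k. cmod (A i j)) * sqnorm k u"
proof -
  have "\<bar>herm_form k A u\<bar> \<le> cmod (sesq_form k A u u)" unfolding herm_form_eq_sesq_form by (rule abs_Re_le_cmod)
  also have "\<dots> \<le> (\<Sum>i<k. \<Sum>j<k. cmod (cnj (u i) * A i j * u j))"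
    unfolding sesq_form_def by (intro order_trans[OF norm_sum] sum_mono norm_sum)
  also have "\<dots> \<le> (\<Sum>i<k. \<Sum>j<k. cmod (A i j) * sqnorm k u)"
  proof (intro sum_mono)
    fix i j assume ij: "i \<in> {..<k}" "j \<in> {..<k}"
    have "cmod (u i) * cmod (u j) \<le> ((cmod (u i))\<^sup>2 + (cmod (u j))\<^sup>2) / 2"
      using zero_le_power2[of "cmod (u i) - cmod (u j)"] by (simp add: power2_eq_square algebra_simps)
    also have "\<dots> \<le> sqnorm k u" using norm_le_sqnorm[of i k u] norm_le_sqnorm[of j k u] ij by simp
    finally have "cmod (A i j) * (cmod (u i) * cmod (u j)) \<le> cmod (A i j) * sqnorm k u" by (intro mult_left_mono) auto
    then show "cmod (cnj (u i) * A i j * u j) \<le> cmod (A i j) * sqnorm k u" by (simp add: norm_mult mult_ac)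
  qed
  also have "\<dots> = (\<Sum>i<k. \<Sum>j<k. cmod (A i j)) * sqnorm k u" by (simp add: sum_distrib_right)
  finally show ?thesis .
qed

lemma sesq_form_hermitian:
  assumes "\<And>i j. i < k \<Longrightarrow> j < k \<Longrightarrow> A i j = cnj (A j i)"
  shows "sesq_form k A u v = cnj (sesq_form k A v u)"
proof -
  have "cnj (sesq_form k A v u) = (\<Sum>i<k. \<Sum>j<k. v i * cnj (A i j) * cnj (u j))" by (simp add: sesq_form_def)
  also have "\<dots> = (\<Sum>j<k. \<Sum>i<k. v i * cnj (A i j) * cnj (u j))" by (rule sum.swap)
  also have "\<dots> = sesq_form k A u v"
    unfolding sesq_form_def
  proof (intro sum.cong refl)
    fix i j assume "i \<in> {..<k}" "j \<in> {..<k}"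
    then show "v j * cnj (A j i) * cnj (u i) = cnj (u i) * A i j * v j" using assms[of i j] by simp
  qed
  finally show ?thesis ..
qed

lemma herm_form_diff:
  assumes "\<And>i j. i < k \<Longrightarrow> j < k \<Longrightarrow> A i j = cnj (A j i)"
  shows "herm_form k A (\<lambda>i. u i - of_real s * v i) = herm_form k A u - 2 * s * Re (sesq_form k A u v) + s\<^sup>2 * herm_form k A v"
proof -
  have "sesq_form k A (\<lambda>i. u i - of_real s * v i) (\<lambda>i. u i - of_real s * v i)
    = sesq_form k A u u - of_real s * sesq_form k A u v - of_real s * sesq_form k A v u + of_real (s\<^sup>2) * sesq_form k A v v"
    unfolding sesq_form_def by (simp add: algebra_simps sum.distrib sum_subtractf sum_distrib_left power2_eq_square)
  moreover have "Re (sesq_form k A v u) = Re (sesq_form k A u v)" by (subst sesq_form_hermitian[OF assms]) auto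
  ultimately show ?thesis unfolding herm_form_eq_sesq_form by simp
qed

lemma spec_below_mono:
  assumes "spec_below k A w t" "t \<le> t'" shows "spec_below k A w t'"
proof -
  obtain e where e: "0 < e" "\<And>u. herm_form k A u + (cmod (cip k w u))\<^sup>2 \<le> (t - e) * sqnorm k u"
    using assms(1) by (auto simp: spec_below_def)
  have "herm_form k A u + (cmod (cip k w u))\<^sup>2 \<le> (t' - e) * sqnorm k u" for u
    by (rule order_trans[OF e(2)]) (use assms(2) in \<open>auto intro!: mult_right_mono sqnorm_nonneg\<close>)
  then show ?thesis using e(1) by (auto simp: spec_below_def)
qed

section \<open>Eigenvalues and the quadratic form\<close>

lemma mult_mat_vec_index:
  assumes "A \<in> carrier_mat n n" "v \<in> carrier_vec n" "i < n"
  shows "vec_index (A *\<^sub>v v) i = (\<Sum>j<n. A $$ (i, j) * vec_index v j)"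
  using assms by (simp add: scalar_prod_def atLeast0LessThan)

lemma eigenvector_sum:
  assumes A: "A \<in> carrier_mat n n" and ev: "eigenvector A v l"
  shows "sesq_form n (\<lambda>i j. A $$ (i, j)) (vec_index v) (vec_index v) = l * of_real (sqnorm n (vec_index v))" "0 < sqnorm n (vec_index v)"
proof -
  have v: "v \<in> carrier_vec n" "v \<noteq> 0\<^sub>v n" "A *\<^sub>v v = l \<cdot>\<^sub>v v"
    using ev A by (auto simp: eigenvector_def)
  have e: "(\<Sum>j<n. A $$ (i, j) * vec_index v j) = l * vec_index v i" if "i < n" for i
    using mult_mat_vec_index[OF A v(1) that] v that by simp
  have "sesq_form n (\<lambda>i j. A $$ (i, j)) (vec_index v) (vec_index v) = (\<Sum>i<n. cnj (vec_index v i) * (\<Sum>j<n. A $$ (i, j) * vec_index v j))"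
    by (simp add: sesq_form_def sum_distrib_left mult.assoc)
  also have "\<dots> = (\<Sum>i<n. l * of_real ((cmod (vec_index v i))\<^sup>2))"
    by (intro sum.cong refl) (simp only: e lessThan_iff complex_norm_square, simp add: mult_ac)
  finally show "sesq_form n (\<lambda>i j. A $$ (i, j)) (vec_index v) (vec_index v) = l * of_real (sqnorm n (vec_index v))"
    by (simp add: sqnorm_def sum_distrib_left)
  obtain i where "i < n" "vec_index v i \<noteq> 0"
    using v by (metis carrier_vecD eq_vecI index_zero_vec(1) index_zero_vec(2))
  then have "0 < (cmod (vec_index v i))\<^sup>2" by simp
  also have "\<dots> \<le> sqnorm n (vec_index v)" using \<open>i < n\<close> by (rule norm_le_sqnorm)
  finally show "0 < sqnorm n (vec_index v)" .
qed

text \<open>No diagonalisation: \<open>B\<close>, the matrix of \<open>t - A\<close>, is positive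
  semidefinite and invertible. With \<open>B v = u\<close>, nonnegativity of the form at
  \<open>u - v / K\<close> yields the lower bound \<open>sqnorm n u / K\<close> for the form at
  \<open>u\<close>, once \<open>K\<close> bounds the inverse.\<close>

lemma noneigenvalue_coercive:
  fixes A :: "complex mat"
  assumes A: "A \<in> carrier_mat n n" and herm: "\<And>i j. i < n \<Longrightarrow> j < n \<Longrightarrow> A $$ (i, j) = cnj (A $$ (j, i))"
    and psd: "\<And>u. herm_form n (\<lambda>i j. A $$ (i, j)) u \<le> t * sqnorm n u" and t: "\<not> eigenvalue A (of_real t)"
  shows "spec_below n (\<lambda>i j. A $$ (i, j)) (\<lambda>_. 0) t"
proof -
  define D where "D = char_matrix A (of_real t)"
  have D: "D \<in> carrier_mat n n" unfolding D_def using A by simp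
  have "Determinant.det D \<noteq> 0" using t eigenvalue_det[OF A] by (simp add: D_def)
  from det_non_zero_imp_unit[OF D this]
  obtain C where C: "C \<in> carrier_mat n n" "D * C = 1\<^sub>m n"
    by (auto simp: Units_def ring_mat_def)
  define B where "B = (\<lambda>i j. - (D $$ (i, j)))"
  have Dij: "D $$ (i, j) = A $$ (i, j) - (if i = j then of_real t else 0)" if "i < n" "j < n" for i j
    using A that by (auto simp: D_def char_matrix_def)
  have Bherm: "B i j = cnj (B j i)" if "i < n" "j < n" for i j
    using herm[OF that] that by (auto simp: B_def Dij)
  have hqB: "herm_form n B u = t * sqnorm n u - herm_form n (\<lambda>i j. A $$ (i, j)) u" for u
  proof -
    have "sesq_form n B u u = (\<Sum>i<n. \<Sum>j<n. (if i = j then of_real t * (cnj (u i) * u i) else 0) - cnj (u i) * A $$ (i, j) * u j)"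
      unfolding sesq_form_def by (intro sum.cong refl) (auto simp: B_def Dij algebra_simps)
    also have "\<dots> = (\<Sum>i<n. of_real t * (cnj (u i) * u i)) - sesq_form n (\<lambda>i j. A $$ (i, j)) u u"
      by (simp add: sum_subtractf sesq_form_def)
    also have "(\<Sum>i<n. of_real t * (cnj (u i) * u i)) = of_real (t * sqnorm n u)"
      unfolding sqnorm_def sum_distrib_left of_real_sum of_real_mult
      by (intro sum.cong refl) (simp only: complex_norm_square, simp add: mult_ac)
    finally show ?thesis unfolding herm_form_eq_sesq_form by simp
  qed
  \<comment> \<open>A bound for the form of the inverse; the added 1 makes it positive.\<close>
  define K where "K = (\<Sum>i<n. \<Sum>j<n. cmod (C $$ (i, j))) + 1"
  have K: "0 < K" unfolding K_def by (intro add_nonneg_pos sum_nonneg) auto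
  have main: "sqnorm n u / K \<le> herm_form n B u" for u
  proof -
    define uv where "uv = Matrix.vec n u"
    define v where "v i = - vec_index (C *\<^sub>v uv) i" for i
    have uv: "uv \<in> carrier_vec n" by (simp add: uv_def)
    have Cuv: "C *\<^sub>v uv \<in> carrier_vec n" using C uv by simp
    have "D *\<^sub>v (C *\<^sub>v uv) = uv" using C D uv by (simp add: assoc_mult_mat_vec[symmetric])
    then have "(\<Sum>j<n. D $$ (i, j) * vec_index (C *\<^sub>v uv) j) = u i" if "i < n" for i
      using mult_mat_vec_index[OF D Cuv that] that by (simp add: uv_def)
    then have Bv: "(\<Sum>j<n. B i j * v j) = u i" if "i < n" for i
      using that by (simp add: B_def v_def)
    have sluv: "sesq_form n B w v = cip n w u" for w
      unfolding sesq_form_def cip_def by (intro sum.cong refl) (simp add: mult.assoc sum_distrib_left[symmetric] Bv)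
    have vC: "v i = - (\<Sum>j<n. C $$ (i, j) * u j)" if "i < n" for i
      using mult_mat_vec_index[OF C(1) uv that] by (simp add: v_def uv_def)
    have Qv: "herm_form n B v \<le> K * sqnorm n u"
    proof -
      have "herm_form n B v = Re (cip n v u)" unfolding herm_form_eq_sesq_form sluv ..
      also have "cip n v u = - cnj (sesq_form n (\<lambda>i j. C $$ (i, j)) u u)"
        unfolding cip_def sesq_form_def cnj_sum sum_negf[symmetric]
        by (intro sum.cong refl) (simp add: vC sum_distrib_right sum_distrib_left sum_negf mult_ac)
      also have "Re \<dots> = - herm_form n (\<lambda>i j. C $$ (i, j)) u" by (simp add: herm_form_eq_sesq_form)
      also have "\<dots> \<le> (\<Sum>i<n. \<Sum>j<n. cmod (C $$ (i, j))) * sqnorm n u" using herm_form_bound[of n "\<lambda>i j. C $$ (i, j)" u] by linarith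
      also have "\<dots> \<le> K * sqnorm n u" unfolding K_def by (intro mult_right_mono sqnorm_nonneg) simp
      finally show ?thesis .
    qed
    have "0 \<le> herm_form n B (\<lambda>i. u i - of_real (1 / K) * v i)" unfolding hqB using psd by simp
    also have "\<dots> = herm_form n B u - 2 * (1 / K) * Re (sesq_form n B u v) + (1 / K)\<^sup>2 * herm_form n B v"
      by (rule herm_form_diff[OF Bherm])
    also have "Re (sesq_form n B u v) = sqnorm n u"
    proof -
      have "cip n u u = of_real (sqnorm n u)"
        unfolding cip_def sqnorm_def of_real_sum by (intro sum.cong refl) (simp only: complex_norm_square, simp add: mult.commute)
      then show ?thesis unfolding sluv by simp
    qed
    also have "(1 / K)\<^sup>2 * herm_form n B v \<le> (1 / K)\<^sup>2 * (K * sqnorm n u)" by (intro mult_left_mono Qv) simp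
    also have "(1 / K)\<^sup>2 * (K * sqnorm n u) = sqnorm n u / K" using K by (simp add: power2_eq_square)
    finally show ?thesis by simp
  qed
  have "herm_form n (\<lambda>i j. A $$ (i, j)) u + (cmod (cip n (\<lambda>_. 0) u))\<^sup>2 \<le> (t - 1 / K) * sqnorm n u" for u
    using main[of u] unfolding hqB by (simp add: cip_def algebra_simps)
  then show ?thesis unfolding spec_below_def using K by (intro exI[of _ "1 / K"]) simp
qed

lemma real_eigenvalues:
  fixes A :: "complex mat"
  assumes A: "A \<in> carrier_mat n n" and n: "0 < n" and herm: "\<And>i j. i < n \<Longrightarrow> j < n \<Longrightarrow> A $$ (i, j) = cnj (A $$ (j, i))"
  shows "finite {x :: real. eigenvalue A (of_real x)}" "{x :: real. eigenvalue A (of_real x)} \<noteq> {}"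
proof -
  have "{x :: real. eigenvalue A (of_real x)} = of_real -` spectrum A" by (auto simp: spectrum_def)
  then show "finite {x :: real. eigenvalue A (of_real x)}"
    using card_finite_spectrum(1)[OF A] by (simp add: finite_vimageI inj_on_def)
  obtain l where "eigenvalue A l" using spectrum_non_empty[OF A n] by (auto simp: spectrum_def)
  then obtain v where v: "eigenvector A v l" by (auto simp: eigenvalue_def)
  let ?s = "sesq_form n (\<lambda>i j. A $$ (i, j)) (vec_index v) (vec_index v)"
  have "?s = cnj ?s" by (rule sesq_form_hermitian[OF herm])
  then have "l * of_real (sqnorm n (vec_index v)) = cnj l * of_real (sqnorm n (vec_index v))"
    using eigenvector_sum(1)[OF A v] by simp
  then have "l = cnj l" using eigenvector_sum(2)[OF A v] by simp
  then have "l = of_real (Re l)" by (simp add: complex_eq_iff)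
  then have "eigenvalue A (of_real (Re l))" using \<open>eigenvalue A l\<close> by simp
  then show "{x :: real. eigenvalue A (of_real x)} \<noteq> {}" by blast
qed

text \<open>The infimum \<open>t\<close> of all admissible bounds is an eigenvalue, since otherwise
  \<open>noneigenvalue_coercive\<close> would give a smaller bound. If \<open>spec_below\<close>
  fails at \<open>x\<close>, then \<open>t \<ge> x\<close>, so not all eigenvalues lie below
  \<open>x\<close>.\<close>

lemma largest_eigenvalue_less_iff:
  fixes A :: "complex mat"
  assumes A: "A \<in> carrier_mat n n" and n: "0 < n" and herm: "\<And>i j. i < n \<Longrightarrow> j < n \<Longrightarrow> A $$ (i, j) = cnj (A $$ (j, i))"
  shows "largest_eigenvalue A < x \<longleftrightarrow> spec_below n (\<lambda>i j. A $$ (i, j)) (\<lambda>_. 0) x"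
proof -
  note ev = real_eigenvalues[OF A n herm]
  have max: "largest_eigenvalue A < x \<longleftrightarrow> (\<forall>l. eigenvalue A (of_real l) \<longrightarrow> l < x)"
    unfolding largest_eigenvalue_def using ev by auto
  let ?A = "\<lambda>i j. A $$ (i, j)"
  show ?thesis
    unfolding max
  proof
    assume "spec_below n ?A (\<lambda>_. 0) x"
    then obtain e where e: "0 < e" "\<And>u. herm_form n ?A u + (cmod (cip n (\<lambda>_. 0) u))\<^sup>2 \<le> (x - e) * sqnorm n u"
      by (auto simp: spec_below_def)
    show "\<forall>l. eigenvalue A (of_real l) \<longrightarrow> l < x"
    proof (intro allI impI)
      fix l assume "eigenvalue A (of_real l)"
      then obtain v where v: "eigenvector A v (of_real l)" by (auto simp: eigenvalue_def)
      have "herm_form n ?A (vec_index v) = l * sqnorm n (vec_index v)"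
        unfolding herm_form_eq_sesq_form eigenvector_sum(1)[OF A v] by simp
      moreover have "herm_form n ?A (vec_index v) \<le> (x - e) * sqnorm n (vec_index v)" using e(2)[of "vec_index v"] by (simp add: cip_def)
      ultimately have "l \<le> x - e" using eigenvector_sum(2)[OF A v] by simp
      then show "l < x" using e(1) by simp
    qed
  next
    assume all: "\<forall>l. eigenvalue A (of_real l) \<longrightarrow> l < x"
    show "spec_below n ?A (\<lambda>_. 0) x"
    proof (rule ccontr)
      assume not: "\<not> spec_below n ?A (\<lambda>_. 0) x"
      define T where "T = {t. spec_below n ?A (\<lambda>_. 0) t}"
      have lower: "x \<le> t" if "t \<in> T" for t
        using not spec_below_mono[of n ?A "\<lambda>_. 0" t x] that by (force simp: T_def)
      define C where "C = (\<Sum>i<n. \<Sum>j<n. cmod (A $$ (i, j)))"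
      have "herm_form n ?A u + (cmod (cip n (\<lambda>_. 0) u))\<^sup>2 \<le> (C + 1 - 1) * sqnorm n u" for u
        using herm_form_bound[of n ?A u] by (simp add: C_def cip_def)
      then have "C + 1 \<in> T" unfolding T_def spec_below_def by (auto intro!: exI[of _ 1])
      then have ne: "T \<noteq> {}" by auto
      have bdd: "bdd_below T" using lower by (intro bdd_belowI[of _ x])
      define t where "t = Inf T"
      have xt: "x \<le> t" unfolding t_def by (rule cInf_greatest[OF ne lower])
      have psd: "herm_form n ?A u \<le> t * sqnorm n u" for u
      proof -
        have "herm_form n ?A u \<le> (t + e) * sqnorm n u" if e: "0 < e" for e
        proof -
          obtain s where s: "s \<in> T" "s < t + e"
            using cInf_lessD[OF ne, of "t + e"] e by (auto simp: t_def)
          then obtain e' where "0 < e'" "\<And>u. herm_form n ?A u + (cmod (cip n (\<lambda>_. 0) u))\<^sup>2 \<le> (s - e') * sqnorm n u"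
            by (auto simp: T_def spec_below_def)
          then have "herm_form n ?A u \<le> (s - e') * sqnorm n u" by (simp add: cip_def)
          also have "\<dots> \<le> (t + e) * sqnorm n u" using s \<open>0 < e'\<close> by (intro mult_right_mono sqnorm_nonneg) simp
          finally show ?thesis .
        qed
        then have le: "herm_form n ?A u - t * sqnorm n u \<le> e * sqnorm n u" if "0 < e" for e
          using that by (simp add: algebra_simps)
        show ?thesis
        proof (rule ccontr)
          assume "\<not> herm_form n ?A u \<le> t * sqnorm n u"
          then have pos: "0 < herm_form n ?A u - t * sqnorm n u" by simp
          define e where "e = (herm_form n ?A u - t * sqnorm n u) / (2 * (sqnorm n u + 1))"
          have d: "0 < sqnorm n u + 1" using sqnorm_nonneg[of n u] by simp
          have e: "0 < e" using pos d by (simp add: e_def)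
          have "herm_form n ?A u - t * sqnorm n u \<le> e * sqnorm n u" by (rule le[OF e])
          also have "\<dots> \<le> e * (sqnorm n u + 1)" using e by simp
          also have "\<dots> = (herm_form n ?A u - t * sqnorm n u) / 2"
          proof -
            have "X / (2 * Y) * Y = X / 2" if "0 < Y" for X Y :: real using that by simp
            from this[OF d] show ?thesis unfolding e_def .
          qed
          finally show False using pos by (simp only: field_simps)
        qed
      qed
      have "\<not> eigenvalue A (of_real t)" using all xt by auto
      from noneigenvalue_coercive[OF A herm psd this]
      have "spec_below n ?A (\<lambda>_. 0) t" .
      then obtain e where e: "0 < e" "\<And>u. herm_form n ?A u + (cmod (cip n (\<lambda>_. 0) u))\<^sup>2 \<le> (t - e) * sqnorm n u"
        by (auto simp: spec_below_def)
      then have "t - e / 2 \<in> T" unfolding T_def spec_below_def by (auto intro!: exI[of _ "e / 2"])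
      then have "t \<le> t - e / 2" unfolding t_def by (rule cInf_lower[OF _ bdd])
      then show False using e by simp
    qed
  qed
qed

section \<open>Large deviations from tail estimates\<close>

lemma ereal_le_minus_swap: "a \<le> - b \<Longrightarrow> b \<le> - (a :: ereal)"
  by (cases rule: ereal2_cases[of a b]) auto

lemma ereal_minus_le_swap: "- a \<le> b \<Longrightarrow> - b \<le> (a :: ereal)"
  by (cases rule: ereal2_cases[of a b]) auto

lemma exp_neg_tendsto_0: "0 < (a::real) \<Longrightarrow> (\<lambda>N. exp (- real N * a)) \<longlonglongrightarrow> 0"
  by real_asymp

text \<open>The factor 2 accounts for closed sets covered by two half-lines.\<close>

lemma limsup_log_prob_le:
  assumes "\<forall>\<^sub>F N in sequentially. p N \<le> 2 * exp (- real N * r)" "\<And>N. 0 \<le> p N"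
  shows "limsup (\<lambda>N. ereal (1 / real N) * log_prob (p N)) \<le> - ereal r"
proof -
  have "limsup (\<lambda>N. ereal (1 / real N) * log_prob (p N)) \<le> limsup (\<lambda>N. ereal (ln 2 / real N - r))"
  proof (rule Limsup_mono)
    show "\<forall>\<^sub>F N in sequentially. ereal (1 / real N) * log_prob (p N) \<le> ereal (ln 2 / real N - r)"
      using assms(1) eventually_gt_at_top[of 0]
    proof eventually_elim
      case (elim N)
      show ?case
      proof (cases "p N = 0")
        case True
        then show ?thesis using elim by (simp add: log_prob_def)
      next
        case False
        then have p: "0 < p N" using assms(2)[of N] by simp
        have "ln (p N) \<le> ln (2 * exp (- real N * r))" using p elim by simp
        also have "\<dots> = ln 2 - real N * r" by (simp add: ln_mult)
        finally have "1 / real N * ln (p N) \<le> 1 / real N * (ln 2 - real N * r)" using elim by (intro mult_left_mono) auto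
        also have "\<dots> = ln 2 / real N - r" using elim by (simp add: field_simps)
        finally show ?thesis using False by (simp add: log_prob_def)
      qed
    qed
  qed
  also have "\<dots> = - ereal r"
  proof (rule lim_imp_Limsup)
    have "(\<lambda>N. ln 2 / real N - r) \<longlonglongrightarrow> - r" by real_asymp
    then show "(\<lambda>N. ereal (ln 2 / real N - r)) \<longlonglongrightarrow> - ereal r" by simp
  qed simp
  finally show ?thesis .
qed

lemma liminf_log_prob_ge:
  assumes "\<forall>\<^sub>F N in sequentially. exp (- real N * r) \<le> p N"
  shows "- ereal r \<le> liminf (\<lambda>N. ereal (1 / real N) * log_prob (p N))"
proof (rule Liminf_bounded)
  show "\<forall>\<^sub>F N in sequentially. - ereal r \<le> ereal (1 / real N) * log_prob (p N)"
    using assms eventually_gt_at_top[of 0]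
  proof eventually_elim
    case (elim N)
    have p: "0 < p N" using elim(1) exp_gt_zero less_le_trans by blast
    have "- real N * r = ln (exp (- real N * r))" by simp
    also have "\<dots> \<le> ln (p N)" using elim p by (subst ln_le_cancel_iff) auto
    finally have "1 / real N * (- real N * r) \<le> 1 / real N * ln (p N)" using elim by (intro mult_left_mono) auto
    then show ?case using elim p by (simp add: log_prob_def)
  qed
qed

text \<open>An interval is a half-line minus a farther one. The farther one has a larger rate
  \<open>r > k\<close> and is negligible, at an arbitrarily small price in the exponent.\<close>

lemma exp_diff_lower:
  assumes "k < r" "0 < \<epsilon>"
  shows "\<exists>\<epsilon>'>0. \<forall>\<^sub>F N in sequentially. exp (- real N * (k + \<epsilon>)) \<le> exp (- real N * (k + \<epsilon>')) - exp (- real N * r)"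
proof -
  define e where "e = min (\<epsilon> / 2) ((r - k) / 2)"
  have e: "0 < e" "e \<le> \<epsilon> / 2" "e \<le> (r - k) / 2" using assms unfolding e_def by (simp_all only: min.cobounded1 min.cobounded2, simp)
  have "(\<lambda>N. exp (- real N * (\<epsilon> - e)) + exp (- real N * (r - k - e))) \<longlonglongrightarrow> 0"
  proof -
    have "0 < \<epsilon> - e" using e(1,2) assms(2) by linarith
    moreover have "0 < r - k - e"
    proof -
      have "2 * e \<le> r - k" using e(3) by simp
      then show ?thesis using assms(1) e(1) by linarith
    qed
    ultimately show ?thesis
      by (intro tendsto_add_zero exp_neg_tendsto_0)
  qed
  then have "\<forall>\<^sub>F N in sequentially. exp (- real N * (\<epsilon> - e)) + exp (- real N * (r - k - e)) < 1"
    by (rule order_tendstoD(2)) simp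
  then have "\<forall>\<^sub>F N in sequentially. exp (- real N * (k + \<epsilon>)) \<le> exp (- real N * (k + e)) - exp (- real N * r)"
  proof eventually_elim
    case (elim N)
    have "exp (- real N * (k + e)) * (exp (- real N * (\<epsilon> - e)) + exp (- real N * (r - k - e))) \<le> exp (- real N * (k + e)) * 1"
      using elim by (intro mult_left_mono) auto
    moreover have "exp (- real N * (k + e)) * exp (- real N * (\<epsilon> - e)) = exp (- real N * (k + \<epsilon>))"
      "exp (- real N * (k + e)) * exp (- real N * (r - k - e)) = exp (- real N * r)"
      by (simp_all add: exp_add[symmetric] algebra_simps)
    ultimately show ?case by (simp add: distrib_left)
  qed
  then show ?thesis using e(1) by blast
qed

text \<open>A closed set that misses \<open>m\<close> is covered by two half-lines ending at its
  points nearest to \<open>m\<close>, and a neighbourhood of a point other than \<open>m\<close>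
  contains a difference of half-lines. Strict monotonicity of \<open>k\<close> on both sides of
  \<open>m\<close> separates the rates of the two half-lines in such a difference.\<close>

lemma LDP_from_tails:
  fixes \<mu> :: "nat \<Rightarrow> real measure" and k :: "real \<Rightarrow> real"
  assumes K: "\<And>x. K x = (if x < b then \<infinity> else ereal (k x))" and m: "b \<le> m" "k m = 0"
    and cont: "continuous_on {b..} k"
    and inc: "\<And>x y. m \<le> x \<Longrightarrow> x < y \<Longrightarrow> k x < k y"
    and dec: "\<And>x y. b \<le> x \<Longrightarrow> x < y \<Longrightarrow> y \<le> m \<Longrightarrow> k y < k x"
    and unb: "\<And>c. \<exists>x\<ge>m. c < k x"
    and prob: "\<forall>\<^sub>F N in sequentially. prob_space (\<mu> N) \<and> sets (\<mu> N) = sets borel"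
    and RU: "\<And>x \<epsilon>. m < x \<Longrightarrow> 0 < \<epsilon> \<Longrightarrow> \<forall>\<^sub>F N in sequentially. measure (\<mu> N) {x..} \<le> exp (- real N * (k x - \<epsilon>))"
    and RL: "\<And>x \<epsilon>. m < x \<Longrightarrow> 0 < \<epsilon> \<Longrightarrow> \<forall>\<^sub>F N in sequentially. exp (- real N * (k x + \<epsilon>)) \<le> measure (\<mu> N) {x..}"
    and LU: "\<And>x \<epsilon>. b < x \<Longrightarrow> x < m \<Longrightarrow> 0 < \<epsilon> \<Longrightarrow> \<forall>\<^sub>F N in sequentially. measure (\<mu> N) {..<x} \<le> exp (- real N * (k x - \<epsilon>))"
    and LL: "\<And>x \<epsilon>. b < x \<Longrightarrow> x < m \<Longrightarrow> 0 < \<epsilon> \<Longrightarrow> \<forall>\<^sub>F N in sequentially. exp (- real N * (k x + \<epsilon>)) \<le> measure (\<mu> N) {..<x}"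
    and L0: "\<And>x r. x < b \<Longrightarrow> \<forall>\<^sub>F N in sequentially. measure (\<mu> N) {..<x} \<le> exp (- real N * r)"
  shows "good_rate_function K \<and> large_deviation_principle \<mu> (\<lambda>N. real N) K"
proof -
  have k0: "0 \<le> k x" if "b \<le> x" for x
    using inc[of m x] dec[of x m] m that by (cases x m rule: linorder_cases) auto
  have Kpos: "0 \<le> K x" for x using k0 by (simp add: K)
  have Km: "K m = 0" using m by (simp add: K zero_ereal_def)
  have sub: "{x. K x \<le> ereal c} = {b..} \<inter> k -` {..c}" for c by (auto simp: K)
  have closed: "closed {x. K x \<le> ereal c}" for c
    unfolding sub by (intro continuous_closed_preimage cont) auto
  have "compact {x. K x \<le> ereal c}" for c
  proof -
    obtain y where y: "m \<le> y" "c < k y" using unb by blast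
    have "{x. K x \<le> ereal c} \<subseteq> {b..y}"
    proof
      fix x assume "x \<in> {x. K x \<le> ereal c}"
      then have x: "b \<le> x" "k x \<le> c" by (auto simp: K split: if_splits)
      then have "\<not> y < x" using inc[OF y(1), of x] y(2) by auto
      then show "x \<in> {b..y}" using x by simp
    qed
    then have "bounded {x. K x \<le> ereal c}" using bounded_closed_interval bounded_subset by blast
    then show ?thesis using closed by (simp add: compact_eq_bounded_closed)
  qed
  then have good: "good_rate_function K" and rate: "rate_function K"
    using closed Kpos by (auto simp: good_rate_function_def rate_function_def)
  have UR: "\<forall>\<^sub>F N in sequentially. measure (\<mu> N) {x..} \<le> exp (- real N * r)" if "m < x" "ereal r < K x" for x r
  proof -
    have "r < k x" using that m by (simp add: K)
    then show ?thesis using RU[OF that(1), of "k x - r"] by simp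
  qed
  \<comment> \<open>The hypotheses concern open half-lines \<open>{..<y}\<close>. Continuity of
    \<open>k\<close>, or the infinite rate below \<open>b\<close>, leaves room for some
    \<open>y > x\<close> with the same bound.\<close>
  have UL: "\<forall>\<^sub>F N in sequentially. measure (\<mu> N) {..x} \<le> exp (- real N * r)" if x: "x < m" "ereal r < K x" for x r
  proof -
    have "\<exists>y>x. \<forall>\<^sub>F N in sequentially. measure (\<mu> N) {..<y} \<le> exp (- real N * r)"
    proof (cases "x < b")
      case True
      then obtain y where "x < y" "y < b" using dense by blast
      then show ?thesis using L0 by blast
    next
      case False
      then have r: "r < k x" using x by (simp add: K)
      have "(k \<longlongrightarrow> k x) (at x within {b..})" using cont False by (simp add: continuous_on_def)
      then have "\<forall>\<^sub>F y in at x within {b..}. r < k y" using r by (rule order_tendstoD(1))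
      then obtain d where d: "0 < d" "\<And>y. b \<le> y \<Longrightarrow> y \<noteq> x \<Longrightarrow> dist y x < d \<Longrightarrow> r < k y"
        unfolding eventually_at by auto
      define y where "y = min (x + d / 2) ((x + m) / 2)"
      have y: "x < y" "y \<le> x + d / 2" "y \<le> (x + m) / 2"
        using d x unfolding y_def by (simp_all only: min.cobounded1 min.cobounded2, simp)
      have "2 * y \<le> x + m" using y(3) by simp
      then have yb: "b < y" "y < m" using y(1) False x(1) by linarith+
      have "r < k y" using y yb d(1) by (intro d(2)) (auto simp: dist_real_def)
      then have "\<forall>\<^sub>F N in sequentially. measure (\<mu> N) {..<y} \<le> exp (- real N * r)"
        using LU[OF yb, of "k y - r"] by simp
      then show ?thesis using y by blast
    qed
    then obtain y where y: "x < y" "\<forall>\<^sub>F N in sequentially. measure (\<mu> N) {..<y} \<le> exp (- real N * r)" by blast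
    from y(2) prob show ?thesis
    proof eventually_elim
      case (elim N)
      interpret prob_space "\<mu> N" using elim by simp
      have "measure (\<mu> N) {..x} \<le> measure (\<mu> N) {..<y}" using y(1) elim by (intro finite_measure_mono) auto
      then show ?case using elim by simp
    qed
  qed
  have upper: "limsup (\<lambda>N. ereal (1 / real N) * log_prob (measure (\<mu> N) F)) \<le> - (INF x\<in>F. K x)" (is "?L \<le> - ?I")
    if F: "closed F" for F
  proof -
    have bnd: "?L \<le> - ereal r" if r: "ereal r < ?I" for r
    proof (rule limsup_log_prob_le)
      have rK: "ereal r < K x" if "x \<in> F" for x using r INF_lower[OF that, of K] by (rule less_le_trans)
      show "\<forall>\<^sub>F N in sequentially. measure (\<mu> N) F \<le> 2 * exp (- real N * r)"
      proof (cases "m \<in> F")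
        \<comment> \<open>The infimum is then 0 and \<open>r\<close> is negative, so the trivial
          bound 1 on the mass suffices.\<close>
        case True
        then have "r < 0" using rK[OF True] Km by simp
        from prob show ?thesis
        proof eventually_elim
          case (elim N)
          interpret prob_space "\<mu> N" using elim by simp
          have "measure (\<mu> N) F \<le> 1" by (rule prob_le_1)
          also have "1 \<le> exp (- real N * r)" using \<open>r < 0\<close> by (simp add: mult_nonneg_nonpos)
          also have "\<dots> \<le> 2 * exp (- real N * r)" by simp
          finally show ?case .
        qed
      next
        case False
        have "\<exists>l. F \<inter> {..m} \<subseteq> {..l} \<and> (\<forall>\<^sub>F N in sequentially. measure (\<mu> N) {..l} \<le> exp (- real N * r))"
        proof (cases "F \<inter> {..m} = {}")
          case True
          \<comment> \<open>With nothing of \<open>F\<close> on this side, any half-line of infinite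
            rate serves.\<close>
          show ?thesis
            using True UL[of "b - 1" r] m by (intro exI[of _ "b - 1"]) (auto simp: K)
        next
          case ne: False
          define l where "l = Sup (F \<inter> {..m})"
          have bdd: "bdd_above (F \<inter> {..m})" by (intro bdd_aboveI[of _ m]) auto
          have "l \<in> F \<inter> {..m}" unfolding l_def using ne bdd F by (intro closed_contains_Sup) auto
          then have l: "l \<in> F" "l < m" using False by (auto simp: less_le)
          then show ?thesis using UL[OF l(2) rK[OF l(1)]] cSup_upper[OF _ bdd] by (auto simp: l_def)
        qed
        then obtain l where l: "F \<inter> {..m} \<subseteq> {..l}" "\<forall>\<^sub>F N in sequentially. measure (\<mu> N) {..l} \<le> exp (- real N * r)" by blast
        have "\<exists>u. F \<inter> {m..} \<subseteq> {u..} \<and> (\<forall>\<^sub>F N in sequentially. measure (\<mu> N) {u..} \<le> exp (- real N * r))"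
        proof (cases "F \<inter> {m..} = {}")
          case True
          obtain u where u: "m \<le> u" "r < k u" using unb by blast
          have "k u < k (u + 1)" using u by (intro inc) auto
          then have "ereal r < K (u + 1)" using u m by (simp add: K)
          then show ?thesis using True UR[of "u + 1" r] u by auto
        next
          case ne: False
          define u where "u = Inf (F \<inter> {m..})"
          have bdd: "bdd_below (F \<inter> {m..})" by (intro bdd_belowI[of _ m]) auto
          have "u \<in> F \<inter> {m..}" unfolding u_def using ne bdd F by (intro closed_contains_Inf) auto
          then have u: "u \<in> F" "m < u" using False by (auto simp: less_le)
          then show ?thesis using UR[OF u(2) rK[OF u(1)]] cInf_lower[OF _ bdd] by (auto simp: u_def)
        qed
        then obtain u where u: "F \<inter> {m..} \<subseteq> {u..}" "\<forall>\<^sub>F N in sequentially. measure (\<mu> N) {u..} \<le> exp (- real N * r)" by blast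
        from l(2) u(2) prob show ?thesis
        proof eventually_elim
          case (elim N)
          interpret prob_space "\<mu> N" using elim by simp
          have "F \<subseteq> {..l} \<union> {u..}" 
          proof
            fix t assume "t \<in> F"
            then show "t \<in> {..l} \<union> {u..}" using subsetD[OF l(1), of t] subsetD[OF u(1), of t] by (cases "t \<le> m") auto
          qed
          then have "measure (\<mu> N) F \<le> measure (\<mu> N) ({..l} \<union> {u..})" using elim by (intro finite_measure_mono) auto
          also have "\<dots> \<le> measure (\<mu> N) {..l} + measure (\<mu> N) {u..}" using elim by (intro measure_Un_le) auto
          finally show ?case using elim by simp
        qed
      qed
    qed simp
    have "?I \<le> - ?L"
    proof (rule dense_le)
      fix y assume y: "y < ?I"
      then obtain z where z: "y < z" "z < ?I" using dense by blast
      show "y \<le> - ?L"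
      proof (cases z)
        case (real r)
        then have "?L \<le> - z" using bnd[of r] z real by simp
        then have "z \<le> - ?L" by (rule ereal_le_minus_swap)
        then show ?thesis using z by (meson less_imp_le order_trans)
      qed (use z in auto)
    qed
    then show ?thesis by (rule ereal_le_minus_swap)
  qed
  have point: "\<forall>\<^sub>F N in sequentially. exp (- real N * (k x + \<epsilon>)) \<le> measure (\<mu> N) G"
    if G: "open G" "x \<in> G" and x: "b \<le> x" and \<epsilon>: "0 < \<epsilon>" for G x \<epsilon>
  proof -
    obtain d where d: "0 < d" "\<And>y. \<bar>y - x\<bar> < d \<Longrightarrow> y \<in> G"
      using G unfolding open_real by (metis dist_real_def open_dist)
    consider "x = m" | "m < x" | "x < m" by linarith
    then show ?thesis
    proof cases
      case 1
      \<comment> \<open>At the zero of the rate both half-lines outside the neighbourhood have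
        exponentially small mass, so the mass of \<open>G\<close> tends to 1.\<close>
      define y where "y = m + d / 2"
      define l where "l = m - d / 2"
      have y: "m < y" and l: "l < m" using d by (auto simp: y_def l_def)
      have "0 < k y" using inc[of m y] m y by simp
      then have R: "\<forall>\<^sub>F N in sequentially. measure (\<mu> N) {y..} \<le> exp (- real N * (k y / 2))"
        using m y by (intro UR y) (simp add: K)
      have "\<exists>r>0. ereal r < K l"
      proof (cases "l < b")
        case False
        then have "0 < k l" using dec[of l m] m l by simp
        then show ?thesis using False by (intro exI[of _ "k l / 2"]) (simp add: K)
      qed (auto simp: K intro: exI[of _ 1])
      then obtain r where r: "0 < r" "ereal r < K l" by blast
      note L = UL[OF l r(2)]
      have "(\<lambda>N. exp (- real N * (k y / 2)) + exp (- real N * r) + exp (- real N * \<epsilon>)) \<longlonglongrightarrow> 0"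
      proof -
        have "0 < k y / 2" using \<open>0 < k y\<close> by simp
        then show ?thesis using r(1) \<epsilon> by (intro tendsto_add_zero exp_neg_tendsto_0)
      qed
      then have "\<forall>\<^sub>F N in sequentially. exp (- real N * (k y / 2)) + exp (- real N * r) + exp (- real N * \<epsilon>) < 1"
        by (rule order_tendstoD(2)) simp
      with R L prob show ?thesis
      proof eventually_elim
        case (elim N)
        interpret prob_space "\<mu> N" using elim by simp
        have sp: "space (\<mu> N) = UNIV" using sets_eq_imp_space_eq[of "\<mu> N" borel] elim by simp
        have "- G \<subseteq> {..l} \<union> {y..}"
        proof
          fix t assume "t \<in> - G"
          then have "\<not> \<bar>t - m\<bar> < d" using d(2)[of t] 1 by auto
          then show "t \<in> {..l} \<union> {y..}" using d(1) by (auto simp: l_def y_def abs_if split: if_splits)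
        qed
        have "measure (\<mu> N) (- G) \<le> measure (\<mu> N) ({..l} \<union> {y..})"
          using elim \<open>- G \<subseteq> {..l} \<union> {y..}\<close> by (intro finite_measure_mono) auto
        also have "\<dots> \<le> measure (\<mu> N) {..l} + measure (\<mu> N) {y..}" using elim by (intro measure_Un_le) auto
        finally have "measure (\<mu> N) (- G) \<le> 1 - exp (- real N * \<epsilon>)" using elim by simp
        moreover have "measure (\<mu> N) (- G) = 1 - measure (\<mu> N) G"
          using prob_compl[of G] G elim sp by (simp add: Compl_eq_Diff_UNIV)
        ultimately show ?case using 1 m by simp
      qed
    next
      case 2
      have "k x < k (x + d)" using 2 d by (intro inc) auto
      then obtain r where r: "k x < r" "r < k (x + d)" using dense by blast
      obtain \<epsilon>' where e: "0 < \<epsilon>'" "\<forall>\<^sub>F N in sequentially. exp (- real N * (k x + \<epsilon>)) \<le> exp (- real N * (k x + \<epsilon>')) - exp (- real N * r)"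
        using exp_diff_lower[OF r(1) \<epsilon>] by blast
      have "\<forall>\<^sub>F N in sequentially. measure (\<mu> N) {x + d..} \<le> exp (- real N * r)"
        using 2 d r m x by (intro UR) (auto simp: K)
      with e(2) RL[OF 2 e(1)] prob show ?thesis
      proof eventually_elim
        case (elim N)
        interpret prob_space "\<mu> N" using elim by simp
        have "{x..} \<subseteq> G \<union> {x + d..}"
        proof
          fix t assume "t \<in> {x..}"
          then show "t \<in> G \<union> {x + d..}" using d(2)[of t] by (cases "x + d \<le> t") (auto simp: abs_less_iff)
        qed
        then have "measure (\<mu> N) {x..} \<le> measure (\<mu> N) (G \<union> {x + d..})"
          using elim G by (intro finite_measure_mono) auto
        also have "\<dots> \<le> measure (\<mu> N) G + measure (\<mu> N) {x + d..}" using elim G by (intro measure_Un_le) auto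
        finally show ?case using elim by simp
      qed
    next
      case 3
      \<comment> \<open>\<open>x = b\<close> is allowed here, but left tails are known only beyond
        \<open>b\<close>. So the interval from \<open>y'\<close> to \<open>y\<close> is placed
        strictly to the right of \<open>x\<close>, still inside \<open>G\<close>; its rate
        \<open>k y\<close> is below \<open>k x\<close>.\<close>
      define y where "y = min (x + d / 2) ((x + m) / 2)"
      have y: "x < y" "y \<le> x + d / 2" "y \<le> (x + m) / 2"
        using d 3 unfolding y_def by (simp_all only: min.cobounded1 min.cobounded2, simp)
      define y' where "y' = (x + y) / 2"
      have yy: "b < y" "y < m" "b < y'" "y' < y" "x < y'" "y' < m" using y 3 x d by (auto simp: y'_def)
      have ky: "k y < k x" "k y < k y'" using x y yy by (auto intro!: dec)
      obtain r where r: "k y < r" "r < k y'" using ky(2) dense by blast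
      obtain \<epsilon>' where e: "0 < \<epsilon>'" "\<forall>\<^sub>F N in sequentially. exp (- real N * (k y + \<epsilon>)) \<le> exp (- real N * (k y + \<epsilon>')) - exp (- real N * r)"
        using exp_diff_lower[OF r(1) \<epsilon>] by blast
      have "\<forall>\<^sub>F N in sequentially. measure (\<mu> N) {..<y'} \<le> exp (- real N * r)"
        using LU[OF yy(3,6), of "k y' - r"] r by simp
      with e(2) LL[OF yy(1,2) e(1)] prob show ?thesis
      proof eventually_elim
        case (elim N)
        interpret prob_space "\<mu> N" using elim by simp
        have "{..<y} \<subseteq> G \<union> {..<y'}"
        proof
          fix t assume "t \<in> {..<y}"
          then show "t \<in> G \<union> {..<y'}" using d(2)[of t] y yy by (cases "t < y'") (auto simp: abs_less_iff)
        qed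
        then have "measure (\<mu> N) {..<y} \<le> measure (\<mu> N) (G \<union> {..<y'})"
          using elim G by (intro finite_measure_mono) auto
        also have "\<dots> \<le> measure (\<mu> N) G + measure (\<mu> N) {..<y'}" using elim G by (intro measure_Un_le) auto
        finally have "exp (- real N * (k y + \<epsilon>)) \<le> measure (\<mu> N) G" using elim by simp
        moreover have "exp (- real N * (k x + \<epsilon>)) \<le> exp (- real N * (k y + \<epsilon>))"
          using ky by (simp add: mult_left_mono)
        ultimately show ?case by (rule order_trans[rotated])
      qed
    qed
  qed
  have lower: "- (INF x\<in>G. K x) \<le> liminf (\<lambda>N. ereal (1 / real N) * log_prob (measure (\<mu> N) G))" (is "_ \<le> ?L")
    if G: "open G" for G
  proof -
    have "- ?L \<le> K x" if x: "x \<in> G" for x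
    proof (cases "x < b")
      case False
      have "- ?L \<le> ereal (k x) + ereal \<epsilon>" if "0 < \<epsilon>" for \<epsilon>
      proof -
        have "- ereal (k x + \<epsilon>) \<le> ?L"
          using point[OF G x _ that] False by (intro liminf_log_prob_ge) auto
        then show ?thesis using ereal_minus_le_swap[of "ereal (k x + \<epsilon>)" ?L] by simp
      qed
      then have "\<And>\<epsilon>. 0 < \<epsilon> \<Longrightarrow> - ?L \<le> ereal (k x) + ereal \<epsilon>" .
      then have "- ?L \<le> ereal (k x)" by (rule ereal_le_epsilon2)
      then show ?thesis using False by (simp add: K)
    qed (simp add: K)
    then have "- ?L \<le> (INF x\<in>G. K x)" by (rule INF_greatest)
    then show ?thesis by (rule ereal_minus_le_swap)
  qed
  have "large_deviation_principle \<mu> (\<lambda>N. real N) K"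
    unfolding large_deviation_principle_def
    by (intro conjI allI impI rate filterlim_real_sequentially prob upper lower)
  then show ?thesis using good by blast
qed

section \<open>The rate function\<close>

text \<open>The \<open>A\<close> of the overview: the larger solution of
  \<open>A + 1 / A = x\<close>.\<close>

definition outer_root :: "real \<Rightarrow> real" where
  "outer_root x = (x + sqrt (x\<^sup>2 - 4)) / 2"

text \<open>One formula for both tails of the chain: between 2 and the minimizer
  \<open>\<theta>\<close> exceeds \<open>outer_root x\<close>, so the maximum is
  \<open>\<theta>\<close>, the starting point of the descent.\<close>

definition rate :: "real \<Rightarrow> real \<Rightarrow> real" where
  "rate \<theta> x = psi x (max \<theta> (1 / outer_root x)) - psi x (outer_root x)"

lemma outer_root:
  assumes "2 \<le> x"
  shows "1 \<le> outer_root x" "x = outer_root x + 1 / outer_root x" "1 / outer_root x = (x - sqrt (x\<^sup>2 - 4)) / 2"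
proof -
  have x2: "4 \<le> x\<^sup>2" using assms power_mono[of 2 x 2] by simp
  have s: "(sqrt (x\<^sup>2 - 4))\<^sup>2 = x\<^sup>2 - 4" "0 \<le> sqrt (x\<^sup>2 - 4)" using x2 by auto
  show 1: "1 \<le> outer_root x" unfolding outer_root_def using assms s(2) by argo
  have "outer_root x * ((x - sqrt (x\<^sup>2 - 4)) / 2) = 1"
    using s by (simp add: outer_root_def field_simps power2_eq_square)
  then show 3: "1 / outer_root x = (x - sqrt (x\<^sup>2 - 4)) / 2" using 1 by (simp add: field_simps)
  show "x = outer_root x + 1 / outer_root x" unfolding 3 by (simp add: outer_root_def field_simps)
qed

lemma outer_root_add_inverse:
  assumes "1 \<le> a" shows "outer_root (a + 1 / a) = a" "2 \<le> a + 1 / a"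
proof -
  have "(a + 1 / a)\<^sup>2 - 4 = (a - 1 / a)\<^sup>2" using assms by (simp add: power2_eq_square field_simps)
  moreover have "1 / a \<le> a" using assms by (smt (verit) divide_le_eq_1)
  ultimately show "outer_root (a + 1 / a) = a" by (simp add: outer_root_def)
  have "0 \<le> (a - 1)\<^sup>2 / a" using assms by simp
  also have "(a - 1)\<^sup>2 / a = a + 1 / a - 2" using assms by (simp add: field_simps power2_eq_square)
  finally show "2 \<le> a + 1 / a" by simp
qed

lemma outer_root_strict_mono: "2 \<le> x \<Longrightarrow> x < y \<Longrightarrow> outer_root x < outer_root y"
proof -
  assume "2 \<le> x" "x < y"
  moreover from this have "sqrt (x\<^sup>2 - 4) \<le> sqrt (y\<^sup>2 - 4)" using power_mono[of x y 2] by simp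
  ultimately show ?thesis unfolding outer_root_def by argo
qed

lemma continuous_outer_root: "continuous_on S outer_root"
  unfolding outer_root_def[abs_def] by (intro continuous_intros) auto

lemma continuous_rate:
  assumes "0 \<le> \<theta>" shows "continuous_on {2..} (rate \<theta>)"
proof -
  have "outer_root x \<noteq> 0" "max \<theta> (1 / outer_root x) \<noteq> 0" if "x \<in> {2..}" for x
  proof -
    have "1 \<le> outer_root x" using outer_root that by simp
    then show "outer_root x \<noteq> 0" by simp
    have "0 < 1 / outer_root x" using \<open>1 \<le> outer_root x\<close> by simp
    then show "max \<theta> (1 / outer_root x) \<noteq> 0" by linarith
  qed
  then show ?thesis
    unfolding rate_def[abs_def] psi_def
    by (intro continuous_intros continuous_outer_root ballI) simp_all
qed

section \<open>Monotonicity of the rate\<close>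

lemma bulk_rate_deriv:
  assumes "0 < a"
  shows "((\<lambda>a. psi (a + 1 / a) (1 / a) - psi (a + 1 / a) a) has_real_derivative a * (1 - 1 / a\<^sup>2)\<^sup>2) (at a)"
proof -
  have eq: "psi (b + 1 / b) (1 / b) - psi (b + 1 / b) b = b\<^sup>2 / 2 - 1 / (2 * b\<^sup>2) - 2 * ln b" if "b \<in> {0<..}" for b
    using that by (simp add: psi_def ln_div field_simps power2_eq_square)
  have "((\<lambda>b. b\<^sup>2 / 2 - 1 / (2 * b\<^sup>2) - 2 * ln b) has_real_derivative a + 1 / a ^ 3 - 2 / a) (at a)"
    using assms by (auto intro!: derivative_eq_intros simp: field_simps eval_nat_numeral)
  moreover have "a + 1 / a ^ 3 - 2 / a = a * (1 - 1 / a\<^sup>2)\<^sup>2"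
    using assms by (simp add: field_simps eval_nat_numeral)
  ultimately show ?thesis
    using has_field_derivative_transform_within_open[of "\<lambda>b. b\<^sup>2 / 2 - 1 / (2 * b\<^sup>2) - 2 * ln b" _ a "{0<..}" "\<lambda>a. psi (a + 1 / a) (1 / a) - psi (a + 1 / a) a"] assms eq by simp
qed

lemma spiked_rate_deriv:
  assumes "0 < a"
  shows "((\<lambda>a. psi (a + 1 / a) \<theta> - psi (a + 1 / a) a) has_real_derivative (a - \<theta>) * (1 - 1 / a\<^sup>2)) (at a)"
proof -
  have eq: "psi (b + 1 / b) \<theta> - psi (b + 1 / b) b = \<theta>\<^sup>2 / 2 + ln \<theta> - (b + 1 / b) * \<theta> + b\<^sup>2 / 2 + 1 - ln b" if "b \<in> {0<..}" for b
    using that by (simp add: psi_def field_simps power2_eq_square)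
  have "((\<lambda>b. \<theta>\<^sup>2 / 2 + ln \<theta> - (b + 1 / b) * \<theta> + b\<^sup>2 / 2 + 1 - ln b) has_real_derivative - (1 - 1 / a\<^sup>2) * \<theta> + a - 1 / a) (at a)"
    using assms by (auto intro!: derivative_eq_intros simp: field_simps power2_eq_square)
  moreover have "- (1 - 1 / a\<^sup>2) * \<theta> + a - 1 / a = (a - \<theta>) * (1 - 1 / a\<^sup>2)"
    using assms by (simp add: field_simps power2_eq_square)
  ultimately show ?thesis
    using has_field_derivative_transform_within_open[of "\<lambda>b. \<theta>\<^sup>2 / 2 + ln \<theta> - (b + 1 / b) * \<theta> + b\<^sup>2 / 2 + 1 - ln b" _ a "{0<..}" "\<lambda>a. psi (a + 1 / a) \<theta> - psi (a + 1 / a) a"] assms eq by simp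
qed

lemma one_minus_inverse_square_pos: "1 < (a::real) \<Longrightarrow> 0 < 1 - 1 / a\<^sup>2"
  by simp

lemma bulk_rate_increasing:
  assumes "1 \<le> a" "a < a'"
  shows "psi (a + 1 / a) (1 / a) - psi (a + 1 / a) a < psi (a' + 1 / a') (1 / a') - psi (a' + 1 / a') a'"
proof (rule DERIV_pos_imp_increasing_open[OF assms(2)])
  fix t assume t: "a < t" "t < a'"
  have "0 < t * (1 - 1 / t\<^sup>2)\<^sup>2" using t assms one_minus_inverse_square_pos[of t] by (intro mult_pos_pos zero_less_power) auto
  then show "\<exists>y. ((\<lambda>a. psi (a + 1 / a) (1 / a) - psi (a + 1 / a) a) has_real_derivative y) (at t) \<and> 0 < y"
    using bulk_rate_deriv[of t] t assms by auto
next
  show "continuous_on {a..a'} (\<lambda>a. psi (a + 1 / a) (1 / a) - psi (a + 1 / a) a)"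
    unfolding psi_def using assms by (intro continuous_intros) auto
qed

lemma spiked_rate_increasing:
  assumes "1 \<le> a" "\<theta> \<le> a" "a < a'"
  shows "psi (a + 1 / a) \<theta> - psi (a + 1 / a) a < psi (a' + 1 / a') \<theta> - psi (a' + 1 / a') a'"
proof (rule DERIV_pos_imp_increasing_open[OF assms(3)])
  fix t assume t: "a < t" "t < a'"
  have "0 < (t - \<theta>) * (1 - 1 / t\<^sup>2)" using t assms one_minus_inverse_square_pos[of t] by (intro mult_pos_pos) auto
  then show "\<exists>y. ((\<lambda>a. psi (a + 1 / a) \<theta> - psi (a + 1 / a) a) has_real_derivative y) (at t) \<and> 0 < y"
    using spiked_rate_deriv[of t \<theta>] t assms by auto
next
  show "continuous_on {a..a'} (\<lambda>a. psi (a + 1 / a) \<theta> - psi (a + 1 / a) a)"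
    unfolding psi_def using assms by (intro continuous_intros) auto
qed

lemma spiked_rate_decreasing:
  assumes "1 \<le> a" "a < a'" "a' \<le> \<theta>"
  shows "psi (a' + 1 / a') \<theta> - psi (a' + 1 / a') a' < psi (a + 1 / a) \<theta> - psi (a + 1 / a) a"
proof (rule DERIV_neg_imp_decreasing_open[OF assms(2)])
  fix t assume t: "a < t" "t < a'"
  have "(t - \<theta>) * (1 - 1 / t\<^sup>2) < 0" using t assms one_minus_inverse_square_pos[of t] by (intro mult_neg_pos) auto
  then show "\<exists>y. ((\<lambda>a. psi (a + 1 / a) \<theta> - psi (a + 1 / a) a) has_real_derivative y) (at t) \<and> y < 0"
    using spiked_rate_deriv[of t \<theta>] t assms by auto
next
  show "continuous_on {a..a'} (\<lambda>a. psi (a + 1 / a) \<theta> - psi (a + 1 / a) a)"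
    unfolding psi_def using assms by (intro continuous_intros) auto
qed

text \<open>The rate in the variable \<open>a = outer_root x\<close>, in which no square roots occur
  and the derivatives of both branches factor with visible sign.\<close>

definition root_rate :: "real \<Rightarrow> real \<Rightarrow> real" where
  "root_rate \<theta> a = psi (a + 1 / a) (max \<theta> (1 / a)) - psi (a + 1 / a) a"

lemma rate_eq_root_rate: "2 \<le> x \<Longrightarrow> rate \<theta> x = root_rate \<theta> (outer_root x)"
  using outer_root(2)[of x] by (simp add: rate_def root_rate_def)

lemma root_rate_increasing:
  assumes \<theta>: "0 \<le> \<theta>" and a: "max \<theta> 1 \<le> a" "a < a'"
  shows "root_rate \<theta> a < root_rate \<theta> a'"
proof -
  have low: "root_rate \<theta> a < root_rate \<theta> a'" if "max \<theta> 1 \<le> a" "a < a'" "\<theta> \<le> 1 / a'" for a a'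
  proof -
    have "1 / a' \<le> 1 / a" using that by (intro divide_left_mono) auto
    then have "max \<theta> (1 / a) = 1 / a" "max \<theta> (1 / a') = 1 / a'" using that by auto
    then show ?thesis unfolding root_rate_def using bulk_rate_increasing[of a a'] that by simp
  qed
  have high: "root_rate \<theta> a < root_rate \<theta> a'" if "max \<theta> 1 \<le> a" "a < a'" "1 / a \<le> \<theta>" for a a'
  proof -
    have "1 / a' \<le> 1 / a" using that by (intro divide_left_mono) auto
    then have "max \<theta> (1 / a) = \<theta>" "max \<theta> (1 / a') = \<theta>" using that by auto
    then show ?thesis unfolding root_rate_def using spiked_rate_increasing[of a \<theta> a'] that by simp
  qed
  show ?thesis
  proof (cases "\<theta> \<le> 1 / a' \<or> 1 / a \<le> \<theta>")
    case True
    then show ?thesis using low[OF a] high[OF a] by blast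
  next
    case False
    then have f: "1 / a' < \<theta>" "\<theta> < 1 / a" by auto
    have a0: "0 < a" "0 < a'" using a by auto
    have \<theta>0: "0 < \<theta>" using f a0 by (smt (verit) divide_pos_pos)
    \<comment> \<open>The maximum changes branch at \<open>1 / \<theta>\<close>, which lies between
      \<open>a\<close> and \<open>a'\<close>; the two monotone pieces are joined there.\<close>
    have "a < 1 / \<theta>" "1 / \<theta> < a'" using f a0 \<theta>0 by (simp_all add: field_simps)
    then show ?thesis using low[of a "1 / \<theta>"] high[of "1 / \<theta>" a'] a \<theta>0 by fastforce
  qed
qed

lemma root_rate_decreasing:
  assumes "1 \<le> a" "a < a'" "a' \<le> \<theta>"
  shows "root_rate \<theta> a' < root_rate \<theta> a"
proof -
  have "1 / a \<le> 1" "1 / a' \<le> 1" using assms by auto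
  then have "max \<theta> (1 / a) = \<theta>" "max \<theta> (1 / a') = \<theta>" using assms by linarith+
  then show ?thesis unfolding root_rate_def using spiked_rate_decreasing[of a a' \<theta>] assms by simp
qed

text \<open>The zero of the rate, where the largest eigenvalue concentrates: 2 for
  \<open>\<theta> \<le> 1\<close> and \<open>\<theta> + 1 / \<theta>\<close> beyond.\<close>

definition minimizer :: "real \<Rightarrow> real" where
  "minimizer \<theta> = max \<theta> 1 + 1 / max \<theta> 1"

lemma minimizer: "2 \<le> minimizer \<theta>" "outer_root (minimizer \<theta>) = max \<theta> 1"
  unfolding minimizer_def by (rule outer_root_add_inverse; simp)+

lemma rate_minimizer: "rate \<theta> (minimizer \<theta>) = 0"
proof -
  have "1 / max \<theta> 1 \<le> 1" by simp
  then have "max \<theta> (1 / max \<theta> 1) = max \<theta> 1" by (cases "\<theta> \<le> 1") (simp_all only: max_absorb1 max_absorb2 linear not_le order.trans less_imp_le)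
  then show ?thesis by (simp add: rate_def minimizer)
qed

lemma minimizer_le_iff: "2 \<le> x \<Longrightarrow> minimizer \<theta> \<le> x \<longleftrightarrow> max \<theta> 1 \<le> outer_root x"
  using outer_root_strict_mono[of x "minimizer \<theta>"] outer_root_strict_mono[of "minimizer \<theta>" x] minimizer[of \<theta>]
  by (cases "minimizer \<theta> = x") (auto simp: not_le[symmetric] simp del: max.bounded_iff)

lemma rate_increasing:
  assumes "0 \<le> \<theta>" "minimizer \<theta> \<le> x" "x < y"
  shows "rate \<theta> x < rate \<theta> y"
proof -
  have x: "2 \<le> x" "2 \<le> y" using assms minimizer(1)[of \<theta>] by auto
  have "max \<theta> 1 \<le> outer_root x" using minimizer_le_iff[OF x(1)] assms by blast
  then show ?thesis unfolding rate_eq_root_rate[OF x(1)] rate_eq_root_rate[OF x(2)]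
    using outer_root_strict_mono[OF x(1) assms(3)] by (intro root_rate_increasing assms) auto
qed

lemma rate_decreasing:
  assumes "0 \<le> \<theta>" "2 \<le> x" "x < y" "y \<le> minimizer \<theta>"
  shows "rate \<theta> y < rate \<theta> x"
proof -
  have y: "2 \<le> y" using assms by simp
  have r: "outer_root x < outer_root y" by (rule outer_root_strict_mono[OF assms(2,3)])
  have "outer_root y \<le> max \<theta> 1"
    using outer_root_strict_mono[of "minimizer \<theta>" y] assms(4) minimizer[of \<theta>] outer_root_strict_mono[OF y, of "minimizer \<theta>"]
    by (cases "y = minimizer \<theta>") auto
  moreover have "1 \<le> outer_root x" by (rule outer_root(1)[OF assms(2)])
  ultimately have "outer_root y \<le> \<theta>" using r by linarith
  then show ?thesis unfolding rate_eq_root_rate[OF y] rate_eq_root_rate[OF assms(2)]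
    by (intro root_rate_decreasing r outer_root assms)
qed

lemma rate_unbounded:
  assumes \<theta>: "0 \<le> \<theta>"
  shows "\<exists>x\<ge>minimizer \<theta>. c < rate \<theta> x"
proof -
  have "\<forall>\<^sub>F a in at_top. c < root_rate \<theta> a"
  proof (cases "\<theta> = 0")
    case True
    have "filterlim (\<lambda>a::real. a\<^sup>2 / 2 - 1 / (2 * a\<^sup>2) - 2 * ln a) at_top at_top"
      by real_asymp
    then have "\<forall>\<^sub>F a in at_top. c < a\<^sup>2 / 2 - 1 / (2 * a\<^sup>2) - 2 * ln a"
      by (simp add: filterlim_at_top_dense)
    then show ?thesis using eventually_gt_at_top[of 0]
    proof eventually_elim
      case (elim a)
      then have "root_rate 0 a = a\<^sup>2 / 2 - 1 / (2 * a\<^sup>2) - 2 * ln a"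
        by (simp add: root_rate_def psi_def max_absorb2 ln_div field_simps power2_eq_square)
      then show ?case using elim True by simp
    qed
  next
    case False
    then have \<theta>0: "0 < \<theta>" using \<theta> by simp
    have "filterlim (\<lambda>a::real. \<theta>\<^sup>2 / 2 + ln \<theta> - (a + 1 / a) * \<theta> + a\<^sup>2 / 2 + 1 - ln a) at_top at_top"
      by real_asymp
    then have "\<forall>\<^sub>F a in at_top. c < \<theta>\<^sup>2 / 2 + ln \<theta> - (a + 1 / a) * \<theta> + a\<^sup>2 / 2 + 1 - ln a"
      by (simp add: filterlim_at_top_dense)
    then show ?thesis using eventually_gt_at_top[of 0] eventually_gt_at_top[of "1 / \<theta>"]
    proof eventually_elim
      case (elim a)
      then have "1 / a \<le> \<theta>" using \<theta>0 by (simp add: field_simps)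
      then have "root_rate \<theta> a = \<theta>\<^sup>2 / 2 + ln \<theta> - (a + 1 / a) * \<theta> + a\<^sup>2 / 2 + 1 - ln a"
        using elim by (simp add: root_rate_def psi_def max_absorb1 field_simps power2_eq_square)
      then show ?case using elim by simp
    qed
  qed
  then have "\<forall>\<^sub>F a in at_top. c < root_rate \<theta> a \<and> max \<theta> 1 \<le> a"
    using eventually_ge_at_top by (rule eventually_conj)
  then obtain a where a: "c < root_rate \<theta> a" "max \<theta> 1 \<le> a"
    using eventually_happens'[OF trivial_limit_at_top_linorder] by blast
  have a1: "1 \<le> a" using a by simp
  note o = outer_root_add_inverse[OF a1]
  have "minimizer \<theta> \<le> a + 1 / a" unfolding minimizer_le_iff[OF o(2)] o(1) by (rule a)
  moreover have "c < rate \<theta> (a + 1 / a)" unfolding rate_eq_root_rate[OF o(2)] o(1) by (rule a)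
  ultimately show ?thesis by blast
qed

text \<open>\<open>F_eq\<close> identifies the potential difference between the two fixed points
  with the classical antiderivative of \<open>sqrt (z\<^sup>2 - 4)\<close>, and it vanishes at 2,
  where the fixed points merge.\<close>

lemma bulk_integral:
  assumes "2 \<le> x"
  shows "(LBINT z=ereal 2..ereal x. sqrt (z\<^sup>2 - 4)) = psi x (1 / outer_root x) - psi x (outer_root x)"
proof (cases "x = 2")
  case True
  have "outer_root 2 = 1" by (simp add: outer_root_def)
  then show ?thesis using True by (simp add: interval_integral_endpoints_same)
next
  case False
  then have x: "2 < x" using assms by simp
  define F where "F z = psi z (1 / outer_root z) - psi z (outer_root z)" for z
  have F_eq: "F z = z * sqrt (z\<^sup>2 - 4) / 2 - 2 * ln ((z + sqrt (z\<^sup>2 - 4)) / 2)" if "2 \<le> z" for z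
  proof -
    define a where "a = outer_root z"
    have a: "1 \<le> a" "z = a + 1 / a" using outer_root(1,2)[OF that] unfolding a_def .
    have s: "sqrt (z\<^sup>2 - 4) = a - 1 / a" using outer_root(3)[OF that] outer_root_def[of z] unfolding a_def by argo
    have "(z + sqrt (z\<^sup>2 - 4)) / 2 = a" by (simp add: a_def outer_root_def)
    moreover have "z * sqrt (z\<^sup>2 - 4) = a\<^sup>2 - 1 / a\<^sup>2" unfolding s using a by (simp add: field_simps power2_eq_square)
    moreover have "F z = a\<^sup>2 / 2 - 1 / (2 * a\<^sup>2) - 2 * ln a"
    proof -
      have "z * a = a\<^sup>2 + 1" "z * (1 / a) = 1 + 1 / a\<^sup>2"
        unfolding a(2) using a(1) by (simp_all add: field_simps power2_eq_square)
      moreover have "ln (1 / a) = - ln a" using a by (simp add: ln_div)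
      ultimately show ?thesis
        unfolding F_def a_def[symmetric] psi_def by (simp add: power_divide)
    qed
    ultimately show ?thesis by (simp add: field_simps)
  qed
  have deriv: "(F has_real_derivative sqrt (z\<^sup>2 - 4)) (at z)" if z: "2 < z" for z
  proof -
    have z2: "4 < z\<^sup>2" using z power_strict_mono[of 2 z 2] by simp
    define s where "s = sqrt (z\<^sup>2 - 4)"
    have s: "0 < s" "s\<^sup>2 = z\<^sup>2 - 4" using z2 by (auto simp: s_def)
    have dS: "((\<lambda>z. sqrt (z\<^sup>2 - 4)) has_real_derivative z / s) (at z)"
      using z2 by (auto intro!: derivative_eq_intros simp: s_def field_simps)
    have "((\<lambda>z. (z + sqrt (z\<^sup>2 - 4)) / 2) has_real_derivative (1 + z / s) / 2) (at z)"
      by (rule DERIV_cdivide[OF DERIV_add[OF DERIV_ident dS]])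
    moreover have "0 < (z + sqrt (z\<^sup>2 - 4)) / 2" using z s by (simp add: s_def[symmetric])
    ultimately have "((\<lambda>z. ln ((z + sqrt (z\<^sup>2 - 4)) / 2)) has_real_derivative (1 + z / s) / 2 / ((z + sqrt (z\<^sup>2 - 4)) / 2)) (at z)"
      by (intro DERIV_ln_divide[THEN DERIV_chain2, THEN DERIV_cong]) auto
    moreover have "(1 + z / s) / 2 / ((z + sqrt (z\<^sup>2 - 4)) / 2) = 1 / s"
      using s z by (simp add: s_def[symmetric] divide_simps add_eq_0_iff)
    ultimately have dL: "((\<lambda>z. ln ((z + sqrt (z\<^sup>2 - 4)) / 2)) has_real_derivative 1 / s) (at z)" by simp
    have "((\<lambda>z. z * sqrt (z\<^sup>2 - 4) / 2 - 2 * ln ((z + sqrt (z\<^sup>2 - 4)) / 2)) has_real_derivative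
        (s + z * (z / s)) / 2 - 2 * (1 / s)) (at z)"
      using DERIV_diff[OF DERIV_cdivide[OF DERIV_mult[OF DERIV_ident dS]] DERIV_cmult[OF dL]]
      by (simp add: s_def[symmetric] mult.commute)
    moreover have "(s + z * (z / s)) / 2 - 2 * (1 / s) = s"
    proof -
      have "z * (z / s) = s + 4 / s"
        using s by (simp add: power2_eq_square nonzero_eq_divide_eq divide_add_eq_iff add_divide_eq_iff)
      then show ?thesis by argo
    qed
    ultimately have "((\<lambda>z. z * sqrt (z\<^sup>2 - 4) / 2 - 2 * ln ((z + sqrt (z\<^sup>2 - 4)) / 2)) has_real_derivative s) (at z)" by simp
    then show ?thesis unfolding s_def
      by (rule has_field_derivative_transform_within_open[where S = "{2<..}"]) (use z F_eq in auto)
  qed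
  have contF: "continuous_on {2..} F"
  proof -
    have "outer_root z \<noteq> 0" if "z \<in> {2..}" for z using outer_root(1)[of z] that by auto
    then show ?thesis unfolding F_def psi_def by (intro continuous_intros continuous_outer_root) auto
  qed
  have "(LBINT z=ereal 2..ereal x. sqrt (z\<^sup>2 - 4)) = F x - F 2"
  \<comment> \<open>The derivative is established for \<open>z > 2\<close> only, so the endpoint 2
    enters through a limit from the right.\<close>
  proof (rule interval_integral_FTC_nonneg(2))
    show "ereal 2 < ereal x" using x by simp
    show "(F has_real_derivative sqrt (z\<^sup>2 - 4)) (at z)" if "ereal 2 < ereal z" for z using deriv that by simp
    show "isCont (\<lambda>z. sqrt (z\<^sup>2 - 4)) z" for z by (intro continuous_intros)
    show "AE z in lborel. ereal 2 < ereal z \<longrightarrow> ereal z < ereal x \<longrightarrow> 0 \<le> sqrt (z\<^sup>2 - 4)"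
    proof (intro AE_I2 impI)
      fix z assume "ereal 2 < ereal z"
      then have "2\<^sup>2 \<le> z\<^sup>2" by (intro power_mono) auto
      then show "0 \<le> sqrt (z\<^sup>2 - 4)" by simp
    qed
    have "(F \<longlongrightarrow> F 2) (at 2 within {2..})" using contF by (simp add: continuous_on_def)
    then have "(F \<longlongrightarrow> F 2) (at_right 2)" by (rule tendsto_within_subset) auto
    then show "((F \<circ> real_of_ereal) \<longlongrightarrow> F 2) (at_right (ereal 2))"
      by (simp add: ereal_tendsto_simps)
    have "(F \<longlongrightarrow> F x) (at x within {2..})" using contF x by (simp add: continuous_on_def)
    moreover have "at x within {2..} = at x" using x by (intro at_within_interior) simp
    ultimately have "(F \<longlongrightarrow> F x) (at x)" by simp
    then have "(F \<longlongrightarrow> F x) (at_left x)" by (rule tendsto_within_subset) auto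
    then show "((F \<circ> real_of_ereal) \<longlongrightarrow> F x) (at_left (ereal x))"
      by (simp add: ereal_tendsto_simps)
  qed
  moreover have "F 2 = 0" by (simp add: F_def outer_root_def)
  ultimately show ?thesis by (simp add: F_def)
qed

text \<open>The left side is the combination of terms behind both \<open>M_rate\<close> and
  \<open>L_rate\<close>; its value is \<open>- psi x a\<close> at
  \<open>x = a + 1 / a\<close>.\<close>

lemma bulk_integral_closed:
  assumes "1 \<le> a"
  shows "1 / 2 * (LBINT z=ereal 2..ereal (a + 1 / a). sqrt (z\<^sup>2 - 4)) + 1 / 4 * (a + 1 / a)\<^sup>2 + 1 / 2 = a\<^sup>2 / 2 + 1 - ln a"
  unfolding bulk_integral[OF outer_root_add_inverse(2)[OF assms]] outer_root_add_inverse(1)[OF assms] psi_def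
  using assms by (simp add: ln_div field_simps power2_eq_square)

text \<open>Valid for either order of \<open>x\<close> and \<open>y\<close>, as the lower limit in
  \<open>L_rate\<close> may exceed the upper one.\<close>

lemma interval_integral_diff:
  assumes "2 \<le> y" "2 \<le> x"
  shows "(LBINT z=ereal y..ereal x. sqrt (z\<^sup>2 - 4)) = (LBINT z=ereal 2..ereal x. sqrt (z\<^sup>2 - 4)) - (LBINT z=ereal 2..ereal y. sqrt (z\<^sup>2 - 4))"
proof -
  have int: "interval_lebesgue_integrable lborel (ereal (min 2 (min y x))) (ereal (max 2 (max y x))) (\<lambda>z. sqrt (z\<^sup>2 - 4))"
    by (intro interval_integrable_continuous_on continuous_intros) auto
  have "(LBINT z=ereal 2..ereal y. sqrt (z\<^sup>2 - 4)) + (LBINT z=ereal y..ereal x. sqrt (z\<^sup>2 - 4)) = (LBINT z=ereal 2..ereal x. sqrt (z\<^sup>2 - 4))"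
    using int by (intro interval_integral_sum) (simp only: ereal_min ereal_max)
  then show ?thesis by simp
qed

lemma K_rate_eq:
  assumes \<theta>: "0 \<le> \<theta>"
  shows "K_rate \<theta> x = (if x < 2 then \<infinity> else ereal (rate \<theta> x))"
proof (cases "x < 2")
  case False
  define a where "a = outer_root x"
  have a: "1 \<le> a" "x = a + 1 / a" using outer_root(1,2)[OF leI[OF False]] unfolding a_def .
  have bulk: "1 / 2 * (LBINT z=ereal 2..ereal x. sqrt (z\<^sup>2 - 4)) + 1 / 4 * x\<^sup>2 + 1 / 2 = a\<^sup>2 / 2 + 1 - ln a"
    unfolding a(2) by (rule bulk_integral_closed[OF a(1)])
  have psia: "psi x a = - (a\<^sup>2 / 2) - 1 + ln a" unfolding psi_def a(2) using a(1) by (simp add: field_simps power2_eq_square)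
  show ?thesis
  proof (cases "\<theta> \<le> 1")
    case True
    \<comment> \<open>Expressed through \<open>a\<close>, the threshold is the point where the
      maximum in \<open>rate\<close> changes branch.\<close>
    have thr: "ereal x \<le> threshold \<theta> \<longleftrightarrow> \<theta> \<le> 1 / a"
    proof (cases "\<theta> = 0")
      case True
      then show ?thesis using a by (simp add: threshold_def)
    next
      case False
      then have \<theta>0: "0 < \<theta>" using \<theta> by simp
      have "x - (\<theta> + 1 / \<theta>) = (a - \<theta>) * (\<theta> - 1 / a) / \<theta>" unfolding a(2) using a(1) \<theta>0 by (simp add: field_simps)
      moreover have "(a - \<theta>) * (\<theta> - 1 / a) / \<theta> \<le> 0 \<longleftrightarrow> \<theta> \<le> 1 / a"
      proof (cases "a = \<theta>")
        case eq: True
        then have "a = 1" using a(1) \<open>\<theta> \<le> 1\<close> by simp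
        then show ?thesis using eq by simp
      next
        case False
        then have "0 < a - \<theta>" using a(1) \<open>\<theta> \<le> 1\<close> by simp
        then show ?thesis using \<theta>0 by (simp add: divide_le_0_iff mult_le_0_iff)
      qed
      ultimately have "x \<le> \<theta> + 1 / \<theta> \<longleftrightarrow> \<theta> \<le> 1 / a" by argo
      then show ?thesis using False by (simp add: threshold_def)
    qed
    show ?thesis
    proof (cases "\<theta> \<le> 1 / a")
      case le: True
      then show ?thesis
        using True False thr bulk_integral[of x] by (simp add: K_rate_def rate_def a_def[symmetric] max_absorb2)
    next
      case gt: False
      have "M_rate \<theta> x = psi x \<theta> - psi x a"
        unfolding M_rate_def psia using bulk by (simp add: psi_def algebra_simps)
      then show ?thesis
        using True False gt thr by (simp add: K_rate_def rate_def a_def[symmetric] max_absorb1)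
    qed
  next
    case gt: False
    then have \<theta>1: "1 \<le> \<theta>" by simp
    define x0 where "x0 = \<theta> + 1 / \<theta>"
    have x0: "2 \<le> x0" unfolding x0_def by (rule outer_root_add_inverse(2)[OF \<theta>1])
    have bulk0: "1 / 2 * (LBINT z=ereal 2..ereal x0. sqrt (z\<^sup>2 - 4)) + 1 / 4 * x0\<^sup>2 + 1 / 2 = \<theta>\<^sup>2 / 2 + 1 - ln \<theta>"
      unfolding x0_def by (rule bulk_integral_closed[OF \<theta>1])
    have "\<theta> * x0 = \<theta>\<^sup>2 + 1" using \<theta>1 by (simp add: x0_def power2_eq_square distrib_left)
    have "L_rate \<theta> x = psi x \<theta> - psi x a"
      unfolding L_rate_def x0_def[symmetric] interval_integral_diff[OF x0 leI[OF False]] psia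
      using bulk bulk0 \<open>\<theta> * x0 = \<theta>\<^sup>2 + 1\<close> by (simp add: psi_def algebra_simps)
    moreover have "max \<theta> (1 / a) = \<theta>"
    proof -
      have "1 / a \<le> 1" using a by simp
      then show ?thesis using \<theta>1 by simp
    qed
    ultimately show ?thesis using gt False by (simp add: K_rate_def rate_def a_def[symmetric])
  qed
qed (simp add: K_rate_def)

section \<open>The deformed Hermitian Brownian motion at time 1\<close>

lemma independent_brownian_motions_at_1:
  assumes W: "independent_brownian_motions M J W" and J: "J \<noteq> {}"
  shows "distr M (Pi\<^sub>M J (\<lambda>_. borel)) (\<lambda>\<omega>. \<lambda>j\<in>J. W j 1 \<omega>) = std_gauss J"
proof -
  interpret prob_space M using W by (simp add: independent_brownian_motions_def)
  have B: "standard_brownian_motion M (W j)" if "j \<in> J" for j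
    using W that by (simp add: independent_brownian_motions_def)
  have rv: "random_variable borel (W j 1)" if "j \<in> J" for j
    using B[OF that] by (simp add: standard_brownian_motion_def)
  have law: "distr M borel (W j 1) = std_normal" if "j \<in> J" for j
  proof -
    have [measurable]: "random_variable borel (W j 0)" "random_variable borel (W j 1)"
      using B[OF that] by (simp_all add: standard_brownian_motion_def)
    have AE0: "AE \<omega> in M. W j 0 \<omega> = 0"
      and inc: "\<forall>s t. 0 \<le> s \<longrightarrow> s < t \<longrightarrow>
        distributed M lborel (\<lambda>\<omega>. W j t \<omega> - W j s \<omega>) (normal_density 0 (sqrt (t - s)))"
      using B[OF that] unfolding standard_brownian_motion_def by simp_all
    have d: "distributed M lborel (\<lambda>\<omega>. W j 1 \<omega> - W j 0 \<omega>) (normal_density 0 1)"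
      using inc[rule_format, of 0 1] by simp
    \<comment> \<open>The definition prescribes laws of increments and the start at 0 only almost
      surely, so the value at time 1 is replaced by the increment from time 0.\<close>
    have "distr M borel (W j 1) = distr M borel (\<lambda>\<omega>. W j 1 \<omega> - W j 0 \<omega>)"
      using AE0 by (intro distr_cong_AE refl) auto
    also have "\<dots> = distr M lborel (\<lambda>\<omega>. W j 1 \<omega> - W j 0 \<omega>)"
      by (intro distr_cong) auto
    also have "\<dots> = std_normal"
      using distributed_distr_eq_density[OF d] by (simp add: std_normal_def)
    finally show ?thesis .
  qed
  have "indep_vars (\<lambda>_. Pi\<^sub>M {0..} (\<lambda>_. borel)) (\<lambda>j \<omega>. \<lambda>t\<in>{0..}. W j t \<omega>) J"
    using W by (simp add: independent_brownian_motions_def)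
  then have "indep_vars (\<lambda>_. borel) (\<lambda>j \<omega>. (\<lambda>t\<in>{0..}. W j t \<omega>) 1) J"
    by (rule indep_vars_compose2) (rule measurable_component_singleton, simp)
  then have "indep_vars (\<lambda>_. borel) (\<lambda>j. W j 1) J" by simp
  then have "distr M (Pi\<^sub>M J (\<lambda>_. borel)) (\<lambda>\<omega>. \<lambda>j\<in>J. W j 1 \<omega>) = Pi\<^sub>M J (\<lambda>j. distr M borel (W j 1))"
    using J rv by (subst (asm) indep_vars_iff_distr_eq_PiM') auto
  also have "\<dots> = std_gauss J"
    unfolding std_gauss_def by (intro PiM_cong refl law)
  finally show ?thesis .
qed

lemma std_gauss_reindex:
  assumes f: "inj_on f I" "f \<in> I \<rightarrow> J"
  shows "distr (std_gauss J) (Pi\<^sub>M I (\<lambda>_. borel)) (\<lambda>\<omega>. \<lambda>i\<in>I. \<omega> (f i)) = std_gauss I"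
proof -
  have "distr (Pi\<^sub>M J (\<lambda>_. std_normal)) (Pi\<^sub>M I (\<lambda>_. std_normal)) (\<lambda>\<omega>. \<lambda>i\<in>I. \<omega> (f i)) = Pi\<^sub>M I (\<lambda>_. std_normal)"
    using distr_PiM_reindex[OF _ f, of "\<lambda>_. std_normal"] prob_space_std_normal by simp
  moreover have "distr (std_gauss J) (Pi\<^sub>M I (\<lambda>_. borel)) (\<lambda>\<omega>. \<lambda>i\<in>I. \<omega> (f i)) = distr (std_gauss J) (std_gauss I) (\<lambda>\<omega>. \<lambda>i\<in>I. \<omega> (f i))"
    by (intro distr_cong) auto
  ultimately show ?thesis by (simp add: std_gauss_def)
qed

text \<open>The Brownian motion whose value at time 1 is the coordinate \<open>p\<close> in the sense of \<open>herm\<close>; the \<open>\<beta>'\<^sub>k\<^sub>k\<close> are not used.\<close>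

definition slot :: "nat \<times> nat \<Rightarrow> nat \<times> nat + nat \<times> nat" where
  "slot p = (if fst p \<le> snd p then Inl p else Inr (snd p, fst p))"

definition gaussians ::
    "nat \<Rightarrow> (nat \<times> nat \<Rightarrow> real \<Rightarrow> 'a \<Rightarrow> real) \<Rightarrow> (nat \<times> nat \<Rightarrow> real \<Rightarrow> 'a \<Rightarrow> real) \<Rightarrow> 'a \<Rightarrow> nat \<times> nat \<Rightarrow> real" where
  "gaussians N \<beta> \<beta>' \<omega> = (\<lambda>p\<in>sq N. case_sum \<beta> \<beta>' (slot p) 1 \<omega>)"

lemma gaussians_law:
  fixes M :: "'a measure"
  assumes N: "1 \<le> N"
    and ind: "independent_brownian_motions M (upper_indices N <+> upper_indices N) (case_sum \<beta> \<beta>')"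
  shows "gaussians N \<beta> \<beta>' \<in> M \<rightarrow>\<^sub>M Pi\<^sub>M (sq N) (\<lambda>_. borel)"
    and "distr M (Pi\<^sub>M (sq N) (\<lambda>_. borel)) (gaussians N \<beta> \<beta>') = std_gauss (sq N)"
proof -
  let ?J = "upper_indices N <+> upper_indices N"
  let ?W = "case_sum \<beta> \<beta>'"
  have J: "?J \<noteq> {}" using N by (auto simp: upper_indices_def intro!: exI[of _ 0])
  have slot: "slot \<in> sq N \<rightarrow> ?J" by (auto simp: slot_def upper_indices_def)
  have inj: "inj_on slot (sq N)" by (auto simp: inj_on_def slot_def split: if_splits)
  have meas: "(\<lambda>\<omega>. \<lambda>j\<in>?J. ?W j 1 \<omega>) \<in> M \<rightarrow>\<^sub>M Pi\<^sub>M ?J (\<lambda>_. borel)"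
    using ind by (intro measurable_restrict) (simp add: independent_brownian_motions_def standard_brownian_motion_def)
  have re: "(\<lambda>\<omega>. \<lambda>i\<in>sq N. \<omega> (slot i)) \<in> Pi\<^sub>M ?J (\<lambda>_. borel) \<rightarrow>\<^sub>M Pi\<^sub>M (sq N) (\<lambda>_. borel :: real measure)"
    using slot by (intro measurable_restrict measurable_component_singleton) auto
  have eq: "gaussians N \<beta> \<beta>' = (\<lambda>\<omega>. \<lambda>i\<in>sq N. \<omega> (slot i)) \<circ> (\<lambda>\<omega>. \<lambda>j\<in>?J. ?W j 1 \<omega>)"
    using slot by (auto simp: gaussians_def fun_eq_iff restrict_def)
  show "gaussians N \<beta> \<beta>' \<in> M \<rightarrow>\<^sub>M Pi\<^sub>M (sq N) (\<lambda>_. borel)"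
    unfolding eq by (rule measurable_comp[OF meas re])
  have "distr M (Pi\<^sub>M (sq N) (\<lambda>_. borel)) (gaussians N \<beta> \<beta>')
      = distr (distr M (Pi\<^sub>M ?J (\<lambda>_. borel)) (\<lambda>\<omega>. \<lambda>j\<in>?J. ?W j 1 \<omega>)) (Pi\<^sub>M (sq N) (\<lambda>_. borel)) (\<lambda>\<omega>. \<lambda>i\<in>sq N. \<omega> (slot i))"
    unfolding eq by (rule distr_distr[OF re meas, symmetric])
  also have "\<dots> = std_gauss (sq N)"
    unfolding independent_brownian_motions_at_1[OF ind J] by (rule std_gauss_reindex[OF inj slot])
  finally show "distr M (Pi\<^sub>M (sq N) (\<lambda>_. borel)) (gaussians N \<beta> \<beta>') = std_gauss (sq N)" .
qed

lemma deformed_hermitian_bm_index: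
  assumes "i < N" "j < N"
  shows "deformed_hermitian_bm \<theta> N \<beta> \<beta>' 1 \<omega> $$ (i, j)
    = gue N (gaussians N \<beta> \<beta>' \<omega>) i j + (if i = 0 \<and> j = 0 then of_real \<theta> else 0)"
proof -
  have s: "sqrt (2 * real N) = sqrt 2 * sqrt (real N)" by (rule real_sqrt_mult)
  show ?thesis
    using assms
    by (auto simp: deformed_hermitian_bm_def hermitian_bm_def gue_def herm_def gaussians_def slot_def mat_diag_def s
        complex_eq_iff field_simps simp flip: real_sqrt_mult)
qed

text \<open>The rank-one deformation moves from the matrix into the vector argument of
  \<open>spec_below\<close>, whose squared length is the starting point of the chain.\<close>

lemma spec_below_deformed:
  assumes \<theta>: "0 \<le> \<theta>" and N: "0 < N"
  shows "spec_below N (\<lambda>i j. deformed_hermitian_bm \<theta> N \<beta> \<beta>' 1 \<omega> $$ (i, j)) (\<lambda>_. 0) x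
    \<longleftrightarrow> spec_below N (gue N (gaussians N \<beta> \<beta>' \<omega>)) (spike_vec \<theta>) x"
proof -
  let ?D = "\<lambda>i j. deformed_hermitian_bm \<theta> N \<beta> \<beta>' 1 \<omega> $$ (i, j)" and ?G = "gue N (gaussians N \<beta> \<beta>' \<omega>)"
  have "herm_form N ?D u + (cmod (cip N (\<lambda>_. 0) u))\<^sup>2 = herm_form N ?G u + (cmod (cip N (spike_vec \<theta>) u))\<^sup>2" for u
  proof -
    have "herm_form N ?D u = Re (\<Sum>i<N. \<Sum>j<N. cnj (u i) * ?G i j * u j
        + (if i = 0 then if j = 0 then of_real \<theta> * (cnj (u i) * u j) else 0 else 0))"
      unfolding herm_form_def by (intro arg_cong[where f = Re] sum.cong refl)
        (simp add: deformed_hermitian_bm_index algebra_simps)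
    also have "\<dots> = herm_form N ?G u + Re (of_real \<theta> * (cnj (u 0) * u 0))"
      using N by (simp add: sum.distrib herm_form_def if_distrib[where f = "sum _"] sum.If_cases)
    also have "Re (of_real \<theta> * (cnj (u 0) * u 0)) = \<theta> * (cmod (u 0))\<^sup>2"
      unfolding complex_norm_square[symmetric] mult.commute[of "cnj _"]
      by (simp add: cmod_power2 power2_eq_square)
    also have "\<dots> = (cmod (cip N (spike_vec \<theta>) u))\<^sup>2"
    proof -
      have "cip N (spike_vec \<theta>) u = (\<Sum>i\<in>{0}. cnj (spike_vec \<theta> i) * u i)"
        unfolding cip_def using N by (intro sum.mono_neutral_right) (auto simp: spike_vec_def)
      then show ?thesis using \<theta> by (simp add: spike_vec_def norm_mult power_mult_distrib)
    qed
    finally show ?thesis by (simp add: cip_def)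
  qed
  then show ?thesis by (simp add: spec_below_def)
qed

lemma largest_eigenvalue_deformed_less_iff:
  assumes \<theta>: "0 \<le> \<theta>" and N: "0 < N"
  shows "largest_eigenvalue (deformed_hermitian_bm \<theta> N \<beta> \<beta>' 1 \<omega>) < x
    \<longleftrightarrow> spec_below N (gue N (gaussians N \<beta> \<beta>' \<omega>)) (spike_vec \<theta>) x"
  unfolding spec_below_deformed[OF assms, symmetric]
proof (rule largest_eigenvalue_less_iff)
  show "deformed_hermitian_bm \<theta> N \<beta> \<beta>' 1 \<omega> \<in> carrier_mat N N"
    by (simp add: deformed_hermitian_bm_def hermitian_bm_def)
  show "deformed_hermitian_bm \<theta> N \<beta> \<beta>' 1 \<omega> $$ (i, j) = cnj (deformed_hermitian_bm \<theta> N \<beta> \<beta>' 1 \<omega> $$ (j, i))"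
    if "i < N" "j < N" for i j
    unfolding deformed_hermitian_bm_index[OF that] deformed_hermitian_bm_index[OF that(2,1)] gue_def
    by (subst herm_hermitian) auto
qed (rule N)

lemma largest_eigenvalue_law:
  fixes M :: "'a measure"
  assumes \<theta>: "0 \<le> \<theta>" and N: "1 \<le> N"
    and ind: "independent_brownian_motions M (upper_indices N <+> upper_indices N) (case_sum \<beta> \<beta>')"
  defines "\<mu> \<equiv> distr M borel (\<lambda>\<omega>. largest_eigenvalue (deformed_hermitian_bm \<theta> N \<beta> \<beta>' 1 \<omega>))"
  shows "prob_space \<mu>" "emeasure \<mu> {..<x} = surv N x N \<theta>" "emeasure \<mu> {x..} = dead N x N \<theta>"
proof -
  interpret prob_space M using ind by (simp add: independent_brownian_motions_def)
  have N0: "0 < N" using N by simp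
  let ?X = "\<lambda>\<omega>. largest_eigenvalue (deformed_hermitian_bm \<theta> N \<beta> \<beta>' 1 \<omega>)"
  note less = largest_eigenvalue_deformed_less_iff[OF \<theta> N0, of \<beta> \<beta>']
  note G = gaussians_law[OF N ind]
  have pred: "Measurable.pred (std_gauss (sq N)) (\<lambda>z. spec_below N (gue N z) (spike_vec \<theta>) x)" for x
    by (intro measurable_spec_below measurable_gue) auto
  have sgm: "sets (std_gauss (sq N)) = sets (Pi\<^sub>M (sq N) (\<lambda>_. borel))" by simp
  have below: "{z \<in> space (std_gauss (sq N)). spec_below N (gue N z) (spike_vec \<theta>) x} \<in> sets (Pi\<^sub>M (sq N) (\<lambda>_. borel))" for x
    unfolding sgm[symmetric] using pred by (simp only: pred_def)
  have above: "{z \<in> space (std_gauss (sq N)). \<not> spec_below N (gue N z) (spike_vec \<theta>) x} \<in> sets (Pi\<^sub>M (sq N) (\<lambda>_. borel))" for x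
    unfolding sgm[symmetric] using pred_intros_logic(2)[OF pred] by (simp only: pred_def)
  have space: "gaussians N \<beta> \<beta>' \<omega> \<in> space (std_gauss (sq N))" for \<omega> by (auto simp: gaussians_def)
  have vimage: "{\<omega> \<in> space M. ?X \<omega> < x} = gaussians N \<beta> \<beta>' -` {z \<in> space (std_gauss (sq N)). spec_below N (gue N z) (spike_vec \<theta>) x} \<inter> space M" for x
    using space by (auto simp: less simp del: space_std_gauss)
  have vimage': "{\<omega> \<in> space M. x \<le> ?X \<omega>} = gaussians N \<beta> \<beta>' -` {z \<in> space (std_gauss (sq N)). \<not> spec_below N (gue N z) (spike_vec \<theta>) x} \<inter> space M" for x
    using space by (auto simp: less not_less[symmetric] simp del: space_std_gauss)
  have X: "?X \<in> borel_measurable M"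
    unfolding borel_measurable_iff_less vimage using measurable_sets[OF G(1) below] by blast
  show "prob_space \<mu>" unfolding \<mu>_def by (rule prob_space_distr[OF X])
  have "emeasure \<mu> {..<x} = emeasure M {\<omega> \<in> space M. ?X \<omega> < x}"
    unfolding \<mu>_def using X by (subst emeasure_distr) (auto intro!: arg_cong[where f = "emeasure M"])
  also have "\<dots> = emeasure (distr M (Pi\<^sub>M (sq N) (\<lambda>_. borel)) (gaussians N \<beta> \<beta>')) {z \<in> space (std_gauss (sq N)). spec_below N (gue N z) (spike_vec \<theta>) x}"
    unfolding vimage by (rule emeasure_distr[OF G(1) below, symmetric])
  also have "\<dots> = surv N x N \<theta>"
    unfolding G(2) by (rule emeasure_spec_below[OF N0 \<theta> N0])
  finally show "emeasure \<mu> {..<x} = surv N x N \<theta>" .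
  have "emeasure \<mu> {x..} = emeasure M {\<omega> \<in> space M. x \<le> ?X \<omega>}"
    unfolding \<mu>_def using X by (subst emeasure_distr) (auto intro!: arg_cong[where f = "emeasure M"])
  also have "\<dots> = emeasure (distr M (Pi\<^sub>M (sq N) (\<lambda>_. borel)) (gaussians N \<beta> \<beta>')) {z \<in> space (std_gauss (sq N)). \<not> spec_below N (gue N z) (spike_vec \<theta>) x}"
    unfolding vimage' by (rule emeasure_distr[OF G(1) above, symmetric])
  also have "\<dots> = dead N x N \<theta>"
    unfolding G(2) by (rule emeasure_spec_below[OF N0 \<theta> N0])
  finally show "emeasure \<mu> {x..} = dead N x N \<theta>" .
qed

theorem theorem1p2:
  fixes \<theta> :: real
    and M :: "nat \<Rightarrow> 'a measure"
    and \<beta> \<beta>' :: "nat \<Rightarrow> nat \<times> nat \<Rightarrow> real \<Rightarrow> 'a \<Rightarrow> real"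
  assumes "0 \<le> \<theta>"
    and "\<And>N. 1 \<le> N \<Longrightarrow>
      independent_brownian_motions (M N) (upper_indices N <+> upper_indices N)
        (case_sum (\<beta> N) (\<beta>' N))"
  shows "good_rate_function (K_rate \<theta>) \<and>
    large_deviation_principle
      (\<lambda>N. distr (M N) borel
        (\<lambda>\<omega>. largest_eigenvalue (deformed_hermitian_bm \<theta> N (\<beta> N) (\<beta>' N) 1 \<omega>)))
      (\<lambda>N. real N) (K_rate \<theta>)"
proof -
  let ?\<mu> = "\<lambda>N. distr (M N) borel
    (\<lambda>\<omega>. largest_eigenvalue (deformed_hermitian_bm \<theta> N (\<beta> N) (\<beta>' N) 1 \<omega>))"
  note law = largest_eigenvalue_law[OF assms(1) _ assms(2)]
  \<comment> \<open>Here and in \<open>LBD\<close> the shift is \<open>j = 0\<close>: the chain runs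
    for all \<open>N\<close> steps.\<close>
  have UBD: "\<forall>\<^sub>F N in sequentially. measure (?\<mu> N) A \<le> exp (- real N * (r - \<epsilon>))"
    if exp_upper: "exp_upper P \<theta> r" and A: "\<And>N. 1 \<le> N \<Longrightarrow> emeasure (?\<mu> N) A = P N N \<theta>" and \<epsilon>: "0 < \<epsilon>" for P r A \<epsilon>
  proof -
    have "\<forall>\<^sub>F N in sequentially. P N (N - 0) \<theta> \<le> ennreal (exp (- real N * (r - \<epsilon>)))"
      using exp_upper \<epsilon> unfolding exp_upper_def by blast
    then show ?thesis using eventually_ge_at_top[of 1]
    proof eventually_elim
      case (elim N)
      interpret prob_space "?\<mu> N" by (rule law(1)) (rule elim)+
      have "ennreal (prob A) \<le> ennreal (exp (- real N * (r - \<epsilon>)))"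
        using elim A[OF elim(2)] by (simp add: emeasure_eq_measure)
      then show ?case by simp
    qed
  qed
  have LBD: "\<forall>\<^sub>F N in sequentially. exp (- real N * (r + \<epsilon>)) \<le> measure (?\<mu> N) A"
    if exp_lower: "exp_lower P \<theta> r" and A: "\<And>N. 1 \<le> N \<Longrightarrow> emeasure (?\<mu> N) A = P N N \<theta>" and \<epsilon>: "0 < \<epsilon>" for P r A \<epsilon>
  proof -
    have "\<forall>\<^sub>F N in sequentially. ennreal (exp (- real N * (r + \<epsilon>))) \<le> P N (N - 0) \<theta>"
      using exp_lower \<epsilon> unfolding exp_lower_def by blast
    then show ?thesis using eventually_ge_at_top[of 1]
    proof eventually_elim
      case (elim N)
      interpret prob_space "?\<mu> N" by (rule law(1)) (rule elim)+
      have "ennreal (exp (- real N * (r + \<epsilon>))) \<le> ennreal (prob A)"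
        using elim A[OF elim(2)] by (simp add: emeasure_eq_measure)
      then show ?case by simp
    qed
  qed
  \<comment> \<open>To the right of the minimizer \<open>\<theta>\<close> lies below the repelling
    fixed point, and large eigenvalues correspond to death.\<close>
  have up: "1 < outer_root x" "x = outer_root x + 1 / outer_root x" "\<theta> < outer_root x"
    if "minimizer \<theta> < x" for x
  proof -
    have "max \<theta> 1 < outer_root x"
      using outer_root_strict_mono[OF minimizer(1) that] by (simp only: minimizer(2))
    then show "1 < outer_root x" "\<theta> < outer_root x" by auto
    show "x = outer_root x + 1 / outer_root x" using that minimizer(1)[of \<theta>] by (intro outer_root(2)) simp
  qed
  \<comment> \<open>This range is empty unless \<open>\<theta> > 1\<close>. In it
    \<open>\<theta>\<close> lies above the repelling fixed point, and small eigenvalues correspond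
    to survival.\<close>
  have down: "1 < outer_root x" "x = outer_root x + 1 / outer_root x" "outer_root x < \<theta>"
      "rate \<theta> x = psi x \<theta> - psi x (outer_root x)"
    if x: "2 < x" "x < minimizer \<theta>" for x
  proof -
    have "outer_root 2 = 1" by (simp add: outer_root_def)
    then show 1: "1 < outer_root x" using outer_root_strict_mono[of 2 x] x by simp
    have "outer_root x < max \<theta> 1"
      using outer_root_strict_mono[of x "minimizer \<theta>"] x by (simp only: minimizer(2))
    then show 2: "outer_root x < \<theta>" using 1 by auto
    show "x = outer_root x + 1 / outer_root x" using x by (intro outer_root(2)) simp
    have "1 / outer_root x \<le> \<theta>" using 1 2 by (smt (verit) divide_le_eq_1)
    then show "rate \<theta> x = psi x \<theta> - psi x (outer_root x)" by (simp add: rate_def max_absorb1)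
  qed
  show ?thesis
  proof (rule LDP_from_tails[where b = 2 and m = "minimizer \<theta>" and k = "rate \<theta>"])
    show "\<forall>\<^sub>F N in sequentially. prob_space (?\<mu> N) \<and> sets (?\<mu> N) = sets borel"
      using eventually_ge_at_top[of 1] by eventually_elim (simp add: law(1))
    show "\<forall>\<^sub>F N in sequentially. measure (?\<mu> N) {x..} \<le> exp (- real N * (rate \<theta> x - \<epsilon>))"
      if "minimizer \<theta> < x" "0 < \<epsilon>" for x \<epsilon>
      using dead_upper[OF up[OF that(1)]] unfolding rate_def
      by (rule UBD) (use that law(3) in auto)
    show "\<forall>\<^sub>F N in sequentially. exp (- real N * (rate \<theta> x + \<epsilon>)) \<le> measure (?\<mu> N) {x..}"
      if "minimizer \<theta> < x" "0 < \<epsilon>" for x \<epsilon>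
      using dead_lower[OF up(1,2)[OF that(1)] assms(1) less_imp_le[OF up(3)[OF that(1)]]] unfolding rate_def
      by (rule LBD) (use that law(3) in auto)
    show "\<forall>\<^sub>F N in sequentially. measure (?\<mu> N) {..<x} \<le> exp (- real N * (rate \<theta> x - \<epsilon>))"
      if "2 < x" "x < minimizer \<theta>" "0 < \<epsilon>" for x \<epsilon>
      using surv_upper[OF down(1-3)[OF that(1,2)]] unfolding down(4)[OF that(1,2)]
      by (rule UBD) (use that law(2) in auto)
    show "\<forall>\<^sub>F N in sequentially. exp (- real N * (rate \<theta> x + \<epsilon>)) \<le> measure (?\<mu> N) {..<x}"
      if "2 < x" "x < minimizer \<theta>" "0 < \<epsilon>" for x \<epsilon>
      using surv_lower[OF down(1-3)[OF that(1,2)]] unfolding down(4)[OF that(1,2)]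
      by (rule LBD) (use that law(2) in auto)
    show "\<forall>\<^sub>F N in sequentially. measure (?\<mu> N) {..<x} \<le> exp (- real N * r)" if "x < 2" for x r
    proof -
      \<comment> \<open>\<open>surv_upper_sub\<close> gives every rate; \<open>r + 1\<close> leaves
        the slack 1.\<close>
      have "\<forall>\<^sub>F N in sequentially. measure (?\<mu> N) {..<x} \<le> exp (- real N * (r + 1 - 1))"
        using surv_upper_sub[OF that assms(1)] by (rule UBD) (use law(2) in auto)
      then show ?thesis by simp
    qed
  qed (use assms(1) in \<open>simp_all add: K_rate_eq minimizer rate_minimizer continuous_rate rate_increasing rate_decreasing rate_unbounded\<close>)
qed

end
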